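(* Let $A$, $F$, $\sigma$, $L$, $N$, $P$, $Q$ be as in the context. Assume that the spectral gap condition $$\lambda_{N+1}-\lambda_N\ \ge\ \frac{2L}{\mu}\Big(\lambda_N^\sigma+\sigma^\sigma\Gamma(1-\sigma)(\lambda_{N+1}-\lambda_N)^\sigma+\lambda_{N+1}^\sigma\Big)$$ holds for some $\mu\in(0,1)$. Then there exists a Lipschitz inertial manifold for the random equation $\frac{du}{dt}+Au=z(\theta_t\omega)u+G(\theta_t\omega,u)$, which is given by $$\mathscr M(\omega)=\{\xi+\psi(\omega,\xi)\mid\xi\in PD(A^\sigma)\},$$ where $\psi(\omega,\cdot):PD(A^\sigma)\to QD(A^\sigma)$ is Lipschitz continuous, defined by $$\psi(\omega,\xi)=\int_{-\infty}^0e^{As+\int_s^0z(\theta_r\omega)dr}QG(\theta_s\omega,\bar u(s,\omega,\xi))ds,\qquad\xi\in PD(A^\sigma),$$ and $\psi$ is measurable in $(\omega,\xi)$. Here $\bar u(\cdot,\omega,\xi)$ is the unique solution in $\mathcal C_\beta^-$ of $$u(t)=e^{-At+\int_0^tz(\theta_r\omega)dr}\xi+\int_0^te^{-A(t-s)+\int_s^tz(\theta_r\omega)dr}PG(\theta_s\omega,u(s))ds+\int_{-\infty}^te^{-A(t-s)+\int_s^tz(\theta_r\omega)dr}QG(\theta_s\omega,u(s))ds,\quad t\le0.$$ Furthermore, $\widetilde{\mathscr M}(\omega)=e^{z(\omega)}\mathscr M(\omega)$, i.e. $$\widetilde{\mathscr M}(\omega)=\{\xi+e^{z(\omega)}\psi(\omega,e^{-z(\omega)}\xi)\mid\xi\in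 PD(A^\sigma)\},$$ is a Lipschitz inertial manifold of the equation $\frac{dv}{dt}+Av=F(v)+v\circ\dot W_t$. In addition, if $F\in C^1$, then $\mathscr M(\omega)$ is a $C^1$ inertial manifold for the random equation, i.e. $\psi(\omega,\xi)$ is $C^1$ in $\xi$; consequently, $\widetilde{\mathscr M}(\omega)$ is a $C^1$ inertial manifold of $\frac{dv}{dt}+Av=F(v)+v\circ\dot W_t$.
   Context: **Operator and nonlinearity.** $H$ is a separable Hilbert space with norm $\|\cdot\|$. There is an orthonormal basis $\{e_k\}$ of $H$ with $Ae_k=\lambda_ke_k$, $0<\lambda_1\le\lambda_2\le\cdots$, $\lambda_k\to+\infty$. $D(A^\sigma)$ carries the norm $\|u\|_\sigma=\|A^\sigma u\|$. $0\le\sigma<1$, and $F:D(A^\sigma)\to H$ satisfies $F(0)=0$ and $\|F(u_1)-F(u_2)\|\le L\|u_1-u_2\|_\sigma$ for all $u_1,u_2\in D(A^\sigma)$, with $L>0$. $F\in C^1$ means $C^1$ from $D(A^\sigma)$ to $H$. $N\ge1$ is a fixed integer with $\lambda_N<\lambda_{N+1}$, $P$ is the orthogonal projector onto $\mathrm{span}\{e_1,\dots,e_N\}$, $Q=I-P$. When $\sigma=0$, $\sigma^\sigma=1$. **Noise.** $W_t(\omega)=\omega_t$ is a two-sided standard one-dimensional Brownian motion on the Wiener space of continuous functions $\omega:\mathbb R\to\mathbb R$ with $\omega_0=0$, with shift $\theta_t\omega=\omega_{t+\cdot}-\omega_t$. $z(\omega)=-\int_{-\infty}^0e^s\omega_sds$,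 so $z(\theta_t\omega)=\omega_t-\int_{-\infty}^0e^s\omega_{t+s}ds$ is the stationary Ornstein–Uhlenbeck process solving $dz=-z\,dt+dW_t$. The probability space is restricted to a $\theta$-invariant set of full measure on which, as $t\to\pm\infty$, $\omega_t/t\to0$, $z(\theta_t\omega)/t\to0$ and $\frac1t\int_0^tz(\theta_s\omega)ds\to0$. **Equations.** $G(\omega,u)=e^{-z(\omega)}F(e^{z(\omega)}u)$. $u(t,\omega,x)$ is the solution of the random equation (in the variation-of-constants sense) with value $x$ at $t=0$; it generates a random dynamical system. The Stratonovich equation has solution $v(t,\omega,x)=e^{z(\theta_t\omega)}u(t,\omega,e^{-z(\omega)}x)$, which also generates a random dynamical system. **Function space.** $\beta=\lambda_N+\frac2\mu L\lambda_N^\sigma\in(\lambda_N,\lambda_{N+1})$ and $$\mathcal C_\beta^-=\Big\{\varphi\in C((-\infty,0],D(A^\sigma)):\ \sup_{t\le0}e^{\beta t-\int_0^tz(\theta_r\omega)dr}\|\varphi(t)\|_\sigma<\infty\Big\},$$ with that supremum as norm. **Inertial manifolds.** For a random dynamical system $\phi(t,\omega,x)$ on the phase space $D(A^\sigma)$ over $\theta$: a random set is a family $M(\omega)$ of nonempty closed sets such that $\omega\mapsto\inf_{y\in M(\omega)}\|x-y\|_\sigma$ is a random variable for every $x$; it is invariant if $\phi(t,\omega,M(\omega))\subset M(\theta_t\omega)$ for all $t\ge0$. An invariant random set $M$ is a Lipschitz (resp. $C^1$) inertial manifold if (i) $M(\omega)=\{\xi+m(\omega,\xi):\xi\in H_1\}$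 for a Lipschitz (resp. $C^1$) map $m(\omega,\cdot):H_1\to H_2$, where the phase space is $H_1\oplus H_2$ with $H_1$ finite-dimensional (here $H_1=PD(A^\sigma)$, $H_2=QD(A^\sigma)$); and (ii) there is a constant $b>0$ such that for every $x$ there is a random variable $K(\omega,x)$ with $\mathrm{dist}(\phi(t,\omega,x),M(\theta_t\omega))\le Ke^{-bt}$ for all $t\ge0$. *)

theory Defs
  imports "HOL-Probability.Probability"
begin

section \<open>The operator: spectral data and functional calculus\<close>

text \<open>Indices start at 1 as on paper; \<open>e 0\<close> and \<open>lam 0\<close> are never used.\<close>

definition spectral_data :: "(nat \<Rightarrow> real) \<Rightarrow> (nat \<Rightarrow> 'h::{real_inner,banach}) \<Rightarrow> bool" where
  "spectral_data lam e \<longleftrightarrow>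
     (\<forall>i\<ge>1. \<forall>j\<ge>1. e i \<bullet> e j = (if i = j then 1 else 0)) \<and>
     closure (span (e ` {1..})) = UNIV \<and>
     0 < lam 1 \<and> (\<forall>k\<ge>1. lam k \<le> lam (Suc k)) \<and> filterlim lam at_top sequentially"

text \<open>\<open>spec_op lam e g\<close> is the operator \<open>g(A)\<close> for the self-adjoint \<open>A\<close> with \<open>A e\<^sub>k = lam\<^sub>k e\<^sub>k\<close>;
  it is only meaningful on \<open>spec_dom lam e g\<close>, the domain of \<open>g(A)\<close>.\<close>

definition spec_op ::
    "(nat \<Rightarrow> real) \<Rightarrow> (nat \<Rightarrow> 'h::{real_inner,banach}) \<Rightarrow> (real \<Rightarrow> real) \<Rightarrow> 'h \<Rightarrow> 'h" where
  "spec_op lam e g u = (\<Sum>k. (g (lam (Suc k)) * (u \<bullet> e (Suc k))) *\<^sub>R e (Suc k))"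

definition spec_dom ::
    "(nat \<Rightarrow> real) \<Rightarrow> (nat \<Rightarrow> 'h::{real_inner,banach}) \<Rightarrow> (real \<Rightarrow> real) \<Rightarrow> 'h set" where
  "spec_dom lam e g = {u. summable (\<lambda>k. (g (lam (Suc k)) * (u \<bullet> e (Suc k)))\<^sup>2)}"

definition pow_dom :: "(nat \<Rightarrow> real) \<Rightarrow> (nat \<Rightarrow> 'h::{real_inner,banach}) \<Rightarrow> real \<Rightarrow> 'h set" where
  "pow_dom lam e \<sigma> = spec_dom lam e (\<lambda>x. x powr \<sigma>)"

definition pow_norm :: "(nat \<Rightarrow> real) \<Rightarrow> (nat \<Rightarrow> 'h::{real_inner,banach}) \<Rightarrow> real \<Rightarrow> 'h \<Rightarrow> real" where
  "pow_norm lam e \<sigma> u = norm (spec_op lam e (\<lambda>x. x powr \<sigma>) u)"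

text \<open>\<open>semigroup_op lam e t\<close> is \<open>e\<^sup>-\<^sup>A\<^sup>t\<close>.  For negative \<open>t\<close> it is only applied to elements of
  the range of the finite-rank projector \<open>P\<close>, where the series has finitely many nonzero terms.\<close>

definition semigroup_op :: "(nat \<Rightarrow> real) \<Rightarrow> (nat \<Rightarrow> 'h::{real_inner,banach}) \<Rightarrow> real \<Rightarrow> 'h \<Rightarrow> 'h" where
  "semigroup_op lam e t = spec_op lam e (\<lambda>x. exp (- t * x))"

definition projP :: "(nat \<Rightarrow> 'h::{real_inner,banach}) \<Rightarrow> nat \<Rightarrow> 'h \<Rightarrow> 'h" where
  "projP e N u = (\<Sum>k=1..N. (u \<bullet> e k) *\<^sub>R e k)"

definition projQ :: "(nat \<Rightarrow> 'h::{real_inner,banach}) \<Rightarrow> nat \<Rightarrow> 'h \<Rightarrow> 'h" where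
  "projQ e N u = u - projP e N u"


section \<open>Analysis on a linear subspace carrying its own norm\<close>

text \<open>\<open>D(A\<^sup>\<sigma>)\<close> is a subset of \<open>H\<close> with a norm different from that of \<open>H\<close>.
  A normed space is therefore given by a carrier set \<open>X\<close> and a norm function \<open>nX\<close>.\<close>

definition norm_topology :: "'a::real_vector set \<Rightarrow> ('a \<Rightarrow> real) \<Rightarrow> 'a topology" where
  "norm_topology X nX = Metric_space.mtopology X (\<lambda>x y. nX (x - y))"

definition norm_borel :: "'a::real_vector set \<Rightarrow> ('a \<Rightarrow> real) \<Rightarrow> 'a measure" where
  "norm_borel X nX = sigma X {U. openin (norm_topology X nX) U}"

definition lipschitz_map ::
    "'a::real_vector set \<Rightarrow> ('a \<Rightarrow> real) \<Rightarrow> ('b::real_vector \<Rightarrow> real) \<Rightarrow> ('a \<Rightarrow> 'b) \<Rightarrow> bool" where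
  "lipschitz_map X nX nY f \<longleftrightarrow> (\<exists>C. \<forall>x\<in>X. \<forall>y\<in>X. nY (f x - f y) \<le> C * nX (x - y))"

definition bounded_linear_map ::
    "'a::real_vector set \<Rightarrow> ('a \<Rightarrow> real) \<Rightarrow> 'b::real_vector set \<Rightarrow> ('b \<Rightarrow> real) \<Rightarrow> ('a \<Rightarrow> 'b) \<Rightarrow> bool" where
  "bounded_linear_map X nX Y nY T \<longleftrightarrow>
     T \<in> X \<rightarrow> Y \<and>
     (\<forall>x\<in>X. \<forall>y\<in>X. T (x + y) = T x + T y) \<and>
     (\<forall>c. \<forall>x\<in>X. T (c *\<^sub>R x) = c *\<^sub>R T x) \<and>
     (\<exists>C. \<forall>x\<in>X. nY (T x) \<le> C * nX x)"

text \<open>Frechet differentiable on all of \<open>X\<close>, with derivative continuous in the operator norm.\<close>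

definition C1_map ::
    "'a::real_vector set \<Rightarrow> ('a \<Rightarrow> real) \<Rightarrow> 'b::real_vector set \<Rightarrow> ('b \<Rightarrow> real) \<Rightarrow> ('a \<Rightarrow> 'b) \<Rightarrow> bool" where
  "C1_map X nX Y nY f \<longleftrightarrow>
     f \<in> X \<rightarrow> Y \<and>
     (\<exists>f'. (\<forall>x\<in>X. bounded_linear_map X nX Y nY (f' x)) \<and>
           (\<forall>x\<in>X. \<forall>\<epsilon>>0. \<exists>\<delta>>0. \<forall>h\<in>X. nX h < \<delta> \<longrightarrow>
               nY (f (x + h) - f x - f' x h) \<le> \<epsilon> * nX h) \<and>
           (\<forall>x\<in>X. \<forall>\<epsilon>>0. \<exists>\<delta>>0. \<forall>y\<in>X. nX (y - x) < \<delta> \<longrightarrow>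
               (\<forall>h\<in>X. nY (f' y h - f' x h) \<le> \<epsilon> * nX h)))"


section \<open>The noise\<close>

type_synonym path = "real \<Rightarrow> real"

definition wiener_paths :: "path set" where
  "wiener_paths = {\<omega>. continuous_on UNIV \<omega> \<and> \<omega> 0 = 0}"

text \<open>Two-sided Wiener measure: the law under which the coordinate process is a two-sided standard
  Brownian motion.  The sigma-algebra generated by the coordinates is the Borel
  sigma-algebra of the compact-open topology on the path space.\<close>

definition two_sided_wiener :: "path measure \<Rightarrow> bool" where
  "two_sided_wiener W \<longleftrightarrow>
     prob_space W \<and>
     space W = wiener_paths \<and>
     sets W = sets (restrict_space (Pi\<^sub>M UNIV (\<lambda>_. borel)) wiener_paths) \<and>
     (\<forall>s t. s < t \<longrightarrow>
        distributed W lborel (\<lambda>\<omega>. \<omega> t - \<omega> s) (\<lambda>x. ennreal (normal_density 0 (sqrt (t - s)) x))) \<and>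
     (\<forall>n (\<tau> :: nat \<Rightarrow> real). strict_mono_on {..n} \<tau> \<longrightarrow>
        prob_space.indep_vars W (\<lambda>_. borel) (\<lambda>i \<omega>. \<omega> (\<tau> (Suc i)) - \<omega> (\<tau> i)) {..<n})"

definition path_shift :: "real \<Rightarrow> path \<Rightarrow> path" where
  "path_shift t \<omega> = (\<lambda>r. \<omega> (t + r) - \<omega> t)"

definition ou :: "path \<Rightarrow> real" where
  "ou \<omega> = - interval_lebesgue_integral lborel (-\<infinity>) 0 (\<lambda>s. exp s * \<omega> s)"

definition ou_int :: "path \<Rightarrow> real \<Rightarrow> real \<Rightarrow> real" where
  "ou_int \<omega> s t = interval_lebesgue_integral lborel (ereal s) (ereal t) (\<lambda>r. ou (path_shift r \<omega>))"

definition good_paths :: "path measure \<Rightarrow> path set \<Rightarrow> bool" where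
  "good_paths W \<Omega> \<longleftrightarrow>
     \<Omega> \<in> sets W \<and> emeasure W \<Omega> = 1 \<and> (\<forall>t. \<forall>\<omega>\<in>\<Omega>. path_shift t \<omega> \<in> \<Omega>) \<and>
     (\<forall>\<omega>\<in>\<Omega>. \<forall>F\<in>{at_top, at_bot}.
        ((\<lambda>t. \<omega> t / t) \<longlongrightarrow> 0) F \<and>
        ((\<lambda>t. ou (path_shift t \<omega>) / t) \<longlongrightarrow> 0) F \<and>
        ((\<lambda>t. ou_int \<omega> 0 t / t) \<longlongrightarrow> 0) F)"


section \<open>Random dynamical systems and inertial manifolds\<close>

text \<open>\<open>Pr\<close> is the probability space, \<open>\<theta>\<close> the driving flow, \<open>(X, nX)\<close> the phase space.
  The values of \<open>\<phi> t\<close> for negative \<open>t\<close>, for \<open>\<omega>\<close> outside \<open>space Pr\<close> and on states outside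
  \<open>X\<close> are irrelevant.\<close>

definition random_dynamical_system ::
    "'w measure \<Rightarrow> (real \<Rightarrow> 'w \<Rightarrow> 'w) \<Rightarrow> 'a::real_vector set \<Rightarrow> ('a \<Rightarrow> real) \<Rightarrow>
     (real \<Rightarrow> 'w \<Rightarrow> 'a \<Rightarrow> 'a) \<Rightarrow> bool" where
  "random_dynamical_system Pr \<theta> X nX \<phi> \<longleftrightarrow>
     (\<lambda>(t, \<omega>, x). \<phi> t \<omega> x) \<in>
        restrict_space borel {0..} \<Otimes>\<^sub>M (Pr \<Otimes>\<^sub>M norm_borel X nX) \<rightarrow>\<^sub>M norm_borel X nX \<and>
     (\<forall>\<omega>\<in>space Pr. \<forall>x\<in>X. \<phi> 0 \<omega> x = x) \<and>
     (\<forall>\<omega>\<in>space Pr. \<forall>x\<in>X. \<forall>s\<ge>0. \<forall>t\<ge>0. \<phi> (t + s) \<omega> x = \<phi> t (\<theta> s \<omega>) (\<phi> s \<omega> x))"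

definition set_dist :: "('a::real_vector \<Rightarrow> real) \<Rightarrow> 'a \<Rightarrow> 'a set \<Rightarrow> real" where
  "set_dist nX x S = (INF y\<in>S. nX (x - y))"

definition random_set ::
    "'w measure \<Rightarrow> 'a::real_vector set \<Rightarrow> ('a \<Rightarrow> real) \<Rightarrow> ('w \<Rightarrow> 'a set) \<Rightarrow> bool" where
  "random_set Pr X nX M \<longleftrightarrow>
     (\<forall>\<omega>\<in>space Pr. M \<omega> \<noteq> {} \<and> closedin (norm_topology X nX) (M \<omega>)) \<and>
     (\<forall>x\<in>X. (\<lambda>\<omega>. set_dist nX x (M \<omega>)) \<in> borel_measurable Pr)"

definition invariant_set ::
    "'w measure \<Rightarrow> (real \<Rightarrow> 'w \<Rightarrow> 'w) \<Rightarrow> (real \<Rightarrow> 'w \<Rightarrow> 'a \<Rightarrow> 'a) \<Rightarrow> ('w \<Rightarrow> 'a set) \<Rightarrow> bool" where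
  "invariant_set Pr \<theta> \<phi> M \<longleftrightarrow> (\<forall>\<omega>\<in>space Pr. \<forall>t\<ge>0. \<phi> t \<omega> ` M \<omega> \<subseteq> M (\<theta> t \<omega>))"

text \<open>\<open>reg\<close> is the regularity demanded of the map whose graph is the manifold.\<close>

definition inertial_manifold ::
    "(('a::real_vector \<Rightarrow> 'a) \<Rightarrow> bool) \<Rightarrow> 'w measure \<Rightarrow> (real \<Rightarrow> 'w \<Rightarrow> 'w) \<Rightarrow> 'a set \<Rightarrow> ('a \<Rightarrow> real) \<Rightarrow>
     'a set \<Rightarrow> 'a set \<Rightarrow> (real \<Rightarrow> 'w \<Rightarrow> 'a \<Rightarrow> 'a) \<Rightarrow> ('w \<Rightarrow> 'a set) \<Rightarrow> bool" where
  "inertial_manifold reg Pr \<theta> X nX H1 H2 \<phi> M \<longleftrightarrow>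
     random_dynamical_system Pr \<theta> X nX \<phi> \<and>
     subspace H1 \<and> subspace H2 \<and> (\<exists>B. finite B \<and> H1 = span B) \<and>
     H1 \<inter> H2 = {0} \<and> X = {a + b | a b. a \<in> H1 \<and> b \<in> H2} \<and>
     random_set Pr X nX M \<and> invariant_set Pr \<theta> \<phi> M \<and>
     (\<forall>\<omega>\<in>space Pr. \<exists>m. m \<in> H1 \<rightarrow> H2 \<and> reg m \<and> M \<omega> = {\<xi> + m \<xi> | \<xi>. \<xi> \<in> H1}) \<and>
     (\<exists>b>0. \<forall>x\<in>X. \<exists>K. K \<in> borel_measurable Pr \<and>
        (\<forall>\<omega>\<in>space Pr. \<forall>t\<ge>0. set_dist nX (\<phi> t \<omega> x) (M (\<theta> t \<omega>)) \<le> K \<omega> * exp (- b * t)))"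

definition lipschitz_inertial_manifold ::
    "'w measure \<Rightarrow> (real \<Rightarrow> 'w \<Rightarrow> 'w) \<Rightarrow> 'a::real_vector set \<Rightarrow> ('a \<Rightarrow> real) \<Rightarrow>
     'a set \<Rightarrow> 'a set \<Rightarrow> (real \<Rightarrow> 'w \<Rightarrow> 'a \<Rightarrow> 'a) \<Rightarrow> ('w \<Rightarrow> 'a set) \<Rightarrow> bool" where
  "lipschitz_inertial_manifold Pr \<theta> X nX H1 H2 = inertial_manifold (lipschitz_map H1 nX nX) Pr \<theta> X nX H1 H2"

definition C1_inertial_manifold ::
    "'w measure \<Rightarrow> (real \<Rightarrow> 'w \<Rightarrow> 'w) \<Rightarrow> 'a::real_vector set \<Rightarrow> ('a \<Rightarrow> real) \<Rightarrow>
     'a set \<Rightarrow> 'a set \<Rightarrow> (real \<Rightarrow> 'w \<Rightarrow> 'a \<Rightarrow> 'a) \<Rightarrow> ('w \<Rightarrow> 'a set) \<Rightarrow> bool" where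
  "C1_inertial_manifold Pr \<theta> X nX H1 H2 = inertial_manifold (C1_map H1 nX H2 nX) Pr \<theta> X nX H1 H2"


section \<open>The equations\<close>

definition G_map :: "('h::real_vector \<Rightarrow> 'h) \<Rightarrow> path \<Rightarrow> 'h \<Rightarrow> 'h" where
  "G_map F \<omega> u = exp (- ou \<omega>) *\<^sub>R F (exp (ou \<omega>) *\<^sub>R u)"

text \<open>\<open>evol lam e \<omega> t s\<close> is \<open>exp (- A (t - s) + \<integral>\<^sub>s\<^sup>t z(\<theta>\<^sub>r \<omega>) dr)\<close>.\<close>

definition evol ::
    "(nat \<Rightarrow> real) \<Rightarrow> (nat \<Rightarrow> 'h::{real_inner,banach}) \<Rightarrow> path \<Rightarrow> real \<Rightarrow> real \<Rightarrow> 'h \<Rightarrow> 'h" where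
  "evol lam e \<omega> t s w = exp (ou_int \<omega> s t) *\<^sub>R semigroup_op lam e (t - s) w"

text \<open>All \<open>H\<close>-valued integrals are Bochner integrals, and integrability is part of
  being a solution.\<close>

definition mild_solution ::
    "(nat \<Rightarrow> real) \<Rightarrow> (nat \<Rightarrow> 'h::{real_inner,banach,second_countable_topology}) \<Rightarrow> real \<Rightarrow>
     ('h \<Rightarrow> 'h) \<Rightarrow> path \<Rightarrow> 'h \<Rightarrow> (real \<Rightarrow> 'h) \<Rightarrow> bool" where
  "mild_solution lam e \<sigma> F \<omega> x u \<longleftrightarrow>
     continuous_map (top_of_set {0..}) (norm_topology (pow_dom lam e \<sigma>) (pow_norm lam e \<sigma>)) u \<and>
     (\<forall>t\<ge>0.
        interval_lebesgue_integrable lborel 0 (ereal t)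
          (\<lambda>s. evol lam e \<omega> t s (G_map F (path_shift s \<omega>) (u s))) \<and>
        u t = evol lam e \<omega> t 0 x +
          interval_lebesgue_integral lborel 0 (ereal t)
            (\<lambda>s. evol lam e \<omega> t s (G_map F (path_shift s \<omega>) (u s))))"

text \<open>The space \<open>C\<^sub>\<beta>\<^sup>-\<close>; the values of its elements at positive times are irrelevant.\<close>

definition C_beta_minus ::
    "(nat \<Rightarrow> real) \<Rightarrow> (nat \<Rightarrow> 'h::{real_inner,banach}) \<Rightarrow> real \<Rightarrow> real \<Rightarrow> path \<Rightarrow> (real \<Rightarrow> 'h) set" where
  "C_beta_minus lam e \<sigma> \<beta> \<omega> =
     {\<phi>. continuous_map (top_of_set {..0}) (norm_topology (pow_dom lam e \<sigma>) (pow_norm lam e \<sigma>)) \<phi> \<and>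
         bdd_above ((\<lambda>t. exp (\<beta> * t - ou_int \<omega> 0 t) * pow_norm lam e \<sigma> (\<phi> t)) ` {..0})}"

definition backward_solution ::
    "(nat \<Rightarrow> real) \<Rightarrow> (nat \<Rightarrow> 'h::{real_inner,banach,second_countable_topology}) \<Rightarrow> nat \<Rightarrow>
     ('h \<Rightarrow> 'h) \<Rightarrow> path \<Rightarrow> 'h \<Rightarrow> (real \<Rightarrow> 'h) \<Rightarrow> bool" where
  "backward_solution lam e N F \<omega> \<xi> u \<longleftrightarrow>
     (\<forall>t\<le>0.
        interval_lebesgue_integrable lborel 0 (ereal t)
          (\<lambda>s. evol lam e \<omega> t s (projP e N (G_map F (path_shift s \<omega>) (u s)))) \<and>
        interval_lebesgue_integrable lborel (-\<infinity>) (ereal t)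
          (\<lambda>s. evol lam e \<omega> t s (projQ e N (G_map F (path_shift s \<omega>) (u s)))) \<and>
        u t = evol lam e \<omega> t 0 \<xi> +
          interval_lebesgue_integral lborel 0 (ereal t)
            (\<lambda>s. evol lam e \<omega> t s (projP e N (G_map F (path_shift s \<omega>) (u s)))) +
          interval_lebesgue_integral lborel (-\<infinity>) (ereal t)
            (\<lambda>s. evol lam e \<omega> t s (projQ e N (G_map F (path_shift s \<omega>) (u s)))))"

text \<open>The flow of the Stratonovich equation, obtained from the flow \<open>u\<close> of the random equation
  by the Ornstein-Uhlenbeck change of variables.\<close>

definition strat_flow :: "(real \<Rightarrow> path \<Rightarrow> 'h::real_vector \<Rightarrow> 'h) \<Rightarrow> real \<Rightarrow> path \<Rightarrow> 'h \<Rightarrow> 'h" where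
  "strat_flow u t \<omega> x = exp (ou (path_shift t \<omega>)) *\<^sub>R u t \<omega> (exp (- ou \<omega>) *\<^sub>R x)"

end

theory Submission
  imports Defs
begin

text \<open>
  Conjugating by \<open>A\<^sup>\<sigma>\<close> and dividing by \<open>exp (\<integral>\<^sub>0\<^sup>t z(\<theta>\<^sub>r \<omega>) dr)\<close> turns the random equation into the
  deterministic nonautonomous equation \<open>y' + A y = A\<^sup>\<sigma> g(t, y)\<close> on \<open>H\<close>, where
  \<open>g(t, y) = exp (- a(t)) f(exp (a(t)) y)\<close>, \<open>f = F \<circ> A\<^sup>-\<^sup>\<sigma>\<close> and \<open>a(t) = z(\<theta>\<^sub>t \<omega>) + \<integral>\<^sub>0\<^sup>t z(\<theta>\<^sub>r \<omega>) dr\<close>; the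
  Lipschitz constant \<open>L\<close> survives.  Its Lyapunov-Perron operator has a kernel whose norm, weighted
  with \<open>exp (\<beta> t)\<close>, has integral at most \<open>\<mu> / L\<close> by the gap condition, so it is a contraction with
  constant \<open>\<mu>\<close>, and Picard iteration from \<open>0\<close> keeps the dependence on \<open>(\<omega>, \<xi>)\<close> measurable.

  Attraction uses the same contraction on the whole line: the unknown is the tracking orbit for
  \<open>t < 0\<close> and its difference to the given orbit for \<open>t \<ge> 0\<close>, so no smallness of the Lipschitz constant of \<open>\<psi>\<close> is
  needed, and the rate is \<open>exp (- \<beta> t + \<integral>\<^sub>0\<^sup>t z(\<theta>\<^sub>r \<omega>) dr)\<close>.  Invariance is the special case in which
  that difference vanishes.  Differentiability follows by passing to the limit along sequences in
  the linearised equation.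
\<close>

section \<open>Diagonal operators\<close>

text \<open>The number \<beta> is where the gap condition is spent: it exceeds \<open>lam N\<close>
  by \<open>2 / \<mu> * L * lam N powr \<sigma>\<close>, which makes the low-mode half of the kernel
  contribute exactly \<mu>/2 to the contraction constant, and the distance left up to
  \<open>lam (Suc N)\<close> makes the high-mode half, singular like
  \<open>\<tau> powr (- \<sigma>)\<close> at 0, contribute at most \<mu>/2. Three obstacles shape
  the rest. The flow \<open>u\<close> is given path by path as some family of mild solutions, so its
  joint measurability has to be recovered: by uniqueness it agrees with a Picard limit, which is
  measurable in its parameter. The superposition operator of a C1 map need not be differentiable
  between spaces with the same exponential weight, so remainders are shown to vanish at each time
  rather than in norm, through their upper limits. And gluing orbits at a time is awkward for
  vector-valued convolutions with a singular kernel; it is checked one eigenvector at a time after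
  multiplying by \<open>exp (l j * t)\<close>, where it is additivity of scalar integrals.\<close>

lemma measurable_curry_borel:
  assumes "(\<lambda>(x, y). f x y) \<in> borel_measurable (A \<Otimes>\<^sub>M B)" "g \<in> M \<rightarrow>\<^sub>M A" "h \<in> M \<rightarrow>\<^sub>M B"
  shows "(\<lambda>x. f (g x) (h x)) \<in> borel_measurable M"
  using measurable_compose[OF measurable_Pair[OF assms(2,3)] assms(1)] by simp

locale onb =
  fixes lam :: "nat \<Rightarrow> real" and e :: "nat \<Rightarrow> 'h::{real_inner,banach,second_countable_topology}"
  assumes spectral: "spectral_data lam e"
begin

definition b :: "nat \<Rightarrow> 'h" where "b k = e (Suc k)"
definition l :: "nat \<Rightarrow> real" where "l k = lam (Suc k)"

section \<open>Fourier expansion in the orthonormal basis\<close>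

lemma inner_b: "b i \<bullet> b j = (if i = j then 1 else 0)"
  using spectral by (auto simp: spectral_data_def b_def)

lemma l_mono: "i \<le> j \<Longrightarrow> l i \<le> l j"
  by (rule lift_Suc_mono_le[of l]) (use spectral in \<open>auto simp: spectral_data_def l_def\<close>)

lemma l_pos: "0 < l k"
  using l_mono[of 0 k] spectral by (auto simp: spectral_data_def l_def)

text \<open>The hyperplane orthogonal to \<open>x\<close> is closed and contains the dense span of
  the basis, hence contains \<open>x\<close> itself. Through \<open>coeff_eqI\<close> many vector
  identities below are reduced to comparing coefficients.\<close>

lemma orth_zero:
  assumes "\<And>k. x \<bullet> b k = 0" shows "x = 0"
proof -
  have "e ` {1..} \<subseteq> {y. x \<bullet> y = 0}"
  proof clarify
    fix k :: nat assume "1 \<le> k"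
    then have "e k = b (k - 1)" by (simp add: b_def)
    then show "x \<bullet> e k = 0" using assms by simp
  qed
  then have "span (e ` {1..}) \<subseteq> {y. x \<bullet> y = 0}"
    by (rule span_minimal) (auto simp: subspace_def inner_add_right)
  then have "closure (span (e ` {1..})) \<subseteq> {y. x \<bullet> y = 0}"
    by (rule closure_minimal) (rule closed_hyperplane)
  then have "x \<in> {y. x \<bullet> y = 0}" using spectral unfolding spectral_data_def by blast
  then have "x \<bullet> x = 0" by simp
  then show ?thesis by simp
qed

lemma coeff_eqI:
  assumes "\<And>k. x \<bullet> b k = y \<bullet> b k" shows "x = y"
  using orth_zero[of "x - y"] assms by (simp add: inner_diff_left)

lemma inner_sum_b: "(\<Sum>k\<in>I. c k *\<^sub>R b k) \<bullet> b j = (if j \<in> I then c j else 0)" if "finite I"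
proof -
  have "(\<Sum>k\<in>I. c k *\<^sub>R b k) \<bullet> b j = (\<Sum>k\<in>I. if k = j then c k else 0)"
    by (simp add: inner_sum_left inner_b if_distrib[of "(*) _"] cong: if_cong)
  also have "\<dots> = (if j \<in> I then c j else 0)"
    using that by simp
  finally show ?thesis .
qed

lemma norm_sum_b: "(norm (\<Sum>k\<in>I. c k *\<^sub>R b k))\<^sup>2 = (\<Sum>k\<in>I. (c k)\<^sup>2)" if "finite I"
proof -
  have "(norm (\<Sum>k\<in>I. c k *\<^sub>R b k))\<^sup>2 = (\<Sum>k\<in>I. c k * ((\<Sum>k\<in>I. c k *\<^sub>R b k) \<bullet> b k))"
    unfolding power2_norm_eq_inner by (simp add: inner_sum_right)
  also have "\<dots> = (\<Sum>k\<in>I. (c k)\<^sup>2)"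
    using that by (intro sum.cong) (auto simp: inner_sum_b power2_eq_square)
  finally show ?thesis .
qed

text \<open>By Pythagoras (\<open>norm_sum_b\<close>) the squared norm of a block of the series is
  the same block of the series of squares, so the Cauchy criterion carries over.\<close>

lemma summable_series:
  assumes "summable (\<lambda>k. (c k)\<^sup>2)"
  shows "summable (\<lambda>k. c k *\<^sub>R b k)"
  unfolding summable_Cauchy
proof (intro allI impI)
  fix \<epsilon> :: real assume \<epsilon>: "\<epsilon> > 0"
  then obtain N where N: "\<And>m n. m \<ge> N \<Longrightarrow> norm (\<Sum>k=m..<n. (c k)\<^sup>2) < \<epsilon>\<^sup>2"
    using assms unfolding summable_Cauchy by (metis zero_less_power)
  show "\<exists>N. \<forall>m\<ge>N. \<forall>n. norm (\<Sum>k=m..<n. c k *\<^sub>R b k) < \<epsilon>"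
  proof (intro exI[of _ N] allI impI)
    fix m n assume "m \<ge> N"
    have "(norm (\<Sum>k=m..<n. c k *\<^sub>R b k))\<^sup>2 < \<epsilon>\<^sup>2"
      using N[OF \<open>m \<ge> N\<close>, of n] by (simp add: norm_sum_b sum_nonneg)
    then show "norm (\<Sum>k=m..<n. c k *\<^sub>R b k) < \<epsilon>"
      using \<epsilon> by (meson less_imp_le power_less_imp_less_base)
  qed
qed

lemma inner_series:
  assumes "summable (\<lambda>k. (c k)\<^sup>2)"
  shows "(\<Sum>k. c k *\<^sub>R b k) \<bullet> b j = c j"
proof -
  have "(\<lambda>n. (\<Sum>k<n. c k *\<^sub>R b k) \<bullet> b j) \<longlonglongrightarrow> (\<Sum>k. c k *\<^sub>R b k) \<bullet> b j"
    by (intro tendsto_intros summable_LIMSEQ summable_series assms)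
  moreover have "(\<lambda>n. (\<Sum>k<n. c k *\<^sub>R b k) \<bullet> b j) \<longlonglongrightarrow> c j"
    by (rule tendsto_eventually) (auto simp: inner_sum_b eventually_sequentially intro!: exI[of _ "Suc j"])
  ultimately show ?thesis by (rule LIMSEQ_unique)
qed

lemma norm_series:
  assumes "summable (\<lambda>k. (c k)\<^sup>2)"
  shows "(norm (\<Sum>k. c k *\<^sub>R b k))\<^sup>2 = (\<Sum>k. (c k)\<^sup>2)"
proof -
  have "(\<lambda>n. (norm (\<Sum>k<n. c k *\<^sub>R b k))\<^sup>2) \<longlonglongrightarrow> (norm (\<Sum>k. c k *\<^sub>R b k))\<^sup>2"
    by (intro tendsto_intros summable_LIMSEQ summable_series assms)
  moreover have "(\<lambda>n. (norm (\<Sum>k<n. c k *\<^sub>R b k))\<^sup>2) \<longlonglongrightarrow> (\<Sum>k. (c k)\<^sup>2)"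
    using summable_LIMSEQ[OF assms] by (simp add: norm_sum_b)
  ultimately show ?thesis by (rule LIMSEQ_unique)
qed

text \<open>Bessel's inequality: the squared distance from \<open>x\<close> to its partial sum is
  nonnegative and equals \<open>(norm x)\<^sup>2\<close> minus the partial sum of squares.\<close>

lemma summable_coeff: "summable (\<lambda>k. (x \<bullet> b k)\<^sup>2)"
proof (rule summableI_nonneg_bounded)
  fix n
  let ?s = "\<Sum>k<n. (x \<bullet> b k) *\<^sub>R b k"
  have xs: "x \<bullet> ?s = (\<Sum>k<n. (x \<bullet> b k)\<^sup>2)"
    by (simp add: inner_sum_right power2_eq_square)
  have "0 \<le> (norm (x - ?s))\<^sup>2" by simp
  also have "\<dots> = (norm x)\<^sup>2 - (\<Sum>k<n. (x \<bullet> b k)\<^sup>2)"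
    unfolding power2_norm_eq_inner
    using norm_sum_b[of "{..<n}" "\<lambda>k. x \<bullet> b k"] xs
    by (simp add: inner_diff_left inner_diff_right inner_commute power2_norm_eq_inner)
  finally show "(\<Sum>k<n. (x \<bullet> b k)\<^sup>2) \<le> (norm x)\<^sup>2" by simp
qed simp

lemma expansion: "x = (\<Sum>k. (x \<bullet> b k) *\<^sub>R b k)"
  by (rule coeff_eqI) (simp add: inner_series summable_coeff)

lemma parseval: "(norm x)\<^sup>2 = (\<Sum>k. (x \<bullet> b k)\<^sup>2)"
  using norm_series[OF summable_coeff, of x] unfolding expansion[of x, symmetric] .

section \<open>Operators with a diagonal symbol\<close>

text \<open>Symbols are arbitrary sequences and not functions of the eigenvalue, so that spectral
  projectors, truncated semigroups and the sign-changing Lyapunov-Perron kernel are all of this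
  form.\<close>

definition diag :: "(nat \<Rightarrow> real) \<Rightarrow> 'h \<Rightarrow> 'h" where
  "diag c x = (\<Sum>k. (c k * (x \<bullet> b k)) *\<^sub>R b k)"

lemma spec_op_diag: "spec_op lam e g = diag (\<lambda>k. g (l k))"
  by (simp add: fun_eq_iff spec_op_def diag_def b_def l_def)

text \<open>The version for unbounded symbols, applied to \<open>A\<^sup>\<sigma>\<close> on its
  domain; \<open>diag_inner\<close> is the bounded case.\<close>

lemma diag_inner':
  "summable (\<lambda>k. (c k * (x \<bullet> b k))\<^sup>2) \<Longrightarrow> diag c x \<bullet> b j = c j * (x \<bullet> b j)"
  unfolding diag_def by (rule inner_series)

lemma summable_diag:
  assumes "\<And>k. \<bar>c k\<bar> \<le> C"
  shows "summable (\<lambda>k. (c k * (x \<bullet> b k))\<^sup>2)"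
proof (rule summable_comparison_test)
  show "\<exists>N. \<forall>n\<ge>N. norm ((c n * (x \<bullet> b n))\<^sup>2) \<le> C\<^sup>2 * (x \<bullet> b n)\<^sup>2"
    using power_mono[OF assms abs_ge_zero, of _ 2]
    by (auto simp: power_mult_distrib intro!: mult_right_mono)
qed (intro summable_mult summable_coeff)

lemma diag_inner:
  assumes "\<And>k. \<bar>c k\<bar> \<le> C"
  shows "diag c x \<bullet> b j = c j * (x \<bullet> b j)"
  by (intro diag_inner' summable_diag[OF assms])

lemma norm_diag:
  assumes "\<And>k. \<bar>c k\<bar> \<le> C"
  shows "norm (diag c x) \<le> C * norm x"
proof -
  have C: "0 \<le> C" using order_trans[OF abs_ge_zero assms[of 0]] .
  have "(norm (diag c x))\<^sup>2 = (\<Sum>k. (c k * (x \<bullet> b k))\<^sup>2)"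
    unfolding diag_def by (intro norm_series summable_diag[OF assms])
  also have "\<dots> \<le> (\<Sum>k. C\<^sup>2 * (x \<bullet> b k)\<^sup>2)"
    using power_mono[OF assms abs_ge_zero, of _ 2]
    by (intro suminf_le summable_diag[OF assms] summable_mult summable_coeff)
      (auto simp: power_mult_distrib intro!: mult_right_mono)
  also have "\<dots> = (C * norm x)\<^sup>2"
    by (simp add: suminf_mult summable_coeff parseval power_mult_distrib)
  finally show ?thesis
    by (rule power2_le_imp_le) (use C in auto)
qed

lemma bounded_linear_diag:
  assumes "\<And>k. \<bar>c k\<bar> \<le> C"
  shows "bounded_linear (diag c)"
  by (rule bounded_linear_intro[where K = C])
    (auto intro!: coeff_eqI norm_diag[OF assms, THEN order_trans]
      simp: diag_inner[OF assms] inner_add_left algebra_simps)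

text \<open>Strong convergence from a uniform bound and convergence of each symbol; convergence in
  operator norm would fail already for the semigroup at time 0. Parseval turns the claim into a
  series dominated by \<open>(2 * C)\<^sup>2\<close> times the squared coefficients of
  \<open>x\<close>, to which Tannery's theorem applies.\<close>

lemma tendsto_diag:
  assumes "eventually (\<lambda>t. \<forall>k. \<bar>c t k\<bar> \<le> C) G" "\<And>k. ((\<lambda>t. c t k) \<longlongrightarrow> c' k) G"
  shows "((\<lambda>t. diag (c t) x) \<longlongrightarrow> diag c' x) G"
proof (cases "G = bot")
  case False
  have c': "\<bar>c' k\<bar> \<le> C" for k
    using assms(1) by (intro tendsto_upperbound[OF tendsto_rabs[OF assms(2)] _ False])
      (auto elim: eventually_mono)
  have "((\<lambda>t. \<Sum>k. ((c t k - c' k) * (x \<bullet> b k))\<^sup>2) \<longlongrightarrow> (\<Sum>k. 0)) G"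
  proof (rule tannerys_theorem[THEN conjunct2, THEN conjunct2])
    show "((\<lambda>t. ((c t k - c' k) * (x \<bullet> b k))\<^sup>2) \<longlongrightarrow> 0) G" for k
      using assms(2)[of k] by (auto intro!: tendsto_eq_intros)
    show "\<forall>\<^sub>F (k, t) in at_top \<times>\<^sub>F G. norm (((c t k - c' k) * (x \<bullet> b k))\<^sup>2) \<le> (2 * C)\<^sup>2 * (x \<bullet> b k)\<^sup>2"
    proof (rule eventually_mono[OF eventually_prodI[OF eventually_True assms(1)]])
      fix kt :: "nat \<times> 'a" assume "True \<and> (\<forall>k. \<bar>c (snd kt) k\<bar> \<le> C)"
      then have "\<bar>c (snd kt) (fst kt) - c' (fst kt)\<bar> \<le> 2 * C"
        using c'[of "fst kt"] by (smt (verit))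
      from power_mono[OF this, of 2]
      show "case kt of (k, t) \<Rightarrow> norm (((c t k - c' k) * (x \<bullet> b k))\<^sup>2) \<le> (2 * C)\<^sup>2 * (x \<bullet> b k)\<^sup>2"
        by (auto simp: power_mult_distrib split: prod.split intro!: mult_right_mono)
    qed
  qed (auto intro!: summable_mult summable_coeff False)
  moreover have "\<forall>\<^sub>F t in G. (norm (diag (c t) x - diag c' x))\<^sup>2 = (\<Sum>k. ((c t k - c' k) * (x \<bullet> b k))\<^sup>2)"
    using assms(1)
  proof eventually_elim
    case (elim t)
    have *: "\<bar>c t k - c' k\<bar> \<le> 2 * C" for k using elim[rule_format, of k] c'[of k] by linarith
    have "diag (c t) x - diag c' x = diag (\<lambda>k. c t k - c' k) x"
      by (rule coeff_eqI)
        (simp add: diag_inner[OF c'] diag_inner[OF elim[rule_format]] diag_inner[OF *] inner_diff_left left_diff_distrib)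
    then show ?case by (simp add: diag_def norm_series[OF summable_diag[OF *]])
  qed
  ultimately have "((\<lambda>t. (norm (diag (c t) x - diag c' x))\<^sup>2) \<longlongrightarrow> 0) G"
    by (simp add: filterlim_cong)
  then have "((\<lambda>t. sqrt ((norm (diag (c t) x - diag c' x))\<^sup>2)) \<longlongrightarrow> sqrt 0) G"
    by (intro tendsto_intros)
  then show ?thesis
    by (simp add: tendsto_norm_zero_iff LIM_zero_iff)
qed simp

lemma measurable_diag:
  assumes "\<And>k. (\<lambda>t. c t k) \<in> borel_measurable M" "g \<in> borel_measurable M"
  shows "(\<lambda>t. diag (c t) (g t)) \<in> borel_measurable M"
  unfolding diag_def
  by (intro borel_measurable_suminf borel_measurable_scaleR borel_measurable_times assms
      borel_measurable_inner borel_measurable_const)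

lemma projP_diag: "projP e n = diag (\<lambda>k. if k < n then 1 else 0)"
proof
  fix x
  have "projP e n x = (\<Sum>k<n. (x \<bullet> b k) *\<^sub>R b k)"
    unfolding projP_def b_def
    by (rule sum.reindex_bij_witness[where i = Suc and j = "\<lambda>k. k - 1"]) auto
  moreover have "diag (\<lambda>k. if k < n then 1 else 0) x = (\<Sum>k<n. (x \<bullet> b k) *\<^sub>R b k)"
    unfolding diag_def by (subst suminf_finite[of "{..<n}"]) auto
  ultimately show "projP e n x = diag (\<lambda>k. if k < n then 1 else 0) x" by simp
qed

lemma projP_inner: "projP e n x \<bullet> b j = (if j < n then x \<bullet> b j else 0)"
  unfolding projP_diag by (subst diag_inner[where C = 1]) auto

lemma projQ_inner: "projQ e n x \<bullet> b j = (if j < n then 0 else x \<bullet> b j)"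
  by (simp add: projQ_def inner_diff_left projP_inner)

lemma projQ_diag: "projQ e n = diag (\<lambda>k. if k < n then 0 else 1)"
  by (rule ext, rule coeff_eqI, subst diag_inner[where C = 1]) (auto simp: projQ_inner)

end

section \<open>Convolution equations with a weakly singular kernel\<close>

text \<open>From \<open>norm (f n x - f' x) \<le> g n x + g' x\<close> the distance is at most its
  minimum with \<open>2 * g' x\<close>, plus the positive part of \<open>g n x - g' x\<close>. The
  first term has the fixed majorant \<open>2 * g'\<close>. The second is \<open>g n x - g' x\<close>
  plus the positive part of \<open>g' x - g n x\<close>: the integral of the former tends to 0 by
  assumption, and the latter is dominated by \<open>g'\<close>. It is wanted for kernels whose
  singularity moves with \<open>n\<close>.\<close>

lemma dominated_convergence_varying_bound:
  fixes f :: "nat \<Rightarrow> 'a \<Rightarrow> 'b::{banach,second_countable_topology}" and g :: "nat \<Rightarrow> 'a \<Rightarrow> real"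
  assumes [measurable]: "\<And>n. f n \<in> borel_measurable M" "f' \<in> borel_measurable M"
    and g: "\<And>n. integrable M (g n)" "integrable M g'"
    and f_lim: "AE x in M. (\<lambda>n. f n x) \<longlonglongrightarrow> f' x"
    and g_lim: "AE x in M. (\<lambda>n. g n x) \<longlonglongrightarrow> g' x"
    and bound: "\<And>n. AE x in M. norm (f n x) \<le> g n x"
    and g_int: "(\<lambda>n. LINT x|M. g n x) \<longlonglongrightarrow> (LINT x|M. g' x)"
  shows "(\<lambda>n. LINT x|M. f n x) \<longlonglongrightarrow> (LINT x|M. f' x)"
proof -
  have [measurable]: "\<And>n. g n \<in> borel_measurable M" "g' \<in> borel_measurable M"
    using g by auto
  have bound': "AE x in M. \<forall>n. norm (f n x) \<le> g n x"
    using bound by (simp add: AE_all_countable)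
  have bf': "AE x in M. norm (f' x) \<le> g' x"
    using bound' f_lim g_lim
  proof eventually_elim
    case (elim x)
    then show ?case by (intro LIMSEQ_le[OF tendsto_norm[OF elim(2)] elim(3)]) auto
  qed
  have f: "integrable M (f n)" for n
    by (rule Bochner_Integration.integrable_bound[OF g(1)[of n]])
      (use bound[of n] in \<open>auto elim: eventually_mono\<close>)
  have f': "integrable M f'"
    by (rule Bochner_Integration.integrable_bound[OF g(2)]) (use bf' in \<open>auto elim: eventually_mono\<close>)
  let ?m = "\<lambda>n x. min (norm (f n x - f' x)) (2 * g' x)"
  let ?p = "\<lambda>n x. max (g' x - g n x) 0"
  have m0: "(\<lambda>n. LINT x|M. ?m n x) \<longlonglongrightarrow> (LINT x|M. 0)"
  proof (rule integral_dominated_convergence[where w = "\<lambda>x. 2 * g' x"])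
    show "AE x in M. (\<lambda>n. ?m n x) \<longlonglongrightarrow> 0"
      using f_lim bf'
    proof eventually_elim
      case (elim x)
      have "0 \<le> g' x" using elim(2) by (rule order_trans[OF norm_ge_zero])
      then show ?case
        by (auto intro!: tendsto_eq_intros elim(1))
    qed
    show "AE x in M. norm (?m n x) \<le> 2 * g' x" for n
      using bf'
    proof eventually_elim
      case (elim x)
      have "0 \<le> g' x" using elim by (rule order_trans[OF norm_ge_zero])
      then show ?case by auto
    qed
  qed (use g in auto)
  have p0: "(\<lambda>n. LINT x|M. ?p n x) \<longlonglongrightarrow> (LINT x|M. 0)"
  proof (rule integral_dominated_convergence[where w = "g'"])
    show "AE x in M. (\<lambda>n. ?p n x) \<longlonglongrightarrow> 0"
      using g_lim by eventually_elim (auto intro!: tendsto_eq_intros)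
    show "AE x in M. norm (?p n x) \<le> g' x" for n
      using bf' bound[of n]
    proof eventually_elim
      case (elim x)
      have "0 \<le> g' x" "0 \<le> g n x" using elim norm_ge_zero order_trans by blast+
      then show ?case by auto
    qed
  qed (use g in auto)
  have pint: "integrable M (?p n)" for n using g by auto
  have mint: "integrable M (?m n)" for n using g f f' by auto
  have "(\<lambda>n. (LINT x|M. ?m n x) + (((LINT x|M. g n x) - (LINT x|M. g' x)) + (LINT x|M. ?p n x))) \<longlonglongrightarrow> 0"
    using m0 p0 g_int by (auto intro!: tendsto_eq_intros)
  moreover have "norm ((LINT x|M. f n x) - (LINT x|M. f' x)) \<le>
      (LINT x|M. ?m n x) + (((LINT x|M. g n x) - (LINT x|M. g' x)) + (LINT x|M. ?p n x))" for n
  proof -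
    have "norm ((LINT x|M. f n x) - (LINT x|M. f' x)) = norm (LINT x|M. f n x - f' x)"
      using f f' by simp
    also have "\<dots> \<le> (LINT x|M. norm (f n x - f' x))" by (rule integral_norm_bound)
    also have "\<dots> \<le> (LINT x|M. ?m n x + ((g n x - g' x) + ?p n x))"
    proof (rule integral_mono_AE)
      show "AE x in M. norm (f n x - f' x) \<le> ?m n x + ((g n x - g' x) + ?p n x)"
        using bf' bound[of n]
      proof eventually_elim
        case (elim x)
        show ?case using norm_triangle_ineq4[of "f n x" "f' x"] elim by auto
      qed
    qed (use g f f' mint pint in auto)
    also have "\<dots> = (LINT x|M. ?m n x) + (((LINT x|M. g n x) - (LINT x|M. g' x)) + (LINT x|M. ?p n x))"
      using g mint pint by simp
    finally show ?thesis .
  qed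
  ultimately have "(\<lambda>n. (LINT x|M. f n x) - (LINT x|M. f' x)) \<longlonglongrightarrow> 0"
    by (rule Lim_null_comparison[OF always_eventually[OF allI], rotated])
  then show ?thesis by (simp add: LIM_zero_iff)
qed

text \<open>Instantiated twice: by the two-sided Lyapunov-Perron kernel with weight
  \<open>bet = \<beta>\<close> and by the causal kernel of the forward problem with weight
  \<open>bet = - \<gamma>\<close>. Inputs are functions bounded by a multiple of
  \<open>exp (- bet * t)\<close>, on which convolution has norm at most \<open>q\<close>. Continuity
  is demanded only off 0, since at 0 the kernel jumps and its bound may blow up.\<close>

locale conv_kernel =
  fixes k :: "real \<Rightarrow> 'h::{banach,second_countable_topology} \<Rightarrow> 'h"
    and \<kappa> :: "real \<Rightarrow> real" and bet q :: real
  assumes k_measurable: "(\<lambda>(\<tau>, x). k \<tau> x) \<in> borel_measurable (borel \<Otimes>\<^sub>M borel)"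
    and k_linear: "linear (k \<tau>)"
    and k_bound: "norm (k \<tau> x) \<le> \<kappa> \<tau> * norm x"
    and \<kappa>_nonneg: "0 \<le> \<kappa> \<tau>"
    and \<kappa>_integrable: "integrable lborel (\<lambda>\<tau>. exp (bet * \<tau>) * \<kappa> \<tau>)"
    and \<kappa>_q: "(LINT \<tau>|lborel. exp (bet * \<tau>) * \<kappa> \<tau>) \<le> q"
    and k_cont: "\<tau> \<noteq> 0 \<Longrightarrow> isCont (\<lambda>\<tau>. k \<tau> x) \<tau>"
    and \<kappa>_cont: "\<tau> \<noteq> 0 \<Longrightarrow> isCont \<kappa> \<tau>"
begin

lemma q_nonneg: "0 \<le> q"
proof -
  have "0 \<le> (LINT \<tau>|lborel. exp (bet * \<tau>) * \<kappa> \<tau>)"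
    by (intro integral_nonneg_AE AE_I2 mult_nonneg_nonneg \<kappa>_nonneg exp_ge_zero)
  then show ?thesis using \<kappa>_q by linarith
qed

lemma k_measurable' [measurable (raw)]:
  "f \<in> borel_measurable M \<Longrightarrow> g \<in> borel_measurable M \<Longrightarrow> (\<lambda>x. k (f x) (g x)) \<in> borel_measurable M"
  by (rule measurable_curry_borel[OF k_measurable])

lemma \<kappa>_measurable [measurable]: "\<kappa> \<in> borel_measurable borel"
proof -
  have "(\<lambda>\<tau>. exp (- bet * \<tau>) * (exp (bet * \<tau>) * \<kappa> \<tau>)) \<in> borel_measurable lborel"
    by (intro borel_measurable_times borel_measurable_integrable[OF \<kappa>_integrable]) auto
  then show ?thesis by (simp add: mult.assoc[symmetric] exp_add[symmetric])
qed

lemma kernel_integral: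
  "integrable lborel (\<lambda>s. \<kappa> (t - s) * exp (- bet * s))"
  "(LINT s|lborel. \<kappa> (t - s) * exp (- bet * s)) = exp (- bet * t) * (LINT \<tau>|lborel. exp (bet * \<tau>) * \<kappa> \<tau>)"
proof -
  have eq: "\<kappa> (t - s) * exp (- bet * s) = exp (- bet * t) * (exp (bet * (t + (-1) * s)) * \<kappa> (t + (-1) * s))" for s
    by (simp add: algebra_simps exp_add[symmetric] exp_diff) (simp add: exp_minus field_simps)
  show "integrable lborel (\<lambda>s. \<kappa> (t - s) * exp (- bet * s))"
    unfolding eq by (intro integrable_mult_right lborel_integrable_real_affine \<kappa>_integrable) auto
  show "(LINT s|lborel. \<kappa> (t - s) * exp (- bet * s)) = exp (- bet * t) * (LINT \<tau>|lborel. exp (bet * \<tau>) * \<kappa> \<tau>)"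
    unfolding eq
    by (subst lborel_integral_real_affine[of "-1" "\<lambda>\<tau>. exp (bet * \<tau>) * \<kappa> \<tau>" t]) simp_all
qed

lemma kernel_integral_le: "(LINT s|lborel. \<kappa> (t - s) * exp (- bet * s)) \<le> q * exp (- bet * t)"
  unfolding kernel_integral(2) mult.commute[of q] using \<kappa>_q by (rule mult_left_mono) simp

definition conv :: "(real \<Rightarrow> 'h) \<Rightarrow> real \<Rightarrow> 'h" where
  "conv h t = (LINT s|lborel. k (t - s) (h s))"

lemma bounded_integrable:
  assumes [measurable]: "r \<in> borel_measurable borel" and r: "\<And>s. \<bar>r s\<bar> \<le> C * exp (- bet * s)"
  shows "integrable lborel (\<lambda>s. \<kappa> (t - s) * r s)"
proof (rule Bochner_Integration.integrable_bound)
  show "integrable lborel (\<lambda>s. C * (\<kappa> (t - s) * exp (- bet * s)))"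
    by (intro integrable_mult_right kernel_integral)
  show "AE s in lborel. norm (\<kappa> (t - s) * r s) \<le> norm (C * (\<kappa> (t - s) * exp (- bet * s)))"
  proof (rule AE_I2)
    fix s
    have "\<kappa> (t - s) * \<bar>r s\<bar> \<le> \<kappa> (t - s) * (C * exp (- bet * s))"
      by (intro mult_left_mono r \<kappa>_nonneg)
    also have "\<dots> \<le> norm (C * (\<kappa> (t - s) * exp (- bet * s)))"
      by (simp add: mult.left_commute abs_mult) (metis abs_ge_self abs_mult mult.left_commute)
    finally show "norm (\<kappa> (t - s) * r s) \<le> norm (C * (\<kappa> (t - s) * exp (- bet * s)))"
      using \<kappa>_nonneg by (simp add: abs_mult)
  qed
qed auto

text \<open>The majorant \<open>r\<close> is kept inside the integral, while the exponential bound
  provides integrability: the pointwise limit argument of \<open>sequence_gronwall\<close> uses the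
  information in \<open>r\<close>.\<close>

lemma conv_norm_le:
  assumes [measurable]: "h \<in> borel_measurable borel" "r \<in> borel_measurable borel"
    and "\<And>s. norm (h s) \<le> r s" and r: "\<And>s. r s \<le> C * exp (- bet * s)"
  shows "integrable lborel (\<lambda>s. k (t - s) (h s))" and "norm (conv h t) \<le> (LINT s|lborel. \<kappa> (t - s) * r s)"
proof -
  have r0: "0 \<le> r s" for s using assms(3)[of s] norm_ge_zero order_trans by blast
  have i: "integrable lborel (\<lambda>s. \<kappa> (t - s) * r s)"
    using r r0 by (intro bounded_integrable) auto
  have b: "norm (k (t - s) (h s)) \<le> \<kappa> (t - s) * r s" for s
    using k_bound[of "t - s" "h s"] mult_left_mono[OF assms(3)[of s] \<kappa>_nonneg[of "t - s"]] by linarith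
  show "integrable lborel (\<lambda>s. k (t - s) (h s))"
    by (rule Bochner_Integration.integrable_bound[OF i]) (auto intro!: AE_I2 order_trans[OF b])
  then show "norm (conv h t) \<le> (LINT s|lborel. \<kappa> (t - s) * r s)"
    unfolding conv_def using b by (intro Bochner_Integration.integral_norm_bound_integral i) auto
qed

lemma conv_bound:
  assumes [measurable]: "h \<in> borel_measurable borel" and "\<And>s. norm (h s) \<le> C * exp (- bet * s)"
  shows "integrable lborel (\<lambda>s. k (t - s) (h s))" and "norm (conv h t) \<le> C * q * exp (- bet * t)"
proof -
  have C: "0 \<le> C" using order_trans[OF norm_ge_zero assms(2)[of 0]] by simp
  show "integrable lborel (\<lambda>s. k (t - s) (h s))"
    by (rule conv_norm_le[OF _ _ assms(2) order_refl]) auto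
  have "norm (conv h t) \<le> (LINT s|lborel. \<kappa> (t - s) * (C * exp (- bet * s)))"
    by (rule conv_norm_le[OF _ _ assms(2) order_refl]) auto
  also have "\<dots> = C * (LINT s|lborel. \<kappa> (t - s) * exp (- bet * s))"
    by (simp add: mult.left_commute)
  also have "\<dots> \<le> C * (q * exp (- bet * t))"
    by (intro mult_left_mono kernel_integral_le C)
  finally show "norm (conv h t) \<le> C * q * exp (- bet * t)" by (simp add: mult.assoc)
qed

lemma conv_diff:
  assumes "h \<in> borel_measurable borel" "\<And>s. norm (h s) \<le> C * exp (- bet * s)"
    and "h' \<in> borel_measurable borel" "\<And>s. norm (h' s) \<le> C' * exp (- bet * s)"
  shows "conv h t - conv h' t = conv (\<lambda>s. h s - h' s) t"
  using conv_bound(1)[OF assms(1,2), of t] conv_bound(1)[OF assms(3,4), of t]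
  by (simp add: conv_def linear_diff[OF k_linear])

lemma conv_scaleR: "conv (\<lambda>s. c *\<^sub>R h s) t = c *\<^sub>R conv h t"
  by (simp add: conv_def linear_scale[OF k_linear])

lemma conv_measurable:
  assumes [measurable]: "(\<lambda>(p, s). h p s) \<in> borel_measurable (M \<Otimes>\<^sub>M borel)"
  shows "(\<lambda>(p, t). conv (h p) t) \<in> borel_measurable (M \<Otimes>\<^sub>M borel)"
  unfolding conv_def by measurable

text \<open>The singularity of the majorant \<open>\<kappa> (x n - s)\<close> moves with
  \<open>n\<close>, so no fixed integrable majorant is at hand. The integrals of the majorants are
  explicit multiples of \<open>exp (- bet * x n)\<close> and converge, which is what the theorem
  with varying bounds asks for.\<close>

lemma conv_continuous:
  assumes [measurable]: "h \<in> borel_measurable borel" and h: "\<And>s. norm (h s) \<le> C * exp (- bet * s)"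
  shows "isCont (conv h) t"
  unfolding continuous_at_sequentially o_def conv_def
proof (intro allI impI)
  fix x :: "nat \<Rightarrow> real" assume x: "x \<longlonglongrightarrow> t"
  have ae: "AE s in lborel. s \<noteq> t" by (rule AE_lborel_singleton)
  show "(\<lambda>n. LINT s|lborel. k (x n - s) (h s)) \<longlonglongrightarrow> (LINT s|lborel. k (t - s) (h s))"
  proof (rule dominated_convergence_varying_bound[where
        g = "\<lambda>n s. C * (\<kappa> (x n - s) * exp (- bet * s))" and g' = "\<lambda>s. C * (\<kappa> (t - s) * exp (- bet * s))"])
    show "AE s in lborel. (\<lambda>n. k (x n - s) (h s)) \<longlonglongrightarrow> k (t - s) (h s)"
      using ae
    proof eventually_elim
      case (elim s)
      show ?case
        by (rule isCont_tendsto_compose[OF k_cont[of "t - s" "h s"]]) (use elim x in \<open>auto intro!: tendsto_intros\<close>)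
    qed
    show "AE s in lborel. (\<lambda>n. C * (\<kappa> (x n - s) * exp (- bet * s))) \<longlonglongrightarrow> C * (\<kappa> (t - s) * exp (- bet * s))"
      using ae
    proof eventually_elim
      case (elim s)
      have "(\<lambda>n. \<kappa> (x n - s)) \<longlonglongrightarrow> \<kappa> (t - s)"
        by (rule isCont_tendsto_compose[OF \<kappa>_cont[of "t - s"]]) (use elim x in \<open>auto intro!: tendsto_intros\<close>)
      then show ?case by (intro tendsto_intros)
    qed
    show "AE s in lborel. norm (k (x n - s) (h s)) \<le> C * (\<kappa> (x n - s) * exp (- bet * s))" for n
    proof (rule AE_I2)
      fix s
      have "norm (k (x n - s) (h s)) \<le> \<kappa> (x n - s) * (C * exp (- bet * s))"
        using k_bound[of "x n - s" "h s"] mult_left_mono[OF h[of s] \<kappa>_nonneg[of "x n - s"]] by linarith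
      then show "norm (k (x n - s) (h s)) \<le> C * (\<kappa> (x n - s) * exp (- bet * s))"
        by (simp add: mult.left_commute)
    qed
    show "(\<lambda>n. LINT s|lborel. C * (\<kappa> (x n - s) * exp (- bet * s))) \<longlonglongrightarrow> (LINT s|lborel. C * (\<kappa> (t - s) * exp (- bet * s)))"
      by (simp only: integral_mult_right_zero kernel_integral(2)) (intro tendsto_intros x)
    show "integrable lborel (\<lambda>s. C * (\<kappa> (x n - s) * exp (- bet * s)))"
      "integrable lborel (\<lambda>s. C * (\<kappa> (t - s) * exp (- bet * s)))" for n
      by (intro integrable_mult_right kernel_integral)+
  qed measurable
qed

section \<open>Gronwall inequalities\<close>

text \<open>In the weighted supremum \<open>S\<close> the inequality reads
  \<open>S \<le> C0 + \<mu> * S\<close>. The a priori bound with \<open>C\<close> makes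
  \<open>S\<close> finite, which is what permits absorbing; the resulting constant depends on
  \<open>C0\<close> and \<mu> alone.\<close>

lemma gronwall:
  assumes [measurable]: "h \<in> borel_measurable borel"
    and w: "\<And>t. norm (w t) \<le> C * exp (- bet * t)"
    and h: "\<And>s. norm (h s) \<le> L * norm (w s)"
    and ineq: "\<And>t. norm (w t) \<le> C0 * exp (- bet * t) + norm (conv h t)"
    and L: "0 \<le> L" "L * q \<le> \<mu>" "\<mu> < 1"
  shows "norm (w t) \<le> C0 / (1 - \<mu>) * exp (- bet * t)"
proof -
  define S where "S = (SUP t. exp (bet * t) * norm (w t))"
  have bdd: "bdd_above (range (\<lambda>t. exp (bet * t) * norm (w t)))"
    using w by (auto intro!: bdd_aboveI[of _ C] simp: exp_minus field_simps)
  have S: "norm (w t) \<le> S * exp (- bet * t)" for t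
    using cSUP_upper[OF UNIV_I bdd, of t] by (simp add: S_def exp_minus field_simps)
  have S0: "0 \<le> S" using order_trans[OF norm_ge_zero S[of 0]] by simp
  have "norm (h s) \<le> (L * S) * exp (- bet * s)" for s
    using h[of s] mult_left_mono[OF S[of s] L(1)] by (simp add: mult.assoc)
  then have c: "norm (conv h t) \<le> L * S * q * exp (- bet * t)" for t
    by (rule conv_bound(2)[OF assms(1)])
  have "exp (bet * t) * norm (w t) \<le> C0 + \<mu> * S" for t
  proof -
    have "norm (w t) \<le> (C0 + (L * q) * S) * exp (- bet * t)"
      using ineq[of t] c[of t] by (simp add: algebra_simps)
    also have "\<dots> \<le> (C0 + \<mu> * S) * exp (- bet * t)"
      using L S0 by (intro mult_right_mono add_left_mono) auto
    finally show ?thesis by (simp add: exp_minus field_simps)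
  qed
  then have "S \<le> C0 + \<mu> * S"
    unfolding S_def by (intro cSUP_least) auto
  then have "S \<le> C0 / (1 - \<mu>)"
    using L by (simp add: field_simps)
  then show ?thesis
    using S[of t] by (meson exp_ge_zero mult_right_mono order_trans)
qed

text \<open>A pointwise statement without a rate: \<open>r n\<close> tends to 0 at each time, not in
  the weighted supremum, so \<open>gronwall\<close> does not apply. Instead, an upper limit of at
  most \<open>c\<close> times the weight at every time is improved by dominated convergence to
  \<open>\<mu> * c\<close>; iterating from \<open>C\<close> leaves 0.\<close>

lemma sequence_gronwall:
  assumes [measurable]: "\<And>n. d n \<in> borel_measurable borel" "\<And>n. r n \<in> borel_measurable borel"
    and d: "\<And>n t. 0 \<le> d n t" "\<And>n t. d n t \<le> C * exp (- bet * t)"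
    and r: "\<And>n t. 0 \<le> r n t" "\<And>n t. r n t \<le> C' * exp (- bet * t)"
    and r0: "\<And>s. (\<lambda>n. r n s) \<longlonglongrightarrow> 0"
    and ineq: "\<And>n t. d n t \<le> (LINT s|lborel. \<kappa> (t - s) * (L * d n s + r n s))"
    and L: "0 \<le> L" "L * q \<le> \<mu>" "\<mu> < 1"
  shows "(\<lambda>n. d n t) \<longlonglongrightarrow> 0"
proof -
  \<comment> \<open>\<open>P c\<close> says that at every time \<open>s\<close> the upper limit of
    \<open>d n s\<close> is at most \<open>c * exp (- bet * s)\<close>.\<close>
  define P where "P c \<longleftrightarrow> 0 \<le> c \<and> (\<forall>s. \<forall>\<epsilon>>0. \<forall>\<^sub>F n in sequentially. d n s < (c + \<epsilon>) * exp (- bet * s))" for c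
  have C: "0 \<le> C" "0 \<le> C'" using d[of 0 0] r[of 0 0] by auto
  have \<mu>: "0 \<le> \<mu>" using L q_nonneg by (meson mult_nonneg_nonneg order_trans)
  have step: "P (\<mu> * c)" if c: "P c" for c
    unfolding P_def
  proof (intro conjI allI impI)
    show "0 \<le> \<mu> * c" using c \<mu> by (auto simp: P_def)
    fix t \<epsilon> :: real assume \<epsilon>: "\<epsilon> > 0"
    have c0: "0 \<le> c" using c by (auto simp: P_def)
    \<comment> \<open>\<open>d n s\<close> itself need not converge; raised to at least
      \<open>c * exp (- bet * s)\<close> it does, because its upper limit is at most that.\<close>
    let ?m = "\<lambda>n s. max (d n s) (c * exp (- bet * s))"
    have m: "(\<lambda>n. ?m n s) \<longlonglongrightarrow> c * exp (- bet * s)" for s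
    proof (rule LIMSEQ_I)
      fix \<delta> :: real assume \<delta>: "\<delta> > 0"
      have "\<forall>\<^sub>F n in sequentially. d n s < (c + \<delta> * exp (bet * s)) * exp (- bet * s)"
        using c \<delta> by (auto simp: P_def)
      then have "\<forall>\<^sub>F n in sequentially. norm (?m n s - c * exp (- bet * s)) < \<delta>"
      proof eventually_elim
        case (elim n)
        have "(c + \<delta> * exp (bet * s)) * exp (- bet * s) = c * exp (- bet * s) + \<delta>"
          by (simp add: distrib_right mult.assoc exp_add[symmetric])
        then show ?case using elim \<delta> by auto
      qed
      then show "\<exists>no. \<forall>n\<ge>no. norm (?m n s - c * exp (- bet * s)) < \<delta>"
        by (simp add: eventually_sequentially)
    qed
    let ?K = "L * (C + c) + C'"
    have bd: "\<bar>L * ?m n s + r n s\<bar> \<le> ?K * exp (- bet * s)" for n s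
    proof -
      have 1: "0 \<le> ?m n s" using d by (simp add: le_max_iff_disj)
      have "?m n s \<le> (C + c) * exp (- bet * s)"
        using d(2)[of n s] C c0 by (auto simp: distrib_right intro: add_increasing add_increasing2)
      then have "L * ?m n s + r n s \<le> L * ((C + c) * exp (- bet * s)) + C' * exp (- bet * s)"
        using L r(2) by (intro add_mono mult_left_mono) auto
      moreover have "0 \<le> L * ?m n s" using 1 L by simp
      ultimately show ?thesis using r(1)[of n s] by (simp add: algebra_simps)
    qed
    have "(\<lambda>n. LINT s|lborel. \<kappa> (t - s) * (L * ?m n s + r n s)) \<longlonglongrightarrow>
        (LINT s|lborel. \<kappa> (t - s) * (L * (c * exp (- bet * s))))"
    proof (rule integral_dominated_convergence[where w = "\<lambda>s. ?K * (\<kappa> (t - s) * exp (- bet * s))"])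
      show "integrable lborel (\<lambda>s. ?K * (\<kappa> (t - s) * exp (- bet * s)))"
        by (intro integrable_mult_right kernel_integral)
      show "AE s in lborel. (\<lambda>n. \<kappa> (t - s) * (L * ?m n s + r n s)) \<longlonglongrightarrow> \<kappa> (t - s) * (L * (c * exp (- bet * s)))"
        using tendsto_mult[OF tendsto_const tendsto_add[OF tendsto_mult[OF tendsto_const m] r0]]
        by (intro AE_I2) simp
      show "AE s in lborel. norm (\<kappa> (t - s) * (L * ?m n s + r n s)) \<le> ?K * (\<kappa> (t - s) * exp (- bet * s))" for n
      proof (rule AE_I2)
        fix s
        have "norm (\<kappa> (t - s) * (L * ?m n s + r n s)) = \<kappa> (t - s) * \<bar>L * ?m n s + r n s\<bar>"
          using \<kappa>_nonneg by (simp add: abs_mult)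
        also have "\<dots> \<le> \<kappa> (t - s) * (?K * exp (- bet * s))"
          by (intro mult_left_mono bd \<kappa>_nonneg)
        finally show "norm (\<kappa> (t - s) * (L * ?m n s + r n s)) \<le> ?K * (\<kappa> (t - s) * exp (- bet * s))"
          by (simp add: mult.left_commute)
      qed
    qed auto
    moreover have "(LINT s|lborel. \<kappa> (t - s) * (L * (c * exp (- bet * s)))) < (\<mu> * c + \<epsilon>) * exp (- bet * t)"
    proof -
      have "(LINT s|lborel. \<kappa> (t - s) * (L * (c * exp (- bet * s)))) = L * c * (LINT s|lborel. \<kappa> (t - s) * exp (- bet * s))"
        by (simp add: mult.left_commute mult.assoc)
      also have "\<dots> \<le> L * c * (q * exp (- bet * t))"
        using L c0 by (intro mult_left_mono kernel_integral_le) auto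
      also have "\<dots> = (L * q) * (c * exp (- bet * t))" by simp
      also have "\<dots> \<le> \<mu> * (c * exp (- bet * t))"
        using L c0 by (intro mult_right_mono) auto
      also have "\<dots> < (\<mu> * c + \<epsilon>) * exp (- bet * t)"
        using \<epsilon> by (simp add: distrib_right)
      finally show ?thesis .
    qed
    ultimately have "\<forall>\<^sub>F n in sequentially. (LINT s|lborel. \<kappa> (t - s) * (L * ?m n s + r n s)) < (\<mu> * c + \<epsilon>) * exp (- bet * t)"
      by (rule order_tendstoD(2))
    then show "\<forall>\<^sub>F n in sequentially. d n t < (\<mu> * c + \<epsilon>) * exp (- bet * t)"
    proof eventually_elim
      case (elim n)
      have "d n t \<le> (LINT s|lborel. \<kappa> (t - s) * (L * d n s + r n s))" by (rule ineq)
      also have "\<dots> \<le> (LINT s|lborel. \<kappa> (t - s) * (L * ?m n s + r n s))"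
      proof (rule integral_mono)
        have "\<bar>L * d n s + r n s\<bar> \<le> ?K * exp (- bet * s)" for s
        proof -
          have "L * d n s + r n s \<le> L * ?m n s + r n s" "0 \<le> L * d n s + r n s"
            using L d r by (auto intro!: mult_left_mono)
          then show ?thesis using bd[of n s] by linarith
        qed
        then show "integrable lborel (\<lambda>s. \<kappa> (t - s) * (L * d n s + r n s))"
          by (intro bounded_integrable) auto
        show "integrable lborel (\<lambda>s. \<kappa> (t - s) * (L * ?m n s + r n s))"
          by (intro bounded_integrable[OF _ bd]) auto
        show "\<kappa> (t - s) * (L * d n s + r n s) \<le> \<kappa> (t - s) * (L * ?m n s + r n s)" for s
          using L \<kappa>_nonneg by (intro mult_left_mono add_right_mono) auto
      qed
      finally show ?case using elim by linarith
    qed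
  qed
  have PC: "P C"
    unfolding P_def
  proof (intro conjI allI impI always_eventually)
    fix s \<epsilon> :: real and n assume "\<epsilon> > 0"
    then show "d n s < (C + \<epsilon>) * exp (- bet * s)"
      using d(2)[of n s] mult_pos_pos[OF \<open>\<epsilon> > 0\<close> exp_gt_zero, of "- bet * s"] unfolding distrib_right by linarith
  qed (rule C)
  have Pm: "P (\<mu> ^ m * C)" for m
    by (induction m) (use PC step in \<open>auto simp: mult.assoc\<close>)
  show ?thesis
  proof (rule order_tendstoI)
    fix a :: real assume "a < 0"
    then show "\<forall>\<^sub>F n in sequentially. a < d n t"
      using d(1) by (intro always_eventually) (auto intro: less_le_trans)
  next
    fix a :: real assume a: "0 < a"
    define a' where "a' = a * exp (bet * t)"
    have a': "a' > 0" using a by (simp add: a'_def)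
    have "(\<lambda>m. \<mu> ^ m * C) \<longlonglongrightarrow> 0 * C"
      using \<mu> L by (intro tendsto_mult_right LIMSEQ_power_zero) auto
    then have "\<forall>\<^sub>F m in sequentially. \<mu> ^ m * C < a' / 2"
      using a' by (intro order_tendstoD(2)) auto
    then obtain m where m: "\<mu> ^ m * C < a' / 2" by (auto simp: eventually_sequentially)
    have "\<forall>\<^sub>F n in sequentially. d n t < (\<mu> ^ m * C + a' / 2) * exp (- bet * t)"
      using Pm[of m] a' by (auto simp: P_def)
    then show "\<forall>\<^sub>F n in sequentially. d n t < a"
    proof eventually_elim
      case (elim n)
      have "(\<mu> ^ m * C + a' / 2) * exp (- bet * t) \<le> a' * exp (- bet * t)"
        by (intro mult_right_mono, use m in linarith) simp
      also have "\<dots> = a" by (simp add: a'_def mult.assoc exp_add[symmetric])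
      finally show ?case using elim by linarith
    qed
  qed
qed

section \<open>Picard iteration with a measurable parameter\<close>

primrec picard :: "('p \<Rightarrow> real \<Rightarrow> 'h) \<Rightarrow> ('p \<Rightarrow> real \<Rightarrow> 'h \<Rightarrow> 'h) \<Rightarrow> nat \<Rightarrow> 'p \<Rightarrow> real \<Rightarrow> 'h" where
  "picard \<eta> \<Delta> 0 p t = 0"
| "picard \<eta> \<Delta> (Suc n) p t = \<eta> p t + conv (\<lambda>s. \<Delta> p s (picard \<eta> \<Delta> n p s)) t"

text \<open>Banach's theorem on functions weighted by \<open>exp (- bet * t)\<close>, done by hand
  for all parameters at once: a fixed point chosen separately for each \<open>p\<close> would carry
  no measurability in \<open>p\<close>, whereas a limit of measurable iterates does.\<close>

lemma fixed_point:
  fixes \<eta> :: "'p \<Rightarrow> real \<Rightarrow> 'h" and M :: "'p measure"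
  assumes \<Delta>_meas: "(\<lambda>(p, s, x). \<Delta> p s x) \<in> borel_measurable (M \<Otimes>\<^sub>M borel \<Otimes>\<^sub>M borel)"
    and \<eta>_meas: "(\<lambda>(p, t). \<eta> p t) \<in> borel_measurable (M \<Otimes>\<^sub>M borel)"
    and lip: "\<And>p s x y. p \<in> space M \<Longrightarrow> norm (\<Delta> p s x - \<Delta> p s y) \<le> L * norm (x - y)"
    and zero: "\<And>p s. p \<in> space M \<Longrightarrow> \<Delta> p s 0 = 0"
    and \<eta>_bound: "\<And>p. p \<in> space M \<Longrightarrow> \<exists>C. \<forall>t. norm (\<eta> p t) \<le> C * exp (- bet * t)"
    and L: "0 \<le> L" "L * q \<le> \<mu>" "\<mu> < 1"
  obtains w where "(\<lambda>(p, t). w p t) \<in> borel_measurable (M \<Otimes>\<^sub>M borel)"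
    and "\<And>p. p \<in> space M \<Longrightarrow> \<exists>C. \<forall>t. norm (w p t) \<le> C * exp (- bet * t)"
    and "\<And>p t. p \<in> space M \<Longrightarrow> w p t = \<eta> p t + conv (\<lambda>s. \<Delta> p s (w p s)) t"
proof -
  let ?w = "picard \<eta> \<Delta>"
  have \<Delta>_m: "(\<lambda>x. \<Delta> (f x) (g x) (h x)) \<in> borel_measurable M'"
    if "f \<in> M' \<rightarrow>\<^sub>M M" "g \<in> borel_measurable M'" "h \<in> borel_measurable M'" for f g h M'
    using measurable_compose[OF measurable_Pair[OF that(1) measurable_Pair[OF that(2,3)]] \<Delta>_meas] by simp
  have w_meas: "(\<lambda>(p, t). ?w n p t) \<in> borel_measurable (M \<Otimes>\<^sub>M borel)" for n
  proof (induction n)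
    case (Suc n)
    have "(\<lambda>(p, s). \<Delta> p s (?w n p s)) \<in> borel_measurable (M \<Otimes>\<^sub>M borel)"
      using Suc unfolding split_beta' by (intro \<Delta>_m) auto
    from conv_measurable[OF this] show ?case
      using \<eta>_meas unfolding picard.simps split_beta' by (intro borel_measurable_add)
  qed simp
  \<comment> \<open>\<open>lim\<close> is a total function, so measurability can be read off before
    convergence is known.\<close>
  define w where "w p t = lim (\<lambda>n. ?w n p t)" for p t
  have w_measurable: "(\<lambda>(p, t). w p t) \<in> borel_measurable (M \<Otimes>\<^sub>M borel)"
    using w_meas unfolding w_def split_beta' by (intro borel_measurable_lim_metric)
  have \<mu>: "0 \<le> \<mu>" using L q_nonneg by (meson mult_nonneg_nonneg order_trans)
  {
    fix p assume p: "p \<in> space M"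
    obtain C where C: "\<And>t. norm (\<eta> p t) \<le> C * exp (- bet * t)" using \<eta>_bound[OF p] by auto
    have C0: "0 \<le> C" using order_trans[OF norm_ge_zero C[of 0]] by simp
    have \<Delta>_bound: "norm (\<Delta> p s x) \<le> L * norm x" for s x
      using lip[OF p, of s x 0] zero[OF p] by simp
    have sec: "(\<lambda>s. \<Delta> p s (f s)) \<in> borel_measurable borel" if "f \<in> borel_measurable borel" for f
      using that p by (intro \<Delta>_m) auto
    have wm: "(\<lambda>t. ?w n p t) \<in> borel_measurable borel" for n
      using measurable_compose[OF measurable_Pair1'[OF p] w_meas[of n]] by simp
    have step: "norm (conv (\<lambda>s. \<Delta> p s (f s)) t - conv (\<lambda>s. \<Delta> p s (g s)) t) \<le> \<mu> * K * exp (- bet * t)"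
      if f: "f \<in> borel_measurable borel" "\<And>s. norm (f s) \<le> K1 * exp (- bet * s)"
        and g: "g \<in> borel_measurable borel" "\<And>s. norm (g s) \<le> K2 * exp (- bet * s)"
        and K: "\<And>s. norm (f s - g s) \<le> K * exp (- bet * s)" for f g K K1 K2 t
    proof -
      have K0: "0 \<le> K" using order_trans[OF norm_ge_zero K[of 0]] by simp
      have "conv (\<lambda>s. \<Delta> p s (f s)) t - conv (\<lambda>s. \<Delta> p s (g s)) t = conv (\<lambda>s. \<Delta> p s (f s) - \<Delta> p s (g s)) t"
        using order_trans[OF \<Delta>_bound mult_left_mono[OF f(2) L(1)]]
          order_trans[OF \<Delta>_bound mult_left_mono[OF g(2) L(1)]]
        by (intro conv_diff[of _ "L * K1" _ "L * K2"] sec f g) (simp_all add: mult.assoc)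
      moreover have "norm (conv (\<lambda>s. \<Delta> p s (f s) - \<Delta> p s (g s)) t) \<le> (L * K) * q * exp (- bet * t)"
        using order_trans[OF lip[OF p] mult_left_mono[OF K L(1)]]
        by (intro conv_bound borel_measurable_diff sec f g) (simp add: mult.assoc)
      moreover have "(L * q) * (K * exp (- bet * t)) \<le> \<mu> * (K * exp (- bet * t))"
        using L K0 by (intro mult_right_mono) auto
      ultimately show ?thesis by (simp add: mult_ac)
    qed
    \<comment> \<open>Both bounds go through one induction: the increment estimate uses
      \<open>step\<close>, which asks for a size bound on both iterates to make the convolutions
      integrable.\<close>
    have wb: "norm (?w n p t) \<le> (\<Sum>i<n. \<mu> ^ i * C) * exp (- bet * t)
        \<and> norm (?w (Suc n) p t - ?w n p t) \<le> \<mu> ^ n * C * exp (- bet * t)" for n t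
    proof (induction n arbitrary: t)
      case 0
      have "conv (\<lambda>s. \<Delta> p s 0) t = 0"
        by (simp add: conv_def zero[OF p] linear_0[OF k_linear])
      then show ?case using C by simp
    next
      case (Suc n)
      have 1: "norm (?w (Suc n) p t) \<le> (\<Sum>i<Suc n. \<mu> ^ i * C) * exp (- bet * t)" for t
        using norm_triangle_ineq[of "?w (Suc n) p t - ?w n p t" "?w n p t"] Suc[of t]
        by (simp add: distrib_right del: picard.simps)
      have "norm (?w (Suc (Suc n)) p t - ?w (Suc n) p t) \<le> \<mu> * (\<mu> ^ n * C) * exp (- bet * t)"
        using step[OF wm[of "Suc n"] 1 wm[of n] conjunct1[OF Suc] conjunct2[OF Suc], of t] by simp
      then show ?case using 1[of t] by (simp add: mult.assoc)
    qed
    have sm: "summable (\<lambda>i. \<mu> ^ i * C)"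
      using \<mu> L by (intro summable_mult2 summable_geometric) auto
    have conv_seq: "summable (\<lambda>n. ?w (Suc n) p t - ?w n p t)" for t
      using wb[of _ t] by (intro summable_comparison_test'[OF summable_mult2[OF sm, of "exp (- bet * t)"]]) auto
    have lim: "(\<lambda>n. ?w n p t) \<longlonglongrightarrow> w p t" for t
    proof -
      have "convergent (\<lambda>n. ?w n p t)"
        using summable_LIMSEQ[OF conv_seq[of t]] sum_lessThan_telescope[of "\<lambda>i. ?w i p t"]
        unfolding convergent_def by (intro exI) simp
      then show ?thesis by (simp add: w_def convergent_LIMSEQ_iff)
    qed
    \<comment> \<open>The increments are summed from index \<open>n\<close> on; this geometric tail
      then lets the iteration formula pass to the limit.\<close>
    have tail: "norm (w p t - ?w n p t) \<le> (\<Sum>i. \<mu> ^ (i + n) * C) * exp (- bet * t)" for n t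
    proof (rule LIMSEQ_le_const2)
      show "(\<lambda>m. norm (?w (m + n) p t - ?w n p t)) \<longlonglongrightarrow> norm (w p t - ?w n p t)"
        by (intro tendsto_intros LIMSEQ_ignore_initial_segment lim)
      have sn: "summable (\<lambda>i. \<mu> ^ (i + n) * C)" using summable_ignore_initial_segment[OF sm, of n] .
      have "norm (?w (m + n) p t - ?w n p t) \<le> (\<Sum>i<m. \<mu> ^ (i + n) * C) * exp (- bet * t)" for m
      proof (induction m)
        case (Suc m)
        show ?case
          using norm_triangle_ineq[of "?w (Suc (m + n)) p t - ?w (m + n) p t" "?w (m + n) p t - ?w n p t"]
            conjunct2[OF wb[of "m + n" t]] Suc
          by (simp add: distrib_right del: picard.simps(2))
      qed simp
      moreover have "(\<Sum>i<m. \<mu> ^ (i + n) * C) \<le> (\<Sum>i. \<mu> ^ (i + n) * C)" for m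
        using \<mu> C0 by (intro sum_le_suminf sn) auto
      ultimately show "\<exists>N. \<forall>m\<ge>N. norm (?w (m + n) p t - ?w n p t) \<le> (\<Sum>i. \<mu> ^ (i + n) * C) * exp (- bet * t)"
        by (meson exp_ge_zero mult_right_mono order_trans)
    qed
    have wb': "norm (w p t) \<le> (\<Sum>i. \<mu> ^ i * C) * exp (- bet * t)" for t
      using tail[of t 0] by simp
    have wm': "w p \<in> borel_measurable borel"
      using measurable_compose[OF measurable_Pair1'[OF p] w_measurable] by simp
    have eq: "w p t = \<eta> p t + conv (\<lambda>s. \<Delta> p s (w p s)) t" for t
    proof -
      have T0: "(\<lambda>n. (\<Sum>i. \<mu> ^ (i + n) * C)) \<longlonglongrightarrow> 0"
        by (rule suminf_exist_split2[OF sm])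
      have "(\<lambda>n. \<mu> * (\<Sum>i. \<mu> ^ (i + n) * C) * exp (- bet * t)) \<longlonglongrightarrow> 0"
        by (auto intro!: tendsto_eq_intros T0)
      then have "(\<lambda>n. conv (\<lambda>s. \<Delta> p s (w p s)) t - conv (\<lambda>s. \<Delta> p s (?w n p s)) t) \<longlonglongrightarrow> 0"
        by (rule Lim_null_comparison[rotated])
          (intro always_eventually allI step[OF wm' wb' wm conjunct1[OF wb] tail])
      then have "(\<lambda>n. conv (\<lambda>s. \<Delta> p s (w p s)) t - (conv (\<lambda>s. \<Delta> p s (w p s)) t - conv (\<lambda>s. \<Delta> p s (?w n p s)) t))
          \<longlonglongrightarrow> conv (\<lambda>s. \<Delta> p s (w p s)) t - 0"
        by (intro tendsto_diff tendsto_const)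
      then have "(\<lambda>n. \<eta> p t + conv (\<lambda>s. \<Delta> p s (?w n p s)) t) \<longlonglongrightarrow> \<eta> p t + conv (\<lambda>s. \<Delta> p s (w p s)) t"
        by (intro tendsto_intros) simp
      then have "(\<lambda>n. ?w (Suc n) p t) \<longlonglongrightarrow> \<eta> p t + conv (\<lambda>s. \<Delta> p s (w p s)) t"
        by simp
      then show ?thesis using LIMSEQ_unique lim[THEN LIMSEQ_Suc] by blast
    qed
    have "\<exists>C. \<forall>t. norm (w p t) \<le> C * exp (- bet * t)" using wb' by blast
    moreover have "\<forall>t. w p t = \<eta> p t + conv (\<lambda>s. \<Delta> p s (w p s)) t" using eq by blast
    ultimately have "(\<exists>C. \<forall>t. norm (w p t) \<le> C * exp (- bet * t)) \<and>
      (\<forall>t. w p t = \<eta> p t + conv (\<lambda>s. \<Delta> p s (w p s)) t)" ..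
  }
  note * = this
  show thesis
    by (rule that[OF w_measurable]) (use * in blast)+
qed

end

section \<open>The operator kernels\<close>

text \<open>Substitution of \<open>a * \<tau>\<close> in Euler's integral for
  \<open>Gamma (1 - s)\<close>. The case \<open>s = 0\<close> is the plain exponential integral, so
  one formula serves all terms of the kernel bounds.\<close>

lemma has_bochner_integral_powr_exp:
  fixes s a :: real
  assumes s: "s < 1" and a: "0 < a"
  shows "has_bochner_integral lborel (\<lambda>\<tau>. indicator {0<..} \<tau> * (\<tau> powr (- s) * exp (- a * \<tau>)))
    (Gamma (1 - s) * a powr (s - 1))"
proof -
  let ?f = "\<lambda>t::real. indicator {0..} t * t powr (1 - s - 1) / exp t"
  have "has_bochner_integral lborel ?f (Gamma (1 - s))"
    by (rule has_bochner_integral_nn_integral)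
      (use s Gamma_conv_nn_integral_real[of "1 - s"] Gamma_real_pos[of "1 - s"] in auto)
  then have "has_bochner_integral lborel (\<lambda>x. ?f (0 + a * x)) (Gamma (1 - s) /\<^sub>R \<bar>a\<bar>)"
    using a by (subst (asm) lborel_has_bochner_integral_real_affine_iff[of a _ _ 0]) auto
  then have "has_bochner_integral lborel (\<lambda>x. a powr s * ?f (0 + a * x)) (a powr s * (Gamma (1 - s) /\<^sub>R \<bar>a\<bar>))"
    by (rule has_bochner_integral_mult_right)
  moreover have "a powr s * ?f (0 + a * x) = indicator {0<..} x * (x powr (- s) * exp (- a * x))" for x
  proof -
    have "a powr s * a powr (- s) = 1" using a by (simp add: powr_minus)
    then show ?thesis
      using a by (auto simp: indicator_def powr_mult exp_minus field_simps zero_le_mult_iff)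
  qed
  moreover have "a powr s * (Gamma (1 - s) /\<^sub>R \<bar>a\<bar>) = Gamma (1 - s) * a powr (s - 1)"
    using a by (simp add: powr_diff field_simps)
  ultimately show ?thesis by (simp only:)
qed

text \<open>Take \<open>y = x * t / s\<close> in \<open>y \<le> exp y\<close> and raise to the power
  \<open>s\<close>. The case distinction is forced by \<open>0 powr 0 = 0\<close>, while the
  constant must be 1 for \<open>s = 0\<close>.\<close>

lemma powr_exp_le:
  fixes s x t :: real
  assumes s: "0 \<le> s" and x: "0 \<le> x" and t: "0 < t"
  shows "x powr s * exp (- x * t) \<le> (if s = 0 then 1 else s powr s) * t powr (- s)"
proof (cases "s = 0 \<or> x = 0")
  case True
  then show ?thesis using x t s by auto
next
  case False
  then have s0: "s > 0" and x0: "x > 0" using s x by auto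
  have "x * t / s \<le> exp (x * t / s)"
    using exp_ge_add_one_self[of "x * t / s"] by linarith
  then have "(x * t / s) powr s \<le> exp (x * t / s) powr s"
    using s x t by (intro powr_mono2) auto
  also have "\<dots> = exp (x * t)" using s0 by (simp add: powr_def)
  finally have "x powr s * t powr s \<le> s powr s * exp (x * t)"
    using s0 x0 t by (simp add: powr_mult powr_divide field_simps)
  then show ?thesis
    using s0 t by (simp add: exp_minus powr_minus field_simps)
qed

text \<open>Each of the fractions \<open>a / (a + b)\<close> and \<open>b / (a + b)\<close> is at
  most its own power with exponent \<open>s \<le> 1\<close>, and they add up to 1.\<close>

lemma powr_add_le:
  fixes a b s :: real
  assumes "0 \<le> a" "0 < b" "0 \<le> s" "s \<le> 1"
  shows "(a + b) powr s \<le> a powr s + b powr s"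
proof (cases "a = 0")
  case False
  then have a: "a > 0" using assms by simp
  have *: "x / (a + b) \<le> (x / (a + b)) powr s" if "0 < x" "x \<le> a + b" for x
    using that assms powr_mono'[of s 1 "x / (a + b)"] by auto
  have "1 = a / (a + b) + b / (a + b)"
    using a assms by (simp add: add_divide_distrib[symmetric])
  also have "\<dots> \<le> (a / (a + b)) powr s + (b / (a + b)) powr s"
    using a assms by (intro add_mono *) auto
  also have "\<dots> = (a powr s + b powr s) / (a + b) powr s"
    using a assms by (simp add: powr_divide add_divide_distrib)
  finally show ?thesis using a assms by (simp add: field_simps)
qed (use assms in simp)

locale inertial = onb lam e
  for lam :: "nat \<Rightarrow> real" and e :: "nat \<Rightarrow> 'h::{real_inner,banach,second_countable_topology}" +
  fixes F :: "'h \<Rightarrow> 'h" and \<sigma> L \<mu> \<beta> :: real and N :: nat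
  assumes \<sigma>: "0 \<le> \<sigma>" "\<sigma> < 1"
    and F0: "F 0 = 0"
    and L: "L > 0"
    and F_lipschitz: "\<forall>u1\<in>pow_dom lam e \<sigma>. \<forall>u2\<in>pow_dom lam e \<sigma>. norm (F u1 - F u2) \<le> L * pow_norm lam e \<sigma> (u1 - u2)"
    and N: "N \<ge> 1" "lam N < lam (Suc N)"
    and \<mu>: "0 < \<mu>" "\<mu> < 1"
    and gap: "lam (Suc N) - lam N \<ge> 2 * L / \<mu> *
      (lam N powr \<sigma>
       + (if \<sigma> = 0 then 1 else \<sigma> powr \<sigma>) * Gamma (1 - \<sigma>) * (lam (Suc N) - lam N) powr \<sigma>
       + lam (Suc N) powr \<sigma>)"
    and \<beta>_def: "\<beta> = lam N + 2 / \<mu> * L * lam N powr \<sigma>"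
begin

section \<open>Fractional powers, spectral projectors and the conjugated nonlinearity\<close>

definition D :: "'h set" where "D = pow_dom lam e \<sigma>"
definition n\<sigma> :: "'h \<Rightarrow> real" where "n\<sigma> = pow_norm lam e \<sigma>"
text \<open>\<open>J\<close> is \<open>A\<^sup>\<sigma>\<close> and \<open>Ji\<close> is
  \<open>A\<^sup>-\<^sup>\<sigma>\<close>. Only \<open>Ji\<close> is bounded in general;
  \<open>J\<close> is a series that is trusted on \<open>D\<close> alone. \<open>Ji\<close> is an
  isometry of \<open>H\<close> onto \<open>D\<close> with the norm \<open>n\<sigma>\<close>, so the
  analysis takes place in \<open>H\<close> and is carried to \<open>D\<close> by
  \<open>Ji\<close>.\<close>

definition J :: "'h \<Rightarrow> 'h" where "J = diag (\<lambda>k. l k powr \<sigma>)"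
definition Ji :: "'h \<Rightarrow> 'h" where "Ji = diag (\<lambda>k. l k powr (- \<sigma>))"
definition P :: "'h \<Rightarrow> 'h" where "P = projP e N"
definition Q :: "'h \<Rightarrow> 'h" where "Q = projQ e N"
definition f :: "'h \<Rightarrow> 'h" where "f y = F (Ji y)"
definition c\<sigma> :: real where "c\<sigma> = (if \<sigma> = 0 then 1 else \<sigma> powr \<sigma>)"

lemma Ji_bound: "\<bar>l k powr (- \<sigma>)\<bar> \<le> l 0 powr (- \<sigma>)"
  using l_pos[of 0] l_mono[of 0 k] \<sigma> by (auto intro: powr_mono2')

lemma Ji_inner: "Ji y \<bullet> b k = l k powr (- \<sigma>) * (y \<bullet> b k)"
  unfolding Ji_def by (rule diag_inner[OF Ji_bound])

lemma bounded_linear_Ji: "bounded_linear Ji"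
  unfolding Ji_def by (rule bounded_linear_diag[OF Ji_bound])

lemma D_iff: "u \<in> D \<longleftrightarrow> summable (\<lambda>k. (l k powr \<sigma> * (u \<bullet> b k))\<^sup>2)"
  by (simp add: D_def pow_dom_def spec_dom_def l_def b_def)

lemma J_inner: "u \<in> D \<Longrightarrow> J u \<bullet> b k = l k powr \<sigma> * (u \<bullet> b k)"
  unfolding J_def D_iff by (rule diag_inner')

lemma n\<sigma>_J: "n\<sigma> u = norm (J u)"
  by (simp add: n\<sigma>_def pow_norm_def spec_op_diag J_def)

lemma powr_cancel: "l k powr \<sigma> * (l k powr (- \<sigma>) * x) = x"
  using l_pos[of k] by (simp add: powr_minus)

lemma powr_cancel': "l k powr (- \<sigma>) * (l k powr \<sigma> * x) = x"
  using l_pos[of k] by (simp add: powr_minus)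

lemma Ji_in_D [simp]: "Ji y \<in> D"
  unfolding D_iff Ji_inner powr_cancel by (rule summable_coeff)

lemma J_Ji [simp]: "J (Ji y) = y"
  by (rule coeff_eqI) (simp add: J_inner Ji_inner powr_cancel)

lemma Ji_J: "u \<in> D \<Longrightarrow> Ji (J u) = u"
  by (rule coeff_eqI) (simp add: J_inner Ji_inner powr_cancel')

lemma D_eq: "D = range Ji"
  using Ji_J by (metis Ji_in_D image_subset_iff rangeI subsetI subset_antisym)

lemma Ji_add: "Ji (x + y) = Ji x + Ji y" and Ji_diff: "Ji (x - y) = Ji x - Ji y"
  and Ji_scaleR: "Ji (c *\<^sub>R x) = c *\<^sub>R Ji x" and Ji_0 [simp]: "Ji 0 = 0"
  using bounded_linear.linear[OF bounded_linear_Ji]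
  by (auto simp: linear_add linear_diff linear_scale linear_0)

lemma subspace_D: "subspace D"
  unfolding D_eq by (rule linear_subspace_image[OF bounded_linear.linear[OF bounded_linear_Ji] subspace_UNIV])

lemma J_add: "u \<in> D \<Longrightarrow> v \<in> D \<Longrightarrow> J (u + v) = J u + J v"
  by (metis J_Ji Ji_J Ji_add)

lemma J_diff: "u \<in> D \<Longrightarrow> v \<in> D \<Longrightarrow> J (u - v) = J u - J v"
  by (metis J_Ji Ji_J Ji_diff)

lemma J_scaleR: "u \<in> D \<Longrightarrow> J (c *\<^sub>R u) = c *\<^sub>R J u"
  by (metis J_Ji Ji_J Ji_scaleR)

lemma P_inner: "P x \<bullet> b j = (if j < N then x \<bullet> b j else 0)"
  by (simp add: P_def projP_inner)

lemma Q_inner: "Q x \<bullet> b j = (if j < N then 0 else x \<bullet> b j)"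
  by (simp add: Q_def projQ_inner)

lemma bounded_linear_P: "bounded_linear P"
  unfolding P_def projP_diag by (rule bounded_linear_diag[where C = 1]) auto

lemma bounded_linear_Q: "bounded_linear Q"
  unfolding Q_def projQ_diag by (rule bounded_linear_diag[where C = 1]) auto

lemma norm_P: "norm (P x) \<le> norm x"
  using norm_diag[of "\<lambda>k. if k < N then 1 else 0" 1 x] by (simp add: P_def projP_diag)

lemma norm_Q: "norm (Q x) \<le> norm x"
  using norm_diag[of "\<lambda>k. if k < N then 0 else 1" 1 x] by (simp add: Q_def projQ_diag)

lemma P_plus_Q: "P x + Q x = x"
  by (simp add: P_def Q_def projQ_def)

lemma P_P [simp]: "P (P x) = P x" and P_Q [simp]: "P (Q x) = 0"
  and Q_P [simp]: "Q (P x) = 0" and Q_Q [simp]: "Q (Q x) = Q x"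
  by (rule coeff_eqI, simp add: P_inner Q_inner)+

lemma Ji_P: "Ji (P x) = P (Ji x)" and Ji_Q: "Ji (Q x) = Q (Ji x)"
  by (rule coeff_eqI, simp add: P_inner Q_inner Ji_inner)+

lemma f_lipschitz: "norm (f x - f y) \<le> L * norm (x - y)"
  using F_lipschitz[rule_format, of "Ji x" "Ji y"] Ji_in_D n\<sigma>_J[of "Ji x - Ji y"]
  by (simp add: D_def[symmetric] n\<sigma>_def[symmetric] f_def Ji_diff[symmetric])

lemma f_0 [simp]: "f 0 = 0"
  by (simp add: f_def F0)

lemma f_continuous: "continuous_on UNIV f"
proof (rule lipschitz_on_continuous_on[where L = L])
  show "L-lipschitz_on UNIV f"
    using L f_lipschitz by (auto simp: lipschitz_on_def dist_norm)
qed

lemma f_measurable [measurable]: "f \<in> borel_measurable borel"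
  using f_continuous by (rule borel_measurable_continuous_onI)

section \<open>The spectral gap\<close>

definition \<Lambda>1 :: real where "\<Lambda>1 = lam N"
definition \<Lambda>2 :: real where "\<Lambda>2 = lam (Suc N)"

lemma l_le_\<Lambda>1: "j < N \<Longrightarrow> l j \<le> \<Lambda>1"
  using l_mono[of j "N - 1"] N by (simp add: \<Lambda>1_def l_def)

lemma l_ge_\<Lambda>2: "N \<le> j \<Longrightarrow> \<Lambda>2 \<le> l j"
  using l_mono[of N j] by (simp add: \<Lambda>2_def l_def)

lemma \<Lambda>1_pos: "0 < \<Lambda>1"
  using l_pos[of "N - 1"] N by (simp add: \<Lambda>1_def l_def)

lemma c\<sigma>_pos: "0 < c\<sigma>"
  using \<sigma> by (simp add: c\<sigma>_def)

lemma \<Gamma>_pos: "0 < Gamma (1 - \<sigma>)"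
  using \<sigma> by (intro Gamma_real_pos) simp

lemma \<beta>_gt: "\<Lambda>1 < \<beta>"
  using \<mu> L \<Lambda>1_pos by (simp add: \<beta>_def \<Lambda>1_def)

lemma \<beta>_pos: "0 < \<beta>"
  using \<beta>_gt \<Lambda>1_pos by simp

text \<open>\<beta> lies above \<open>\<Lambda>1\<close> by exactly the first summand of the gap
  condition, so the other two summands remain below \<open>\<Lambda>2 - \<beta>\<close>.\<close>

lemma \<beta>_gap: "\<Lambda>2 - \<beta> \<ge> 2 * L / \<mu> * (c\<sigma> * Gamma (1 - \<sigma>) * (\<Lambda>2 - \<Lambda>1) powr \<sigma> + \<Lambda>2 powr \<sigma>)"
  using gap by (simp add: \<beta>_def \<Lambda>1_def \<Lambda>2_def c\<sigma>_def algebra_simps)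

lemma \<Lambda>2_gt: "\<beta> < \<Lambda>2"
proof -
  have "0 < \<Lambda>2" using l_pos[of N] by (simp add: \<Lambda>2_def l_def)
  then have "0 < 2 * L / \<mu> * (c\<sigma> * Gamma (1 - \<sigma>) * (\<Lambda>2 - \<Lambda>1) powr \<sigma> + \<Lambda>2 powr \<sigma>)"
    using L \<mu> c\<sigma>_pos \<Gamma>_pos by (intro mult_pos_pos add_nonneg_pos divide_pos_pos mult_nonneg_nonneg) auto
  then show ?thesis using \<beta>_gap by linarith
qed

text \<open>Only the factor \<open>exp (- \<Lambda>2 * \<tau>)\<close> is split off. Subadditivity
  of the power separates \<open>l j\<close> into \<open>\<Lambda>2\<close> and the excess; the
  excess is paid for by \<open>powr_exp_le\<close>, with a bound independent of
  \<open>j\<close>.\<close>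

lemma powr_exp_le_kernel:
  assumes "N \<le> j" "0 < \<tau>"
  shows "l j powr \<sigma> * exp (- l j * \<tau>) \<le> (c\<sigma> * \<tau> powr (- \<sigma>) + \<Lambda>2 powr \<sigma>) * exp (- \<Lambda>2 * \<tau>)"
proof -
  let ?x = "l j - \<Lambda>2"
  have x: "0 \<le> ?x" using l_ge_\<Lambda>2[OF assms(1)] by simp
  have p: "0 < \<Lambda>2" using \<Lambda>2_gt \<beta>_pos by simp
  have "l j powr \<sigma> \<le> ?x powr \<sigma> + \<Lambda>2 powr \<sigma>"
    using powr_add_le[of ?x \<Lambda>2 \<sigma>] x p \<sigma> by simp
  then have "l j powr \<sigma> * exp (- ?x * \<tau>) \<le> (?x powr \<sigma> + \<Lambda>2 powr \<sigma>) * exp (- ?x * \<tau>)"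
    by (rule mult_right_mono) simp
  also have "\<dots> = ?x powr \<sigma> * exp (- ?x * \<tau>) + \<Lambda>2 powr \<sigma> * exp (- ?x * \<tau>)"
    by (rule distrib_right)
  also have "\<dots> \<le> c\<sigma> * \<tau> powr (- \<sigma>) + \<Lambda>2 powr \<sigma> * 1"
  proof (intro add_mono mult_left_mono)
    show "?x powr \<sigma> * exp (- ?x * \<tau>) \<le> c\<sigma> * \<tau> powr (- \<sigma>)"
      unfolding c\<sigma>_def using x assms \<sigma> by (intro powr_exp_le) auto
    have "0 \<le> ?x * \<tau>" using x assms by simp
    then have "- ?x * \<tau> \<le> 0" by (simp only: minus_mult_left[symmetric] neg_le_0_iff_le)
    then show "exp (- ?x * \<tau>) \<le> 1" by (simp only: exp_le_one_iff)
  qed simp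
  finally have "l j powr \<sigma> * exp (- ?x * \<tau>) * exp (- \<Lambda>2 * \<tau>) \<le> (c\<sigma> * \<tau> powr (- \<sigma>) + \<Lambda>2 powr \<sigma> * 1) * exp (- \<Lambda>2 * \<tau>)"
    by (rule mult_right_mono) simp
  then show ?thesis by (simp add: mult.assoc exp_add[symmetric] algebra_simps)
qed

text \<open>Symbols of the Lyapunov-Perron kernel (\<open>A\<^sup>\<sigma> e\<^sup>-\<^sup>A\<^sup>\<tau> Q\<close> for \<open>\<tau> > 0\<close>, \<open>- A\<^sup>\<sigma> e\<^sup>-\<^sup>A\<^sup>\<tau> P\<close> for \<open>\<tau> < 0\<close>) and of the
  forward kernel, with norm bounds \<open>\<kappa>\<close> and \<open>\<kappa>f\<close>.\<close>

definition kc :: "real \<Rightarrow> nat \<Rightarrow> real" where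
  "kc \<tau> j = (if 0 < \<tau> then (if j < N then 0 else l j powr \<sigma> * exp (- l j * \<tau>))
     else if \<tau> < 0 then (if j < N then - (l j powr \<sigma> * exp (- l j * \<tau>)) else 0) else 0)"

definition \<kappa> :: "real \<Rightarrow> real" where
  "\<kappa> \<tau> = (if 0 < \<tau> then (c\<sigma> * \<tau> powr (- \<sigma>) + \<Lambda>2 powr \<sigma>) * exp (- \<Lambda>2 * \<tau>)
     else if \<tau> < 0 then \<Lambda>1 powr \<sigma> * exp (- \<Lambda>1 * \<tau>) else 0)"

definition kf :: "real \<Rightarrow> nat \<Rightarrow> real" where
  "kf \<tau> j = (if 0 < \<tau> then l j powr \<sigma> * exp (- l j * \<tau>) else 0)"

definition \<kappa>f :: "real \<Rightarrow> real" where
  "\<kappa>f \<tau> = (if 0 < \<tau> then c\<sigma> * \<tau> powr (- \<sigma>) else 0)"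

lemma kc_bound: "\<bar>kc \<tau> j\<bar> \<le> \<kappa> \<tau>"
proof -
  have "l j powr \<sigma> * exp (- l j * \<tau>) \<le> \<Lambda>1 powr \<sigma> * exp (- \<Lambda>1 * \<tau>)" if "j < N" "\<tau> < 0"
    using that l_le_\<Lambda>1[of j] l_pos[of j] \<sigma>
    by (intro mult_mono powr_mono2) (auto intro: mult_right_mono_neg)
  then show ?thesis
    using powr_exp_le_kernel[of j \<tau>] c\<sigma>_pos \<sigma> by (auto simp: kc_def \<kappa>_def abs_mult)
qed

lemma kf_bound: "\<bar>kf \<tau> j\<bar> \<le> \<kappa>f \<tau>"
  using powr_exp_le[of \<sigma> "l j" \<tau>] \<sigma> l_pos[of j] by (auto simp: kf_def \<kappa>f_def c\<sigma>_def abs_mult)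

text \<open>Weighting by \<open>exp (\<beta> * \<tau>)\<close> turns the rates into
  \<open>\<Lambda>2 - \<beta>\<close> for positive and \<open>\<beta> - \<Lambda>1\<close> for
  negative times, both positive. The exponents 0 are left unevaluated, so that all three terms are
  instances of the same Gamma integral, the third one reflected.\<close>

lemma has_integral_\<kappa>: 
  "has_bochner_integral lborel (\<lambda>\<tau>. exp (\<beta> * \<tau>) * \<kappa> \<tau>)
     (c\<sigma> * (Gamma (1 - \<sigma>) * (\<Lambda>2 - \<beta>) powr (\<sigma> - 1)) + \<Lambda>2 powr \<sigma> * (Gamma (1 - 0) * (\<Lambda>2 - \<beta>) powr (0 - 1))
      + \<Lambda>1 powr \<sigma> * (Gamma (1 - 0) * (\<beta> - \<Lambda>1) powr (0 - 1)))"
proof -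
  note i = has_bochner_integral_powr_exp
  have 3: "has_bochner_integral lborel (\<lambda>\<tau>. indicator {0<..} (- \<tau>) * ((- \<tau>) powr (- 0) * exp (- (\<beta> - \<Lambda>1) * (- \<tau>))))
      (Gamma (1 - 0) * (\<beta> - \<Lambda>1) powr (0 - 1))"
    using lborel_has_bochner_integral_real_affine_iff[of "-1" _ _ 0, THEN iffD1, OF _ i[of 0 "\<beta> - \<Lambda>1"]] \<beta>_gt
    by (simp del: powr_zero_eq_one)
  have "has_bochner_integral lborel (\<lambda>\<tau>.
      c\<sigma> * (indicator {0<..} \<tau> * (\<tau> powr (- \<sigma>) * exp (- (\<Lambda>2 - \<beta>) * \<tau>)))
      + \<Lambda>2 powr \<sigma> * (indicator {0<..} \<tau> * (\<tau> powr (- 0) * exp (- (\<Lambda>2 - \<beta>) * \<tau>)))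
      + \<Lambda>1 powr \<sigma> * (indicator {0<..} (- \<tau>) * ((- \<tau>) powr (- 0) * exp (- (\<beta> - \<Lambda>1) * (- \<tau>)))))
     (c\<sigma> * (Gamma (1 - \<sigma>) * (\<Lambda>2 - \<beta>) powr (\<sigma> - 1)) + \<Lambda>2 powr \<sigma> * (Gamma (1 - 0) * (\<Lambda>2 - \<beta>) powr (0 - 1))
      + \<Lambda>1 powr \<sigma> * (Gamma (1 - 0) * (\<beta> - \<Lambda>1) powr (0 - 1)))"
    using \<Lambda>2_gt \<beta>_gt \<sigma>
    by (intro has_bochner_integral_add has_bochner_integral_mult_right i 3) auto
  moreover have "c\<sigma> * (indicator {0<..} \<tau> * (\<tau> powr (- \<sigma>) * exp (- (\<Lambda>2 - \<beta>) * \<tau>)))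
      + \<Lambda>2 powr \<sigma> * (indicator {0<..} \<tau> * (\<tau> powr (- 0) * exp (- (\<Lambda>2 - \<beta>) * \<tau>)))
      + \<Lambda>1 powr \<sigma> * (indicator {0<..} (- \<tau>) * ((- \<tau>) powr (- 0) * exp (- (\<beta> - \<Lambda>1) * (- \<tau>))))
      = exp (\<beta> * \<tau>) * \<kappa> \<tau>" for \<tau>
  proof -
    have e: "exp (- (\<Lambda>2 - \<beta>) * \<tau>) = exp (\<beta> * \<tau>) * exp (- \<Lambda>2 * \<tau>)"
      "exp (- (\<beta> - \<Lambda>1) * (- \<tau>)) = exp (\<beta> * \<tau>) * exp (- \<Lambda>1 * \<tau>)"
      by (simp_all add: exp_add[symmetric] algebra_simps)
    show ?thesis unfolding e \<kappa>_def by (auto simp: indicator_def algebra_simps)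
  qed
  ultimately show ?thesis by simp
qed

definition q :: real where "q = (LINT \<tau>|lborel. exp (\<beta> * \<tau>) * \<kappa> \<tau>)"

lemma L_q: "L * q \<le> \<mu>"
proof -
  have d: "0 < \<Lambda>2 - \<beta>" "0 < \<beta> - \<Lambda>1" using \<Lambda>2_gt \<beta>_gt by auto
  have q: "q = (c\<sigma> * Gamma (1 - \<sigma>) * (\<Lambda>2 - \<beta>) powr \<sigma> + \<Lambda>2 powr \<sigma>) / (\<Lambda>2 - \<beta>) + \<Lambda>1 powr \<sigma> / (\<beta> - \<Lambda>1)"
    unfolding q_def has_bochner_integral_integral_eq[OF has_integral_\<kappa>]
  proof -
    have "x powr (\<sigma> - 1) = x powr \<sigma> / x" "x powr (0 - 1) = 1 / x" if "0 < x" for x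
      using that by (simp_all add: powr_diff powr_minus_divide)
    then show "c\<sigma> * (Gamma (1 - \<sigma>) * (\<Lambda>2 - \<beta>) powr (\<sigma> - 1)) + \<Lambda>2 powr \<sigma> * (Gamma (1 - 0) * (\<Lambda>2 - \<beta>) powr (0 - 1))
      + \<Lambda>1 powr \<sigma> * (Gamma (1 - 0) * (\<beta> - \<Lambda>1) powr (0 - 1)) = (c\<sigma> * Gamma (1 - \<sigma>) * (\<Lambda>2 - \<beta>) powr \<sigma> + \<Lambda>2 powr \<sigma>) / (\<Lambda>2 - \<beta>) + \<Lambda>1 powr \<sigma> / (\<beta> - \<Lambda>1)"
      using d by (simp add: Gamma_1 add_divide_distrib)
  qed
  \<comment> \<open>An equality: \<open>\<beta> - \<Lambda>1\<close> was defined as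
    \<open>2 / \<mu> * L * \<Lambda>1 powr \<sigma>\<close>.\<close>
  have 1: "L * (\<Lambda>1 powr \<sigma> / (\<beta> - \<Lambda>1)) = \<mu> / 2"
    using L \<mu> \<Lambda>1_pos by (simp add: \<beta>_def \<Lambda>1_def[symmetric])
  \<comment> \<open>The power of \<open>\<Lambda>2 - \<beta>\<close> coming from the integral is
    enlarged to that of \<open>\<Lambda>2 - \<Lambda>1\<close>, the form in which the gap condition
    is stated.\<close>
  have "2 * L / \<mu> * (c\<sigma> * Gamma (1 - \<sigma>) * (\<Lambda>2 - \<beta>) powr \<sigma> + \<Lambda>2 powr \<sigma>)
      \<le> 2 * L / \<mu> * (c\<sigma> * Gamma (1 - \<sigma>) * (\<Lambda>2 - \<Lambda>1) powr \<sigma> + \<Lambda>2 powr \<sigma>)"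
    using L \<mu> c\<sigma>_pos \<Gamma>_pos d \<sigma> by (intro mult_left_mono add_right_mono powr_mono2) auto
  also have "\<dots> \<le> \<Lambda>2 - \<beta>" by (rule \<beta>_gap)
  finally have "L * ((c\<sigma> * Gamma (1 - \<sigma>) * (\<Lambda>2 - \<beta>) powr \<sigma> + \<Lambda>2 powr \<sigma>) / (\<Lambda>2 - \<beta>)) \<le> \<mu> / 2"
    using d \<mu> by (simp add: field_simps)
  then show ?thesis using 1 unfolding q distrib_left by linarith
qed

text \<open>With the weight \<open>exp (- \<gamma> t)\<close> the forward problem is a contraction with constant \<open>1/2\<close>.\<close>

definition \<gamma> :: real where "\<gamma> = (2 * L * (c\<sigma> * Gamma (1 - \<sigma>)) + 1) powr (1 / (1 - \<sigma>))"

lemma \<gamma>_pos: "0 < \<gamma>"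
  using L c\<sigma>_pos \<Gamma>_pos by (simp add: \<gamma>_def add_pos_pos less_imp_neq[symmetric])

lemma has_integral_\<kappa>f:
  "has_bochner_integral lborel (\<lambda>\<tau>. exp (- \<gamma> * \<tau>) * \<kappa>f \<tau>) (c\<sigma> * (Gamma (1 - \<sigma>) * \<gamma> powr (\<sigma> - 1)))"
proof -
  have "has_bochner_integral lborel (\<lambda>\<tau>. c\<sigma> * (indicator {0<..} \<tau> * (\<tau> powr (- \<sigma>) * exp (- \<gamma> * \<tau>))))
      (c\<sigma> * (Gamma (1 - \<sigma>) * \<gamma> powr (\<sigma> - 1)))"
    using \<sigma> \<gamma>_pos by (intro has_bochner_integral_mult_right has_bochner_integral_powr_exp) auto
  moreover have "c\<sigma> * (indicator {0<..} \<tau> * (\<tau> powr (- \<sigma>) * exp (- \<gamma> * \<tau>))) = exp (- \<gamma> * \<tau>) * \<kappa>f \<tau>" for \<tau>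
    by (simp add: \<kappa>f_def indicator_def)
  ultimately show ?thesis by (simp only:)
qed

text \<open>Writing \<open>a\<close> for \<open>L * (c\<sigma> * Gamma (1 - \<sigma>))\<close>, the
  choice of \<gamma> means \<open>\<gamma> powr (1 - \<sigma>) = 2 * a + 1\<close>, so the product
  is \<open>a / (2 * a + 1)\<close>.\<close>

lemma L_qf: "L * (c\<sigma> * (Gamma (1 - \<sigma>) * \<gamma> powr (\<sigma> - 1))) \<le> 1 / 2"
proof -
  let ?a = "L * (c\<sigma> * Gamma (1 - \<sigma>))"
  have a: "0 < ?a" using L c\<sigma>_pos \<Gamma>_pos by simp
  have "\<gamma> powr (\<sigma> - 1) = (2 * L * (c\<sigma> * Gamma (1 - \<sigma>)) + 1) powr (- 1)"
  proof -
    have "1 / (1 - \<sigma>) * (\<sigma> - 1) = - 1" using \<sigma> by (simp add: field_simps)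
    then show ?thesis unfolding \<gamma>_def powr_powr by simp
  qed
  also have "\<dots> = 1 / (2 * ?a + 1)"
    using a by (simp add: powr_minus_divide mult.assoc)
  finally have "L * (c\<sigma> * (Gamma (1 - \<sigma>) * \<gamma> powr (\<sigma> - 1))) = ?a / (2 * ?a + 1)"
    by simp
  also have "\<dots> \<le> 1 / 2" using a by (simp add: field_simps)
  finally show ?thesis .
qed

lemma kc_measurable: "(\<lambda>\<tau>. kc \<tau> j) \<in> borel_measurable borel"
  unfolding kc_def by measurable

lemma kf_measurable: "(\<lambda>\<tau>. kf \<tau> j) \<in> borel_measurable borel"
  unfolding kf_def by measurable

text \<open>\<open>tendsto_diag\<close> asks for a bound on the symbols near the point; continuity
  of \<open>\<kappa>'\<close> there supplies it.\<close>

lemma isCont_diag_kernel: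
  assumes bound: "\<And>\<tau> j. \<bar>c \<tau> j\<bar> \<le> \<kappa>' \<tau>" and \<kappa>': "isCont \<kappa>' \<tau>" and c: "\<And>j. isCont (\<lambda>\<tau>. c \<tau> j) \<tau>"
  shows "isCont (\<lambda>\<tau>. diag (c \<tau>) x) \<tau>"
  unfolding isCont_def
proof (rule tendsto_diag[where C = "\<kappa>' \<tau> + 1"])
  have "\<forall>\<^sub>F t in at \<tau>. \<kappa>' t < \<kappa>' \<tau> + 1"
    using \<kappa>' by (intro order_tendstoD(2)) (auto simp: isCont_def)
  then show "\<forall>\<^sub>F t in at \<tau>. \<forall>k. \<bar>c t k\<bar> \<le> \<kappa>' \<tau> + 1"
  proof eventually_elim
    case (elim t)
    then show ?case using bound[of t] by (meson less_imp_le order_trans)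
  qed
qed (use c in \<open>auto simp: isCont_def\<close>)

lemma isCont_eq_open:
  fixes g h :: "real \<Rightarrow> real"
  assumes "open S" "x \<in> S" "\<And>y. y \<in> S \<Longrightarrow> g y = h y" "isCont h x"
  shows "isCont g x"
proof -
  have "\<forall>\<^sub>F y in nhds x. g y = h y"
    using eventually_nhds_in_open[OF assms(1,2)] by eventually_elim (use assms in auto)
  then show ?thesis using isCont_cong assms(4) by blast
qed

lemma isCont_kernels:
  assumes "\<tau> \<noteq> 0"
  shows "isCont \<kappa> \<tau>" "isCont \<kappa>f \<tau>" "isCont (\<lambda>\<tau>. kc \<tau> j) \<tau>" "isCont (\<lambda>\<tau>. kf \<tau> j) \<tau>"
proof -
  consider "\<tau> < 0" | "0 < \<tau>" using assms by linarith
  then have "isCont \<kappa> \<tau> \<and> isCont \<kappa>f \<tau> \<and> isCont (\<lambda>\<tau>. kc \<tau> j) \<tau> \<and> isCont (\<lambda>\<tau>. kf \<tau> j) \<tau>"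
  proof cases
    case 1
    show ?thesis
      by (cases "j < N"; intro conjI; rule isCont_eq_open[OF open_lessThan[of 0]])
        (use 1 in \<open>auto simp: \<kappa>_def \<kappa>f_def kc_def kf_def intro!: continuous_intros\<close>)
  next
    case 2
    show ?thesis
      by (cases "j < N"; intro conjI; rule isCont_eq_open[OF open_greaterThan[of 0]])
        (use 2 in \<open>auto simp: \<kappa>_def \<kappa>f_def kc_def kf_def intro!: continuous_intros\<close>)
  qed
  then show "isCont \<kappa> \<tau>" "isCont \<kappa>f \<tau>" "isCont (\<lambda>\<tau>. kc \<tau> j) \<tau>" "isCont (\<lambda>\<tau>. kf \<tau> j) \<tau>" by auto
qed

sublocale lp: conv_kernel "\<lambda>\<tau>. diag (kc \<tau>)" \<kappa> \<beta> q
proof (rule conv_kernel.intro)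
  show "(\<lambda>(\<tau>, x). diag (kc \<tau>) x) \<in> borel_measurable (borel \<Otimes>\<^sub>M borel)"
    unfolding split_beta' by (intro measurable_diag measurable_compose[OF measurable_fst kc_measurable]) auto
  show "linear (diag (kc \<tau>))" for \<tau>
    by (rule bounded_linear.linear[OF bounded_linear_diag[OF kc_bound]])
  show "norm (diag (kc \<tau>) x) \<le> \<kappa> \<tau> * norm x" for \<tau> x by (rule norm_diag[OF kc_bound])
  show "0 \<le> \<kappa> \<tau>" for \<tau> by (rule order_trans[OF abs_ge_zero kc_bound])
  show "integrable lborel (\<lambda>\<tau>. exp (\<beta> * \<tau>) * \<kappa> \<tau>)" using has_integral_\<kappa> by (simp add: has_bochner_integral_iff)
  show "(LINT \<tau>|lborel. exp (\<beta> * \<tau>) * \<kappa> \<tau>) \<le> q" by (simp add: q_def)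
qed (auto intro!: isCont_diag_kernel[OF kc_bound] isCont_kernels)

text \<open>With the negative weight, functions may grow like \<open>exp (\<gamma> * t)\<close>. The
  kernel is \<open>A\<^sup>\<sigma> e\<^sup>-\<^sup>A\<^sup>\<tau>\<close> on both spectral parts,
  supported on positive times, and its convolution constant is made small by enlarging \<gamma>
  rather than by the gap condition.\<close>

sublocale fw: conv_kernel "\<lambda>\<tau>. diag (kf \<tau>)" \<kappa>f "- \<gamma>" "c\<sigma> * (Gamma (1 - \<sigma>) * \<gamma> powr (\<sigma> - 1))"
proof (rule conv_kernel.intro)
  show "(\<lambda>(\<tau>, x). diag (kf \<tau>) x) \<in> borel_measurable (borel \<Otimes>\<^sub>M borel)"
    unfolding split_beta' by (intro measurable_diag measurable_compose[OF measurable_fst kf_measurable]) auto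
  show "linear (diag (kf \<tau>))" for \<tau>
    by (rule bounded_linear.linear[OF bounded_linear_diag[OF kf_bound]])
  show "norm (diag (kf \<tau>) x) \<le> \<kappa>f \<tau> * norm x" for \<tau> x by (rule norm_diag[OF kf_bound])
  show "0 \<le> \<kappa>f \<tau>" for \<tau> by (rule order_trans[OF abs_ge_zero kf_bound])
  show "integrable lborel (\<lambda>\<tau>. exp (- \<gamma> * \<tau>) * \<kappa>f \<tau>)" using has_integral_\<kappa>f by (simp add: has_bochner_integral_iff)
  show "(LINT \<tau>|lborel. exp (- \<gamma> * \<tau>) * \<kappa>f \<tau>) \<le> c\<sigma> * (Gamma (1 - \<sigma>) * \<gamma> powr (\<sigma> - 1))"
    using has_bochner_integral_integral_eq[OF has_integral_\<kappa>f] by simp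
qed (auto intro!: isCont_diag_kernel[OF kf_bound] isCont_kernels)

end

section \<open>Forward and backward solutions after removal of the noise\<close>

context conv_kernel begin

text \<open>The parameter is a dummy real number, and \<open>gronwall\<close> sharpens the
  unspecified bound to \<open>C / (1 - \<mu>)\<close>, which becomes the constant in the attraction
  estimate and in the bound on the derivative.\<close>

lemma fixed_point_single:
  fixes \<Delta> :: "real \<Rightarrow> 'h \<Rightarrow> 'h"
  assumes \<Delta>_meas: "(\<lambda>(s, x). \<Delta> s x) \<in> borel_measurable (borel \<Otimes>\<^sub>M borel)"
    and \<eta>_meas: "\<eta> \<in> borel_measurable borel"
    and lip: "\<And>s x y. norm (\<Delta> s x - \<Delta> s y) \<le> L * norm (x - y)"
    and zero: "\<And>s. \<Delta> s 0 = 0"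
    and \<eta>_bound: "\<And>t. norm (\<eta> t) \<le> C * exp (- bet * t)"
    and L: "0 \<le> L" "L * q \<le> \<mu>" "\<mu> < 1"
  obtains w where "w \<in> borel_measurable borel" "\<And>t. norm (w t) \<le> C / (1 - \<mu>) * exp (- bet * t)"
    "\<And>t. w t = \<eta> t + conv (\<lambda>s. \<Delta> s (w s)) t"
proof -
  have 1: "(\<lambda>(p::real, s, x). \<Delta> s x) \<in> borel_measurable (borel \<Otimes>\<^sub>M borel \<Otimes>\<^sub>M borel)"
    using measurable_compose[OF measurable_snd \<Delta>_meas] by (simp add: split_beta')
  have 2: "(\<lambda>(p::real, t). \<eta> t) \<in> borel_measurable (borel \<Otimes>\<^sub>M borel)"
    using measurable_compose[OF measurable_snd \<eta>_meas] by (simp add: split_beta')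
  obtain w :: "real \<Rightarrow> real \<Rightarrow> 'h" where w: "(\<lambda>(p, t). w p t) \<in> borel_measurable (borel \<Otimes>\<^sub>M borel)"
    "\<And>p. p \<in> space borel \<Longrightarrow> \<exists>C. \<forall>t. norm (w p t) \<le> C * exp (- bet * t)"
    "\<And>p t. p \<in> space borel \<Longrightarrow> w p t = \<eta> t + conv (\<lambda>s. \<Delta> s (w p s)) t"
    by (rule fixed_point[OF 1 2 lip zero _ L]) (use \<eta>_bound in blast, rule that)
  have wm: "w 0 \<in> borel_measurable borel"
    using measurable_compose[OF measurable_Pair1' w(1), of 0] by simp
  have hm: "(\<lambda>s. \<Delta> s (w 0 s)) \<in> borel_measurable borel"
    by (rule measurable_curry_borel[OF \<Delta>_meas _ wm]) auto
  obtain C' where C': "\<And>t. norm (w 0 t) \<le> C' * exp (- bet * t)" using w(2)[of 0] by auto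
  have "norm (w 0 t) \<le> C * exp (- bet * t) + norm (conv (\<lambda>s. \<Delta> s (w 0 s)) t)" for t
    by (subst w(3)) (simp, rule norm_triangle_mono[OF \<eta>_bound order_refl])
  moreover have "norm (\<Delta> s (w 0 s)) \<le> L * norm (w 0 s)" for s
    using lip[of s "w 0 s" 0] zero by simp
  ultimately have "norm (w 0 t) \<le> C / (1 - \<mu>) * exp (- bet * t)" for t
    using gronwall[OF hm C' _ _ L] by blast
  moreover have "w 0 t = \<eta> t + conv (\<lambda>s. \<Delta> s (w 0 s)) t" for t by (rule w(3)) simp
  ultimately show thesis by (rule that[OF wm])
qed

end

context inertial begin

definition g :: "(real \<Rightarrow> real) \<Rightarrow> real \<Rightarrow> 'h \<Rightarrow> 'h" where
  "g a s y = exp (- a s) *\<^sub>R f (exp (a s) *\<^sub>R y)"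

lemma g_lipschitz: "norm (g a s x - g a s y) \<le> L * norm (x - y)"
proof -
  have "norm (g a s x - g a s y) = exp (- a s) * norm (f (exp (a s) *\<^sub>R x) - f (exp (a s) *\<^sub>R y))"
    by (simp add: g_def scaleR_diff_right[symmetric])
  also have "\<dots> \<le> exp (- a s) * (L * norm (exp (a s) *\<^sub>R x - exp (a s) *\<^sub>R y))"
    by (intro mult_left_mono f_lipschitz) simp
  also have "\<dots> = L * norm (x - y)"
    by (simp add: scaleR_diff_right[symmetric] exp_minus)
  finally show ?thesis .
qed

lemma g_0 [simp]: "g a s 0 = 0"
  by (simp add: g_def)

lemma norm_g: "norm (g a s x) \<le> L * norm x"
  using g_lipschitz[of a s x 0] by simp

lemma g_measurable:
  assumes [measurable]: "(\<lambda>x. a (p x) (s x)) \<in> borel_measurable M" "v \<in> borel_measurable M"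
  shows "(\<lambda>x. g (a (p x)) (s x) (v x)) \<in> borel_measurable M"
  unfolding g_def by measurable

lemma g_measurable1:
  assumes "a \<in> borel_measurable borel" "v \<in> borel_measurable borel"
  shows "(\<lambda>s. g a s (v s)) \<in> borel_measurable borel"
  using g_measurable[of "\<lambda>_. a" "\<lambda>_. ()" "\<lambda>s. s" borel v] assms by simp

text \<open>Because \<open>g\<close> vanishes at 0, a cutoff in time may be moved inside;
  measurability of \<open>y\<close> is then required on the cutoff set only.\<close>

lemma g_indicator: "indicator A s *\<^sub>R g a s y = g a s (indicator A s *\<^sub>R y)"
  by (cases "s \<in> A") auto

section \<open>The semigroup and its spectral parts\<close>

text \<open>\<open>eP t\<close>, \<open>eQ t\<close> and \<open>S t\<close> are
  \<open>e\<^sup>-\<^sup>A\<^sup>t P\<close>, \<open>e\<^sup>-\<^sup>A\<^sup>t Q\<close> and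
  \<open>e\<^sup>-\<^sup>A\<^sup>t\<close>. The first has finite rank and makes sense for all
  \<open>t\<close>; the estimates for the other two are for \<open>t \<ge> 0\<close>.\<close>

definition eP :: "real \<Rightarrow> 'h \<Rightarrow> 'h" where "eP t = diag (\<lambda>j. if j < N then exp (- l j * t) else 0)"
definition eQ :: "real \<Rightarrow> 'h \<Rightarrow> 'h" where "eQ t = diag (\<lambda>j. if j < N then 0 else exp (- l j * t))"
definition S :: "real \<Rightarrow> 'h \<Rightarrow> 'h" where "S t = diag (\<lambda>j. exp (- l j * t))"

lemma eP_coeff_bound: "\<bar>if j < N then exp (- l j * t) else 0\<bar> \<le> exp (\<Lambda>1 * \<bar>t\<bar>)"
proof -
  have "- l j * t \<le> \<Lambda>1 * \<bar>t\<bar>" if "j < N"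
  proof -
    have "- l j * t \<le> l j * \<bar>t\<bar>" using l_pos[of j] by (simp add: abs_if mult_less_0_iff)
    also have "\<dots> \<le> \<Lambda>1 * \<bar>t\<bar>" using l_le_\<Lambda>1[OF that] by (intro mult_right_mono) auto
    finally show ?thesis .
  qed
  then show ?thesis by auto
qed

lemma eP_inner: "eP t x \<bullet> b j = (if j < N then exp (- l j * t) * (x \<bullet> b j) else 0)"
  unfolding eP_def diag_inner[OF eP_coeff_bound] by simp

lemma linear_eP: "linear (eP t)"
  unfolding eP_def by (intro bounded_linear.linear bounded_linear_diag[OF eP_coeff_bound])

lemma eP_P: "eP t (P x) = eP t x"
  by (rule coeff_eqI) (simp add: eP_inner P_inner)

lemma eP_0: "eP 0 x = P x"
  by (rule coeff_eqI) (simp add: eP_inner P_inner)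

text \<open>Going backward in time, the low modes grow at a rate of at most
  \<open>\<Lambda>1\<close>, which is below \<beta>.\<close>

lemma norm_eP:
  assumes "t \<le> 0" shows "norm (eP t x) \<le> exp (- \<beta> * t) * norm (P x)"
proof -
  have "norm (eP t (P x)) \<le> exp (- \<beta> * t) * norm (P x)"
    unfolding eP_def
  proof (rule norm_diag)
    fix j
    show "\<bar>if j < N then exp (- l j * t) else 0\<bar> \<le> exp (- \<beta> * t)"
      using assms l_le_\<Lambda>1[of j] \<beta>_gt by (auto intro: mult_right_mono_neg)
  qed
  then show ?thesis by (simp add: eP_P)
qed

lemma eQ_coeff_bound: "0 \<le> t \<Longrightarrow> \<bar>if j < N then 0 else exp (- l j * t)\<bar> \<le> exp (- \<beta> * t)"
  using l_ge_\<Lambda>2[of j] \<Lambda>2_gt by (auto intro: mult_right_mono)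

lemma eQ_inner: "0 \<le> t \<Longrightarrow> eQ t x \<bullet> b j = (if j < N then 0 else exp (- l j * t) * (x \<bullet> b j))"
  unfolding eQ_def by (subst diag_inner[OF eQ_coeff_bound]) auto

lemma norm_eQ: "0 \<le> t \<Longrightarrow> norm (eQ t x) \<le> exp (- \<beta> * t) * norm x"
  unfolding eQ_def by (rule norm_diag[OF eQ_coeff_bound])

lemma S_coeff_bound: "0 \<le> t \<Longrightarrow> \<bar>exp (- l j * t)\<bar> \<le> 1"
  using l_pos[of j] by simp

lemma S_inner: "0 \<le> t \<Longrightarrow> S t x \<bullet> b j = exp (- l j * t) * (x \<bullet> b j)"
  unfolding S_def by (rule diag_inner[OF S_coeff_bound])

lemma norm_S: "0 \<le> t \<Longrightarrow> norm (S t x) \<le> norm x"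
  unfolding S_def using norm_diag[of "\<lambda>j. exp (- l j * t)" 1 x] S_coeff_bound by simp

lemma measurable_semigroups:
  assumes [measurable]: "t \<in> borel_measurable M" "x \<in> borel_measurable M"
  shows "(\<lambda>p. eP (t p) (x p)) \<in> borel_measurable M" "(\<lambda>p. eQ (t p) (x p)) \<in> borel_measurable M"
    "(\<lambda>p. S (t p) (x p)) \<in> borel_measurable M"
  unfolding eP_def eQ_def S_def by (intro measurable_diag; measurable)+

lemma continuous_S: "continuous_on {0..} (\<lambda>t. S t x)"
  unfolding continuous_on_def S_def
proof
  fix t :: real assume "t \<in> {0..}"
  show "((\<lambda>t. diag (\<lambda>j. exp (- l j * t)) x) \<longlongrightarrow> diag (\<lambda>j. exp (- l j * t)) x) (at t within {0..})"
  proof (rule tendsto_diag[where C = 1])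
    show "\<forall>\<^sub>F t in at t within {0..}. \<forall>k. \<bar>exp (- l k * t)\<bar> \<le> 1"
      using S_coeff_bound by (auto simp: eventually_at_filter)
  qed (auto intro!: tendsto_intros)
qed

lemma continuous_eP: "continuous_on UNIV (\<lambda>t. eP t x)"
  unfolding continuous_on_def eP_def
proof
  fix t :: real
  show "((\<lambda>t. diag (\<lambda>j. if j < N then exp (- l j * t) else 0) x) \<longlongrightarrow>
      diag (\<lambda>j. if j < N then exp (- l j * t) else 0) x) (at t)"
  proof (rule tendsto_diag[where C = "exp (\<Lambda>1 * (\<bar>t\<bar> + 1))"])
    have "\<forall>\<^sub>F s in at t. \<bar>s\<bar> < \<bar>t\<bar> + 1"
      by (intro order_tendstoD(2)[of _ "\<bar>t\<bar>"] tendsto_intros) auto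
    then show "\<forall>\<^sub>F s in at t. \<forall>k. \<bar>if k < N then exp (- l k * s) else 0\<bar> \<le> exp (\<Lambda>1 * (\<bar>t\<bar> + 1))"
    proof eventually_elim
      case (elim s)
      have "exp (\<Lambda>1 * \<bar>s\<bar>) \<le> exp (\<Lambda>1 * (\<bar>t\<bar> + 1))"
        using elim \<Lambda>1_pos by auto
      then show ?case using eP_coeff_bound[of _ s] order_trans by blast
    qed
    show "((\<lambda>s. if k < N then exp (- l k * s) else 0) \<longlongrightarrow> (if k < N then exp (- l k * t) else 0)) (at t)" for k
      by (cases "k < N") (auto intro!: tendsto_intros)
  qed
qed

text \<open>The integrating factor of mode \<open>j\<close>: after multiplication by
  \<open>exp (l j * t)\<close> the \<open>j\<close>-th coordinate of a convolution becomes the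
  integral of the single function \<open>modal h j\<close> over an interval that depends on
  \<open>t\<close>. Low modes of the Lyapunov-Perron convolution integrate over times after
  \<open>t\<close> with a minus sign; its high modes and all modes of the forward convolution
  integrate over times before \<open>t\<close>.\<close>

definition modal :: "(real \<Rightarrow> 'h) \<Rightarrow> nat \<Rightarrow> real \<Rightarrow> real" where
  "modal h j s = l j powr \<sigma> * (exp (l j * s) * (h s \<bullet> b j))"

lemma lp_coeff:
  assumes h: "h \<in> borel_measurable borel" "\<And>s. norm (h s) \<le> C * exp (- \<beta> * s)"
  shows "j < N \<Longrightarrow> interval_lebesgue_integrable lborel (ereal t) \<infinity> (modal h j)"
    and "j < N \<Longrightarrow> exp (l j * t) * (lp.conv h t \<bullet> b j) = - (LBINT s=ereal t..\<infinity>. modal h j s)"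
    and "N \<le> j \<Longrightarrow> interval_lebesgue_integrable lborel (-\<infinity>) (ereal t) (modal h j)"
    and "N \<le> j \<Longrightarrow> exp (l j * t) * (lp.conv h t \<bullet> b j) = (LBINT s=-\<infinity>..ereal t. modal h j s)"
proof -
  have i: "integrable lborel (\<lambda>s. diag (kc (t - s)) (h s))"
    by (rule lp.conv_bound(1)[OF h])
  have c: "exp (l j * t) * (diag (kc (t - s)) (h s) \<bullet> b j) =
      (if j < N then - (indicator {t<..} s *\<^sub>R modal h j s) else indicator {..<t} s *\<^sub>R modal h j s)" for s
    unfolding diag_inner[OF kc_bound] kc_def modal_def
    by (auto simp: indicator_def exp_add[symmetric] algebra_simps exp_diff)
      (simp_all add: exp_minus field_simps exp_add[symmetric] exp_diff)
  have i': "integrable lborel (\<lambda>s. exp (l j * t) * (diag (kc (t - s)) (h s) \<bullet> b j))"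
    using i by (intro integrable_mult_right integrable_inner_left) auto
  have e: "exp (l j * t) * (lp.conv h t \<bullet> b j) = (LINT s|lborel. exp (l j * t) * (diag (kc (t - s)) (h s) \<bullet> b j))"
    unfolding lp.conv_def using i by simp
  show "interval_lebesgue_integrable lborel (ereal t) \<infinity> (modal h j)" if "j < N"
    using i' unfolding c interval_lebesgue_integrable_def set_integrable_def using that by simp
  show "exp (l j * t) * (lp.conv h t \<bullet> b j) = - (LBINT s=ereal t..\<infinity>. modal h j s)" if "j < N"
    unfolding e c interval_lebesgue_integral_def set_lebesgue_integral_def using that by simp
  show "interval_lebesgue_integrable lborel (-\<infinity>) (ereal t) (modal h j)" if "N \<le> j"
    using i' unfolding c interval_lebesgue_integrable_def set_integrable_def using that by simp
  show "exp (l j * t) * (lp.conv h t \<bullet> b j) = (LBINT s=-\<infinity>..ereal t. modal h j s)" if "N \<le> j"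
    unfolding e c interval_lebesgue_integral_def set_lebesgue_integral_def using that by simp
qed

lemma fw_coeff:
  assumes h: "h \<in> borel_measurable borel" "\<And>s. norm (h s) \<le> C * exp (\<gamma> * s)"
  shows "interval_lebesgue_integrable lborel (-\<infinity>) (ereal t) (modal h j)"
    and "exp (l j * t) * (fw.conv h t \<bullet> b j) = (LBINT s=-\<infinity>..ereal t. modal h j s)"
proof -
  have i: "integrable lborel (\<lambda>s. diag (kf (t - s)) (h s))"
    using h by (intro fw.conv_bound(1)[of _ C]) auto
  have c: "exp (l j * t) * (diag (kf (t - s)) (h s) \<bullet> b j) = indicator {..<t} s *\<^sub>R modal h j s" for s
    unfolding diag_inner[OF kf_bound] kf_def modal_def
    by (auto simp: indicator_def exp_add[symmetric] algebra_simps exp_diff)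
      (simp_all add: exp_minus field_simps exp_add[symmetric] exp_diff)
  have i': "integrable lborel (\<lambda>s. exp (l j * t) * (diag (kf (t - s)) (h s) \<bullet> b j))"
    using i by (intro integrable_mult_right integrable_inner_left) auto
  have e: "exp (l j * t) * (fw.conv h t \<bullet> b j) = (LINT s|lborel. exp (l j * t) * (diag (kf (t - s)) (h s) \<bullet> b j))"
    unfolding fw.conv_def using i by simp
  show "interval_lebesgue_integrable lborel (-\<infinity>) (ereal t) (modal h j)"
    using i' unfolding c interval_lebesgue_integrable_def set_integrable_def by simp
  show "exp (l j * t) * (fw.conv h t \<bullet> b j) = (LBINT s=-\<infinity>..ereal t. modal h j s)"
    unfolding e c interval_lebesgue_integral_def set_lebesgue_integral_def by simp
qed

section \<open>Forward and backward integral equations\<close>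

definition forward_sol :: "(real \<Rightarrow> real) \<Rightarrow> 'h \<Rightarrow> (real \<Rightarrow> 'h) \<Rightarrow> bool" where
  "forward_sol a x y \<longleftrightarrow> continuous_on {0..} y \<and>
     (\<forall>t\<ge>0. y t = S t x + fw.conv (\<lambda>s. indicator {0..} s *\<^sub>R g a s (y s)) t)"

text \<open>Orbits up to time \<tau> of growth at most \<open>exp (- \<beta> * s)\<close> toward the
  past, with \<open>y \<tau>\<close> itself as terminal datum: \<open>eP\<close> sees only its low
  modes, and the high modes are determined by the equation.\<close>

definition backward_sol :: "real \<Rightarrow> (real \<Rightarrow> real) \<Rightarrow> (real \<Rightarrow> 'h) \<Rightarrow> bool" where
  "backward_sol \<tau> a y \<longleftrightarrow> (\<lambda>s. indicator {..<\<tau>} s *\<^sub>R y s) \<in> borel_measurable borel \<and>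
     (\<exists>C. \<forall>s\<le>\<tau>. norm (y s) \<le> C * exp (- \<beta> * s)) \<and>
     (\<forall>t\<le>\<tau>. y t = eP (t - \<tau>) (y \<tau>) + lp.conv (\<lambda>s. indicator {..<\<tau>} s *\<^sub>R g a s (y s)) t)"

lemma fsolD: "forward_sol a x y \<Longrightarrow> 0 \<le> t \<Longrightarrow> y t = S t x + fw.conv (\<lambda>s. indicator {0..} s *\<^sub>R g a s (y s)) t"
  unfolding forward_sol_def by blast

lemma bsolD: "backward_sol \<tau> a y \<Longrightarrow> t \<le> \<tau> \<Longrightarrow>
    y t = eP (t - \<tau>) (y \<tau>) + lp.conv (\<lambda>s. indicator {..<\<tau>} s *\<^sub>R g a s (y s)) t"
  unfolding backward_sol_def by blast

text \<open>Causality: the forward kernel vanishes at nonpositive times. A forward solution comes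
  with no growth bound for large times, and cutting at \<open>T\<close> makes its forcing admissible
  for the weighted estimates.\<close>

lemma fw_conv_cutoff:
  assumes "t \<le> T"
  shows "fw.conv (\<lambda>s. indicator {0..} s *\<^sub>R h s) t = fw.conv (\<lambda>s. indicator {0..<T} s *\<^sub>R h s) t"
  unfolding fw.conv_def
proof (rule Bochner_Integration.integral_cong[OF refl])
  fix s
  show "diag (kf (t - s)) (indicator {0..} s *\<^sub>R h s) = diag (kf (t - s)) (indicator {0..<T} s *\<^sub>R h s)"
  proof (cases "s < t")
    case True
    then show ?thesis using assms by (auto simp: indicator_def)
  next
    case False
    then have "kf (t - s) = (\<lambda>j. 0)" by (auto simp: kf_def)
    then show ?thesis by (simp add: diag_def)
  qed
qed

lemma forward_sol_measurable:
  assumes "forward_sol a x y" "A \<in> sets borel" "A \<subseteq> {0..}"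
  shows "(\<lambda>s. indicator A s *\<^sub>R y s) \<in> borel_measurable borel"
proof -
  have "(\<lambda>s. indicator {0..} s *\<^sub>R y s) \<in> borel_measurable borel"
    using assms(1) borel_measurable_continuous_on_indicator[of "{0..}" y] by (auto simp: forward_sol_def)
  then have "(\<lambda>s. indicator A s *\<^sub>R (indicator {0..} s *\<^sub>R y s)) \<in> borel_measurable borel"
    using assms(2) by measurable
  also have "(\<lambda>s. indicator A s *\<^sub>R (indicator {0..} s *\<^sub>R y s)) = (\<lambda>s. indicator A s *\<^sub>R y s)"
    using assms(3) by (auto simp: indicator_def fun_eq_iff)
  finally show ?thesis .
qed

lemma forward_sol_bounded:
  assumes "forward_sol a x y"
  obtains C where "0 \<le> C" "\<And>s. 0 \<le> s \<Longrightarrow> s \<le> T \<Longrightarrow> norm (y s) \<le> C"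
proof -
  have "compact (y ` {0..T})"
    using assms by (intro compact_continuous_image) (auto simp: forward_sol_def intro: continuous_on_subset)
  from compact_imp_bounded[OF this] obtain C where "\<forall>v\<in>y ` {0..T}. norm v \<le> C"
    by (auto simp: bounded_iff)
  then show thesis by (intro that[of "max C 0"]) (auto simp: max.coboundedI1)
qed

lemma forward_sol_cutoff:
  assumes y: "forward_sol a x y" and a: "a \<in> borel_measurable borel"
  shows "(\<lambda>s. indicator {0..<T} s *\<^sub>R g a s (y s)) \<in> borel_measurable borel"
    and "\<exists>C. \<forall>s. norm (indicator {0..<T} s *\<^sub>R g a s (y s)) \<le> C * exp (\<gamma> * s)"
proof -
  show "(\<lambda>s. indicator {0..<T} s *\<^sub>R g a s (y s)) \<in> borel_measurable borel"
    unfolding g_indicator by (intro g_measurable1 a forward_sol_measurable[OF y]) auto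
  obtain C where C: "0 \<le> C" "\<And>s. 0 \<le> s \<Longrightarrow> s \<le> T \<Longrightarrow> norm (y s) \<le> C" using forward_sol_bounded[OF y] by blast
  have "norm (indicator {0..<T} s *\<^sub>R g a s (y s)) \<le> L * C * exp (\<gamma> * s)" for s
  proof (cases "s \<in> {0..<T}")
    case True
    then have "norm (g a s (y s)) \<le> L * C"
      using order_trans[OF norm_g mult_left_mono[OF C(2)]] L by auto
    also have "\<dots> \<le> L * C * exp (\<gamma> * s)"
    proof -
      have "0 \<le> \<gamma> * s" using \<gamma>_pos True by simp
      moreover have "0 \<le> L * C" using L C(1) by simp
      ultimately show ?thesis using mult_left_mono[of 1 "exp (\<gamma> * s)" "L * C"] by simp
    qed
    finally show ?thesis using True by simp
  qed (use L C in auto)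
  then show "\<exists>C. \<forall>s. norm (indicator {0..<T} s *\<^sub>R g a s (y s)) \<le> C * exp (\<gamma> * s)" by blast
qed

text \<open>The difference, cut off outside \<open>{0..t}\<close>, is bounded by continuity, so
  \<open>gronwall\<close> applies with \<open>C0 = 0\<close>.\<close>

lemma forward_sol_unique:
  assumes y: "forward_sol a x y" and y': "forward_sol a x y'" and a: "a \<in> borel_measurable borel" and t: "0 \<le> t"
  shows "y t = y' t"
proof -
  let ?w = "\<lambda>s. indicator {0..t} s *\<^sub>R (y s - y' s)"
  let ?h = "\<lambda>s. indicator {0..<t} s *\<^sub>R g a s (y s) - indicator {0..<t} s *\<^sub>R g a s (y' s)"
  obtain C where C: "0 \<le> C" "\<And>s. 0 \<le> s \<Longrightarrow> s \<le> t \<Longrightarrow> norm (y s) \<le> C" using forward_sol_bounded[OF y] by blast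
  obtain C' where C': "0 \<le> C'" "\<And>s. 0 \<le> s \<Longrightarrow> s \<le> t \<Longrightarrow> norm (y' s) \<le> C'" using forward_sol_bounded[OF y'] by blast
  obtain B B' where B: "\<And>s. norm (indicator {0..<t} s *\<^sub>R g a s (y s)) \<le> B * exp (\<gamma> * s)"
    "\<And>s. norm (indicator {0..<t} s *\<^sub>R g a s (y' s)) \<le> B' * exp (\<gamma> * s)"
    using forward_sol_cutoff(2)[OF y a, of t] forward_sol_cutoff(2)[OF y' a, of t] by blast
  have diff: "fw.conv ?h s = y s - y' s" if "0 \<le> s" "s \<le> t" for s
  proof -
    have "fw.conv ?h s = fw.conv (\<lambda>s. indicator {0..<t} s *\<^sub>R g a s (y s)) s - fw.conv (\<lambda>s. indicator {0..<t} s *\<^sub>R g a s (y' s)) s"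
      by (rule fw.conv_diff[symmetric, of _ B _ B']) (use B forward_sol_cutoff(1)[OF _ a] y y' in auto)
    moreover have "y s - y' s = fw.conv (\<lambda>s. indicator {0..<t} s *\<^sub>R g a s (y s)) s - fw.conv (\<lambda>s. indicator {0..<t} s *\<^sub>R g a s (y' s)) s"
      by (subst fsolD[OF y that(1)], subst fsolD[OF y' that(1)]) (simp add: fw_conv_cutoff[OF that(2)])
    ultimately show ?thesis by simp
  qed
  have "norm (?w s) \<le> 0 / (1 - 1 / 2) * exp (- (- \<gamma>) * s)" for s
  proof (rule fw.gronwall[where h = ?h and C = "C + C'" and L = L])
    show "?h \<in> borel_measurable borel"
      by (intro borel_measurable_diff forward_sol_cutoff(1)[OF _ a]) (rule y y')+
    show "norm (?w s) \<le> (C + C') * exp (- (- \<gamma>) * s)" for s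
    proof (cases "s \<in> {0..t}")
      case True
      have "norm (y s - y' s) \<le> (C + C') * 1"
        using norm_triangle_ineq4[of "y s" "y' s"] C(2)[of s] C'(2)[of s] True by auto
      also have "\<dots> \<le> (C + C') * exp (\<gamma> * s)"
      proof (rule mult_left_mono)
        have "0 \<le> \<gamma> * s" using \<gamma>_pos True by simp
        then show "1 \<le> exp (\<gamma> * s)" by simp
      qed (use C(1) C'(1) in simp)
      finally show ?thesis using True by simp
    qed (use C(1) C'(1) in auto)
    show "norm (?h s) \<le> L * norm (?w s)" for s
      using g_lipschitz[of a s "y s" "y' s"] L by (auto simp: indicator_def)
    show "norm (?w s) \<le> 0 * exp (- (- \<gamma>) * s) + norm (fw.conv ?h s)" for s
      using diff[of s] by (auto simp: indicator_def)
  qed (use L L_qf in auto)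
  from this[of t] show ?thesis using t by simp
qed

text \<open>This serves measurability: mild solutions are given, and uniqueness will identify them
  with this jointly measurable family.\<close>

lemma forward_sol_exists:
  fixes M :: "'p measure"
  assumes a: "(\<lambda>(p, s). a p s) \<in> borel_measurable (M \<Otimes>\<^sub>M borel)" and x: "x \<in> borel_measurable M"
  obtains y where "(\<lambda>(p, t). y p t) \<in> borel_measurable (M \<Otimes>\<^sub>M borel)"
    and "\<And>p. p \<in> space M \<Longrightarrow> forward_sol (a p) (x p) (y p)"
proof -
  let ?\<Delta> = "\<lambda>p s v. indicator {0..} s *\<^sub>R g (a p) s v"
  let ?\<eta> = "\<lambda>p t. indicator {0..} t *\<^sub>R S t (x p)"
  have 1: "(\<lambda>(p, s, v). ?\<Delta> p s v) \<in> borel_measurable (M \<Otimes>\<^sub>M borel \<Otimes>\<^sub>M borel)"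
    unfolding split_beta'
  proof (intro borel_measurable_scaleR g_measurable)
    show "(\<lambda>x. a (fst x) (fst (snd x))) \<in> borel_measurable (M \<Otimes>\<^sub>M borel \<Otimes>\<^sub>M borel)"
      by (rule measurable_curry_borel[OF a]) auto
  qed auto
  have 2: "(\<lambda>(p, t). ?\<eta> p t) \<in> borel_measurable (M \<Otimes>\<^sub>M borel)"
    unfolding split_beta'
    by (intro borel_measurable_scaleR measurable_semigroups measurable_compose[OF measurable_fst x]) auto
  have lip: "norm (?\<Delta> p s v - ?\<Delta> p s v') \<le> L * norm (v - v')" for p s v v'
    using g_lipschitz[of "a p" s v v'] L by (auto simp: indicator_def)
  have bd: "\<exists>C. \<forall>t. norm (?\<eta> p t) \<le> C * exp (- (- \<gamma>) * t)" for p
  proof (intro exI allI)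
    fix t
    have "norm (S t (x p)) \<le> norm (x p) * exp (\<gamma> * t)" if "0 \<le> t"
    proof -
      have "0 \<le> \<gamma> * t" using \<gamma>_pos that by simp
      then show ?thesis using norm_S[OF that, of "x p"] mult_left_mono[of 1 "exp (\<gamma> * t)" "norm (x p)"] by simp
    qed
    then show "norm (?\<eta> p t) \<le> norm (x p) * exp (- (- \<gamma>) * t)"
      by (auto simp: indicator_def)
  qed
  obtain y where y: "(\<lambda>(p, t). y p t) \<in> borel_measurable (M \<Otimes>\<^sub>M borel)"
    "\<And>p. p \<in> space M \<Longrightarrow> \<exists>C. \<forall>t. norm (y p t) \<le> C * exp (- (- \<gamma>) * t)"
    "\<And>p t. p \<in> space M \<Longrightarrow> y p t = ?\<eta> p t + fw.conv (\<lambda>s. ?\<Delta> p s (y p s)) t"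
  proof (rule fw.fixed_point[where \<Delta> = ?\<Delta> and \<eta> = ?\<eta> and M = M, OF 1 2 lip _ bd _ L_qf])
    show "0 \<le> L" using L by simp
    show "?\<Delta> p s 0 = 0" for p s by simp
    show "1 / 2 < (1::real)" by simp
  qed (rule that)
  show thesis
  proof (rule that[OF y(1)])
    fix p assume p: "p \<in> space M"
    have am: "a p \<in> borel_measurable borel" using measurable_compose[OF measurable_Pair1'[OF p] a] by simp
    have ym: "y p \<in> borel_measurable borel" using measurable_compose[OF measurable_Pair1'[OF p] y(1)] by simp
    have dm: "(\<lambda>s. ?\<Delta> p s (y p s)) \<in> borel_measurable borel"
      using g_measurable1[OF am ym] by measurable
    obtain C where C: "\<And>t. norm (y p t) \<le> C * exp (- (- \<gamma>) * t)" using y(2)[OF p] by blast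
    have C0: "0 \<le> C" using order_trans[OF norm_ge_zero C[of 0]] by simp
    have db: "norm (?\<Delta> p s (y p s)) \<le> L * C * exp (- (- \<gamma>) * s)" for s
      using order_trans[OF norm_g[of "a p" s "y p s"] mult_left_mono[OF C, of L]] L C0
      by (auto simp: indicator_def mult.assoc)
    have "continuous_on {0..} (\<lambda>t. S t (x p) + fw.conv (\<lambda>s. ?\<Delta> p s (y p s)) t)"
      by (intro continuous_intros continuous_S continuous_at_imp_continuous_on ballI fw.conv_continuous[OF dm db])
    then have "continuous_on {0..} (y p)"
      by (rule continuous_on_eq, subst y(3)[OF p]) simp
    then show "forward_sol (a p) (x p) (y p)"
      using y(3)[OF p] unfolding forward_sol_def by (metis (no_types, lifting) atLeast_iff indicator_simps(1) scaleR_one)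
  qed
qed

end

lemma interval_integral_eq_zero:
  assumes "a \<le> b" "\<And>s. s \<in> einterval a b \<Longrightarrow> \<phi> s = (0::real)"
  shows "(LBINT s=a..b. \<phi> s) = 0"
proof -
  have "(LBINT s=a..b. \<phi> s) = (LBINT s=a..b. 0)"
    using assms by (intro interval_integral_cong) (auto simp: min_absorb1 max_absorb2)
  then show ?thesis by simp
qed

context inertial begin

lemma backward_sol_cutoff:
  assumes y: "backward_sol \<tau> a y" and a: "a \<in> borel_measurable borel"
  shows "(\<lambda>s. indicator {..<\<tau>} s *\<^sub>R g a s (y s)) \<in> borel_measurable borel"
    and "\<exists>C. \<forall>s. norm (indicator {..<\<tau>} s *\<^sub>R g a s (y s)) \<le> C * exp (- \<beta> * s)"
proof -
  show "(\<lambda>s. indicator {..<\<tau>} s *\<^sub>R g a s (y s)) \<in> borel_measurable borel"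
    unfolding g_indicator using y by (intro g_measurable1 a) (auto simp: backward_sol_def)
  obtain C where C: "\<And>s. s \<le> \<tau> \<Longrightarrow> norm (y s) \<le> C * exp (- \<beta> * s)"
    using y unfolding backward_sol_def by blast
  have C0: "0 \<le> C"
    using order_trans[OF norm_ge_zero C[OF order_refl]] by (simp add: zero_le_mult_iff)
  have "norm (indicator {..<\<tau>} s *\<^sub>R g a s (y s)) \<le> L * C * exp (- \<beta> * s)" for s
    using order_trans[OF norm_g mult_left_mono[OF C, of s L]] L C0
    by (cases "s < \<tau>") (auto simp: mult.assoc)
  then show "\<exists>C. \<forall>s. norm (indicator {..<\<tau>} s *\<^sub>R g a s (y s)) \<le> C * exp (- \<beta> * s)" by blast
qed

text \<open>The difference solves a backward equation with forcing bounded by \<open>L\<close> times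
  itself. One use of \<open>gronwall\<close> yields both uniqueness for given low modes at 0 and the
  Lipschitz dependence that becomes the Lipschitz property of the graph.\<close>

lemma backward_sol_lipschitz:
  assumes y: "backward_sol 0 a y" and y': "backward_sol 0 a y'" and a: "a \<in> borel_measurable borel" and t: "t \<le> 0"
  shows "norm (y t - y' t) \<le> norm (P (y 0 - y' 0)) / (1 - \<mu>) * exp (- \<beta> * t)"
proof -
  let ?w = "\<lambda>s. indicator {..0} s *\<^sub>R (y s - y' s)"
  let ?h1 = "\<lambda>s. indicator {..<0} s *\<^sub>R g a s (y s)"
  let ?h2 = "\<lambda>s. indicator {..<0} s *\<^sub>R g a s (y' s)"
  let ?h = "\<lambda>s. ?h1 s - ?h2 s"
  obtain C where C: "\<And>s. s \<le> 0 \<Longrightarrow> norm (y s) \<le> C * exp (- \<beta> * s)"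
    using y unfolding backward_sol_def by blast
  obtain C' where C': "\<And>s. s \<le> 0 \<Longrightarrow> norm (y' s) \<le> C' * exp (- \<beta> * s)"
    using y' unfolding backward_sol_def by blast
  have C0: "0 \<le> C" "0 \<le> C'"
    using order_trans[OF norm_ge_zero C[OF order_refl]] order_trans[OF norm_ge_zero C'[OF order_refl]] by auto
  obtain B where B: "\<And>s. norm (?h1 s) \<le> B * exp (- \<beta> * s)" using backward_sol_cutoff(2)[OF y a] by blast
  obtain B' where B': "\<And>s. norm (?h2 s) \<le> B' * exp (- \<beta> * s)" using backward_sol_cutoff(2)[OF y' a] by blast
  have "norm (?w t) \<le> norm (P (y 0 - y' 0)) / (1 - \<mu>) * exp (- \<beta> * t)"
  proof (rule lp.gronwall[where h = ?h and C = "C + C'" and L = L])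
    show "?h \<in> borel_measurable borel"
      by (intro borel_measurable_diff backward_sol_cutoff(1)[OF _ a]) (rule y y')+
    show "norm (?w s) \<le> (C + C') * exp (- \<beta> * s)" for s
    proof (cases "s \<le> 0")
      case True
      then show ?thesis
        using norm_triangle_ineq4[of "y s" "y' s"] C[of s] C'[of s] by (auto simp: distrib_right)
    qed (use C0 in auto)
    show "norm (?h s) \<le> L * norm (?w s)" for s
      using g_lipschitz[of a s "y s" "y' s"] L by (auto simp: indicator_def)
    show "norm (?w s) \<le> norm (P (y 0 - y' 0)) * exp (- \<beta> * s) + norm (lp.conv ?h s)" for s
    proof (cases "s \<le> 0")
      case True
      have "y s - y' s = (eP s (y 0) + lp.conv ?h1 s) - (eP s (y' 0) + lp.conv ?h2 s)"
        using bsolD[OF y True] bsolD[OF y' True] by (intro arg_cong2[where f = minus]) simp_all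
      also have "\<dots> = eP s (y 0 - y' 0) + (lp.conv ?h1 s - lp.conv ?h2 s)"
        by (simp add: linear_diff[OF linear_eP])
      also have "lp.conv ?h1 s - lp.conv ?h2 s = lp.conv ?h s"
        by (rule lp.conv_diff[OF backward_sol_cutoff(1)[OF y a] B backward_sol_cutoff(1)[OF y' a] B'])
      finally have "norm (y s - y' s) \<le> norm (eP s (y 0 - y' 0)) + norm (lp.conv ?h s)"
        by (simp only: norm_triangle_ineq)
      then show ?thesis
        using norm_eP[OF True, of "y 0 - y' 0"] True by (simp add: mult.commute)
    qed simp
  qed (use L L_q \<mu> in auto)
  then show ?thesis using t by simp
qed

text \<open>The low modes of the convolution at \<tau> are integrals over times after \<tau>, where
  \<open>h\<close> vanishes. This is why the low modes of a backward orbit at its end time can be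
  prescribed freely.\<close>

lemma P_conv_cutoff:
  assumes h: "h \<in> borel_measurable borel" "\<And>s. norm (h s) \<le> C * exp (- \<beta> * s)" and h0: "\<And>s. \<tau> \<le> s \<Longrightarrow> h s = 0"
  shows "P (lp.conv h \<tau>) = 0"
proof (rule orth_zero)
  fix j
  have "lp.conv h \<tau> \<bullet> b j = 0" if "j < N"
  proof -
    have "(LBINT s=ereal \<tau>..\<infinity>. modal h j s) = 0"
      by (rule interval_integral_eq_zero) (auto simp: modal_def h0)
    then show ?thesis using lp_coeff(2)[OF h that, of \<tau>] by simp
  qed
  then show "P (lp.conv h \<tau>) \<bullet> b j = 0" by (simp add: P_inner)
qed

lemma backward_sol_exists:
  fixes M :: "'p measure"
  assumes a: "(\<lambda>(p, s). a p s) \<in> borel_measurable (M \<Otimes>\<^sub>M borel)" and x: "x \<in> borel_measurable M"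
  obtains y where "(\<lambda>(p, t). y p t) \<in> borel_measurable (M \<Otimes>\<^sub>M borel)"
    and "\<And>p. p \<in> space M \<Longrightarrow> backward_sol 0 (a p) (y p)" and "\<And>p. p \<in> space M \<Longrightarrow> P (y p 0) = P (x p)"
proof -
  let ?\<Delta> = "\<lambda>p s v. indicator {..<0} s *\<^sub>R g (a p) s v"
  \<comment> \<open>Cut off at 0, because for positive times the low modes decay more slowly than
    \<open>exp (- \<beta> * t)\<close>, and the fixed point lives on the whole line.\<close>
  let ?\<eta> = "\<lambda>p t. indicator {..0} t *\<^sub>R eP t (x p)"
  have 1: "(\<lambda>(p, s, v). ?\<Delta> p s v) \<in> borel_measurable (M \<Otimes>\<^sub>M borel \<Otimes>\<^sub>M borel)"
    unfolding split_beta'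
  proof (intro borel_measurable_scaleR g_measurable)
    show "(\<lambda>x. a (fst x) (fst (snd x))) \<in> borel_measurable (M \<Otimes>\<^sub>M borel \<Otimes>\<^sub>M borel)"
      by (rule measurable_curry_borel[OF a]) auto
  qed auto
  have 2: "(\<lambda>(p, t). ?\<eta> p t) \<in> borel_measurable (M \<Otimes>\<^sub>M borel)"
    unfolding split_beta'
    by (intro borel_measurable_scaleR measurable_semigroups measurable_compose[OF measurable_fst x]) auto
  have lip: "norm (?\<Delta> p s v - ?\<Delta> p s v') \<le> L * norm (v - v')" for p s v v'
    using g_lipschitz[of "a p" s v v'] L by (auto simp: indicator_def)
  have bd: "\<exists>C. \<forall>t. norm (?\<eta> p t) \<le> C * exp (- \<beta> * t)" for p
  proof (intro exI allI)
    show "norm (?\<eta> p t) \<le> norm (P (x p)) * exp (- \<beta> * t)" for t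
      using norm_eP[of t "x p"] by (auto simp: indicator_def mult.commute)
  qed
  obtain y where y: "(\<lambda>(p, t). y p t) \<in> borel_measurable (M \<Otimes>\<^sub>M borel)"
    "\<And>p. p \<in> space M \<Longrightarrow> \<exists>C. \<forall>t. norm (y p t) \<le> C * exp (- \<beta> * t)"
    "\<And>p t. p \<in> space M \<Longrightarrow> y p t = ?\<eta> p t + lp.conv (\<lambda>s. ?\<Delta> p s (y p s)) t"
  proof (rule lp.fixed_point[where \<Delta> = ?\<Delta> and \<eta> = ?\<eta> and M = M, OF 1 2 lip _ bd _ L_q])
    show "0 \<le> L" using L by simp
    show "?\<Delta> p s 0 = 0" for p s by simp
    show "\<mu> < 1" by (rule \<mu>)
  qed (rule that)
  have *: "backward_sol 0 (a p) (y p) \<and> P (y p 0) = P (x p)" if p: "p \<in> space M" for p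
  proof -
    have am: "a p \<in> borel_measurable borel" using measurable_compose[OF measurable_Pair1'[OF p] a] by simp
    have ym: "y p \<in> borel_measurable borel" using measurable_compose[OF measurable_Pair1'[OF p] y(1)] by simp
    have dm: "(\<lambda>s. ?\<Delta> p s (y p s)) \<in> borel_measurable borel"
      using g_measurable1[OF am ym] by measurable
    obtain C where C: "\<And>t. norm (y p t) \<le> C * exp (- \<beta> * t)" using y(2)[OF p] by blast
    have C0: "0 \<le> C" using order_trans[OF norm_ge_zero C[of 0]] by simp
    have db: "norm (?\<Delta> p s (y p s)) \<le> L * C * exp (- \<beta> * s)" for s
      using order_trans[OF norm_g[of "a p" s "y p s"] mult_left_mono[OF C, of L]] L C0
      by (auto simp: indicator_def mult.assoc)
    have "P (lp.conv (\<lambda>s. ?\<Delta> p s (y p s)) 0) = 0"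
      by (rule P_conv_cutoff[OF dm db]) simp
    moreover have "P (y p 0) = P (eP 0 (x p) + lp.conv (\<lambda>s. ?\<Delta> p s (y p s)) 0)"
      by (subst y(3)[OF p]) simp
    ultimately have P0: "P (y p 0) = P (x p)"
      by (simp add: linear_add[OF bounded_linear.linear[OF bounded_linear_P]] eP_0)
    have "y p t = eP (t - 0) (y p 0) + lp.conv (\<lambda>s. ?\<Delta> p s (y p s)) t" if "t \<le> 0" for t
    proof -
      have "eP t (y p 0) = eP t (x p)" using P0 by (metis eP_P)
      then show ?thesis using that by (subst y(3)[OF p]) simp
    qed
    then show ?thesis using P0 ym C unfolding backward_sol_def by (intro conjI) (measurable, blast+)
  qed
  show thesis by (rule that[OF y(1)]) (use * in blast)+
qed

lemma backward_sol_continuous: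
  assumes y: "backward_sol \<tau> a y" and a: "a \<in> borel_measurable borel"
  shows "continuous_on {..\<tau>} y"
proof -
  obtain C where C: "\<And>s. norm (indicator {..<\<tau>} s *\<^sub>R g a s (y s)) \<le> C * exp (- \<beta> * s)"
    using backward_sol_cutoff(2)[OF y a] by blast
  have "continuous_on {..\<tau>} (\<lambda>t. eP (t - \<tau>) (y \<tau>) + lp.conv (\<lambda>s. indicator {..<\<tau>} s *\<^sub>R g a s (y s)) t)"
    by (intro continuous_on_add continuous_on_compose2[OF continuous_eP] continuous_intros
        continuous_at_imp_continuous_on ballI lp.conv_continuous[OF backward_sol_cutoff(1)[OF y a] C]) auto
  then show ?thesis by (rule continuous_on_eq) (simp add: bsolD[OF y, symmetric])
qed

text \<open>Translation makes \<tau> the new time 0, and the factor \<open>exp d\<close> compensates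
  a constant subtracted from \<open>a\<close>. Passing from a path to its shift changes the log
  weight in exactly this way, with \<open>d = ou_int \<omega> 0 \<tau>\<close>.\<close>

lemma backward_sol_shift:
  assumes y: "backward_sol \<tau> a y"
  shows "backward_sol 0 (\<lambda>s. a (s + \<tau>) - d) (\<lambda>s. exp d *\<^sub>R y (s + \<tau>))"
  unfolding backward_sol_def
proof (intro conjI allI impI)
  have "(\<lambda>s. indicator {..<\<tau>} s *\<^sub>R y s) \<in> borel_measurable borel" using y unfolding backward_sol_def by blast
  then have "(\<lambda>s. indicator {..<\<tau>} (s + \<tau>) *\<^sub>R y (s + \<tau>)) \<in> borel_measurable borel"
    by (rule measurable_compose[rotated]) simp
  then have "(\<lambda>s. exp d *\<^sub>R (indicator {..<\<tau>} (s + \<tau>) *\<^sub>R y (s + \<tau>))) \<in> borel_measurable borel"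
    by (rule borel_measurable_scaleR[OF borel_measurable_const])
  also have "(\<lambda>s. exp d *\<^sub>R (indicator {..<\<tau>} (s + \<tau>) *\<^sub>R y (s + \<tau>))) = (\<lambda>s. indicator {..<0} s *\<^sub>R exp d *\<^sub>R y (s + \<tau>))"
    by (rule ext, rename_tac s, case_tac "s < 0") simp_all
  finally show "(\<lambda>s. indicator {..<0} s *\<^sub>R exp d *\<^sub>R y (s + \<tau>)) \<in> borel_measurable borel" .
  obtain C where C: "\<And>s. s \<le> \<tau> \<Longrightarrow> norm (y s) \<le> C * exp (- \<beta> * s)"
    using y unfolding backward_sol_def by blast
  have "norm (exp d *\<^sub>R y (s + \<tau>)) \<le> (exp d * C * exp (- \<beta> * \<tau>)) * exp (- \<beta> * s)" if "s \<le> 0" for s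
  proof -
    have "exp (- \<beta> * (s + \<tau>)) = exp (- \<beta> * \<tau>) * exp (- \<beta> * s)"
      by (simp add: exp_add[symmetric] distrib_left)
    then show ?thesis using mult_left_mono[OF C[of "s + \<tau>"], of "exp d"] that by (simp add: mult.assoc)
  qed
  then show "\<exists>C. \<forall>s\<le>0. norm (exp d *\<^sub>R y (s + \<tau>)) \<le> C * exp (- \<beta> * s)" by blast
  fix t :: real assume t: "t \<le> 0"
  let ?h = "\<lambda>s. indicator {..<\<tau>} s *\<^sub>R g a s (y s)"
  have "lp.conv ?h (t + \<tau>) = lp.conv (\<lambda>s. ?h (s + \<tau>)) t"
    unfolding lp.conv_def by (subst lborel_integral_real_affine[of 1 _ \<tau>]) (simp_all add: algebra_simps)
  then have "exp d *\<^sub>R y (t + \<tau>) = exp d *\<^sub>R (eP t (y \<tau>) + lp.conv (\<lambda>s. ?h (s + \<tau>)) t)"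
    using bsolD[OF y, of "t + \<tau>"] t by simp
  also have "\<dots> = exp d *\<^sub>R eP t (y \<tau>) + exp d *\<^sub>R lp.conv (\<lambda>s. ?h (s + \<tau>)) t"
    by (rule scaleR_add_right)
  also have "exp d *\<^sub>R eP t (y \<tau>) = eP (t - 0) (exp d *\<^sub>R y (0 + \<tau>))"
    by (simp add: linear_scale[OF linear_eP])
  also have "exp d *\<^sub>R lp.conv (\<lambda>s. ?h (s + \<tau>)) t = lp.conv (\<lambda>s. exp d *\<^sub>R ?h (s + \<tau>)) t"
    by (rule lp.conv_scaleR[symmetric])
  also have "(\<lambda>s. exp d *\<^sub>R ?h (s + \<tau>)) = (\<lambda>s. indicator {..<0} s *\<^sub>R g (\<lambda>s. a (s + \<tau>) - d) s (exp d *\<^sub>R y (s + \<tau>)))"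
  proof
    fix s
    have e: "exp (- (a (s + \<tau>) - d)) = exp d * exp (- a (s + \<tau>))" "exp (a (s + \<tau>) - d) * exp d = exp (a (s + \<tau>))"
      by (simp_all add: exp_add[symmetric])
    show "exp d *\<^sub>R ?h (s + \<tau>) = indicator {..<0} s *\<^sub>R g (\<lambda>s. a (s + \<tau>) - d) s (exp d *\<^sub>R y (s + \<tau>))"
      unfolding g_def scaleR_scaleR e by (cases "s < 0") simp_all
  qed
  finally show "exp d *\<^sub>R y (t + \<tau>) = eP (t - 0) (exp d *\<^sub>R y (0 + \<tau>)) +
      lp.conv (\<lambda>s. indicator {..<0} s *\<^sub>R g (\<lambda>s. a (s + \<tau>) - d) s (exp d *\<^sub>R y (s + \<tau>))) t" .
qed

text \<open>The tracking function \<open>w\<close> jumps by \<open>- x\<close> at \<open>0\<close>; the jump is encoded in the inhomogeneity.\<close>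

lemma tracking:
  assumes a: "a \<in> borel_measurable borel" and y: "forward_sol a x y"
    and w: "w \<in> borel_measurable borel" "\<And>t. norm (w t) \<le> C * exp (- \<beta> * t)"
    and w_eq: "\<And>t. w t = (if t < 0 then eP t x else - eQ t x) +
       lp.conv (\<lambda>s. g a s (indicator {0..} s *\<^sub>R y s + w s) - g a s (indicator {0..} s *\<^sub>R y s)) t"
    and \<tau>: "0 \<le> \<tau>"
  shows "backward_sol \<tau> a (\<lambda>s. indicator {0..} s *\<^sub>R y s + w s)"
proof -
  define Y where "Y s = indicator {0..} s *\<^sub>R y s" for s
  define v where "v s = Y s + w s" for s
  define \<Delta> where "\<Delta> s = g a s (v s) - g a s (Y s)" for s
  define hy where "hy s = indicator {0..<\<tau>} s *\<^sub>R g a s (y s)" for s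
  define h where "h s = indicator {..<\<tau>} s *\<^sub>R g a s (v s)" for s
  have w_eq': "w t = (if t < 0 then eP t x else - eQ t x) + lp.conv \<Delta> t" for t
    unfolding \<Delta>_def v_def Y_def by (rule w_eq)
  have Ym: "Y \<in> borel_measurable borel"
    using forward_sol_measurable[OF y, of "{0..}"] by (simp add: Y_def[abs_def])
  have vm: "v \<in> borel_measurable borel"
    unfolding v_def[abs_def] by (intro borel_measurable_add Ym w)
  have \<Delta>m: "\<Delta> \<in> borel_measurable borel"
    unfolding \<Delta>_def[abs_def] by (intro borel_measurable_diff g_measurable1 a vm Ym)
  have \<Delta>b: "norm (\<Delta> s) \<le> L * C * exp (- \<beta> * s)" for s
  proof -
    have "norm (\<Delta> s) \<le> L * norm (w s)"
      using g_lipschitz[of a s "v s" "Y s"] by (simp add: \<Delta>_def v_def)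
    also have "\<dots> \<le> L * (C * exp (- \<beta> * s))" using L by (intro mult_left_mono w) simp
    finally show ?thesis by (simp add: mult.assoc)
  qed
  have hym: "hy \<in> borel_measurable borel"
    unfolding hy_def[abs_def] by (rule forward_sol_cutoff(1)[OF y a])
  obtain B where hyb: "\<And>s. norm (hy s) \<le> B * exp (\<gamma> * s)"
    unfolding hy_def[abs_def] using forward_sol_cutoff(2)[OF y a] by blast
  obtain K where K: "0 \<le> K" "\<And>s. 0 \<le> s \<Longrightarrow> s \<le> \<tau> \<Longrightarrow> norm (y s) \<le> K" using forward_sol_bounded[OF y] by blast
  have C0: "0 \<le> C" using order_trans[OF norm_ge_zero w(2)[of 0]] by simp
  have vb: "norm (v s) \<le> (K * exp (\<beta> * \<tau>) + C) * exp (- \<beta> * s)" if s: "s \<le> \<tau>" for s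
  proof -
    have "norm (Y s) \<le> K * exp (\<beta> * \<tau>) * exp (- \<beta> * s)"
    proof (cases "0 \<le> s")
      case True
      have "0 \<le> \<beta> * (\<tau> - s)" using \<beta>_pos s by simp
      then have "1 \<le> exp (\<beta> * \<tau>) * exp (- \<beta> * s)"
        by (simp add: exp_add[symmetric] algebra_simps)
      then show ?thesis
        using mult_left_mono[of 1 "exp (\<beta> * \<tau>) * exp (- \<beta> * s)" K] K(1) K(2)[OF True s] True
        by (simp add: Y_def mult.assoc)
    qed (use K(1) in \<open>simp add: Y_def\<close>)
    then show ?thesis
      using w(2)[of s] norm_triangle_ineq[of "Y s" "w s"] unfolding v_def distrib_right by linarith
  qed
  have hm: "h \<in> borel_measurable borel"
    unfolding h_def[abs_def] g_indicator by (intro g_measurable1 a) (use vm in measurable)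
  have hb: "norm (h s) \<le> L * (K * exp (\<beta> * \<tau>) + C) * exp (- \<beta> * s)" for s
  proof (cases "s < \<tau>")
    case True
    then show ?thesis
      using order_trans[OF norm_g[of a s "v s"] mult_left_mono[OF vb[of s], of L]] L
      by (simp add: h_def mult.assoc)
  qed (use L K(1) C0 in \<open>simp add: h_def\<close>)
  \<comment> \<open>For negative times \<open>Y\<close> and \<open>hy\<close> vanish, so \<Delta>
    alone is the full forcing; for times in \<open>{0..<\<tau>}\<close> the term
    \<open>g a s (Y s)\<close> subtracted in \<Delta> is given back by \<open>hy\<close>.\<close>
  have h_eq: "modal h j s = modal hy j s + modal \<Delta> j s" if "s < \<tau>" for j s
    using that by (auto simp: modal_def h_def hy_def \<Delta>_def Y_def indicator_def inner_diff_left algebra_simps)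
  \<comment> \<open>The jump disappears here. In a low mode \<open>x \<bullet> b j\<close> enters
    through \<open>w\<close> for negative times and through \<open>Y\<close> afterwards, hence at
    all times; in a high mode the contributions of \<open>Y\<close> and of \<open>- eQ\<close>
    cancel.\<close>
  have coeff: "exp (l j * t) * (v t \<bullet> b j) = (LBINT s=-\<infinity>..ereal t. modal hy j s) +
      (if j < N then (x \<bullet> b j) - (LBINT s=ereal t..\<infinity>. modal \<Delta> j s) else (LBINT s=-\<infinity>..ereal t. modal \<Delta> j s))"
    if t: "t \<le> \<tau>" for t j
  proof -
    have e: "exp (l j * t) * (exp (- l j * t) * r) = r" for r
      by (simp add: mult.assoc[symmetric] exp_add[symmetric])
    have 1: "exp (l j * t) * (Y t \<bullet> b j) = (if 0 \<le> t then x \<bullet> b j else 0) + (LBINT s=-\<infinity>..ereal t. modal hy j s)"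
    proof (cases "0 \<le> t")
      case True
      have "y t = S t x + fw.conv hy t"
        unfolding hy_def[abs_def] fw_conv_cutoff[OF t, symmetric] by (rule fsolD[OF y True])
      then have "exp (l j * t) * (y t \<bullet> b j) = exp (l j * t) * (exp (- l j * t) * (x \<bullet> b j)) + exp (l j * t) * (fw.conv hy t \<bullet> b j)"
        by (simp only: inner_add_left S_inner[OF True] distrib_left)
      then show ?thesis
        unfolding e fw_coeff(2)[OF hym hyb] using True by (simp add: Y_def)
    next
      case False
      have "(LBINT s=-\<infinity>..ereal t. modal hy j s) = 0"
        by (rule interval_integral_eq_zero) (use False in \<open>auto simp: modal_def hy_def\<close>)
      then show ?thesis using False by (simp add: Y_def)
    qed
    have "exp (l j * t) * (w t \<bullet> b j) = (if t < 0 then (if j < N then x \<bullet> b j else 0) else (if j < N then 0 else - (x \<bullet> b j)))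
        + exp (l j * t) * (lp.conv \<Delta> t \<bullet> b j)"
      unfolding w_eq'[of t] inner_add_left distrib_left
      using e[of "x \<bullet> b j"] by (auto simp: eP_inner eQ_inner)
    then show ?thesis
      using 1 lp_coeff(2)[OF \<Delta>m \<Delta>b, of j t] lp_coeff(4)[OF \<Delta>m \<Delta>b, of j t]
      by (auto simp: v_def inner_add_left distrib_left)
  qed
  have "backward_sol \<tau> a v"
    unfolding backward_sol_def h_def[symmetric]
  proof (intro conjI allI impI)
    show "(\<lambda>s. indicator {..<\<tau>} s *\<^sub>R v s) \<in> borel_measurable borel" using vm by measurable
    show "\<exists>C. \<forall>s\<le>\<tau>. norm (v s) \<le> C * exp (- \<beta> * s)" using vb by blast
    fix t assume t: "t \<le> \<tau>"
    show "v t = eP (t - \<tau>) (v \<tau>) + lp.conv h t"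
    proof (rule coeff_eqI)
      fix j
      let ?U = "\<lambda>t. exp (l j * t) * (v t \<bullet> b j)"
      have iy: "interval_lebesgue_integrable lborel (-\<infinity>) (ereal \<tau>) (modal hy j)"
        by (rule fw_coeff(1)[OF hym hyb])
      have eq: "exp (l j * t) * (v t \<bullet> b j) = exp (l j * t) * ((eP (t - \<tau>) (v \<tau>) + lp.conv h t) \<bullet> b j)"
      \<comment> \<open>Low modes are integrated backward from \<tau>: the value at \<open>t\<close>
        is compared with that at \<tau>, and the integrals of \<Delta> beyond \<tau> cancel. High
        modes integrate from minus infinity up to \<open>t\<close>.\<close>
      proof (cases "j < N")
        case True
        have i\<Delta>: "interval_lebesgue_integrable lborel (ereal t) \<infinity> (modal \<Delta> j)"
          by (rule lp_coeff(1)[OF \<Delta>m \<Delta>b True])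
        have ih: "interval_lebesgue_integrable lborel (ereal t) \<infinity> (modal h j)"
          by (rule lp_coeff(1)[OF hm hb True])
        have i1: "interval_lebesgue_integrable lborel (ereal t) (ereal \<tau>) (modal hy j)"
          using iy t unfolding interval_lebesgue_integrable_def by (auto intro: set_integrable_subset)
        have i2: "interval_lebesgue_integrable lborel (ereal t) (ereal \<tau>) (modal \<Delta> j)"
          using i\<Delta> t unfolding interval_lebesgue_integrable_def by (auto intro: set_integrable_subset)
        have s1: "(LBINT s=-\<infinity>..ereal t. modal hy j s) + (LBINT s=ereal t..ereal \<tau>. modal hy j s) = (LBINT s=-\<infinity>..ereal \<tau>. modal hy j s)"
          by (rule interval_integral_sum) (use iy t in \<open>simp add: min_def max_def\<close>)
        have s2: "(LBINT s=ereal t..ereal \<tau>. modal \<Delta> j s) + (LBINT s=ereal \<tau>..\<infinity>. modal \<Delta> j s) = (LBINT s=ereal t..\<infinity>. modal \<Delta> j s)"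
          by (rule interval_integral_sum) (use i\<Delta> t in \<open>simp add: min_def max_def\<close>)
        have s3: "(LBINT s=ereal t..ereal \<tau>. modal h j s) + (LBINT s=ereal \<tau>..\<infinity>. modal h j s) = (LBINT s=ereal t..\<infinity>. modal h j s)"
          by (rule interval_integral_sum) (use ih t in \<open>simp add: min_def max_def\<close>)
        have s4: "(LBINT s=ereal \<tau>..\<infinity>. modal h j s) = 0"
          by (rule interval_integral_eq_zero) (auto simp: modal_def h_def)
        have "(LBINT s=ereal t..ereal \<tau>. modal h j s) = (LBINT s=ereal t..ereal \<tau>. modal hy j s + modal \<Delta> j s)"
          by (rule interval_integral_cong) (use t h_eq in \<open>auto simp: min_def max_def\<close>)
        then have s5: "(LBINT s=ereal t..ereal \<tau>. modal h j s) = (LBINT s=ereal t..ereal \<tau>. modal hy j s) + (LBINT s=ereal t..ereal \<tau>. modal \<Delta> j s)"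
          using interval_lebesgue_integral_add(2)[OF i1 i2] by simp
        have "exp (l j * t) * (eP (t - \<tau>) (v \<tau>) \<bullet> b j) = ?U \<tau>"
        proof -
          have "exp (l j * t) * exp (- l j * (t - \<tau>)) = exp (l j * \<tau>)"
            unfolding exp_add[symmetric] by (simp add: algebra_simps)
          then show ?thesis using True by (simp add: eP_inner mult.assoc[symmetric])
        qed
        then have "exp (l j * t) * ((eP (t - \<tau>) (v \<tau>) + lp.conv h t) \<bullet> b j) = ?U \<tau> - (LBINT s=ereal t..\<infinity>. modal h j s)"
          using lp_coeff(2)[OF hm hb True, of t] unfolding inner_add_left distrib_left by linarith
        also have "\<dots> = ?U t"
          using s1 s2 s3 s4 s5 coeff[OF t, of j] coeff[OF order_refl, of j] True by simp
        finally show ?thesis ..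
      next
        case False
        then have j: "N \<le> j" by simp
        have i1: "interval_lebesgue_integrable lborel (-\<infinity>) (ereal t) (modal hy j)"
          using iy t unfolding interval_lebesgue_integrable_def by (auto intro: set_integrable_subset)
        have i2: "interval_lebesgue_integrable lborel (-\<infinity>) (ereal t) (modal \<Delta> j)"
          by (rule lp_coeff(3)[OF \<Delta>m \<Delta>b j])
        have "(LBINT s=-\<infinity>..ereal t. modal h j s) = (LBINT s=-\<infinity>..ereal t. modal hy j s + modal \<Delta> j s)"
          by (rule interval_integral_cong) (use t h_eq in \<open>auto simp: min_def max_def\<close>)
        then have "(LBINT s=-\<infinity>..ereal t. modal h j s) = ?U t"
          using interval_lebesgue_integral_add(2)[OF i1 i2] coeff[OF t, of j] False by simp
        then show ?thesis
          using lp_coeff(4)[OF hm hb j, of t] False by (simp add: inner_add_left distrib_left eP_inner)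
      qed
      then show "v t \<bullet> b j = (eP (t - \<tau>) (v \<tau>) + lp.conv h t) \<bullet> b j" by simp
    qed
  qed
  then show ?thesis by (simp add: v_def[abs_def] Y_def)
qed

text \<open>The inhomogeneity, \<open>eP t x\<close> before 0 and \<open>- eQ t x\<close> from 0 on,
  is bounded by \<open>norm x * exp (- \<beta> * t)\<close> on both sides of 0, since \<beta>
  separates the spectrum; the fixed point \<open>w\<close> inherits this rate. One tracking orbit
  \<open>v\<close> serves every end time \<tau>, and from 0 on \<open>y - v\<close> is
  \<open>- w\<close>.\<close>

lemma attraction:
  assumes a: "a \<in> borel_measurable borel" and y: "forward_sol a x y"
  obtains v where "\<And>\<tau>. 0 \<le> \<tau> \<Longrightarrow> backward_sol \<tau> a v"
    "\<And>\<tau>. 0 \<le> \<tau> \<Longrightarrow> norm (y \<tau> - v \<tau>) \<le> norm x / (1 - \<mu>) * exp (- \<beta> * \<tau>)"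
proof -
  let ?Y = "\<lambda>s. indicator {0..} s *\<^sub>R y s"
  let ?\<Delta> = "\<lambda>s v. g a s (?Y s + v) - g a s (?Y s)"
  let ?\<eta> = "\<lambda>t. if t < 0 then eP t x else - eQ t x"
  have Ym: "?Y \<in> borel_measurable borel" by (rule forward_sol_measurable[OF y]) auto
  have a': "(\<lambda>x::real \<times> 'h. a (fst x)) \<in> borel_measurable (borel \<Otimes>\<^sub>M borel)"
    by (rule measurable_compose[OF measurable_fst a])
  have Ym': "(\<lambda>x::real \<times> 'h. ?Y (fst x)) \<in> borel_measurable (borel \<Otimes>\<^sub>M borel)"
    by (rule measurable_compose[OF measurable_fst Ym])
  have 1: "(\<lambda>(s, v). ?\<Delta> s v) \<in> borel_measurable (borel \<Otimes>\<^sub>M borel)"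
    unfolding split_beta'
    using g_measurable[of "\<lambda>_. a" "\<lambda>_. ()" fst "borel \<Otimes>\<^sub>M borel" "\<lambda>x. ?Y (fst x) + snd x", OF a']
      g_measurable[of "\<lambda>_. a" "\<lambda>_. ()" fst "borel \<Otimes>\<^sub>M borel" "\<lambda>x. ?Y (fst x)", OF a' Ym'] Ym'
    by (intro borel_measurable_diff) auto
  have 2: "?\<eta> \<in> borel_measurable borel"
    by (intro measurable_If borel_measurable_uminus measurable_semigroups) auto
  have lip: "norm (?\<Delta> s v - ?\<Delta> s v') \<le> L * norm (v - v')" for s v v'
    using g_lipschitz[of a s "?Y s + v" "?Y s + v'"] by simp
  have bd: "norm (?\<eta> t) \<le> norm x * exp (- \<beta> * t)" for t
  proof (cases "t < 0")
    case True
    have "norm (eP t x) \<le> exp (- \<beta> * t) * norm (P x)" using True by (intro norm_eP) auto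
    also have "\<dots> \<le> exp (- \<beta> * t) * norm x" by (intro mult_left_mono norm_P) simp
    finally show ?thesis using True by (simp add: mult.commute)
  next
    case False
    then show ?thesis using norm_eQ[of t x] by (simp add: mult.commute)
  qed
  obtain w where w: "w \<in> borel_measurable borel" "\<And>t. norm (w t) \<le> norm x / (1 - \<mu>) * exp (- \<beta> * t)"
    "\<And>t. w t = ?\<eta> t + lp.conv (\<lambda>s. ?\<Delta> s (w s)) t"
  proof (rule lp.fixed_point_single[where \<Delta> = ?\<Delta> and \<eta> = ?\<eta>, OF 1 2 lip _ bd _ L_q])
    show "0 \<le> L" using L by simp
    show "?\<Delta> s 0 = 0" for s by simp
    show "\<mu> < 1" by (rule \<mu>)
  qed (rule that)
  show thesis
  proof (rule that[of "\<lambda>s. ?Y s + w s"])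
    show "backward_sol \<tau> a (\<lambda>s. ?Y s + w s)" if "0 \<le> \<tau>" for \<tau>
      by (rule tracking[OF a y w(1,2,3) that])
    show "norm (y \<tau> - (?Y \<tau> + w \<tau>)) \<le> norm x / (1 - \<mu>) * exp (- \<beta> * \<tau>)" if "0 \<le> \<tau>" for \<tau>
      using w(2)[of \<tau>] that by simp
  qed
qed

text \<open>The orbit equal to \<open>z\<close> before 0 and to \<open>y\<close> from 0 on is a
  backward orbit: it has the tracking form with \<open>w\<close> the cut-off \<open>z\<close>, and
  it remains to see that this \<open>w\<close> solves the tracking equation with
  \<open>x = z 0\<close>.\<close>

lemma invariance:
  assumes a: "a \<in> borel_measurable borel" and y: "forward_sol a (z 0) y" and z: "backward_sol 0 a z" and \<tau>: "0 \<le> \<tau>"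
  obtains v where "backward_sol \<tau> a v" "v \<tau> = y \<tau>"
proof -
  let ?Y = "\<lambda>s. indicator {0..} s *\<^sub>R y s"
  define w where "w s = indicator {..<0} s *\<^sub>R z s" for s
  define h where "h s = indicator {..<0} s *\<^sub>R g a s (z s)" for s
  obtain C where C: "\<And>s. s \<le> 0 \<Longrightarrow> norm (z s) \<le> C * exp (- \<beta> * s)"
    using z unfolding backward_sol_def by blast
  have C0: "0 \<le> C" using order_trans[OF norm_ge_zero C[of 0]] by simp
  have wm: "w \<in> borel_measurable borel"
    using z by (simp add: w_def[abs_def] backward_sol_def)
  have wb: "norm (w t) \<le> C * exp (- \<beta> * t)" for t
    using C[of t] C0 by (cases "t < 0") (auto simp: w_def)
  have hm: "h \<in> borel_measurable borel" unfolding h_def[abs_def] by (rule backward_sol_cutoff(1)[OF z a])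
  obtain B where hb: "\<And>s. norm (h s) \<le> B * exp (- \<beta> * s)"
    unfolding h_def[abs_def] using backward_sol_cutoff(2)[OF z a] by blast
  have \<Delta>: "(\<lambda>s. g a s (?Y s + w s) - g a s (?Y s)) = h"
    by (auto simp: fun_eq_iff w_def h_def indicator_def)
  have z_eq: "z t = eP t (z 0) + lp.conv h t" if "t \<le> 0" for t
    using bsolD[OF z that] unfolding h_def[abs_def, symmetric] by simp
  have "w t = (if t < 0 then eP t (z 0) else - eQ t (z 0)) + lp.conv (\<lambda>s. g a s (?Y s + w s) - g a s (?Y s)) t" for t
    unfolding \<Delta>
  proof (cases "t < 0")
    case True
    then show "w t = (if t < 0 then eP t (z 0) else - eQ t (z 0)) + lp.conv h t"
      using z_eq[of t] by (simp add: w_def)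
  next
    case False
    then have t: "0 \<le> t" by simp
    \<comment> \<open>The forcing has ended at 0. Low modes integrate over later times and vanish;
      high modes only decay from their value at 0, which the backward equation identifies with that
      of \<open>z 0\<close>.\<close>
    have "lp.conv h t = eQ t (z 0)"
    proof (rule coeff_eqI)
      fix j
      have "exp (l j * t) * (lp.conv h t \<bullet> b j) = exp (l j * t) * (eQ t (z 0) \<bullet> b j)"
      proof (cases "j < N")
        case True
        have "(LBINT s=ereal t..\<infinity>. modal h j s) = 0"
          by (rule interval_integral_eq_zero) (use t in \<open>auto simp: modal_def h_def\<close>)
        then show ?thesis using lp_coeff(2)[OF hm hb True, of t] True t by (simp add: eQ_inner)
      next
        case False
        then have j: "N \<le> j" by simp
        have "(LBINT s=-\<infinity>..ereal 0. modal h j s) + (LBINT s=ereal 0..ereal t. modal h j s) = (LBINT s=-\<infinity>..ereal t. modal h j s)"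
          by (rule interval_integral_sum) (use lp_coeff(3)[OF hm hb j, of t] t in \<open>simp add: min_def max_def\<close>)
        moreover have "(LBINT s=ereal 0..ereal t. modal h j s) = 0"
          by (rule interval_integral_eq_zero) (use t in \<open>auto simp: modal_def h_def\<close>)
        ultimately have "exp (l j * t) * (lp.conv h t \<bullet> b j) = lp.conv h 0 \<bullet> b j"
          using lp_coeff(4)[OF hm hb j, of t] lp_coeff(4)[OF hm hb j, of 0] by simp
        also have "\<dots> = z 0 \<bullet> b j"
          using arg_cong[OF z_eq[OF order_refl], of "\<lambda>v. v \<bullet> b j"] False by (simp add: inner_add_left eP_inner)
        also have "\<dots> = exp (l j * t) * (eQ t (z 0) \<bullet> b j)"
          using False t by (simp add: eQ_inner mult.assoc[symmetric] exp_add[symmetric])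
        finally show ?thesis .
      qed
      then show "lp.conv h t \<bullet> b j = eQ t (z 0) \<bullet> b j" by simp
    qed
    then show "w t = (if t < 0 then eP t (z 0) else - eQ t (z 0)) + lp.conv h t"
      using t by (simp add: w_def)
  qed
  from tracking[OF a y wm wb this \<tau>] show thesis
    by (rule that) (use \<tau> in \<open>simp add: w_def\<close>)
qed

end

section \<open>Differentiability\<close>

lemma (in conv_kernel) conv_add:
  assumes "h \<in> borel_measurable borel" "\<And>s. norm (h s) \<le> C * exp (- bet * s)"
    and "h' \<in> borel_measurable borel" "\<And>s. norm (h' s) \<le> C' * exp (- bet * s)"
  shows "conv h t + conv h' t = conv (\<lambda>s. h s + h' s) t"
  using conv_bound(1)[OF assms(1,2), of t] conv_bound(1)[OF assms(3,4), of t]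
  by (simp add: conv_def linear_add[OF k_linear])

locale inertial_C1 = inertial lam e F \<sigma> L \<mu> \<beta> N
  for lam :: "nat \<Rightarrow> real" and e :: "nat \<Rightarrow> 'h::{real_inner,banach,second_countable_topology}"
    and F :: "'h \<Rightarrow> 'h" and \<sigma> L \<mu> \<beta> :: real and N :: nat +
  fixes fd :: "'h \<Rightarrow> 'h \<Rightarrow> 'h"
  assumes fd_linear: "linear (fd x)"
    and fd_deriv: "0 < \<epsilon> \<Longrightarrow> \<exists>\<delta>>0. \<forall>h. norm h < \<delta> \<longrightarrow> norm (f (x + h) - f x - fd x h) \<le> \<epsilon> * norm h"
    and fd_cont: "0 < \<epsilon> \<Longrightarrow> \<exists>\<delta>>0. \<forall>y. norm (y - x) < \<delta> \<longrightarrow> (\<forall>h. norm (fd y h - fd x h) \<le> \<epsilon> * norm h)"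
begin

text \<open>Difference quotients of \<open>f\<close> are bounded by its Lipschitz constant. Having
  the same \<open>L\<close> makes the linearised equation a contraction with the same \<mu>.\<close>

lemma norm_fd: "norm (fd x h) \<le> L * norm h"
proof (rule field_le_epsilon)
  fix \<epsilon>' :: real assume \<epsilon>': "0 < \<epsilon>'"
  define \<epsilon> where "\<epsilon> = \<epsilon>' / (norm h + 1)"
  have \<epsilon>: "0 < \<epsilon>" using \<epsilon>' by (simp add: \<epsilon>_def add_nonneg_pos)
  obtain \<delta> where \<delta>: "\<delta> > 0" "\<And>h. norm h < \<delta> \<Longrightarrow> norm (f (x + h) - f x - fd x h) \<le> \<epsilon> * norm h"
    using fd_deriv[OF \<epsilon>, of x] by blast
  \<comment> \<open>Small enough that \<open>t *\<^sub>R h\<close> is shorter than \<delta>; the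
    summand 1 covers \<open>h = 0\<close>.\<close>
  define t where "t = \<delta> / (2 * (norm h + 1))"
  have t: "0 < t" using \<delta>(1) by (simp add: t_def add_nonneg_pos)
  have "norm (t *\<^sub>R h) = t * norm h" using t by simp
  also have "\<dots> = (norm h / (norm h + 1)) * (\<delta> / 2)" by (simp add: t_def field_simps)
  also have "\<dots> \<le> 1 * (\<delta> / 2)" using \<delta>(1) by (intro mult_right_mono) (auto simp: divide_le_eq_1 add_nonneg_pos)
  also have "\<dots> < \<delta>" using \<delta>(1) by simp
  finally have "norm (f (x + t *\<^sub>R h) - f x - fd x (t *\<^sub>R h)) \<le> \<epsilon> * norm (t *\<^sub>R h)" by (rule \<delta>(2))
  moreover have "norm (f (x + t *\<^sub>R h) - f x) \<le> L * norm (t *\<^sub>R h)"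
    using f_lipschitz[of "x + t *\<^sub>R h" x] by simp
  moreover have "norm (fd x (t *\<^sub>R h)) = t * norm (fd x h)"
    using t by (simp add: linear_scale[OF fd_linear])
  ultimately have "t * norm (fd x h) \<le> L * (t * norm h) + \<epsilon> * (t * norm h)"
    using norm_triangle_ineq4[of "f (x + t *\<^sub>R h) - f x" "f (x + t *\<^sub>R h) - f x - fd x (t *\<^sub>R h)"] t by simp
  then have "t * norm (fd x h) \<le> t * (L * norm h + \<epsilon> * norm h)" by (simp add: algebra_simps)
  then have "norm (fd x h) \<le> L * norm h + \<epsilon> * norm h" using t by simp
  moreover have "\<epsilon> * norm h \<le> \<epsilon>'"
  proof -
    have "norm h / (norm h + 1) \<le> 1" by (simp add: divide_le_eq_1 add_nonneg_pos)
    then show ?thesis using mult_left_mono[of "norm h / (norm h + 1)" 1 \<epsilon>'] \<epsilon>' by (simp add: \<epsilon>_def)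
  qed
  ultimately show "norm (fd x h) \<le> L * norm h + \<epsilon>'" by linarith
qed

text \<open>Joint continuity on the separable product gives measurability of
  \<open>fd (v s) (w s)\<close> in \<open>s\<close> directly, without passing through the space of
  operators, which need not be separable.\<close>

lemma fd_continuous: "continuous_on UNIV (\<lambda>p. fd (fst p) (snd p))"
  unfolding continuous_on_def
proof
  fix p :: "'h \<times> 'h"
  have "((\<lambda>p'. fd (fst p') (snd p') - fd (fst p) (snd p)) \<longlongrightarrow> 0) (at p)"
  proof (rule tendstoI)
    fix \<epsilon> :: real assume \<epsilon>: "0 < \<epsilon>"
    define K where "K = norm (snd p) + 1"
    have K: "0 < K" by (simp add: K_def add_nonneg_pos)
    have "0 < \<epsilon> / (2 * K)" using \<epsilon> K by simp
    then obtain \<delta> where \<delta>: "\<delta> > 0" "\<And>y h. norm (y - fst p) < \<delta> \<Longrightarrow> norm (fd y h - fd (fst p) h) \<le> \<epsilon> / (2 * K) * norm h"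
      using fd_cont[of "\<epsilon> / (2 * K)" "fst p"] by blast
    have 1: "\<forall>\<^sub>F p' in at p. dist (fst p') (fst p) < \<delta>"
      by (rule tendstoD[OF tendsto_fst[OF tendsto_ident_at] \<delta>(1)])
    have 2: "\<forall>\<^sub>F p' in at p. dist (snd p') (snd p) < min 1 (\<epsilon> / (2 * L))"
      by (rule tendstoD[OF tendsto_snd[OF tendsto_ident_at]]) (use \<epsilon> L in simp)
    show "\<forall>\<^sub>F p' in at p. dist (fd (fst p') (snd p') - fd (fst p) (snd p)) 0 < \<epsilon>"
      using 1 2
    proof eventually_elim
      case (elim p')
      have n: "norm (snd p') < K"
        using norm_triangle_ineq2[of "snd p'" "snd p"] elim by (simp add: K_def dist_norm)
      have "fd (fst p') (snd p') - fd (fst p) (snd p) =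
          (fd (fst p') (snd p') - fd (fst p) (snd p')) + fd (fst p) (snd p' - snd p)"
        by (simp add: linear_diff[OF fd_linear])
      then have "norm (fd (fst p') (snd p') - fd (fst p) (snd p)) \<le>
          norm (fd (fst p') (snd p') - fd (fst p) (snd p')) + norm (fd (fst p) (snd p' - snd p))"
        by (simp only: norm_triangle_ineq)
      also have "\<dots> < \<epsilon> / 2 + \<epsilon> / 2"
      proof (rule add_le_less_mono)
        have "norm (fd (fst p') (snd p') - fd (fst p) (snd p')) \<le> \<epsilon> / (2 * K) * norm (snd p')"
          using elim by (intro \<delta>) (simp add: dist_norm)
        also have "\<dots> \<le> \<epsilon> / (2 * K) * K" using n \<epsilon> K by (intro mult_left_mono) auto
        also have "\<dots> = \<epsilon> / 2" using K by simp
        finally show "norm (fd (fst p') (snd p') - fd (fst p) (snd p')) \<le> \<epsilon> / 2" .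
        have "norm (fd (fst p) (snd p' - snd p)) \<le> L * norm (snd p' - snd p)" by (rule norm_fd)
        also have "\<dots> < L * (\<epsilon> / (2 * L))"
          using elim L by (intro mult_strict_left_mono) (auto simp: dist_norm)
        also have "\<dots> = \<epsilon> / 2" using L by simp
        finally show "norm (fd (fst p) (snd p' - snd p)) < \<epsilon> / 2" .
      qed
      finally show ?case by (simp add: dist_norm)
    qed
  qed
  then show "((\<lambda>p'. fd (fst p') (snd p')) \<longlongrightarrow> fd (fst p) (snd p)) (at p within UNIV)"
    by (simp add: LIM_zero_iff)
qed

lemma fd_measurable:
  assumes "v \<in> borel_measurable M" "w \<in> borel_measurable M"
  shows "(\<lambda>x. fd (v x) (w x)) \<in> borel_measurable M"
proof -
  have "(\<lambda>p. fd (fst p) (snd p)) \<in> borel_measurable (borel \<Otimes>\<^sub>M borel)"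
    unfolding borel_prod by (rule borel_measurable_continuous_onI[OF fd_continuous])
  from measurable_compose[OF measurable_Pair[OF assms] this] show ?thesis by simp
qed

text \<open>The backward equation linearised along \<open>z\<close> in the direction
  \<open>h\<close>; its value at 0 is the candidate derivative. The explicit bound belongs to the
  notion because it gives the operator bound of the derivative and the growth control for
  uniqueness.\<close>

definition variation_sol :: "(real \<Rightarrow> real) \<Rightarrow> (real \<Rightarrow> 'h) \<Rightarrow> 'h \<Rightarrow> (real \<Rightarrow> 'h) \<Rightarrow> bool" where
  "variation_sol a z h v \<longleftrightarrow> v \<in> borel_measurable borel \<and>
     (\<forall>t. norm (v t) \<le> norm h / (1 - \<mu>) * exp (- \<beta> * t)) \<and>
     (\<forall>t\<le>0. v t = eP t h + lp.conv (\<lambda>s. indicator {..<0} s *\<^sub>R fd (exp (a s) *\<^sub>R z s) (v s)) t)"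

lemma fd_indicator: "indicator A s *\<^sub>R fd x v = fd (indicator A s *\<^sub>R x) (indicator A s *\<^sub>R v)"
  by (cases "s \<in> A") (auto simp: linear_0[OF fd_linear])

lemma cutoff_measurable:
  assumes a: "a \<in> borel_measurable borel" and z: "backward_sol 0 a z"
  shows "(\<lambda>s. indicator {..<0} s *\<^sub>R (exp (a s) *\<^sub>R z s)) \<in> borel_measurable borel"
proof -
  have [measurable]: "(\<lambda>s. indicator {..<0} s *\<^sub>R z s) \<in> borel_measurable borel" using z unfolding backward_sol_def by blast
  have "(\<lambda>s. exp (a s) *\<^sub>R (indicator {..<0} s *\<^sub>R z s)) \<in> borel_measurable borel" using a by measurable
  then show ?thesis by (simp add: mult.commute)
qed

lemma fd_cutoff_measurable:
  assumes a: "a \<in> borel_measurable borel" and z: "backward_sol 0 a z" and v: "v \<in> borel_measurable borel"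
  shows "(\<lambda>s. indicator {..<0} s *\<^sub>R fd (exp (a s) *\<^sub>R z s) (v s)) \<in> borel_measurable borel"
  unfolding fd_indicator by (intro fd_measurable cutoff_measurable[OF a z]) (use v in measurable)

lemma variation_sol_exists:
  assumes a: "a \<in> borel_measurable borel" and z: "backward_sol 0 a z"
  obtains v where "variation_sol a z h v"
proof -
  let ?\<Delta> = "\<lambda>s v. indicator {..<0} s *\<^sub>R fd (exp (a s) *\<^sub>R z s) v"
  let ?\<eta> = "\<lambda>t. indicator {..0} t *\<^sub>R eP t h"
  have 1: "(\<lambda>(s, v). ?\<Delta> s v) \<in> borel_measurable (borel \<Otimes>\<^sub>M borel)"
    unfolding split_beta' fd_indicator
    by (intro fd_measurable measurable_compose[OF measurable_fst cutoff_measurable[OF a z]]) measurable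
  have 2: "?\<eta> \<in> borel_measurable borel"
    by (intro borel_measurable_scaleR measurable_semigroups) auto
  have lip: "norm (?\<Delta> s v - ?\<Delta> s v') \<le> L * norm (v - v')" for s v v'
    using norm_fd[of "exp (a s) *\<^sub>R z s" "v - v'"] L by (auto simp: indicator_def linear_diff[OF fd_linear])
  have bd: "norm (?\<eta> t) \<le> norm h * exp (- \<beta> * t)" for t
    using order_trans[OF norm_eP[of t h] mult_left_mono[OF norm_P[of h]]]
    by (auto simp: indicator_def mult.commute)
  obtain v where v: "v \<in> borel_measurable borel" "\<And>t. norm (v t) \<le> norm h / (1 - \<mu>) * exp (- \<beta> * t)"
    "\<And>t. v t = ?\<eta> t + lp.conv (\<lambda>s. ?\<Delta> s (v s)) t"
  proof (rule lp.fixed_point_single[where \<Delta> = ?\<Delta> and \<eta> = ?\<eta>, OF 1 2 lip _ bd _ L_q])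
    show "0 \<le> L" using L by simp
    show "?\<Delta> s 0 = 0" for s by (simp add: linear_0[OF fd_linear])
    show "\<mu> < 1" by (rule \<mu>)
  qed (rule that)
  have "v t = eP t h + lp.conv (\<lambda>s. ?\<Delta> s (v s)) t" if "t \<le> 0" for t
    by (subst v(3)) (use that in simp)
  then show thesis using that v(1,2) unfolding variation_sol_def by blast
qed

lemma vsolD: "variation_sol a z h v \<Longrightarrow> t \<le> 0 \<Longrightarrow>
    v t = eP t h + lp.conv (\<lambda>s. indicator {..<0} s *\<^sub>R fd (exp (a s) *\<^sub>R z s) (v s)) t"
  unfolding variation_sol_def by blast

lemma variation_sol_cutoff_bound:
  assumes "variation_sol a z h v"
  shows "norm (indicator {..<0} s *\<^sub>R fd (exp (a s) *\<^sub>R z' s) (v s)) \<le> L * (norm h / (1 - \<mu>)) * exp (- \<beta> * s)"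
proof -
  have b: "norm (v s) \<le> norm h / (1 - \<mu>) * exp (- \<beta> * s)" using assms unfolding variation_sol_def by blast
  have "norm (indicator {..<0} s *\<^sub>R fd (exp (a s) *\<^sub>R z' s) (v s)) \<le> norm (fd (exp (a s) *\<^sub>R z' s) (v s))"
    by (simp add: indicator_def)
  also have "\<dots> \<le> L * norm (v s)" by (rule norm_fd)
  also have "\<dots> \<le> L * (norm h / (1 - \<mu>) * exp (- \<beta> * s))" using L b by (intro mult_left_mono) auto
  finally show ?thesis by (simp only: mult.assoc)
qed

text \<open>\<open>gronwall\<close> with \<open>C0 = 0\<close>. Applied to combinations such as
  \<open>V x + V y - V (x + y)\<close>, it gives linearity although the solutions \<open>V h\<close>
  are chosen separately for each \<open>h\<close>.\<close>

lemma variation_sol_zero: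
  assumes a: "a \<in> borel_measurable borel" and z: "backward_sol 0 a z"
    and v: "v \<in> borel_measurable borel" "\<And>t. norm (v t) \<le> C * exp (- \<beta> * t)"
    and eq: "\<And>t. t \<le> 0 \<Longrightarrow> v t = lp.conv (\<lambda>s. indicator {..<0} s *\<^sub>R fd (exp (a s) *\<^sub>R z s) (v s)) t"
    and t: "t \<le> 0"
  shows "v t = 0"
proof -
  let ?w = "\<lambda>s. indicator {..0} s *\<^sub>R v s"
  let ?h = "\<lambda>s. indicator {..<0} s *\<^sub>R fd (exp (a s) *\<^sub>R z s) (v s)"
  have C0: "0 \<le> C" using order_trans[OF norm_ge_zero v(2)[of 0]] by simp
  have "norm (?w t) \<le> 0 / (1 - \<mu>) * exp (- \<beta> * t)"
  proof (rule lp.gronwall[where h = ?h and C = C and L = L])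
    show "?h \<in> borel_measurable borel" by (rule fd_cutoff_measurable[OF a z v(1)])
    show "norm (?w s) \<le> C * exp (- \<beta> * s)" for s using v(2)[of s] C0 by (auto simp: indicator_def)
    show "norm (?h s) \<le> L * norm (?w s)" for s
      using norm_fd[of "exp (a s) *\<^sub>R z s" "v s"] L by (auto simp: indicator_def)
    show "norm (?w s) \<le> 0 * exp (- \<beta> * s) + norm (lp.conv ?h s)" for s
      using eq[of s] by (cases "s \<le> 0") (auto simp: indicator_def)
  qed (use L L_q \<mu> in auto)
  then show ?thesis using t by simp
qed

lemma variation_sol_linear:
  assumes a: "a \<in> borel_measurable borel" and z: "backward_sol 0 a z" and v: "\<And>h. variation_sol a z h (V h)" and t: "t \<le> 0"
  shows "linear (\<lambda>h. V h t)"
proof (rule linearI)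
  let ?A = "\<lambda>v s. indicator {..<0} s *\<^sub>R fd (exp (a s) *\<^sub>R z s) (v s)"
  have Vm: "V h \<in> borel_measurable borel" and Vb: "\<And>t. norm (V h t) \<le> norm h / (1 - \<mu>) * exp (- \<beta> * t)" for h
    using v[of h] unfolding variation_sol_def by auto
  note Am = fd_cutoff_measurable[OF a z Vm] and Ab = variation_sol_cutoff_bound[OF v, where z' = z]
  fix x y
  have "V x t + V y t - V (x + y) t = 0"
  proof (rule variation_sol_zero[OF a z _ _ _ t])
    show "(\<lambda>t. V x t + V y t - V (x + y) t) \<in> borel_measurable borel"
      by (intro borel_measurable_diff borel_measurable_add Vm)
    show "norm (V x t + V y t - V (x + y) t) \<le> (norm x / (1 - \<mu>) + norm y / (1 - \<mu>) + norm (x + y) / (1 - \<mu>)) * exp (- \<beta> * t)" for t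
      using norm_triangle_ineq4[of "V x t + V y t" "V (x + y) t"] norm_triangle_ineq[of "V x t" "V y t"]
        Vb[of x t] Vb[of y t] Vb[of "x + y" t] unfolding distrib_right by linarith
    fix t :: real assume t: "t \<le> 0"
    have m: "(\<lambda>s. ?A (V x) s + ?A (V y) s) \<in> borel_measurable borel" by (intro borel_measurable_add Am)
    have b: "norm (?A (V x) s + ?A (V y) s) \<le> (L * (norm x / (1 - \<mu>)) + L * (norm y / (1 - \<mu>))) * exp (- \<beta> * s)" for s
      unfolding distrib_right by (rule norm_triangle_mono[OF Ab Ab])
    have "V x t + V y t - V (x + y) t = (eP t x + eP t y - eP t (x + y)) + (lp.conv (?A (V x)) t + lp.conv (?A (V y)) t - lp.conv (?A (V (x + y))) t)"
      by (subst (1 2 3) vsolD[OF v t]) simp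
    also have "eP t x + eP t y - eP t (x + y) = 0" by (simp add: linear_add[OF linear_eP])
    also have "lp.conv (?A (V x)) t + lp.conv (?A (V y)) t = lp.conv (\<lambda>s. ?A (V x) s + ?A (V y) s) t"
      by (rule lp.conv_add[OF Am Ab Am Ab])
    also have "\<dots> - lp.conv (?A (V (x + y))) t = lp.conv (\<lambda>s. (?A (V x) s + ?A (V y) s) - ?A (V (x + y)) s) t"
      by (rule lp.conv_diff[OF m b Am Ab])
    also have "(\<lambda>s. (?A (V x) s + ?A (V y) s) - ?A (V (x + y)) s) = ?A (\<lambda>t. V x t + V y t - V (x + y) t)"
      by (auto simp: fun_eq_iff indicator_def linear_add[OF fd_linear] linear_diff[OF fd_linear])
    finally show "V x t + V y t - V (x + y) t = lp.conv (?A (\<lambda>t. V x t + V y t - V (x + y) t)) t" by simp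
  qed
  then show "V (x + y) t = V x t + V y t" by simp
next
  let ?A = "\<lambda>v s. indicator {..<0} s *\<^sub>R fd (exp (a s) *\<^sub>R z s) (v s)"
  have Vm: "V h \<in> borel_measurable borel" and Vb: "\<And>t. norm (V h t) \<le> norm h / (1 - \<mu>) * exp (- \<beta> * t)" for h
    using v[of h] unfolding variation_sol_def by auto
  note Am = fd_cutoff_measurable[OF a z Vm] and Ab = variation_sol_cutoff_bound[OF v, where z' = z]
  fix c :: real and x
  have "c *\<^sub>R V x t - V (c *\<^sub>R x) t = 0"
  proof (rule variation_sol_zero[OF a z _ _ _ t])
    show "(\<lambda>t. c *\<^sub>R V x t - V (c *\<^sub>R x) t) \<in> borel_measurable borel"
      by (intro borel_measurable_diff borel_measurable_scaleR borel_measurable_const Vm)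
    show "norm (c *\<^sub>R V x t - V (c *\<^sub>R x) t) \<le> (\<bar>c\<bar> * (norm x / (1 - \<mu>)) + norm (c *\<^sub>R x) / (1 - \<mu>)) * exp (- \<beta> * t)" for t
      using norm_triangle_ineq4[of "c *\<^sub>R V x t" "V (c *\<^sub>R x) t"]
        mult_left_mono[OF Vb[of x t], of "\<bar>c\<bar>"] Vb[of "c *\<^sub>R x" t] unfolding distrib_right mult.assoc by simp
    fix t :: real assume t: "t \<le> 0"
    have m: "(\<lambda>s. c *\<^sub>R ?A (V x) s) \<in> borel_measurable borel" by (intro borel_measurable_scaleR borel_measurable_const Am)
    have b: "norm (c *\<^sub>R ?A (V x) s) \<le> (\<bar>c\<bar> * (L * (norm x / (1 - \<mu>)))) * exp (- \<beta> * s)" for s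
      using mult_left_mono[OF Ab[of s x], of "\<bar>c\<bar>"] by (simp only: norm_scaleR mult.assoc abs_ge_zero)
    have "c *\<^sub>R V x t - V (c *\<^sub>R x) t = (c *\<^sub>R eP t x - eP t (c *\<^sub>R x)) + (c *\<^sub>R lp.conv (?A (V x)) t - lp.conv (?A (V (c *\<^sub>R x))) t)"
      by (subst (1 2) vsolD[OF v t]) (simp only: scaleR_add_right add_diff_add)
    also have "c *\<^sub>R eP t x - eP t (c *\<^sub>R x) = 0" by (simp add: linear_scale[OF linear_eP])
    also have "c *\<^sub>R lp.conv (?A (V x)) t = lp.conv (\<lambda>s. c *\<^sub>R ?A (V x) s) t"
      by (rule lp.conv_scaleR[symmetric])
    also have "\<dots> - lp.conv (?A (V (c *\<^sub>R x))) t = lp.conv (\<lambda>s. c *\<^sub>R ?A (V x) s - ?A (V (c *\<^sub>R x)) s) t"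
      by (rule lp.conv_diff[OF m b Am Ab])
    also have "(\<lambda>s. c *\<^sub>R ?A (V x) s - ?A (V (c *\<^sub>R x)) s) = ?A (\<lambda>t. c *\<^sub>R V x t - V (c *\<^sub>R x) t)"
      by (auto simp: fun_eq_iff indicator_def linear_scale[OF fd_linear] linear_diff[OF fd_linear])
    finally show "c *\<^sub>R V x t - V (c *\<^sub>R x) t = lp.conv (?A (\<lambda>t. c *\<^sub>R V x t - V (c *\<^sub>R x) t)) t" by simp
  qed
  then show "V (c *\<^sub>R x) t = c *\<^sub>R V x t" by simp
qed

text \<open>Vanishing of normalised remainders.  Dominated convergence replaces the usual second
  exponential weight.\<close>

lemma remainder_tendsto_0:
  assumes d: "\<And>n. d n \<in> borel_measurable borel" "\<And>n t. norm (d n t) \<le> c n * (C * exp (- \<beta> * t))"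
    and H: "\<And>n. H n \<in> borel_measurable borel" "\<And>n s. norm (H n s) \<le> L * norm (d n s) + c n * r n s"
    and eq: "\<And>n t. norm (d n t) \<le> norm (lp.conv (H n) t)"
    and r: "\<And>n. r n \<in> borel_measurable borel" "\<And>n s. 0 \<le> r n s" "\<And>n s. r n s \<le> C' * exp (- \<beta> * s)"
    and r0: "\<And>s. (\<lambda>n. r n s) \<longlonglongrightarrow> 0"
    and c: "\<And>n. 0 < c n"
  shows "(\<lambda>n. norm (d n t) / c n) \<longlonglongrightarrow> 0"
proof (rule lp.sequence_gronwall[where d = "\<lambda>n t. norm (d n t) / c n" and r = r and C = C and C' = C' and L = L and \<mu> = \<mu>])
  show dm: "(\<lambda>t. norm (d n t) / c n) \<in> borel_measurable borel" for n using d(1)[of n] by measurable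
  show "0 \<le> norm (d n t) / c n" for n t using c[of n] by simp
  show db: "norm (d n t) / c n \<le> C * exp (- \<beta> * t)" for n t
    using d(2)[of n t] c[of n] by (simp add: field_simps)
  show "norm (d n t) / c n \<le> (LINT s|lborel. \<kappa> (t - s) * (L * (norm (d n s) / c n) + r n s))" for n t
  proof -
    let ?r = "\<lambda>s. c n * (L * (norm (d n s) / c n) + r n s)"
    have "norm (lp.conv (H n) t) \<le> (LINT s|lborel. \<kappa> (t - s) * ?r s)"
    proof (rule lp.conv_norm_le(2)[OF H(1)])
      show "?r \<in> borel_measurable borel" using dm[of n] r(1)[of n] by measurable
      show "norm (H n s) \<le> ?r s" for s using H(2)[of n s] c[of n] by (simp add: distrib_left)
      show "?r s \<le> c n * (L * C + C') * exp (- \<beta> * s)" for s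
      proof -
        have "L * (norm (d n s) / c n) \<le> L * (C * exp (- \<beta> * s))"
          using L by (intro mult_left_mono db) simp
        then have "?r s \<le> c n * (L * (C * exp (- \<beta> * s)) + C' * exp (- \<beta> * s))"
          using c[of n] by (intro mult_left_mono[OF add_mono[OF _ r(3)]]) auto
        then show ?thesis by (simp add: distrib_right mult.assoc)
      qed
    qed
    also have "\<dots> = c n * (LINT s|lborel. \<kappa> (t - s) * (L * (norm (d n s) / c n) + r n s))"
      by (simp only: mult.left_commute[of "\<kappa> _"] integral_mult_right_zero)
    finally show ?thesis using eq[of n t] c[of n] by (simp add: divide_le_eq mult.commute)
  qed
qed (use r r0 L L_q \<mu> in auto)

text \<open>If differentiability fails, there are \<open>h n\<close> tending to 0 that violate the
  estimate. The remainders \<open>d n\<close> divided by \<open>norm (h n)\<close> satisfy a linear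
  inequality whose inhomogeneity \<open>r n\<close> is the Taylor remainder of the nonlinearity
  along the orbit; it tends to 0 at each time because \<open>D n s\<close> is of order
  \<open>norm (h n)\<close>.\<close>

lemma derivative_remainder:
  assumes a: "a \<in> borel_measurable borel"
    and z: "\<And>\<xi>. backward_sol 0 a (z \<xi>)" "\<And>\<xi>. P (z \<xi> 0) = P \<xi>"
    and v: "\<And>h. variation_sol a (z \<xi>) h (V h)" and \<epsilon>: "0 < \<epsilon>"
  shows "\<exists>\<delta>>0. \<forall>h. norm h < \<delta> \<longrightarrow> norm (z (\<xi> + h) 0 - z \<xi> 0 - V h 0) \<le> \<epsilon> * norm h"
proof (rule ccontr)
  assume neg: "\<not> ?thesis"
  have "\<exists>h. norm h < 1 / real (Suc n) \<and> \<not> norm (z (\<xi> + h) 0 - z \<xi> 0 - V h 0) \<le> \<epsilon> * norm h" for n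
  proof -
    have "(0::real) < 1 / real (Suc n)" by simp
    then show ?thesis using neg by blast
  qed
  then obtain h where h: "\<And>n. norm (h n) < 1 / real (Suc n)"
    "\<And>n. \<not> norm (z (\<xi> + h n) 0 - z \<xi> 0 - V (h n) 0) \<le> \<epsilon> * norm (h n)" by metis
  have h0: "h \<longlonglongrightarrow> 0"
    by (rule LIMSEQ_norm_0) (rule h(1))
  have V0: "V 0 0 = 0" using linear_0[OF variation_sol_linear[OF a z(1) v, of 0]] by simp
  have hn: "h n \<noteq> 0" for n
  proof
    assume "h n = 0"
    then show False using h(2)[of n] V0 by simp
  qed
  define D where "D n s = z (\<xi> + h n) s - z \<xi> s" for n s
  define d where "d n t = indicator {..0} t *\<^sub>R (D n t - V (h n) t)" for n t
  define H where "H n s = (indicator {..<0} s *\<^sub>R g a s (z (\<xi> + h n) s) - indicator {..<0} s *\<^sub>R g a s (z \<xi> s))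
      - indicator {..<0} s *\<^sub>R fd (exp (a s) *\<^sub>R z \<xi> s) (V (h n) s)" for n s
  define r where "r n s = indicator {..<0} s * (norm (g a s (z (\<xi> + h n) s) - g a s (z \<xi> s) - fd (exp (a s) *\<^sub>R z \<xi> s) (D n s)) / norm (h n))" for n s
  let ?K = "1 / (1 - \<mu>)"
  have K: "0 < ?K" using \<mu> by simp
  have Db: "norm (D n s) \<le> norm (h n) * (?K * exp (- \<beta> * s))" if "s \<le> 0" for n s
  proof -
    have "norm (D n s) \<le> norm (P (z (\<xi> + h n) 0 - z \<xi> 0)) / (1 - \<mu>) * exp (- \<beta> * s)"
      unfolding D_def by (rule backward_sol_lipschitz[OF z(1) z(1) a that])
    also have "P (z (\<xi> + h n) 0 - z \<xi> 0) = P (h n)"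
      by (simp add: linear_diff[OF bounded_linear.linear[OF bounded_linear_P]] z(2) linear_add[OF bounded_linear.linear[OF bounded_linear_P]])
    also have "norm (P (h n)) / (1 - \<mu>) * exp (- \<beta> * s) \<le> norm (h n) / (1 - \<mu>) * exp (- \<beta> * s)"
      using \<mu> by (intro mult_right_mono divide_right_mono norm_P) auto
    finally show ?thesis by simp
  qed
  have Vm: "V h \<in> borel_measurable borel" and Vb: "\<And>t. norm (V h t) \<le> norm h / (1 - \<mu>) * exp (- \<beta> * t)" for h
    using v[of h] unfolding variation_sol_def by auto
  have zm: "(\<lambda>s. indicator {..<0} s *\<^sub>R z \<xi> s) \<in> borel_measurable borel" for \<xi>
    using z(1)[of \<xi>] unfolding backward_sol_def by blast
  have zm': "(\<lambda>s. indicator {..0} s *\<^sub>R z \<xi> s) \<in> borel_measurable borel" for \<xi>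
    using borel_measurable_continuous_on_indicator[OF _ backward_sol_continuous[OF z(1) a], of \<xi>] by simp
  have dm: "d n \<in> borel_measurable borel" for n
  proof -
    have "(\<lambda>t. (indicator {..0} t *\<^sub>R z (\<xi> + h n) t - indicator {..0} t *\<^sub>R z \<xi> t) - indicator {..0} t *\<^sub>R V (h n) t) \<in> borel_measurable borel"
      using zm' Vm[of "h n"] by measurable
    then show ?thesis by (simp add: d_def[abs_def] D_def scaleR_diff_right)
  qed
  have Hm: "H n \<in> borel_measurable borel" for n
    unfolding H_def[abs_def] by (intro borel_measurable_diff backward_sol_cutoff(1)[OF z(1) a] fd_cutoff_measurable[OF a z(1) Vm])
  have rm: "r n \<in> borel_measurable borel" for n
  proof -
    have Dm: "(\<lambda>s. indicator {..<0} s *\<^sub>R z (\<xi> + h n) s - indicator {..<0} s *\<^sub>R z \<xi> s) \<in> borel_measurable borel"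
      using zm by measurable
    have "(\<lambda>s. norm ((indicator {..<0} s *\<^sub>R g a s (z (\<xi> + h n) s) - indicator {..<0} s *\<^sub>R g a s (z \<xi> s))
        - indicator {..<0} s *\<^sub>R fd (exp (a s) *\<^sub>R z \<xi> s) (indicator {..<0} s *\<^sub>R z (\<xi> + h n) s - indicator {..<0} s *\<^sub>R z \<xi> s)) / norm (h n)) \<in> borel_measurable borel"
      by (intro borel_measurable_divide measurable_compose[OF _ borel_measurable_norm] borel_measurable_diff borel_measurable_const
          backward_sol_cutoff(1)[OF z(1) a] fd_cutoff_measurable[OF a z(1) Dm])
    also have "(\<lambda>s. norm ((indicator {..<0} s *\<^sub>R g a s (z (\<xi> + h n) s) - indicator {..<0} s *\<^sub>R g a s (z \<xi> s))
        - indicator {..<0} s *\<^sub>R fd (exp (a s) *\<^sub>R z \<xi> s) (indicator {..<0} s *\<^sub>R z (\<xi> + h n) s - indicator {..<0} s *\<^sub>R z \<xi> s)) / norm (h n)) = r n"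
      by (auto simp: fun_eq_iff r_def D_def indicator_def)
    finally show ?thesis .
  qed
  have rb: "r n s \<le> (2 * L * ?K) * exp (- \<beta> * s)" for n s
  proof (cases "s < 0")
    case True
    have "norm (g a s (z (\<xi> + h n) s) - g a s (z \<xi> s) - fd (exp (a s) *\<^sub>R z \<xi> s) (D n s)) \<le> L * norm (D n s) + L * norm (D n s)"
      using norm_triangle_le_diff[OF add_mono[OF g_lipschitz[of a s "z (\<xi> + h n) s" "z \<xi> s"] norm_fd[of "exp (a s) *\<^sub>R z \<xi> s" "D n s"]]]
      by (simp add: D_def)
    also have "\<dots> \<le> norm (h n) * ((2 * L * ?K) * exp (- \<beta> * s))"
      using mult_left_mono[OF Db[of s n], of "2 * L"] True L by (simp add: algebra_simps)
    finally show ?thesis using True hn[of n] by (simp add: r_def divide_le_eq mult.commute)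
  next
    case False
    then show ?thesis using L K by (simp add: r_def)
  qed
  have r0: "(\<lambda>n. r n s) \<longlonglongrightarrow> 0" for s
  proof (cases "s < 0")
    case True
    show ?thesis
    proof (rule tendstoI)
      fix \<epsilon>' :: real assume \<epsilon>': "0 < \<epsilon>'"
      \<comment> \<open>\<open>?K * exp (- \<beta> * s)\<close> is the Lipschitz factor from
        \<open>h n\<close> to \<open>D n s\<close>; dividing by it leaves \<epsilon>'/2 per unit of
        \<open>norm (h n)\<close>.\<close>
      define \<epsilon>2 where "\<epsilon>2 = \<epsilon>' / (2 * (?K * exp (- \<beta> * s)))"
      have \<epsilon>2: "0 < \<epsilon>2" using \<epsilon>' K by (simp add: \<epsilon>2_def)
      have \<epsilon>2': "\<epsilon>2 * (?K * exp (- \<beta> * s)) = \<epsilon>' / 2"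
      proof -
        have "x / (2 * k) * k = x / 2" if "k \<noteq> 0" for x k :: real using that by simp
        moreover have "?K * exp (- \<beta> * s) \<noteq> 0" using K by (metis exp_not_eq_zero less_irrefl mult_eq_0_iff)
        ultimately show ?thesis unfolding \<epsilon>2_def by blast
      qed
      obtain \<delta> where \<delta>: "\<delta> > 0" "\<And>h. norm h < \<delta> \<Longrightarrow> norm (f (exp (a s) *\<^sub>R z \<xi> s + h) - f (exp (a s) *\<^sub>R z \<xi> s) - fd (exp (a s) *\<^sub>R z \<xi> s) h) \<le> \<epsilon>2 * norm h"
        using fd_deriv[OF \<epsilon>2] by blast
      have "(\<lambda>n. exp (a s) * (norm (h n) * (?K * exp (- \<beta> * s)))) \<longlonglongrightarrow> 0"
        using tendsto_mult[OF tendsto_const[of "exp (a s)"]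
            tendsto_mult[OF tendsto_norm_zero[OF h0] tendsto_const[of "?K * exp (- \<beta> * s)"]]] by simp
      from order_tendstoD(2)[OF this \<delta>(1)] show "\<forall>\<^sub>F n in sequentially. dist (r n s) 0 < \<epsilon>'"
      proof eventually_elim
        case (elim n)
        have n: "norm (exp (a s) *\<^sub>R D n s) < \<delta>"
          using mult_left_mono[OF Db[of s n], of "exp (a s)"] True elim by simp
        have e: "exp (a s) *\<^sub>R z (\<xi> + h n) s = exp (a s) *\<^sub>R z \<xi> s + exp (a s) *\<^sub>R D n s"
          by (simp add: D_def scaleR_diff_right)
        have "g a s (z (\<xi> + h n) s) - g a s (z \<xi> s) - fd (exp (a s) *\<^sub>R z \<xi> s) (D n s) =
            exp (- a s) *\<^sub>R (f (exp (a s) *\<^sub>R z \<xi> s + exp (a s) *\<^sub>R D n s) - f (exp (a s) *\<^sub>R z \<xi> s) - fd (exp (a s) *\<^sub>R z \<xi> s) (exp (a s) *\<^sub>R D n s))"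
          by (simp add: g_def e scaleR_diff_right linear_scale[OF fd_linear] exp_add[symmetric])
        then have "norm (g a s (z (\<xi> + h n) s) - g a s (z \<xi> s) - fd (exp (a s) *\<^sub>R z \<xi> s) (D n s)) \<le> exp (- a s) * (\<epsilon>2 * norm (exp (a s) *\<^sub>R D n s))"
          using mult_left_mono[OF \<delta>(2)[OF n], of "exp (- a s)"] by simp
        also have "\<dots> = \<epsilon>2 * norm (D n s)" by (simp add: exp_minus)
        also have "\<dots> \<le> \<epsilon>2 * (norm (h n) * (?K * exp (- \<beta> * s)))"
          using \<epsilon>2 True by (intro mult_left_mono Db) auto
        also have "\<dots> = norm (h n) * (\<epsilon>' / 2)" unfolding \<epsilon>2'[symmetric] by simp
        finally have "r n s \<le> \<epsilon>' / 2" using True hn[of n] by (simp add: r_def divide_le_eq mult.commute)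
        moreover have "0 \<le> r n s" by (simp add: r_def)
        ultimately show ?case using \<epsilon>' by simp
      qed
    qed
  next
    case False
    then show ?thesis by (simp add: r_def)
  qed
  have "(\<lambda>n. norm (d n 0) / norm (h n)) \<longlonglongrightarrow> 0"
  proof (rule remainder_tendsto_0[OF dm _ Hm _ _ rm _ rb r0])
    have two: "norm (h n) * (2 * ?K * E) = norm (h n) / (1 - \<mu>) * E + norm (h n) / (1 - \<mu>) * E" for n E
      by (simp add: add_divide_distrib[symmetric])
    show "norm (d n t) \<le> norm (h n) * (2 * ?K * exp (- \<beta> * t))" for n t
    proof (cases "t \<le> 0")
      case True
      have "norm (D n t) \<le> norm (h n) / (1 - \<mu>) * exp (- \<beta> * t)" using Db[OF True, of n] by simp
      then show ?thesis
        using norm_triangle_ineq4[of "D n t" "V (h n) t"] Vb[of "h n" t] True unfolding two d_def by simp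
    next
      case False
      then show ?thesis using K by (simp add: d_def)
    qed
    show "norm (H n s) \<le> L * norm (d n s) + norm (h n) * r n s" for n s
    proof (cases "s < 0")
      case True
      \<comment> \<open>The derivative at the orbit applied to \<open>D n s\<close> is inserted:
        what is left is the Taylor remainder and the linear term in \<open>d n s\<close>.\<close>
      have "H n s = (g a s (z (\<xi> + h n) s) - g a s (z \<xi> s) - fd (exp (a s) *\<^sub>R z \<xi> s) (D n s)) + fd (exp (a s) *\<^sub>R z \<xi> s) (d n s)"
        using True by (simp add: H_def d_def linear_diff[OF fd_linear])
      then have "norm (H n s) \<le> norm (g a s (z (\<xi> + h n) s) - g a s (z \<xi> s) - fd (exp (a s) *\<^sub>R z \<xi> s) (D n s)) + norm (fd (exp (a s) *\<^sub>R z \<xi> s) (d n s))"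
        by (simp only: norm_triangle_ineq)
      then show ?thesis using norm_fd[of "exp (a s) *\<^sub>R z \<xi> s" "d n s"] True hn[of n] by (simp add: r_def)
    next
      case False
      then show ?thesis using L by (simp add: H_def r_def)
    qed
    show "norm (d n t) \<le> norm (lp.conv (H n) t)" for n t
    proof (cases "t \<le> 0")
      case True
      let ?h1 = "\<lambda>s. indicator {..<0} s *\<^sub>R g a s (z (\<xi> + h n) s)"
      let ?h2 = "\<lambda>s. indicator {..<0} s *\<^sub>R g a s (z \<xi> s)"
      let ?h3 = "\<lambda>s. indicator {..<0} s *\<^sub>R fd (exp (a s) *\<^sub>R z \<xi> s) (V (h n) s)"
      obtain B1 where B1: "\<And>s. norm (?h1 s) \<le> B1 * exp (- \<beta> * s)" using backward_sol_cutoff(2)[OF z(1) a] by blast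
      obtain B2 where B2: "\<And>s. norm (?h2 s) \<le> B2 * exp (- \<beta> * s)" using backward_sol_cutoff(2)[OF z(1) a] by blast
      note m1 = backward_sol_cutoff(1)[OF z(1) a, of "\<xi> + h n"] and m2 = backward_sol_cutoff(1)[OF z(1) a, of \<xi>]
        and m3 = fd_cutoff_measurable[OF a z(1) Vm, of \<xi> "h n"]
      have m12: "(\<lambda>s. ?h1 s - ?h2 s) \<in> borel_measurable borel" by (intro borel_measurable_diff m1 m2)
      have b12: "norm (?h1 s - ?h2 s) \<le> (B1 + B2) * exp (- \<beta> * s)" for s
        using norm_triangle_ineq4[of "?h1 s" "?h2 s"] B1[of s] B2[of s] unfolding distrib_right by linarith
      have zt: "z \<xi> t = eP t \<xi> + lp.conv (\<lambda>s. indicator {..<0} s *\<^sub>R g a s (z \<xi> s)) t" for \<xi>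
      proof -
        have "eP t (z \<xi> 0) = eP t \<xi>" by (metis eP_P z(2))
        then show ?thesis using bsolD[OF z(1) True, of \<xi>] by simp
      qed
      have "D n t - V (h n) t = (eP t (\<xi> + h n) - eP t \<xi> - eP t (h n)) + ((lp.conv ?h1 t - lp.conv ?h2 t) - lp.conv ?h3 t)"
        unfolding D_def
        by (subst zt[of "\<xi> + h n"], subst zt[of \<xi>], subst vsolD[OF v[of "h n"] True]) (simp only: algebra_simps)
      also have "eP t (\<xi> + h n) - eP t \<xi> - eP t (h n) = 0" by (simp add: linear_add[OF linear_eP])
      also have "lp.conv ?h1 t - lp.conv ?h2 t = lp.conv (\<lambda>s. ?h1 s - ?h2 s) t"
        by (rule lp.conv_diff[OF m1 B1 m2 B2])
      also have "\<dots> - lp.conv ?h3 t = lp.conv (\<lambda>s. (?h1 s - ?h2 s) - ?h3 s) t"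
        by (rule lp.conv_diff[OF m12 b12 m3 variation_sol_cutoff_bound[OF v[of "h n"], where z' = "z \<xi>"]])
      finally show ?thesis using True by (simp add: d_def H_def[abs_def])
    qed (simp add: d_def)
    show "0 \<le> r n s" for n s by (simp add: r_def)
    show "0 < norm (h n)" for n using hn by simp
  qed
  from order_tendstoD(2)[OF this \<epsilon>] obtain n where "norm (d n 0) / norm (h n) < \<epsilon>"
    by (auto simp: eventually_sequentially)
  then show False using h(2)[of n] hn[of n] by (simp add: d_def D_def divide_less_eq)
qed

text \<open>Continuity in operator norm needs uniformity in \<open>h\<close>, so the contradicting
  sequence supplies base points and directions together, and division by \<open>norm (h n)\<close>
  normalises. The perturbation \<open>r n\<close> comes from \<open>fd\<close> at two nearby base
  points acting on the same \<open>V \<xi> (h n)\<close>; it is small uniformly in the directions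
  because \<open>fd\<close> is continuous in operator norm.\<close>

lemma derivative_continuous:
  assumes a: "a \<in> borel_measurable borel"
    and z: "\<And>\<xi>. backward_sol 0 a (z \<xi>)" "\<And>\<xi>. P (z \<xi> 0) = P \<xi>"
    and v: "\<And>\<xi> h. variation_sol a (z \<xi>) h (V \<xi> h)" and \<epsilon>: "0 < \<epsilon>"
  shows "\<exists>\<delta>>0. \<forall>\<eta>. norm (\<eta> - \<xi>) < \<delta> \<longrightarrow> (\<forall>h. norm (V \<eta> h 0 - V \<xi> h 0) \<le> \<epsilon> * norm h)"
proof (rule ccontr)
  assume neg: "\<not> ?thesis"
  have "\<exists>\<eta> h. norm (\<eta> - \<xi>) < 1 / real (Suc n) \<and> \<not> norm (V \<eta> h 0 - V \<xi> h 0) \<le> \<epsilon> * norm h" for n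
  proof -
    have "(0::real) < 1 / real (Suc n)" by simp
    then show ?thesis using neg by blast
  qed
  then obtain \<eta> h where h: "\<And>n. norm (\<eta> n - \<xi>) < 1 / real (Suc n)"
    "\<And>n. \<not> norm (V (\<eta> n) (h n) 0 - V \<xi> (h n) 0) \<le> \<epsilon> * norm (h n)" by metis
  have h0: "(\<lambda>n. \<eta> n - \<xi>) \<longlonglongrightarrow> 0"
    by (rule LIMSEQ_norm_0) (rule h(1))
  have V0: "V \<xi> 0 0 = 0" for \<xi> using linear_0[OF variation_sol_linear[OF a z(1) v, of 0]] by simp
  have hn: "h n \<noteq> 0" for n
  proof
    assume "h n = 0"
    then show False using h(2)[of n] V0 by simp
  qed
  define A where "A \<xi> v s = indicator {..<0} s *\<^sub>R fd (exp (a s) *\<^sub>R z \<xi> s) (v s)" for \<xi> v s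
  define d where "d n t = indicator {..0} t *\<^sub>R (V (\<eta> n) (h n) t - V \<xi> (h n) t)" for n t
  define H where "H n s = A (\<eta> n) (V (\<eta> n) (h n)) s - A \<xi> (V \<xi> (h n)) s" for n s
  define r where "r n s = norm (A (\<eta> n) (V \<xi> (h n)) s - A \<xi> (V \<xi> (h n)) s) / norm (h n)" for n s
  let ?K = "1 / (1 - \<mu>)"
  have K: "0 < ?K" using \<mu> by simp
  have Vm: "V \<xi> h \<in> borel_measurable borel" and Vb: "\<And>t. norm (V \<xi> h t) \<le> norm h / (1 - \<mu>) * exp (- \<beta> * t)" for \<xi> h
    using v[of \<xi> h] unfolding variation_sol_def by auto
  have Am: "A \<xi> (V \<zeta> k) \<in> borel_measurable borel" for \<xi> \<zeta> k
    unfolding A_def[abs_def] by (rule fd_cutoff_measurable[OF a z(1) Vm])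
  have Ab: "norm (A \<xi> (V \<zeta> k) s) \<le> L * (norm k / (1 - \<mu>)) * exp (- \<beta> * s)" for \<xi> \<zeta> k s
    unfolding A_def by (rule variation_sol_cutoff_bound[OF v])
  have dm: "d n \<in> borel_measurable borel" for n
    unfolding d_def[abs_def] using Vm[of "\<eta> n" "h n"] Vm[of \<xi> "h n"] by measurable
  have Hm: "H n \<in> borel_measurable borel" for n
    unfolding H_def[abs_def] by (intro borel_measurable_diff Am)
  have rm: "r n \<in> borel_measurable borel" for n
    unfolding r_def[abs_def]
    by (intro borel_measurable_divide measurable_compose[OF _ borel_measurable_norm] borel_measurable_diff Am borel_measurable_const)
  have rb: "r n s \<le> (2 * L * ?K) * exp (- \<beta> * s)" for n s
  proof -
    have "norm (A (\<eta> n) (V \<xi> (h n)) s - A \<xi> (V \<xi> (h n)) s) \<le> norm (h n) * ((2 * L * ?K) * exp (- \<beta> * s))"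
      using norm_triangle_le_diff[OF add_mono[OF Ab[of "\<eta> n" \<xi> "h n" s] Ab[of \<xi> \<xi> "h n" s]]]
      by (simp add: algebra_simps)
    then show ?thesis using hn[of n] by (simp add: r_def divide_le_eq mult.commute)
  qed
  have r0: "(\<lambda>n. r n s) \<longlonglongrightarrow> 0" for s
  proof (cases "s < 0")
    case True
    show ?thesis
    proof (rule tendstoI)
      fix \<epsilon>' :: real assume \<epsilon>': "0 < \<epsilon>'"
      define \<epsilon>2 where "\<epsilon>2 = \<epsilon>' / (2 * (?K * exp (- \<beta> * s)))"
      have \<epsilon>2: "0 < \<epsilon>2" using \<epsilon>' K by (simp add: \<epsilon>2_def)
      have \<epsilon>2': "\<epsilon>2 * (?K * exp (- \<beta> * s)) = \<epsilon>' / 2"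
      proof -
        have "x / (2 * k) * k = x / 2" if "k \<noteq> 0" for x k :: real using that by simp
        moreover have "?K * exp (- \<beta> * s) \<noteq> 0" using K by (metis exp_not_eq_zero less_irrefl mult_eq_0_iff)
        ultimately show ?thesis unfolding \<epsilon>2_def by blast
      qed
      obtain \<delta> where \<delta>: "\<delta> > 0" "\<And>y h. norm (y - exp (a s) *\<^sub>R z \<xi> s) < \<delta> \<Longrightarrow> norm (fd y h - fd (exp (a s) *\<^sub>R z \<xi> s) h) \<le> \<epsilon>2 * norm h"
        using fd_cont[OF \<epsilon>2] by blast
      have "(\<lambda>n. exp (a s) * (norm (\<eta> n - \<xi>) * (?K * exp (- \<beta> * s)))) \<longlonglongrightarrow> 0"
        using tendsto_mult[OF tendsto_const[of "exp (a s)"]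
            tendsto_mult[OF tendsto_norm_zero[OF h0] tendsto_const[of "?K * exp (- \<beta> * s)"]]] by simp
      from order_tendstoD(2)[OF this \<delta>(1)] show "\<forall>\<^sub>F n in sequentially. dist (r n s) 0 < \<epsilon>'"
      proof eventually_elim
        case (elim n)
        have "norm (z (\<eta> n) s - z \<xi> s) \<le> norm (P (z (\<eta> n) 0 - z \<xi> 0)) / (1 - \<mu>) * exp (- \<beta> * s)"
          by (rule backward_sol_lipschitz[OF z(1) z(1) a]) (use True in simp)
        also have "P (z (\<eta> n) 0 - z \<xi> 0) = P (\<eta> n - \<xi>)"
          by (simp add: linear_diff[OF bounded_linear.linear[OF bounded_linear_P]] z(2))
        also have "norm (P (\<eta> n - \<xi>)) / (1 - \<mu>) * exp (- \<beta> * s) \<le> norm (\<eta> n - \<xi>) / (1 - \<mu>) * exp (- \<beta> * s)"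
          using \<mu> by (intro mult_right_mono divide_right_mono norm_P) auto
        finally have "norm (z (\<eta> n) s - z \<xi> s) \<le> norm (\<eta> n - \<xi>) * (?K * exp (- \<beta> * s))" by simp
        from mult_left_mono[OF this, of "exp (a s)"]
        have n: "norm (exp (a s) *\<^sub>R z (\<eta> n) s - exp (a s) *\<^sub>R z \<xi> s) < \<delta>"
          using elim by (simp add: scaleR_diff_right[symmetric])
        have "norm (A (\<eta> n) (V \<xi> (h n)) s - A \<xi> (V \<xi> (h n)) s) \<le> \<epsilon>2 * norm (V \<xi> (h n) s)"
          using \<delta>(2)[OF n] True by (simp add: A_def)
        also have "\<dots> \<le> \<epsilon>2 * (norm (h n) / (1 - \<mu>) * exp (- \<beta> * s))"
          using \<epsilon>2 by (intro mult_left_mono Vb) auto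
        also have "\<dots> = norm (h n) * (\<epsilon>2 * (?K * exp (- \<beta> * s)))" by simp
        also note \<epsilon>2'
        finally have "r n s \<le> \<epsilon>' / 2" using hn[of n] by (simp add: r_def divide_le_eq mult.commute)
        moreover have "0 \<le> r n s" by (simp add: r_def)
        ultimately show ?case using \<epsilon>' by simp
      qed
    qed
  next
    case False
    then show ?thesis by (simp add: r_def A_def)
  qed
  have "(\<lambda>n. norm (d n 0) / norm (h n)) \<longlonglongrightarrow> 0"
  proof (rule remainder_tendsto_0[OF dm _ Hm _ _ rm _ rb r0])
    have two: "norm (h n) * (2 * ?K * E) = norm (h n) / (1 - \<mu>) * E + norm (h n) / (1 - \<mu>) * E" for n E
      by (simp add: add_divide_distrib[symmetric])
    show "norm (d n t) \<le> norm (h n) * (2 * ?K * exp (- \<beta> * t))" for n t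
    proof (cases "t \<le> 0")
      case True
      then show ?thesis
        using norm_triangle_ineq4[of "V (\<eta> n) (h n) t" "V \<xi> (h n) t"] Vb[of "\<eta> n" "h n" t] Vb[of \<xi> "h n" t]
        unfolding two d_def by simp
    next
      case False
      then show ?thesis using K by (simp add: d_def)
    qed
    show "norm (H n s) \<le> L * norm (d n s) + norm (h n) * r n s" for n s
    proof (cases "s < 0")
      case True
      have "H n s = fd (exp (a s) *\<^sub>R z (\<eta> n) s) (d n s) + (A (\<eta> n) (V \<xi> (h n)) s - A \<xi> (V \<xi> (h n)) s)"
        using True by (simp add: H_def A_def d_def linear_diff[OF fd_linear])
      then have "norm (H n s) \<le> norm (fd (exp (a s) *\<^sub>R z (\<eta> n) s) (d n s)) + norm (A (\<eta> n) (V \<xi> (h n)) s - A \<xi> (V \<xi> (h n)) s)"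
        by (simp only: norm_triangle_ineq)
      then show ?thesis using norm_fd[of "exp (a s) *\<^sub>R z (\<eta> n) s" "d n s"] hn[of n] by (simp add: r_def)
    next
      case False
      then show ?thesis using L by (simp add: H_def A_def r_def)
    qed
    show "norm (d n t) \<le> norm (lp.conv (H n) t)" for n t
    proof (cases "t \<le> 0")
      case True
      have Vt: "V \<zeta> k t = eP t k + lp.conv (A \<zeta> (V \<zeta> k)) t" for \<zeta> k
        unfolding A_def[abs_def] by (rule vsolD[OF v True])
      have "V (\<eta> n) (h n) t - V \<xi> (h n) t = lp.conv (A (\<eta> n) (V (\<eta> n) (h n))) t - lp.conv (A \<xi> (V \<xi> (h n))) t"
        by (subst Vt[of "\<eta> n" "h n"], subst Vt[of \<xi> "h n"]) simp
      also have "\<dots> = lp.conv (H n) t"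
        unfolding H_def[abs_def] by (rule lp.conv_diff[OF Am Ab Am Ab])
      finally show ?thesis using True by (simp add: d_def)
    qed (simp add: d_def)
    show "0 \<le> r n s" for n s by (simp add: r_def)
    show "0 < norm (h n)" for n using hn by simp
  qed
  from order_tendstoD(2)[OF this \<epsilon>] obtain n where "norm (d n 0) / norm (h n) < \<epsilon>"
    by (auto simp: eventually_sequentially)
  then show False using h(2)[of n] hn[of n] by (simp add: d_def divide_less_eq)
qed

end

section \<open>The Ornstein-Uhlenbeck process along a path\<close>

text \<open>Sublinear growth is weakened to \<open>exp (- s / 2)\<close> so that, against the weight
  \<open>exp s\<close> of the Ornstein-Uhlenbeck integral, \<open>exp (s / 2)\<close> is left as an
  integrable majorant. The limit controls times near minus infinity, continuity the remaining
  compact interval.\<close>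

lemma path_growth:
  fixes \<omega> :: "real \<Rightarrow> real"
  assumes cont: "continuous_on UNIV \<omega>" and lim: "((\<lambda>t. \<omega> t / t) \<longlongrightarrow> 0) at_bot"
  obtains C where "0 \<le> C" "\<And>s. s \<le> R \<Longrightarrow> \<bar>\<omega> s\<bar> \<le> C * exp (- s / 2)"
proof -
  have "\<forall>\<^sub>F t in at_bot. dist (\<omega> t / t) 0 < 1" by (rule tendstoD[OF lim]) simp
  then obtain T0 where T0: "\<And>t. t \<le> T0 \<Longrightarrow> \<bar>\<omega> t / t\<bar> < 1" by (auto simp: eventually_at_bot_linorder)
  define T where "T = min T0 (- 1)"
  have "compact (\<omega> ` {T..R})"
    by (intro compact_continuous_image continuous_on_subset[OF cont]) auto
  from compact_imp_bounded[OF this] obtain B where "\<forall>v\<in>\<omega> ` {T..R}. norm v \<le> B"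
    unfolding bounded_iff by blast
  then have B: "\<bar>\<omega> s\<bar> \<le> B" if "T \<le> s" "s \<le> R" for s using that by simp
  have "\<bar>\<omega> s\<bar> \<le> (2 + \<bar>B\<bar> * exp (R / 2)) * exp (- s / 2)" if s: "s \<le> R" for s
  proof (cases "s \<le> T")
    case True
    then have s0: "s < 0" "s \<le> T0" by (auto simp: T_def)
    have "\<bar>s\<bar> > 0" using s0(1) by simp
    moreover have "\<bar>\<omega> s\<bar> / \<bar>s\<bar> < 1" using T0[OF s0(2)] by (simp only: abs_divide)
    ultimately have "\<bar>\<omega> s\<bar> < \<bar>s\<bar>" by (metis mult_1 pos_divide_less_eq)
    also have "\<dots> \<le> 2 * exp (- s / 2)" using exp_ge_add_one_self[of "- s / 2"] s0 by simp
    also have "\<dots> \<le> (2 + \<bar>B\<bar> * exp (R / 2)) * exp (- s / 2)" by (intro mult_right_mono) auto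
    finally show ?thesis by simp
  next
    case False
    then have "\<bar>\<omega> s\<bar> \<le> \<bar>B\<bar> * 1" using B[of s] s by simp
    also have "1 \<le> exp (R / 2) * exp (- s / 2)" using s by (simp add: exp_add[symmetric])
    then have "\<bar>B\<bar> * 1 \<le> \<bar>B\<bar> * (exp (R / 2) * exp (- s / 2))" by (intro mult_left_mono) auto
    also have "\<dots> \<le> (2 + \<bar>B\<bar> * exp (R / 2)) * exp (- s / 2)" by (simp add: distrib_right)
    finally show ?thesis .
  qed
  then show thesis by (intro that[of "2 + \<bar>B\<bar> * exp (R / 2)"]) auto
qed

lemma integrable_exp_half: "integrable lborel (\<lambda>s::real. indicator {..<0} s * exp (s / 2))"
proof -
  have "integrable lborel (\<lambda>\<tau>::real. indicator {0<..} \<tau> * (\<tau> powr (- 0) * exp (- (1/2) * \<tau>)))"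
    using has_bochner_integral_powr_exp[of 0 "1/2"] by (simp add: has_bochner_integral_iff)
  from lborel_integrable_real_affine[OF this, of "-1" 0]
  have "integrable lborel (\<lambda>s::real. indicator {0<..} (- s) * ((- s) powr (- 0) * exp (- (1/2) * (- s))))" by simp
  also have "(\<lambda>s::real. indicator {0<..} (- s) * ((- s) powr (- 0) * exp (- (1/2) * (- s)))) = (\<lambda>s. indicator {..<0} s * exp (s / 2))"
    by (auto simp: fun_eq_iff indicator_def)
  finally show ?thesis .
qed

lemma ou_shift_eq:
  "ou (path_shift r \<omega>) = - (LINT s|lborel. indicator {..<0} s *\<^sub>R (exp s * (\<omega> (r + s) - \<omega> r)))"
  by (simp add: ou_def path_shift_def interval_lebesgue_integral_def set_lebesgue_integral_def zero_ereal_def)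

lemma ou_shift_continuous:
  assumes cont: "continuous_on UNIV \<omega>" and lim: "((\<lambda>t. \<omega> t / t) \<longlongrightarrow> 0) at_bot"
  shows "isCont (\<lambda>r. ou (path_shift r \<omega>)) r"
  unfolding continuous_at_sequentially o_def ou_shift_eq
proof (intro allI impI tendsto_minus)
  fix x assume x: "x \<longlonglongrightarrow> r"
  have [measurable]: "\<omega> \<in> borel_measurable borel" by (rule borel_measurable_continuous_onI[OF cont])
  have c: "isCont \<omega> s" for s using cont by (simp add: continuous_on_eq_continuous_at)
  obtain B where B: "\<And>n. \<bar>x n\<bar> \<le> B"
    using convergent_imp_Bseq[OF convergentI[OF x]] by (auto simp: Bseq_def)
  obtain C where C: "0 \<le> C" "\<And>s. s \<le> B \<Longrightarrow> \<bar>\<omega> s\<bar> \<le> C * exp (- s / 2)" using path_growth[OF cont lim] by blast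
  show "(\<lambda>n. LINT s|lborel. indicator {..<0} s *\<^sub>R (exp s * (\<omega> (x n + s) - \<omega> (x n)))) \<longlonglongrightarrow>
      (LINT s|lborel. indicator {..<0} s *\<^sub>R (exp s * (\<omega> (r + s) - \<omega> r)))"
  proof (rule integral_dominated_convergence[where w = "\<lambda>s. (2 * C * exp (B / 2)) * (indicator {..<0} s * exp (s / 2))"])
    show "integrable lborel (\<lambda>s. (2 * C * exp (B / 2)) * (indicator {..<0} s * exp (s / 2)))"
      by (intro integrable_mult_right integrable_exp_half)
    show "AE s in lborel. (\<lambda>n. indicator {..<0} s *\<^sub>R (exp s * (\<omega> (x n + s) - \<omega> (x n)))) \<longlonglongrightarrow>
        indicator {..<0} s *\<^sub>R (exp s * (\<omega> (r + s) - \<omega> r))"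
    proof (rule AE_I2)
      fix s
      have "(\<lambda>n. \<omega> (x n + s)) \<longlonglongrightarrow> \<omega> (r + s)" "(\<lambda>n. \<omega> (x n)) \<longlonglongrightarrow> \<omega> r"
        using x by (auto intro!: isCont_tendsto_compose[OF c] tendsto_intros)
      then show "(\<lambda>n. indicator {..<0} s *\<^sub>R (exp s * (\<omega> (x n + s) - \<omega> (x n)))) \<longlonglongrightarrow>
          indicator {..<0} s *\<^sub>R (exp s * (\<omega> (r + s) - \<omega> r))"
        by (intro tendsto_intros)
    qed
    show "AE s in lborel. norm (indicator {..<0} s *\<^sub>R (exp s * (\<omega> (x n + s) - \<omega> (x n)))) \<le>
        (2 * C * exp (B / 2)) * (indicator {..<0} s * exp (s / 2))" for n
    proof (rule AE_I2)
      fix s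
      show "norm (indicator {..<0} s *\<^sub>R (exp s * (\<omega> (x n + s) - \<omega> (x n)))) \<le>
        (2 * C * exp (B / 2)) * (indicator {..<0} s * exp (s / 2))"
      proof (cases "s < 0")
        case True
        have xb: "- B \<le> x n" "x n \<le> B" using B[of n] by auto
        have "exp s * \<bar>\<omega> (x n + s)\<bar> \<le> exp s * (C * exp (- (x n + s) / 2))"
          using xb True by (intro mult_left_mono C) auto
        also have "\<dots> = C * (exp (- x n / 2) * exp (s / 2))"
        proof -
          have "exp s * exp (- (x n + s) / 2) = exp (- x n / 2) * exp (s / 2)"
            unfolding exp_add[symmetric] by (simp add: field_simps)
          then show ?thesis by simp
        qed
        also have "\<dots> \<le> C * (exp (B / 2) * exp (s / 2))"
          using xb C(1) by (intro mult_left_mono mult_right_mono) auto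
        finally have 1: "exp s * \<bar>\<omega> (x n + s)\<bar> \<le> C * (exp (B / 2) * exp (s / 2))" .
        have "exp s * \<bar>\<omega> (x n)\<bar> \<le> exp (s / 2) * (C * exp (B / 2))"
        proof (rule mult_mono)
          have "\<bar>\<omega> (x n)\<bar> \<le> C * exp (- x n / 2)" using xb by (intro C)
          also have "\<dots> \<le> C * exp (B / 2)" using xb C(1) by (intro mult_left_mono) auto
          finally show "\<bar>\<omega> (x n)\<bar> \<le> C * exp (B / 2)" .
        qed (use True in auto)
        then have 2: "exp s * \<bar>\<omega> (x n)\<bar> \<le> C * (exp (B / 2) * exp (s / 2))" by (simp add: mult_ac)
        have "norm (indicator {..<0} s *\<^sub>R (exp s * (\<omega> (x n + s) - \<omega> (x n)))) = exp s * \<bar>\<omega> (x n + s) - \<omega> (x n)\<bar>"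
          using True by (simp add: abs_mult)
        also have "\<dots> \<le> exp s * (\<bar>\<omega> (x n + s)\<bar> + \<bar>\<omega> (x n)\<bar>)"
          by (intro mult_left_mono abs_triangle_ineq4) simp
        also have "\<dots> \<le> C * (exp (B / 2) * exp (s / 2)) + C * (exp (B / 2) * exp (s / 2))"
          using 1 2 by (simp add: distrib_left)
        finally show ?thesis using True by (simp add: mult_ac)
      qed simp
    qed
  qed measurable
qed

lemma path_shift_path_shift: "path_shift r (path_shift \<tau> \<omega>) = path_shift (\<tau> + r) \<omega>"
  by (auto simp: path_shift_def fun_eq_iff add.assoc)

lemma path_shift_0: "\<omega> 0 = 0 \<Longrightarrow> path_shift 0 \<omega> = \<omega>"
  by (simp add: path_shift_def)

lemma interval_integral_translate:
  fixes \<phi> :: "real \<Rightarrow> real" and x y :: real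
  shows "(LBINT r=ereal x..ereal y. \<phi> (\<tau> + r)) = (LBINT r=ereal (\<tau> + x)..ereal (\<tau> + y). \<phi> r)"
proof -
  have "(LINT r:{x<..<y}|lborel. \<phi> (\<tau> + r)) = (LINT r:{\<tau> + x<..<\<tau> + y}|lborel. \<phi> r)" for x y
    unfolding set_lebesgue_integral_def
    by (subst lborel_integral_real_affine[of 1 "\<lambda>r. indicator {\<tau> + x<..<\<tau> + y} r *\<^sub>R \<phi> r" \<tau>])
      (auto intro!: Bochner_Integration.integral_cong simp: indicator_def)
  then show ?thesis by (simp add: interval_lebesgue_integral_def)
qed

locale ou_path =
  fixes \<omega> :: path
  assumes cont: "continuous_on UNIV \<omega>" and lim: "((\<lambda>t. \<omega> t / t) \<longlongrightarrow> 0) at_bot"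
begin

lemma ou_int_diff: "ou_int \<omega> s t = ou_int \<omega> 0 t - ou_int \<omega> 0 s"
proof -
  have "(LBINT r=ereal 0..ereal s. ou (path_shift r \<omega>)) + (LBINT r=ereal s..ereal t. ou (path_shift r \<omega>)) = (LBINT r=ereal 0..ereal t. ou (path_shift r \<omega>))"
  proof (rule interval_integral_sum)
    have "interval_lebesgue_integrable lborel (ereal (min 0 (min s t))) (ereal (max 0 (max s t))) (\<lambda>r. ou (path_shift r \<omega>))"
      by (rule interval_integrable_isCont) (rule ou_shift_continuous[OF cont lim])
    then show "interval_lebesgue_integrable lborel (min (ereal 0) (min (ereal s) (ereal t))) (max (ereal 0) (max (ereal s) (ereal t))) (\<lambda>r. ou (path_shift r \<omega>))"
      by (simp only: ereal_min ereal_max)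
  qed
  then show ?thesis by (simp add: ou_int_def)
qed

lemma ou_int_0 [simp]: "ou_int \<omega> 0 0 = 0"
  by (simp add: ou_int_def)

lemma ou_int_shift: "ou_int (path_shift \<tau> \<omega>) 0 t = ou_int \<omega> 0 (\<tau> + t) - ou_int \<omega> 0 \<tau>"
proof -
  have "ou_int (path_shift \<tau> \<omega>) 0 t = ou_int \<omega> \<tau> (\<tau> + t)"
    unfolding ou_int_def path_shift_path_shift
    using interval_integral_translate[of 0 t "\<lambda>r. ou (path_shift r \<omega>)" \<tau>] by simp
  then show ?thesis by (simp add: ou_int_diff[of \<tau>])
qed

lemma ou_int_continuous: "isCont (ou_int \<omega> 0) t"
proof -
  \<comment> \<open>The margin 1 places \<open>t\<close> in the interior, so that the derivative
    within the interval is a derivative in the usual sense.\<close>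
  let ?a = "min 0 t - 1" and ?b = "max 0 t + 1"
  have "((\<lambda>u. LBINT y=ereal 0..ereal u. ou (path_shift y \<omega>)) has_vector_derivative ou (path_shift t \<omega>)) (at t within {?a..?b})"
    by (rule interval_integral_FTC2) (auto intro!: continuous_at_imp_continuous_on ou_shift_continuous[OF cont lim])
  then have "((\<lambda>u. LBINT y=ereal 0..ereal u. ou (path_shift y \<omega>)) has_vector_derivative ou (path_shift t \<omega>)) (at t)"
    by (subst (asm) at_within_interior) auto
  then show ?thesis unfolding ou_int_def[abs_def] by (rule has_vector_derivative_continuous)
qed

end

section \<open>Measurable dependence on the path\<close>

locale noise =
  fixes W Pr :: "path measure" and \<Omega> :: "path set"
  assumes W_space: "space W = wiener_paths"
    and W_sets: "sets W = sets (restrict_space (Pi\<^sub>M UNIV (\<lambda>_. borel)) wiener_paths)"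
    and good: "good_paths W \<Omega>"
    and Pr_def: "Pr = restrict_space W \<Omega>"
begin

lemma \<Omega>_sub: "\<Omega> \<subseteq> wiener_paths"
  using good sets.sets_into_space[of \<Omega> W] by (auto simp: good_paths_def W_space)

lemma space_Pr: "space Pr = \<Omega>"
  using \<Omega>_sub by (auto simp: Pr_def space_restrict_space W_space)

lemma \<Omega>_shift: "\<omega> \<in> \<Omega> \<Longrightarrow> path_shift t \<omega> \<in> \<Omega>"
  using good by (auto simp: good_paths_def)

lemma \<Omega>_path: "\<omega> \<in> \<Omega> \<Longrightarrow> ou_path \<omega>"
  using good \<Omega>_sub by (auto simp: good_paths_def ou_path_def wiener_paths_def)

lemma \<Omega>_0: "\<omega> \<in> \<Omega> \<Longrightarrow> path_shift 0 \<omega> = \<omega>"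
  using \<Omega>_sub by (intro path_shift_0) (auto simp: wiener_paths_def)

lemma coordinate_measurable: "(\<lambda>\<omega>. \<omega> s) \<in> borel_measurable Pr"
proof -
  have "(\<lambda>\<omega>. \<omega> s) \<in> borel_measurable (restrict_space (Pi\<^sub>M UNIV (\<lambda>_. borel)) wiener_paths)"
    by (intro measurable_restrict_space1 measurable_component_singleton) auto
  then have "(\<lambda>\<omega>. \<omega> s) \<in> borel_measurable W"
    by (simp cong: measurable_cong_sets add: W_sets)
  then show ?thesis unfolding Pr_def by (rule measurable_restrict_space1)
qed

text \<open>The sigma-algebra provides evaluations at fixed times only. Rounding the random time to
  multiples of \<open>1 / Suc n\<close> leaves countably many of them, and continuity of the paths
  recovers the evaluation at \<open>r x\<close> in the limit.\<close>

lemma evaluation_measurable: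
  assumes p: "p \<in> M \<rightarrow>\<^sub>M Pr" and r: "r \<in> borel_measurable M"
  shows "(\<lambda>x. p x (r x)) \<in> borel_measurable M"
proof (rule borel_measurable_LIMSEQ_real)
  fix x assume x: "x \<in> space M"
  have c: "isCont (p x) (r x)"
    using measurable_space[OF p x] \<Omega>_sub by (auto simp: space_Pr wiener_paths_def continuous_on_eq_continuous_at)
  have "(\<lambda>n. of_int \<lfloor>real (Suc n) * r x\<rfloor> / real (Suc n)) \<longlonglongrightarrow> r x"
  proof (rule LIMSEQ_I)
    fix \<epsilon> :: real assume "0 < \<epsilon>"
    then obtain n0 where n0: "1 / real (Suc n0) < \<epsilon>" using nat_approx_posE by blast
    have "norm (of_int \<lfloor>real (Suc n) * r x\<rfloor> / real (Suc n) - r x) < \<epsilon>" if n: "n \<ge> n0" for n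
    proof -
      have "\<bar>of_int \<lfloor>real (Suc n) * r x\<rfloor> - real (Suc n) * r x\<bar> \<le> 1" by linarith
      then have "\<bar>of_int \<lfloor>real (Suc n) * r x\<rfloor> - real (Suc n) * r x\<bar> / real (Suc n) \<le> 1 / real (Suc n)"
        by (rule divide_right_mono) simp
      moreover have "\<bar>of_int \<lfloor>real (Suc n) * r x\<rfloor> - real (Suc n) * r x\<bar> / real (Suc n) = \<bar>of_int \<lfloor>real (Suc n) * r x\<rfloor> / real (Suc n) - r x\<bar>"
      proof -
        have "of_int \<lfloor>real (Suc n) * r x\<rfloor> / real (Suc n) - r x = (of_int \<lfloor>real (Suc n) * r x\<rfloor> - real (Suc n) * r x) / real (Suc n)"
          by (simp add: diff_divide_distrib)
        then show ?thesis by (simp add: abs_divide)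
      qed
      moreover have "1 / real (Suc n) \<le> 1 / real (Suc n0)" using n by (intro divide_left_mono) auto
      ultimately show ?thesis using n0 by simp
    qed
    then show "\<exists>no. \<forall>n\<ge>no. norm (of_int \<lfloor>real (Suc n) * r x\<rfloor> / real (Suc n) - r x) < \<epsilon>" by blast
  qed
  then show "(\<lambda>n. p x (of_int \<lfloor>real (Suc n) * r x\<rfloor> / real (Suc n))) \<longlonglongrightarrow> p x (r x)"
    by (rule isCont_tendsto_compose[OF c])
next
  fix n
  show "(\<lambda>x. p x (of_int \<lfloor>real (Suc n) * r x\<rfloor> / real (Suc n))) \<in> borel_measurable M"
  proof (rule measurable_compose_countable[where f = "\<lambda>m x. p x (of_int m / real (Suc n))"])
    show "(\<lambda>x. p x (of_int m / real (Suc n))) \<in> borel_measurable M" for m :: int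
      by (rule measurable_compose[OF p coordinate_measurable])
    show "(\<lambda>x. \<lfloor>real (Suc n) * r x\<rfloor>) \<in> M \<rightarrow>\<^sub>M count_space UNIV"
      using r by measurable
  qed
qed

lemma ou_measurable:
  assumes p: "p \<in> M \<rightarrow>\<^sub>M Pr" and r: "r \<in> borel_measurable M"
  shows "(\<lambda>x. ou (path_shift (r x) (p x))) \<in> borel_measurable M"
proof -
  have p': "(\<lambda>y. p (fst y)) \<in> M \<Otimes>\<^sub>M lborel \<rightarrow>\<^sub>M Pr" by (rule measurable_compose[OF measurable_fst p])
  have r': "(\<lambda>y. r (fst y)) \<in> borel_measurable (M \<Otimes>\<^sub>M lborel)" by (rule measurable_compose[OF measurable_fst r])
  have s': "(\<lambda>y. snd y) \<in> borel_measurable (M \<Otimes>\<^sub>M lborel)" by simp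
  have [measurable]: "(\<lambda>y. p (fst y) (r (fst y) + snd y)) \<in> borel_measurable (M \<Otimes>\<^sub>M lborel)"
    "(\<lambda>y. p (fst y) (r (fst y))) \<in> borel_measurable (M \<Otimes>\<^sub>M lborel)"
    by (rule evaluation_measurable[OF p' borel_measurable_add[OF r' s']], rule evaluation_measurable[OF p' r'])
  have "(\<lambda>(x, s). indicator {..<0} s *\<^sub>R (exp s * (p x (r x + s) - p x (r x)))) \<in> borel_measurable (M \<Otimes>\<^sub>M lborel)"
    unfolding split_beta' by measurable
  from lborel.borel_measurable_lebesgue_integral[OF this] show ?thesis
    unfolding ou_shift_eq by simp
qed

lemma ou_int_measurable:
  assumes p: "p \<in> M \<rightarrow>\<^sub>M Pr" and r: "r \<in> borel_measurable M"
  shows "(\<lambda>x. ou_int (p x) 0 (r x)) \<in> borel_measurable M"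
proof -
  have p': "(\<lambda>y. p (fst y)) \<in> M \<Otimes>\<^sub>M lborel \<rightarrow>\<^sub>M Pr" by (rule measurable_compose[OF measurable_fst p])
  have [measurable]: "(\<lambda>y. r (fst y)) \<in> borel_measurable (M \<Otimes>\<^sub>M lborel)" by (rule measurable_compose[OF measurable_fst r])
  have [measurable]: "(\<lambda>y. ou (path_shift (snd y) (p (fst y)))) \<in> borel_measurable (M \<Otimes>\<^sub>M lborel)"
    by (rule ou_measurable[OF p']) simp
  have "(\<lambda>(x, s). (if 0 < s \<and> s < r x then 1 else 0) *\<^sub>R ou (path_shift s (p x))) \<in> borel_measurable (M \<Otimes>\<^sub>M lborel)"
    "(\<lambda>(x, s). (if r x < s \<and> s < 0 then 1 else 0) *\<^sub>R ou (path_shift s (p x))) \<in> borel_measurable (M \<Otimes>\<^sub>M lborel)"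
    unfolding split_beta' by measurable
  note i = this[THEN lborel.borel_measurable_lebesgue_integral]
  have eq: "ou_int (p x) 0 (r x) = (if 0 \<le> r x then (LINT s|lborel. (if 0 < s \<and> s < r x then 1 else 0) *\<^sub>R ou (path_shift s (p x)))
      else - (LINT s|lborel. (if r x < s \<and> s < 0 then 1 else 0) *\<^sub>R ou (path_shift s (p x))))" for x
    by (auto simp: ou_int_def interval_lebesgue_integral_def set_lebesgue_integral_def indicator_def
        intro!: Bochner_Integration.integral_cong)
  show ?thesis unfolding eq using i r by (intro measurable_If borel_measurable_uminus) simp_all
qed

end

text \<open>\<open>K\<close> is the supremum over rational times, measurable because it is
  countable. It is finite by compactness together with the bound at infinity, and continuity in
  \<open>t\<close> extends the estimate to real times.\<close>

lemma sup_bound_measurable: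
  fixes \<phi> :: "'w \<Rightarrow> real \<Rightarrow> real"
  assumes m: "\<And>t. 0 \<le> t \<Longrightarrow> (\<lambda>\<omega>. \<phi> \<omega> t) \<in> borel_measurable M"
    and c: "\<And>\<omega> t. \<omega> \<in> space M \<Longrightarrow> isCont (\<phi> \<omega>) t"
    and b: "\<And>\<omega>. \<omega> \<in> space M \<Longrightarrow> \<forall>\<^sub>F t in at_top. \<phi> \<omega> t \<le> 1"
  obtains K where "K \<in> borel_measurable M" "\<And>\<omega> t. \<omega> \<in> space M \<Longrightarrow> 0 \<le> t \<Longrightarrow> \<phi> \<omega> t \<le> K \<omega>"
proof -
  let ?I = "\<rat> \<inter> {0::real..}"
  have bdd: "bdd_above (\<phi> \<omega> ` {0..})" if \<omega>: "\<omega> \<in> space M" for \<omega>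
  proof -
    obtain T where T: "\<And>t. T \<le> t \<Longrightarrow> \<phi> \<omega> t \<le> 1" using b[OF \<omega>] by (auto simp: eventually_at_top_linorder)
    have "compact (\<phi> \<omega> ` {0..T})"
      by (intro compact_continuous_image continuous_at_imp_continuous_on ballI c[OF \<omega>]) auto
    from bounded_imp_bdd_above[OF compact_imp_bounded[OF this]]
    obtain B where "\<forall>v\<in>\<phi> \<omega> ` {0..T}. v \<le> B" unfolding bdd_above_def by blast
    then have B: "\<phi> \<omega> t \<le> B" if "0 \<le> t" "t \<le> T" for t using that by simp
    show ?thesis
    proof (rule bdd_aboveI2)
      fix t :: real assume "t \<in> {0..}"
      then show "\<phi> \<omega> t \<le> max B 1" using B[of t] T[of t] by (cases "t \<le> T") auto
    qed
  qed
  show thesis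
  proof (rule that)
    show "(\<lambda>\<omega>. SUP t\<in>?I. \<phi> \<omega> t) \<in> borel_measurable M"
    proof (rule borel_measurable_cSUP)
      show "countable ?I" using countable_rat by (rule countable_Int1)
      show "(\<lambda>\<omega>. \<phi> \<omega> t) \<in> borel_measurable M" if "t \<in> ?I" for t using m[of t] that by simp
      show "bdd_above ((\<lambda>t. \<phi> \<omega> t) ` ?I)" if "\<omega> \<in> space M" for \<omega>
        by (rule bdd_above_mono[OF bdd[OF that]]) auto
    qed
    fix \<omega> and t :: real assume \<omega>: "\<omega> \<in> space M" and t: "0 \<le> t"
    show "\<phi> \<omega> t \<le> (SUP t\<in>?I. \<phi> \<omega> t)"
    proof (rule ccontr)
      assume "\<not> ?thesis"
      then have gt: "(SUP t\<in>?I. \<phi> \<omega> t) < \<phi> \<omega> t" by simp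
      have "((\<phi> \<omega>) \<longlongrightarrow> \<phi> \<omega> t) (at t)" using c[OF \<omega>, of t] by (simp add: isCont_def)
      from order_tendstoD(1)[OF this gt] obtain d where d: "d > 0"
        "\<And>s. s \<noteq> t \<Longrightarrow> dist s t < d \<Longrightarrow> (SUP t\<in>?I. \<phi> \<omega> t) < \<phi> \<omega> s"
        by (auto simp: eventually_at)
      obtain s where s: "s \<in> \<rat>" "t < s" "s < t + d" using Rats_dense_in_real[of t "t + d"] d(1) by auto
      have "\<phi> \<omega> s \<le> (SUP t\<in>?I. \<phi> \<omega> t)"
        by (rule cSUP_upper) (use s t in \<open>auto intro: bdd_above_mono[OF bdd[OF \<omega>]]\<close>)
      moreover have "(SUP t\<in>?I. \<phi> \<omega> t) < \<phi> \<omega> s" using s by (intro d) (auto simp: dist_real_def)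
      ultimately show False by simp
    qed
  qed
qed

section \<open>Translation to the original equations\<close>

context inertial begin

text \<open>A metric in the sense of \<open>Metric_space\<close> is symmetric on the whole type,
  also off \<open>D\<close>, where the series defining \<open>n\<sigma>\<close> may diverge. In that
  case neither series has a sum, and both sides are built from the same default value.\<close>

lemma n\<sigma>_minus_commute: "n\<sigma> (x - y) = n\<sigma> (y - x)"
proof -
  let ?c = "\<lambda>k. (l k powr \<sigma> * ((x - y) \<bullet> b k)) *\<^sub>R b k"
  have e: "J (x - y) = (\<Sum>k. ?c k)" "J (y - x) = (\<Sum>k. - ?c k)"
    by (simp_all add: J_def diag_def inner_diff_left algebra_simps)
  show ?thesis
  proof (cases "summable ?c")
    case True
    then have "J (y - x) = - J (x - y)" unfolding e by (simp only: suminf_minus)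
    then show ?thesis by (simp add: n\<sigma>_J)
  next
    case False
    then have "\<not> summable (\<lambda>k. - ?c k)" by (simp only: summable_minus_iff not_False_eq_True)
    then have "\<not> (\<lambda>k. - ?c k) sums s" "\<not> ?c sums s" for s using False by (auto simp: summable_def)
    then have "(\<lambda>s. ?c sums s) = (\<lambda>s. (\<lambda>k. - ?c k) sums s)" by blast
    then have "J (y - x) = J (x - y)" unfolding e suminf_def by (simp only:)
    then show ?thesis by (simp add: n\<sigma>_J)
  qed
qed

section \<open>The phase space: topology and Borel structure\<close>

lemma Metric_space_D: "Metric_space D (\<lambda>x y. n\<sigma> (x - y))"
proof (rule Metric_space.intro)
  show "n\<sigma> (x - y) = 0 \<longleftrightarrow> x = y" if "x \<in> D" "y \<in> D" for x y
    using that by (simp add: n\<sigma>_J J_diff) (metis Ji_J)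
  show "n\<sigma> (x - z) \<le> n\<sigma> (x - y) + n\<sigma> (y - z)" if "x \<in> D" "y \<in> D" "z \<in> D" for x y z
    using that norm_triangle_ineq[of "J x - J y" "J y - J z"] by (simp add: n\<sigma>_J J_diff)
qed (simp_all add: n\<sigma>_J n\<sigma>_minus_commute[unfolded n\<sigma>_J])

text \<open>\<open>Ji\<close> maps \<open>H\<close> isometrically onto \<open>D\<close>, so
  topology, continuity and Borel sets of the phase space are those of \<open>H\<close> read through
  \<open>Ji\<close>.\<close>

lemma openin_D: "openin (norm_topology D n\<sigma>) U \<longleftrightarrow> U \<subseteq> D \<and> open (Ji -` U)"
proof -
  interpret D: Metric_space D "\<lambda>x y. n\<sigma> (x - y)" by (rule Metric_space_D)
  have "(\<forall>x. x \<in> U \<longrightarrow> (\<exists>r>0. D.mball x r \<subseteq> U)) \<longleftrightarrow> open (Ji -` U)" if U: "U \<subseteq> D"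
  proof
    assume o: "\<forall>x. x \<in> U \<longrightarrow> (\<exists>r>0. D.mball x r \<subseteq> U)"
    show "open (Ji -` U)"
      unfolding open_contains_ball
    proof
      fix v assume "v \<in> Ji -` U"
      then obtain r where r: "r > 0" "D.mball (Ji v) r \<subseteq> U" using o by auto
      have "ball v r \<subseteq> Ji -` U"
      proof
        fix v' assume "v' \<in> ball v r"
        then have "n\<sigma> (Ji v - Ji v') < r" by (simp add: n\<sigma>_J J_diff dist_norm)
        then have "Ji v' \<in> D.mball (Ji v) r" by simp
        then show "v' \<in> Ji -` U" using r by auto
      qed
      then show "\<exists>r>0. ball v r \<subseteq> Ji -` U" using r by blast
    qed
  next
    assume o: "open (Ji -` U)"
    show "\<forall>x. x \<in> U \<longrightarrow> (\<exists>r>0. D.mball x r \<subseteq> U)"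
    proof (intro allI impI)
      fix x assume x: "x \<in> U"
      then have xD: "x \<in> D" using U by auto
      then have "J x \<in> Ji -` U" using x by (simp add: Ji_J)
      then obtain r where r: "r > 0" "ball (J x) r \<subseteq> Ji -` U" using o open_contains_ball by blast
      have "D.mball x r \<subseteq> U"
      proof
        fix x' assume "x' \<in> D.mball x r"
        then have "x' \<in> D" "n\<sigma> (x - x') < r" by simp_all
        then have x': "x' \<in> D" "J x' \<in> ball (J x) r" using xD by (simp_all add: n\<sigma>_J J_diff dist_norm)
        then have "Ji (J x') \<in> U" using r by auto
        then show "x' \<in> U" using x' by (simp add: Ji_J)
      qed
      then show "\<exists>r>0. D.mball x r \<subseteq> U" using r by blast
    qed
  qed
  then show ?thesis unfolding norm_topology_def D.openin_mtopology by blast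
qed

lemma topspace_D: "topspace (norm_topology D n\<sigma>) = D"
proof -
  interpret D: Metric_space D "\<lambda>x y. n\<sigma> (x - y)" by (rule Metric_space_D)
  show ?thesis by (simp add: norm_topology_def)
qed

lemma closedin_D:
  assumes "C \<subseteq> D" "closed (Ji -` C)" shows "closedin (norm_topology D n\<sigma>) C"
proof -
  have "Ji -` (D - C) = - (Ji -` C)" by auto
  then show ?thesis using assms by (auto simp: closedin_def topspace_D openin_D)
qed

lemma continuous_map_D:
  "continuous_map (top_of_set A) (norm_topology D n\<sigma>) w \<longleftrightarrow> w \<in> A \<rightarrow> D \<and> continuous_on A (\<lambda>t. J (w t))"
proof
  assume w: "continuous_map (top_of_set A) (norm_topology D n\<sigma>) w"
  then have wD: "w \<in> A \<rightarrow> D" by (auto simp: continuous_map_def topspace_D)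
  moreover have "continuous_on A (\<lambda>t. J (w t))"
    unfolding continuous_openin_preimage_eq
  proof (intro allI impI)
    fix B :: "'h set" assume B: "open B"
    have "Ji -` (Ji ` B) = B" by (auto dest: arg_cong[where f = J])
    then have "openin (norm_topology D n\<sigma>) (Ji ` B)" using B by (auto simp: openin_D)
    then have "openin (top_of_set A) {x \<in> topspace (top_of_set A). w x \<in> Ji ` B}"
      using w unfolding continuous_map_def by blast
    also have "{x \<in> topspace (top_of_set A). w x \<in> Ji ` B} = A \<inter> (\<lambda>t. J (w t)) -` B"
      using wD Ji_J by (auto simp: image_iff Pi_iff) metis
    finally show "openin (top_of_set A) (A \<inter> (\<lambda>t. J (w t)) -` B)" .
  qed
  ultimately show "w \<in> A \<rightarrow> D \<and> continuous_on A (\<lambda>t. J (w t))" ..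
next
  assume w: "w \<in> A \<rightarrow> D \<and> continuous_on A (\<lambda>t. J (w t))"
  show "continuous_map (top_of_set A) (norm_topology D n\<sigma>) w"
    unfolding continuous_map_def topspace_D
  proof (intro conjI allI impI)
    show "w \<in> topspace (top_of_set A) \<rightarrow> D" using w by simp
    fix U assume U: "openin (norm_topology D n\<sigma>) U"
    have "openin (top_of_set A) (A \<inter> (\<lambda>t. J (w t)) -` (Ji -` U))"
      using w U unfolding continuous_openin_preimage_eq openin_D by blast
    also have "A \<inter> (\<lambda>t. J (w t)) -` (Ji -` U) = {x \<in> topspace (top_of_set A). w x \<in> U}"
      using w by (auto simp: Ji_J Pi_iff)
    finally show "openin (top_of_set A) {x \<in> topspace (top_of_set A). w x \<in> U}" .
  qed
qed

lemma space_norm_borel: "space (norm_borel D n\<sigma>) = D"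
  unfolding norm_borel_def by (rule space_measure_of) (auto simp: openin_D)

lemma J_measurable: "J \<in> borel_measurable (norm_borel D n\<sigma>)"
proof (rule borel_measurableI)
  fix B :: "'h set" assume B: "open B"
  have "Ji -` (J -` B \<inter> D) = B" by auto
  then have "J -` B \<inter> D \<in> {U. openin (norm_topology D n\<sigma>) U}" using B by (simp add: openin_D)
  then show "J -` B \<inter> space (norm_borel D n\<sigma>) \<in> sets (norm_borel D n\<sigma>)"
    unfolding space_norm_borel unfolding norm_borel_def
    by (subst sets_measure_of) (auto simp: openin_D)
qed

lemma Ji_measurable: "Ji \<in> borel \<rightarrow>\<^sub>M norm_borel D n\<sigma>"
  unfolding norm_borel_def
  by (rule measurable_measure_of) (auto simp: openin_D)

lemma measurable_norm_borel:
  "w \<in> M \<rightarrow>\<^sub>M norm_borel D n\<sigma> \<longleftrightarrow> w \<in> space M \<rightarrow> D \<and> (\<lambda>x. J (w x)) \<in> borel_measurable M"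
proof
  assume w: "w \<in> M \<rightarrow>\<^sub>M norm_borel D n\<sigma>"
  then show "w \<in> space M \<rightarrow> D \<and> (\<lambda>x. J (w x)) \<in> borel_measurable M"
    using measurable_compose[OF w J_measurable] measurable_space[OF w] by (auto simp: space_norm_borel)
next
  assume w: "w \<in> space M \<rightarrow> D \<and> (\<lambda>x. J (w x)) \<in> borel_measurable M"
  then have "(\<lambda>x. Ji (J (w x))) \<in> M \<rightarrow>\<^sub>M norm_borel D n\<sigma>"
    by (intro measurable_compose[OF _ Ji_measurable]) auto
  also have "(\<lambda>x. Ji (J (w x))) \<in> M \<rightarrow>\<^sub>M norm_borel D n\<sigma> \<longleftrightarrow> w \<in> M \<rightarrow>\<^sub>M norm_borel D n\<sigma>"
    using w by (intro measurable_cong) (auto simp: Ji_J Pi_iff)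
  finally show "w \<in> M \<rightarrow>\<^sub>M norm_borel D n\<sigma>" .
qed

definition H1 :: "'h set" where "H1 = projP e N ` D"
definition H2 :: "'h set" where "H2 = projQ e N ` D"

lemma H1_iff: "\<xi> \<in> H1 \<longleftrightarrow> \<xi> \<in> D \<and> P (J \<xi>) = J \<xi>"
proof
  assume "\<xi> \<in> H1"
  then obtain v where "\<xi> = P (Ji v)" by (auto simp: H1_def P_def D_eq)
  then have "\<xi> = Ji (P v)" by (simp add: Ji_P)
  then show "\<xi> \<in> D \<and> P (J \<xi>) = J \<xi>" by simp
next
  assume "\<xi> \<in> D \<and> P (J \<xi>) = J \<xi>"
  then have "\<xi> = P (Ji (J \<xi>))" by (metis Ji_J Ji_P)
  then show "\<xi> \<in> H1" unfolding H1_def P_def[symmetric] using Ji_in_D by blast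
qed

lemma H2_iff: "\<xi> \<in> H2 \<longleftrightarrow> \<xi> \<in> D \<and> Q (J \<xi>) = J \<xi>"
proof
  assume "\<xi> \<in> H2"
  then obtain v where "\<xi> = Q (Ji v)" by (auto simp: H2_def Q_def D_eq)
  then have "\<xi> = Ji (Q v)" by (simp add: Ji_Q)
  then show "\<xi> \<in> D \<and> Q (J \<xi>) = J \<xi>" by simp
next
  assume "\<xi> \<in> D \<and> Q (J \<xi>) = J \<xi>"
  then have "\<xi> = Q (Ji (J \<xi>))" by (metis Ji_J Ji_Q)
  then show "\<xi> \<in> H2" unfolding H2_def Q_def[symmetric] using Ji_in_D by blast
qed

lemma H1_D: "\<xi> \<in> H1 \<Longrightarrow> \<xi> \<in> D" and H2_D: "\<xi> \<in> H2 \<Longrightarrow> \<xi> \<in> D"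
  by (simp_all add: H1_iff H2_iff)

section \<open>From the integral equations to convolutions\<close>

lemma semigroup_op_eq: "semigroup_op lam e \<tau> = S \<tau>"
  by (simp add: semigroup_op_def spec_op_diag S_def mult.commute)

lemma S_P: "S \<tau> (P x) = eP \<tau> x"
  unfolding S_def eP_def diag_def P_inner by (rule arg_cong[where f = suminf]) auto

lemma S_Q: "S \<tau> (Q x) = eQ \<tau> x"
  unfolding S_def eQ_def diag_def Q_inner by (rule arg_cong[where f = suminf]) auto

text \<open>Removing the factor \<open>A\<^sup>\<sigma>\<close> returns the kernels of the original
  integral equations; on negative times the minus sign stays.\<close>

lemma Ji_kernel:
  "0 < \<tau> \<Longrightarrow> Ji (diag (kc \<tau>) v) = eQ \<tau> v"
  "\<tau> < 0 \<Longrightarrow> Ji (diag (kc \<tau>) v) = - eP \<tau> v"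
  "0 < \<tau> \<Longrightarrow> Ji (diag (kf \<tau>) v) = S \<tau> v"
proof -
  show "Ji (diag (kc \<tau>) v) = eQ \<tau> v" if "0 < \<tau>"
    using that powr_cancel'
    by (intro coeff_eqI) (auto simp: Ji_inner diag_inner[OF kc_bound] eQ_inner kc_def mult.assoc)
  show "Ji (diag (kc \<tau>) v) = - eP \<tau> v" if "\<tau> < 0"
    using that powr_cancel'
    by (intro coeff_eqI) (auto simp: Ji_inner diag_inner[OF kc_bound] eP_inner kc_def mult.assoc)
  show "Ji (diag (kf \<tau>) v) = S \<tau> v" if "0 < \<tau>"
    using that powr_cancel'
    by (intro coeff_eqI) (auto simp: Ji_inner diag_inner[OF kf_bound] S_inner kf_def mult.assoc)
qed

lemma Ji_semigroups: "Ji (eP t v) = eP t (Ji v)" "0 \<le> t \<Longrightarrow> Ji (S t v) = S t (Ji v)"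
  by (rule coeff_eqI, simp add: Ji_inner eP_inner S_inner)+

lemma eQ_scaleR: "0 \<le> t \<Longrightarrow> eQ t (c *\<^sub>R x) = c *\<^sub>R eQ t x"
  by (rule coeff_eqI) (simp add: eQ_inner)

lemma S_scaleR: "0 \<le> t \<Longrightarrow> S t (c *\<^sub>R x) = c *\<^sub>R S t x"
  by (rule coeff_eqI) (simp add: S_inner)

text \<open>The exponent \<open>a(t)\<close> of the overview: the noise factor inside
  \<open>G_map\<close> together with the one taken out by the change of unknown.\<close>

definition log_weight :: "path \<Rightarrow> real \<Rightarrow> real" where
  "log_weight \<omega> s = ou (path_shift s \<omega>) + ou_int \<omega> 0 s"

lemma G_map_eq:
  "G_map F (path_shift s \<omega>) (exp (ou_int \<omega> 0 s) *\<^sub>R Ji y) = exp (ou_int \<omega> 0 s) *\<^sub>R g (log_weight \<omega>) s y"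
proof -
  have e: "exp (ou_int \<omega> 0 s) * exp (- log_weight \<omega> s) = exp (- ou (path_shift s \<omega>))"
    "exp (ou (path_shift s \<omega>)) * exp (ou_int \<omega> 0 s) = exp (log_weight \<omega> s)"
    by (simp_all add: log_weight_def exp_add[symmetric])
  show ?thesis
    unfolding G_map_def g_def f_def scaleR_scaleR e Ji_scaleR ..
qed

text \<open>The change of unknown absorbs all noise factors of \<open>evol\<close>. For
  \<open>t \<le> 0\<close> the integral from 0 to \<open>t\<close> is minus the integral over
  \<open>{t<..<0}\<close>, which matches the minus sign of the kernel on negative times, and the two
  integrals merge into one convolution.\<close>

lemma backward_integrals:
  assumes \<omega>: "ou_path \<omega>" and t: "t \<le> 0"
    and h: "(\<lambda>s. indicator {..<0} s *\<^sub>R g (log_weight \<omega>) s (y s)) \<in> borel_measurable borel"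
      "\<And>s. norm (indicator {..<0} s *\<^sub>R g (log_weight \<omega>) s (y s)) \<le> C * exp (- \<beta> * s)"
    and w: "\<And>s. s \<le> 0 \<Longrightarrow> w s = exp (ou_int \<omega> 0 s) *\<^sub>R Ji (y s)"
  shows "interval_lebesgue_integrable lborel 0 (ereal t) (\<lambda>s. evol lam e \<omega> t s (projP e N (G_map F (path_shift s \<omega>) (w s))))"
      (is ?A)
    and "interval_lebesgue_integrable lborel (-\<infinity>) (ereal t) (\<lambda>s. evol lam e \<omega> t s (projQ e N (G_map F (path_shift s \<omega>) (w s))))"
      (is ?B)
    and "interval_lebesgue_integral lborel 0 (ereal t) (\<lambda>s. evol lam e \<omega> t s (projP e N (G_map F (path_shift s \<omega>) (w s)))) +
      interval_lebesgue_integral lborel (-\<infinity>) (ereal t) (\<lambda>s. evol lam e \<omega> t s (projQ e N (G_map F (path_shift s \<omega>) (w s)))) =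
      exp (ou_int \<omega> 0 t) *\<^sub>R Ji (lp.conv (\<lambda>s. indicator {..<0} s *\<^sub>R g (log_weight \<omega>) s (y s)) t)" (is ?C)
proof -
  interpret ou_path \<omega> by (rule \<omega>)
  let ?Z = "ou_int \<omega> 0"
  let ?h = "\<lambda>s. indicator {..<0} s *\<^sub>R g (log_weight \<omega>) s (y s)"
  let ?P = "\<lambda>s. evol lam e \<omega> t s (projP e N (G_map F (path_shift s \<omega>) (w s)))"
  let ?Q = "\<lambda>s. evol lam e \<omega> t s (projQ e N (G_map F (path_shift s \<omega>) (w s)))"
  let ?k = "\<lambda>s. diag (kc (t - s)) (?h s)"
  have i: "integrable lborel ?k" by (rule lp.conv_bound(1)[OF h])
  have G: "G_map F (path_shift s \<omega>) (w s) = exp (?Z s) *\<^sub>R g (log_weight \<omega>) s (y s)" if "s \<le> 0" for s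
    unfolding w[OF that] by (rule G_map_eq)
  have Zs: "exp (ou_int \<omega> s t) * exp (?Z s) = exp (?Z t)" for s
    unfolding ou_int_diff[of s t] by (simp add: exp_add[symmetric])
  have Q: "indicator {..<t} s *\<^sub>R ?Q s = exp (?Z t) *\<^sub>R Ji (indicator {..<t} s *\<^sub>R ?k s)" for s
  proof (cases "s < t")
    case True
    have "?Q s = exp (ou_int \<omega> s t) *\<^sub>R eQ (t - s) (exp (?Z s) *\<^sub>R g (log_weight \<omega>) s (y s))"
      using True t by (simp add: evol_def semigroup_op_eq Q_def[symmetric] S_Q G)
    also have "\<dots> = (exp (ou_int \<omega> s t) * exp (?Z s)) *\<^sub>R eQ (t - s) (g (log_weight \<omega>) s (y s))"
      using True by (simp add: eQ_scaleR)
    also have "\<dots> = exp (?Z t) *\<^sub>R Ji (?k s)"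
      unfolding Zs using True t by (simp add: Ji_kernel)
    finally show ?thesis using True by simp
  qed simp
  have P: "indicator {t<..<0} s *\<^sub>R ?P s = - (exp (?Z t) *\<^sub>R Ji (indicator {t<..<0} s *\<^sub>R ?k s))" for s
  proof (cases "t < s \<and> s < 0")
    case True
    have "?P s = exp (ou_int \<omega> s t) *\<^sub>R eP (t - s) (exp (?Z s) *\<^sub>R g (log_weight \<omega>) s (y s))"
      using True by (simp add: evol_def semigroup_op_eq P_def[symmetric] S_P G)
    also have "\<dots> = (exp (ou_int \<omega> s t) * exp (?Z s)) *\<^sub>R eP (t - s) (g (log_weight \<omega>) s (y s))"
      by (simp add: linear_scale[OF linear_eP])
    also have "\<dots> = - (exp (?Z t) *\<^sub>R Ji (?k s))"
      unfolding Zs using True by (simp add: Ji_kernel)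
    finally show ?thesis using True by simp
  qed auto
  have ik: "integrable lborel (\<lambda>s. indicator X s *\<^sub>R ?k s)" if "X \<in> sets borel" for X
    using i that by (intro integrable_mult_indicator) auto
  have iJ: "integrable lborel (\<lambda>s. exp (?Z t) *\<^sub>R Ji (indicator X s *\<^sub>R ?k s))" if "X \<in> sets borel" for X
    by (intro integrable_scaleR_right integrable_bounded_linear[OF bounded_linear_Ji] ik that)
  have eP0: "interval_lebesgue_integrable lborel 0 (ereal t) \<phi> \<longleftrightarrow> set_integrable lborel {t<..<0} \<phi>"
    "interval_lebesgue_integral lborel 0 (ereal t) \<phi> = - (LINT s:{t<..<0}|lborel. \<phi> s)" for \<phi> :: "real \<Rightarrow> 'h"
    using t by (auto simp: interval_lebesgue_integrable_def interval_lebesgue_integral_def zero_ereal_def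
      set_integrable_def set_lebesgue_integral_def)
  show ?A unfolding eP0 set_integrable_def P by (intro Bochner_Integration.integrable_minus iJ) simp
  show ?B unfolding interval_lebesgue_integrable_def set_integrable_def einterval_eq Q using iJ by simp
  have "interval_lebesgue_integral lborel 0 (ereal t) ?P + interval_lebesgue_integral lborel (-\<infinity>) (ereal t) ?Q =
      (LINT s|lborel. exp (?Z t) *\<^sub>R Ji (indicator {t<..<0} s *\<^sub>R ?k s)) + (LINT s|lborel. exp (?Z t) *\<^sub>R Ji (indicator {..<t} s *\<^sub>R ?k s))"
    unfolding eP0 set_lebesgue_integral_def P
    unfolding interval_lebesgue_integral_def set_lebesgue_integral_def einterval_eq Q by simp
  also have "\<dots> = (LINT s|lborel. exp (?Z t) *\<^sub>R Ji (indicator {t<..<0} s *\<^sub>R ?k s) + exp (?Z t) *\<^sub>R Ji (indicator {..<t} s *\<^sub>R ?k s))"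
    by (rule Bochner_Integration.integral_add[symmetric]) (intro iJ, simp)+
  also have "\<dots> = (LINT s|lborel. exp (?Z t) *\<^sub>R Ji (?k s))"
  proof (rule Bochner_Integration.integral_cong[OF refl])
    fix s
    have "diag (kc (t - s)) (?h s) = 0" if "s = t \<or> 0 \<le> s"
      using that by (auto simp: diag_def kc_def)
    then show "exp (?Z t) *\<^sub>R Ji (indicator {t<..<0} s *\<^sub>R ?k s) + exp (?Z t) *\<^sub>R Ji (indicator {..<t} s *\<^sub>R ?k s) = exp (?Z t) *\<^sub>R Ji (?k s)"
      using t by (cases "s < t"; cases "s = t \<or> 0 \<le> s") auto
  qed
  also have "\<dots> = exp (?Z t) *\<^sub>R Ji (lp.conv ?h t)"
    using integral_bounded_linear[OF bounded_linear_Ji i] by (simp add: lp.conv_def)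
  finally show ?C .
qed

lemma evol_H1:
  assumes "\<xi> \<in> H1"
  shows "evol lam e \<omega> t 0 \<xi> = exp (ou_int \<omega> 0 t) *\<^sub>R Ji (eP t (J \<xi>))"
proof -
  have "\<xi> = P (Ji (J \<xi>))" using assms by (metis H1_iff Ji_J Ji_P)
  then have "S t \<xi> = eP t (Ji (J \<xi>))" by (metis S_P)
  then show ?thesis by (simp add: evol_def semigroup_op_eq Ji_semigroups)
qed

text \<open>At \<open>t = 0\<close> the low-mode integral is empty, so the integral that defines the
  graph is the \<open>Q\<close>-part of the end value of the orbit.\<close>

lemma backward_solutionI:
  assumes \<omega>: "ou_path \<omega>" and y: "backward_sol 0 (log_weight \<omega>) y" and a: "log_weight \<omega> \<in> borel_measurable borel"
    and \<xi>: "\<xi> \<in> H1" "P (y 0) = J \<xi>"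
    and w: "\<And>s. s \<le> 0 \<Longrightarrow> w s = exp (ou_int \<omega> 0 s) *\<^sub>R Ji (y s)"
  shows "w \<in> C_beta_minus lam e \<sigma> \<beta> \<omega>" and "backward_solution lam e N F \<omega> \<xi> w"
    and "interval_lebesgue_integrable lborel (-\<infinity>) 0 (\<lambda>s. evol lam e \<omega> 0 s (projQ e N (G_map F (path_shift s \<omega>) (w s))))"
    and "interval_lebesgue_integral lborel (-\<infinity>) 0 (\<lambda>s. evol lam e \<omega> 0 s (projQ e N (G_map F (path_shift s \<omega>) (w s)))) = Ji (Q (y 0))"
proof -
  interpret ou_path \<omega> by (rule \<omega>)
  let ?Z = "ou_int \<omega> 0"
  let ?h = "\<lambda>s. indicator {..<0} s *\<^sub>R g (log_weight \<omega>) s (y s)"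
  note hm = backward_sol_cutoff(1)[OF y a]
  obtain B where hb: "\<And>s. norm (?h s) \<le> B * exp (- \<beta> * s)" using backward_sol_cutoff(2)[OF y a] by blast
  note I = backward_integrals[OF \<omega> _ hm hb w]
  have Jw: "J (w t) = exp (?Z t) *\<^sub>R y t" if "t \<le> 0" for t
    unfolding w[OF that] by (simp add: J_scaleR)
  have "continuous_on {..0} (\<lambda>t. exp (?Z t) *\<^sub>R y t)"
    by (intro continuous_intros continuous_at_imp_continuous_on ballI ou_int_continuous backward_sol_continuous[OF y a])
  then have "continuous_on {..0} (\<lambda>t. J (w t))" by (rule continuous_on_eq) (simp add: Jw)
  moreover have "w \<in> {..0} \<rightarrow> D" using w subspace_scale[OF subspace_D Ji_in_D] by auto
  moreover have "bdd_above ((\<lambda>t. exp (\<beta> * t - ?Z t) * n\<sigma> (w t)) ` {..0})"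
  proof -
    obtain C where C: "\<And>s. s \<le> 0 \<Longrightarrow> norm (y s) \<le> C * exp (- \<beta> * s)" using y unfolding backward_sol_def by blast
    show ?thesis
    proof (rule bdd_aboveI2)
      fix t :: real assume "t \<in> {..0}"
      then have t: "t \<le> 0" by simp
      have "exp (\<beta> * t - ?Z t) * n\<sigma> (w t) = exp (\<beta> * t) * norm (y t)"
        unfolding n\<sigma>_J Jw[OF t] by (simp add: exp_diff)
      also have "\<dots> \<le> exp (\<beta> * t) * (C * exp (- \<beta> * t))" by (intro mult_left_mono C t) simp
      also have "\<dots> = C" by (simp add: exp_minus)
      finally show "exp (\<beta> * t - ?Z t) * n\<sigma> (w t) \<le> C" .
    qed
  qed
  ultimately show "w \<in> C_beta_minus lam e \<sigma> \<beta> \<omega>"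
    unfolding C_beta_minus_def n\<sigma>_def[symmetric] D_def[symmetric] by (simp add: continuous_map_D)
  show "backward_solution lam e N F \<omega> \<xi> w"
    unfolding backward_solution_def
  proof (intro allI impI conjI)
    fix t :: real assume t: "t \<le> 0"
    show "interval_lebesgue_integrable lborel 0 (ereal t) (\<lambda>s. evol lam e \<omega> t s (projP e N (G_map F (path_shift s \<omega>) (w s))))"
      by (rule I(1)[OF t])
    show "interval_lebesgue_integrable lborel (-\<infinity>) (ereal t) (\<lambda>s. evol lam e \<omega> t s (projQ e N (G_map F (path_shift s \<omega>) (w s))))"
      by (rule I(2)[OF t])
    have "eP t (y 0) = eP t (J \<xi>)" using \<xi>(2) by (metis eP_P)
    then have "y t = eP t (J \<xi>) + lp.conv ?h t" using bsolD[OF y t] by simp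
    then have "w t = exp (?Z t) *\<^sub>R Ji (eP t (J \<xi>)) + exp (?Z t) *\<^sub>R Ji (lp.conv ?h t)"
      unfolding w[OF t] by (simp only: Ji_add scaleR_add_right)
    note w_sum = this
    have i3: "interval_lebesgue_integral lborel 0 (ereal t) (\<lambda>s. evol lam e \<omega> t s (projP e N (G_map F (path_shift s \<omega>) (w s)))) +
        interval_lebesgue_integral lborel (-\<infinity>) (ereal t) (\<lambda>s. evol lam e \<omega> t s (projQ e N (G_map F (path_shift s \<omega>) (w s)))) =
        exp (?Z t) *\<^sub>R Ji (lp.conv ?h t)"
      by (rule I(3)[OF t])
    show "w t = evol lam e \<omega> t 0 \<xi> +
        interval_lebesgue_integral lborel 0 (ereal t) (\<lambda>s. evol lam e \<omega> t s (projP e N (G_map F (path_shift s \<omega>) (w s)))) +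
        interval_lebesgue_integral lborel (-\<infinity>) (ereal t) (\<lambda>s. evol lam e \<omega> t s (projQ e N (G_map F (path_shift s \<omega>) (w s))))"
      using w_sum unfolding evol_H1[OF \<xi>(1)] add.assoc i3 .
  qed
  show "interval_lebesgue_integrable lborel (-\<infinity>) 0 (\<lambda>s. evol lam e \<omega> 0 s (projQ e N (G_map F (path_shift s \<omega>) (w s))))"
    using I(2)[of 0] by (simp add: zero_ereal_def)
  have "y 0 = P (y 0) + lp.conv ?h 0" using bsolD[OF y order_refl] by (simp add: eP_0)
  then have "lp.conv ?h 0 = Q (y 0)" using P_plus_Q[of "y 0"] by (metis add_left_cancel)
  then show "interval_lebesgue_integral lborel (-\<infinity>) 0 (\<lambda>s. evol lam e \<omega> 0 s (projQ e N (G_map F (path_shift s \<omega>) (w s)))) = Ji (Q (y 0))"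
    using I(3)[of 0] by (simp add: zero_ereal_def)
qed

text \<open>The converse change of unknown; it reduces uniqueness in the weighted space of
  continuous functions to \<open>backward_sol_lipschitz\<close>.\<close>

lemma backward_solutionD:
  assumes \<omega>: "ou_path \<omega>" and a: "log_weight \<omega> \<in> borel_measurable borel" and \<xi>: "\<xi> \<in> H1"
    and w: "w \<in> C_beta_minus lam e \<sigma> \<beta> \<omega>" "backward_solution lam e N F \<omega> \<xi> w"
  defines "y \<equiv> \<lambda>t. exp (- ou_int \<omega> 0 t) *\<^sub>R J (w t)"
  shows "backward_sol 0 (log_weight \<omega>) y" and "P (y 0) = J \<xi>" and "t \<le> 0 \<Longrightarrow> w t = exp (ou_int \<omega> 0 t) *\<^sub>R Ji (y t)"
proof -
  interpret ou_path \<omega> by (rule \<omega>)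
  let ?Z = "ou_int \<omega> 0"
  let ?h = "\<lambda>s. indicator {..<0} s *\<^sub>R g (log_weight \<omega>) s (y s)"
  have wD: "\<And>t. t \<le> 0 \<Longrightarrow> w t \<in> D" and wc: "continuous_on {..0} (\<lambda>t. J (w t))"
    and wb: "bdd_above ((\<lambda>t. exp (\<beta> * t - ?Z t) * n\<sigma> (w t)) ` {..0})"
    using w(1) unfolding C_beta_minus_def n\<sigma>_def[symmetric] D_def[symmetric] by (auto simp: continuous_map_D)
  show w_eq: "w t = exp (?Z t) *\<^sub>R Ji (y t)" if "t \<le> 0" for t
    using wD[OF that] by (simp add: y_def Ji_scaleR Ji_J exp_minus)
  have yc: "continuous_on {..0} y"
    unfolding y_def by (intro continuous_intros continuous_at_imp_continuous_on ballI ou_int_continuous wc)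
  have ym0: "(\<lambda>s. indicator {..0} s *\<^sub>R y s) \<in> borel_measurable borel"
    by (rule borel_measurable_continuous_on_indicator[OF _ yc]) simp
  have ym: "(\<lambda>s. indicator {..<0} s *\<^sub>R y s) \<in> borel_measurable borel"
  proof -
    have "(\<lambda>s. indicator {..<0} s *\<^sub>R (indicator {..0} s *\<^sub>R y s)) \<in> borel_measurable borel" using ym0 by measurable
    also have "(\<lambda>s. indicator {..<0} s *\<^sub>R (indicator {..0} s *\<^sub>R y s)) = (\<lambda>s. indicator {..<0} s *\<^sub>R y s)"
      by (auto simp: fun_eq_iff indicator_def)
    finally show ?thesis .
  qed
  obtain C where C: "\<And>t. t \<le> 0 \<Longrightarrow> exp (\<beta> * t - ?Z t) * n\<sigma> (w t) \<le> C" using wb by (auto simp: bdd_above_def)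
  have yb: "norm (y t) \<le> C * exp (- \<beta> * t)" if "t \<le> 0" for t
  proof -
    have "norm (y t) = exp (- \<beta> * t) * (exp (\<beta> * t - ?Z t) * n\<sigma> (w t))"
      by (simp add: y_def n\<sigma>_J exp_diff exp_minus field_simps)
    also have "\<dots> \<le> exp (- \<beta> * t) * C" by (intro mult_left_mono C that) simp
    finally show ?thesis by (simp add: mult.commute)
  qed
  have C0: "0 \<le> C" using order_trans[OF norm_ge_zero yb[of 0]] by simp
  have hm: "?h \<in> borel_measurable borel"
    unfolding g_indicator by (intro g_measurable1 a ym)
  have hb: "norm (?h s) \<le> (L * C) * exp (- \<beta> * s)" for s
    using order_trans[OF norm_g mult_left_mono[OF yb, of s L]] L C0
    by (cases "s < 0") (auto simp: mult.assoc)
  note I = backward_integrals[OF \<omega> _ hm hb w_eq]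
  have y_eq: "y t = eP t (J \<xi>) + lp.conv ?h t" if t: "t \<le> 0" for t
  proof -
    have "w t = evol lam e \<omega> t 0 \<xi> +
        (interval_lebesgue_integral lborel 0 (ereal t) (\<lambda>s. evol lam e \<omega> t s (projP e N (G_map F (path_shift s \<omega>) (w s)))) +
        interval_lebesgue_integral lborel (-\<infinity>) (ereal t) (\<lambda>s. evol lam e \<omega> t s (projQ e N (G_map F (path_shift s \<omega>) (w s)))))"
      using w(2) t unfolding backward_solution_def add.assoc by blast
    also note I(3)[OF t]
    also have "evol lam e \<omega> t 0 \<xi> + exp (?Z t) *\<^sub>R Ji (lp.conv ?h t) = exp (?Z t) *\<^sub>R Ji (eP t (J \<xi>) + lp.conv ?h t)"
      unfolding evol_H1[OF \<xi>] by (simp only: Ji_add scaleR_add_right)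
    finally show ?thesis unfolding y_def by (simp add: J_scaleR exp_minus)
  qed
  have "P (lp.conv ?h 0) = 0" by (rule P_conv_cutoff[OF hm hb]) simp
  then have "P (y 0) = P (J \<xi>)"
    using arg_cong[OF y_eq[OF order_refl], of P]
    by (simp add: linear_add[OF bounded_linear.linear[OF bounded_linear_P]] eP_0)
  then show P0: "P (y 0) = J \<xi>" using \<xi> by (simp add: H1_iff)
  have "eP t (y 0) = eP t (J \<xi>)" for t using P0 by (metis eP_P)
  then show "backward_sol 0 (log_weight \<omega>) y"
    unfolding backward_sol_def using ym yb y_eq by auto
qed

lemma mild_solution_forward_sol:
  assumes \<omega>: "ou_path \<omega>" and a: "log_weight \<omega> \<in> borel_measurable borel" and x: "x \<in> D"
    and v: "mild_solution lam e \<sigma> F \<omega> x v"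
  shows "forward_sol (log_weight \<omega>) (J x) (\<lambda>t. exp (- ou_int \<omega> 0 t) *\<^sub>R J (v t))" and "0 \<le> t \<Longrightarrow> v t \<in> D"
proof -
  interpret ou_path \<omega> by (rule \<omega>)
  let ?Z = "ou_int \<omega> 0"
  define y where "y t = exp (- ?Z t) *\<^sub>R J (v t)" for t
  have vD: "\<And>t. 0 \<le> t \<Longrightarrow> v t \<in> D" and vc: "continuous_on {0..} (\<lambda>t. J (v t))"
    using v unfolding mild_solution_def n\<sigma>_def[symmetric] D_def[symmetric] continuous_map_D by blast+
  then show "0 \<le> t \<Longrightarrow> v t \<in> D" by blast
  have v_eq: "v t = exp (?Z t) *\<^sub>R Ji (y t)" if "0 \<le> t" for t
    using vD[OF that] by (simp add: y_def Ji_scaleR Ji_J exp_minus)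
  have yc: "continuous_on {0..} y"
    unfolding y_def[abs_def] by (intro continuous_intros continuous_at_imp_continuous_on ballI ou_int_continuous vc)
  have ym: "(\<lambda>s. indicator {0..<t} s *\<^sub>R y s) \<in> borel_measurable borel" for t
  proof -
    have "(\<lambda>s. indicator {0..} s *\<^sub>R y s) \<in> borel_measurable borel"
      by (rule borel_measurable_continuous_on_indicator[OF _ yc]) simp
    then have "(\<lambda>s. indicator {0..<t} s *\<^sub>R (indicator {0..} s *\<^sub>R y s)) \<in> borel_measurable borel" by measurable
    also have "(\<lambda>s. indicator {0..<t} s *\<^sub>R (indicator {0..} s *\<^sub>R y s)) = (\<lambda>s. indicator {0..<t} s *\<^sub>R y s)"
      by (auto simp: fun_eq_iff indicator_def)
    finally show ?thesis .
  qed
  have y_eq: "y t = S t (J x) + fw.conv (\<lambda>s. indicator {0..} s *\<^sub>R g (log_weight \<omega>) s (y s)) t" if t: "0 \<le> t" for t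
  proof -
    let ?h = "\<lambda>s. indicator {0..<t} s *\<^sub>R g (log_weight \<omega>) s (y s)"
    let ?E = "\<lambda>s. evol lam e \<omega> t s (G_map F (path_shift s \<omega>) (v s))"
    let ?k = "\<lambda>s. diag (kf (t - s)) (?h s)"
    have hm: "?h \<in> borel_measurable borel"
      unfolding g_indicator by (intro g_measurable1 a ym)
    obtain C where C: "\<And>s. 0 \<le> s \<Longrightarrow> s \<le> t \<Longrightarrow> norm (y s) \<le> C"
    proof -
      have "compact (y ` {0..t})" by (intro compact_continuous_image continuous_on_subset[OF yc]) auto
      from compact_imp_bounded[OF this] obtain C where "\<forall>v\<in>y ` {0..t}. norm v \<le> C"
        unfolding bounded_iff by blast
      then show thesis by (intro that[of C]) auto
    qed
    have C0: "0 \<le> C" using order_trans[OF norm_ge_zero C[of 0]] t by simp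
    have hb: "norm (?h s) \<le> L * C * exp (- (- \<gamma>) * s)" for s
    proof (cases "0 \<le> s \<and> s < t")
      case True
      have "norm (?h s) \<le> L * C * 1" using True order_trans[OF norm_g mult_left_mono[OF C, of s L]] L by simp
      also have "\<dots> \<le> L * C * exp (- (- \<gamma>) * s)"
      proof (rule mult_left_mono)
        have "0 \<le> \<gamma> * s" using True \<gamma>_pos by simp
        then show "1 \<le> exp (- (- \<gamma>) * s)" by simp
      qed (use L C0 in simp)
      finally show ?thesis .
    qed (use L C0 in auto)
    have i: "integrable lborel ?k" by (rule fw.conv_bound(1)[OF hm hb])
    have E: "indicator {0<..<t} s *\<^sub>R ?E s = exp (?Z t) *\<^sub>R Ji (indicator {0<..<t} s *\<^sub>R ?k s)" for s
    proof (cases "0 < s \<and> s < t")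
      case True
      have "exp (ou_int \<omega> s t) * exp (?Z s) = exp (?Z t)"
        unfolding ou_int_diff[of s t] by (simp add: exp_add[symmetric])
      then have "?E s = exp (?Z t) *\<^sub>R S (t - s) (g (log_weight \<omega>) s (y s))"
        using True by (simp add: evol_def semigroup_op_eq v_eq G_map_eq S_scaleR)
      also have "\<dots> = exp (?Z t) *\<^sub>R Ji (?k s)" using True by (simp add: Ji_kernel)
      finally show ?thesis using True by simp
    qed auto
    have "interval_lebesgue_integral lborel 0 (ereal t) ?E = (LINT s|lborel. exp (?Z t) *\<^sub>R Ji (indicator {0<..<t} s *\<^sub>R ?k s))"
      using t by (simp add: interval_lebesgue_integral_def set_lebesgue_integral_def zero_ereal_def E)
    also have "\<dots> = exp (?Z t) *\<^sub>R Ji (LINT s|lborel. indicator {0<..<t} s *\<^sub>R ?k s)"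
    proof -
      have "integrable lborel (\<lambda>s. indicator {0<..<t} s *\<^sub>R ?k s)" using i by (intro integrable_mult_indicator) auto
      from integral_bounded_linear[OF bounded_linear_Ji this] show ?thesis by simp
    qed
    \<comment> \<open>The cutoffs \<open>{0<..<t}\<close> and \<open>{0..<t}\<close> differ at 0
      alone, a null set.\<close>
    also have "(LINT s|lborel. indicator {0<..<t} s *\<^sub>R ?k s) = (LINT s|lborel. ?k s)"
    proof (rule integral_cong_AE)
      show "AE s in lborel. indicator {0<..<t} s *\<^sub>R ?k s = ?k s"
        using AE_lborel_singleton[of 0]
      proof eventually_elim
        case (elim s)
        have "?k s = 0" if "\<not> (0 \<le> s \<and> s < t)" using that by (auto simp: diag_def)
        then show ?case using elim by (auto simp: indicator_def)
      qed
      show "(\<lambda>s. indicator {0<..<t} s *\<^sub>R ?k s) \<in> borel_measurable lborel"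
        using borel_measurable_integrable[OF i] by measurable
    qed (rule borel_measurable_integrable[OF i])
    finally have I: "interval_lebesgue_integral lborel 0 (ereal t) ?E = exp (?Z t) *\<^sub>R Ji (fw.conv ?h t)"
      by (simp add: fw.conv_def)
    have "v t = evol lam e \<omega> t 0 x + interval_lebesgue_integral lborel 0 (ereal t) ?E"
      using v t unfolding mild_solution_def by blast
    also have "evol lam e \<omega> t 0 x = exp (?Z t) *\<^sub>R Ji (S t (J x))"
      using t x by (simp add: evol_def semigroup_op_eq Ji_semigroups Ji_J)
    finally have "v t = exp (?Z t) *\<^sub>R Ji (S t (J x) + fw.conv ?h t)"
      unfolding I by (simp only: Ji_add scaleR_add_right)
    then have "y t = S t (J x) + fw.conv ?h t" unfolding y_def by (simp add: J_scaleR exp_minus)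
    then show ?thesis by (simp only: fw_conv_cutoff[OF order_refl])
  qed
  then show "forward_sol (log_weight \<omega>) (J x) (\<lambda>t. exp (- ?Z t) *\<^sub>R J (v t))"
    unfolding forward_sol_def y_def[symmetric] using yc by (auto simp: y_def[abs_def])
qed

end

section \<open>The inertial manifold\<close>

context inertial begin

lemma S_add: "0 \<le> t \<Longrightarrow> 0 \<le> s \<Longrightarrow> S (t + s) x = S t (S s x)"
  by (rule coeff_eqI) (simp add: S_inner distrib_left exp_add mult.assoc exp_diff exp_minus field_simps)

text \<open>Once the forcing has ended, the integral over later times vanishes and each mode only
  decays by its exponential factor.\<close>

lemma fw_conv_propagate:
  assumes h: "h \<in> borel_measurable borel" "\<And>s. norm (h s) \<le> C * exp (\<gamma> * s)"
    and h0: "\<And>s. 0 \<le> s \<Longrightarrow> h s = 0" and t: "0 \<le> t"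
  shows "fw.conv h t = S t (fw.conv h 0)"
proof (rule coeff_eqI)
  fix j
  have "(LBINT s=-\<infinity>..ereal 0. modal h j s) + (LBINT s=ereal 0..ereal t. modal h j s) = (LBINT s=-\<infinity>..ereal t. modal h j s)"
    by (rule interval_integral_sum) (use fw_coeff(1)[OF h, of t j] t in \<open>simp add: min_def max_def\<close>)
  moreover have "(LBINT s=ereal 0..ereal t. modal h j s) = 0"
    by (rule interval_integral_eq_zero) (use t h0 in \<open>auto simp: modal_def\<close>)
  ultimately have "exp (l j * t) * (fw.conv h t \<bullet> b j) = fw.conv h 0 \<bullet> b j"
    using fw_coeff(2)[OF h, of j t] fw_coeff(2)[OF h, of j 0] by simp
  also have "\<dots> = exp (l j * t) * (S t (fw.conv h 0) \<bullet> b j)"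
    using t by (simp add: S_inner mult.assoc[symmetric] exp_add[symmetric])
  finally show "fw.conv h t \<bullet> b j = S t (fw.conv h 0) \<bullet> b j" by simp
qed

text \<open>The forcing is split at the restarting time \<open>s\<close>. Its past part
  \<open>?h2\<close> is propagated by the semigroup and together with \<open>S s x\<close> makes up
  \<open>S t (y s)\<close>; its future part \<open>?h1\<close> is the convolution of the restarted
  problem. The factor \<open>exp d\<close> plays the same part as in
  \<open>backward_sol_shift\<close>.\<close>

lemma forward_sol_shift:
  assumes y: "forward_sol a x y" and a: "a \<in> borel_measurable borel" and s: "0 \<le> s"
  shows "forward_sol (\<lambda>r. a (s + r) - d) (exp d *\<^sub>R y s) (\<lambda>r. exp d *\<^sub>R y (s + r))"
  unfolding forward_sol_def
proof (intro conjI allI impI)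
  have "continuous_on {0..} y" using y by (simp add: forward_sol_def)
  then have "continuous_on {0..} (\<lambda>r. y (s + r))"
    by (rule continuous_on_compose2) (use s in \<open>auto intro!: continuous_intros\<close>)
  then show "continuous_on {0..} (\<lambda>r. exp d *\<^sub>R y (s + r))"
    by (rule continuous_on_scaleR[OF continuous_on_const])
  fix t :: real assume t: "0 \<le> t"
  let ?h = "\<lambda>r. indicator {0..<s + t} r *\<^sub>R g a r (y r)"
  let ?h1 = "\<lambda>r. indicator {0..} r *\<^sub>R ?h (s + r)"
  let ?h2 = "\<lambda>r. indicator {..<0} r *\<^sub>R ?h (s + r)"
  note hm = forward_sol_cutoff(1)[OF y a, of "s + t"]
  obtain C where hb: "\<And>r. norm (?h r) \<le> C * exp (\<gamma> * r)" using forward_sol_cutoff(2)[OF y a] by blast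
  have C0: "0 \<le> C" using order_trans[OF norm_ge_zero hb[of 0]] by simp
  have hm': "(\<lambda>r. ?h (s + r)) \<in> borel_measurable borel"
    by (rule measurable_compose[OF _ hm]) simp
  have hb': "norm (?h (s + r)) \<le> (C * exp (\<gamma> * s)) * exp (\<gamma> * r)" for r
    using hb[of "s + r"] by (simp only: distrib_left exp_add mult.assoc)
  have hm1: "?h1 \<in> borel_measurable borel" and hm2: "?h2 \<in> borel_measurable borel"
    using hm' by measurable
  have hb1: "norm (?h1 r) \<le> (C * exp (\<gamma> * s)) * exp (\<gamma> * r)" and hb2: "norm (?h2 r) \<le> (C * exp (\<gamma> * s)) * exp (\<gamma> * r)" for r
    using hb'[of r] C0 by (cases "0 \<le> r"; simp)+
  have tr: "fw.conv ?h (s + \<tau>) = fw.conv (\<lambda>r. ?h (s + r)) \<tau>" for \<tau>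
    unfolding fw.conv_def by (subst lborel_integral_real_affine[of 1 _ s]) simp_all
  have sum: "fw.conv (\<lambda>r. ?h (s + r)) \<tau> = fw.conv ?h1 \<tau> + fw.conv ?h2 \<tau>" for \<tau>
  proof -
    have "fw.conv ?h1 \<tau> + fw.conv ?h2 \<tau> = fw.conv (\<lambda>r. ?h1 r + ?h2 r) \<tau>"
      using hb1 hb2 by (intro fw.conv_add[OF hm1 _ hm2]) auto
    also have "(\<lambda>r. ?h1 r + ?h2 r) = (\<lambda>r. ?h (s + r))" by (rule ext, rename_tac r, case_tac "0 \<le> r") auto
    finally show ?thesis ..
  qed
  have h10: "fw.conv ?h1 0 = 0"
  proof -
    have "diag (kf (0 - r)) (?h1 r) = 0" for r by (cases "0 \<le> r") (auto simp: diag_def kf_def)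
    then show ?thesis unfolding fw.conv_def by simp
  qed
  have "y (s + t) = S (s + t) x + fw.conv ?h (s + t)"
    using fsolD[OF y, of "s + t"] s t fw_conv_cutoff[of "s + t" "s + t" "\<lambda>r. g a r (y r)"] by simp
  also have "\<dots> = S t (S s x) + (fw.conv ?h1 t + fw.conv ?h2 t)"
    using S_add[OF t s, of x] tr[of t] sum[of t] by (simp only: add.commute)
  also have "fw.conv ?h2 t = S t (fw.conv ?h2 0)"
    by (rule fw_conv_propagate[OF hm2 hb2 _ t]) simp
  also have "fw.conv ?h2 0 = fw.conv ?h s" using tr[of 0] sum[of 0] h10 by simp
  also have "S t (S s x) + (fw.conv ?h1 t + S t (fw.conv ?h s)) = S t (S s x + fw.conv ?h s) + fw.conv ?h1 t"
  proof -
    have "S t (v + w) = S t v + S t w" for v w by (rule coeff_eqI) (simp add: S_inner t inner_add_left distrib_left)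
    then show ?thesis by (simp only: add_ac)
  qed
  also have "S s x + fw.conv ?h s = y s"
    using fsolD[OF y s] s t fw_conv_cutoff[of s "s + t" "\<lambda>r. g a r (y r)"] by simp
  finally have "exp d *\<^sub>R y (s + t) = S t (exp d *\<^sub>R y s) + exp d *\<^sub>R fw.conv ?h1 t"
    by (simp only: scaleR_add_right S_scaleR[OF t])
  also have "exp d *\<^sub>R fw.conv ?h1 t = fw.conv (\<lambda>r. exp d *\<^sub>R ?h1 r) t" by (rule fw.conv_scaleR[symmetric])
  also have "(\<lambda>r. exp d *\<^sub>R ?h1 r) = (\<lambda>r. indicator {0..<t} r *\<^sub>R g (\<lambda>r. a (s + r) - d) r (exp d *\<^sub>R y (s + r)))"
  proof
    fix r
    have e: "exp (- (a (s + r) - d)) = exp d * exp (- a (s + r))" "exp (a (s + r) - d) * exp d = exp (a (s + r))"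
      by (simp_all add: exp_add[symmetric])
    show "exp d *\<^sub>R ?h1 r = indicator {0..<t} r *\<^sub>R g (\<lambda>r. a (s + r) - d) r (exp d *\<^sub>R y (s + r))"
      unfolding g_def scaleR_scaleR e using s by (cases "0 \<le> r \<and> r < t") auto
  qed
  finally show "exp d *\<^sub>R y (s + t) = S t (exp d *\<^sub>R y s) +
      fw.conv (\<lambda>r. indicator {0..} r *\<^sub>R g (\<lambda>r. a (s + r) - d) r (exp d *\<^sub>R y (s + r))) t"
    by (simp only: fw_conv_cutoff[OF order_refl])
qed

lemma subspace_H: "subspace H1" "subspace H2"
  unfolding H1_def H2_def P_def[symmetric] Q_def[symmetric]
  by (intro linear_subspace_image subspace_D bounded_linear.linear bounded_linear_P bounded_linear_Q)+

lemma H1_finite: "\<exists>B. finite B \<and> H1 = span B"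
proof (intro exI conjI)
  show "finite (b ` {..<N})" by simp
  show "H1 = span (b ` {..<N})"
  proof
    show "H1 \<subseteq> span (b ` {..<N})"
    proof
      fix \<xi> assume "\<xi> \<in> H1"
      then obtain x where x: "\<xi> = P x" by (auto simp: H1_def P_def)
      have "\<xi> = (\<Sum>k<N. (x \<bullet> b k) *\<^sub>R b k)"
        by (rule coeff_eqI) (simp add: x P_inner inner_sum_b)
      moreover have "(\<Sum>k<N. (x \<bullet> b k) *\<^sub>R b k) \<in> span (b ` {..<N})"
        by (intro span_sum span_scale span_base imageI)
      ultimately show "\<xi> \<in> span (b ` {..<N})" by simp
    qed
    have "b k \<in> H1" if "k < N" for k
    proof -
      have "b k = Ji (l k powr \<sigma> *\<^sub>R b k)"
        using powr_cancel[of k 1] by (intro coeff_eqI) (auto simp: Ji_inner inner_b mult.commute)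
      then have "b k \<in> D" by (metis Ji_in_D)
      moreover have "P (b k) = b k" using that by (intro coeff_eqI) (auto simp: P_inner inner_b)
      ultimately show ?thesis unfolding H1_def P_def[symmetric] by (metis imageI)
    qed
    then show "span (b ` {..<N}) \<subseteq> H1" by (intro span_minimal subspace_H) auto
  qed
qed

lemma H1_Int_H2: "H1 \<inter> H2 = {0}"
proof
  show "H1 \<inter> H2 \<subseteq> {0}"
  proof
    fix x assume "x \<in> H1 \<inter> H2"
    then have x: "x \<in> D" "P (J x) = J x" "Q (J x) = J x" by (auto simp: H1_iff H2_iff)
    have "J x = 0" using x(2,3) by (metis P_Q)
    then show "x \<in> {0}" using Ji_J[OF x(1)] by simp
  qed
qed (use subspace_H subspace_0 in auto)

lemma D_sum: "D = {x + y | x y. x \<in> H1 \<and> y \<in> H2}"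
proof
  show "D \<subseteq> {x + y | x y. x \<in> H1 \<and> y \<in> H2}"
  proof
    fix x assume x: "x \<in> D"
    have "x = Ji (P (J x)) + Ji (Q (J x))"
      using x by (simp add: Ji_add[symmetric] P_plus_Q Ji_J)
    moreover have "Ji (P (J x)) \<in> H1" "Ji (Q (J x)) \<in> H2" by (simp_all add: H1_iff H2_iff)
    ultimately show "x \<in> {x + y | x y. x \<in> H1 \<and> y \<in> H2}" by blast
  qed
qed (auto dest!: H1_D H2_D intro: subspace_add[OF subspace_D])

end

locale setting = inertial lam e F \<sigma> L \<mu> \<beta> N + noise W Pr \<Omega>
  for lam :: "nat \<Rightarrow> real" and e :: "nat \<Rightarrow> 'h::{real_inner,banach,second_countable_topology}"
    and F :: "'h \<Rightarrow> 'h" and \<sigma> L \<mu> \<beta> :: real and N :: nat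
    and W Pr :: "path measure" and \<Omega> :: "path set" +
  fixes u :: "real \<Rightarrow> path \<Rightarrow> 'h \<Rightarrow> 'h"
  assumes solution: "\<forall>\<omega>\<in>\<Omega>. \<forall>x\<in>pow_dom lam e \<sigma>. mild_solution lam e \<sigma> F \<omega> x (\<lambda>t. u t \<omega> x)"
begin

lemma ou_continuous: "\<omega> \<in> \<Omega> \<Longrightarrow> isCont (\<lambda>r. ou (path_shift r \<omega>)) t"
  using \<Omega>_path by (intro ou_shift_continuous) (auto simp: ou_path_def)

lemma ou_int_isCont: "\<omega> \<in> \<Omega> \<Longrightarrow> isCont (ou_int \<omega> 0) t"
  using ou_path.ou_int_continuous[OF \<Omega>_path] .

lemma log_weight_measurable: "\<omega> \<in> \<Omega> \<Longrightarrow> log_weight \<omega> \<in> borel_measurable borel"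
  unfolding log_weight_def[abs_def]
  by (intro borel_measurable_continuous_onI continuous_at_imp_continuous_on ballI continuous_intros
      ou_continuous ou_int_isCont)

lemma log_weight_shift: "\<omega> \<in> \<Omega> \<Longrightarrow> log_weight (path_shift \<tau> \<omega>) s = log_weight \<omega> (\<tau> + s) - ou_int \<omega> 0 \<tau>"
  using ou_path.ou_int_shift[OF \<Omega>_path, of \<omega> \<tau> s] by (simp add: log_weight_def path_shift_path_shift)

lemma log_weight_joint_measurable:
  "(\<lambda>(p, s). log_weight (fst p) s) \<in> borel_measurable ((Pr \<Otimes>\<^sub>M (borel :: 'h measure)) \<Otimes>\<^sub>M borel)"
proof -
  have p: "(\<lambda>x. fst (fst x)) \<in> (Pr \<Otimes>\<^sub>M (borel :: 'h measure)) \<Otimes>\<^sub>M borel \<rightarrow>\<^sub>M Pr"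
    by (rule measurable_compose[OF measurable_fst measurable_fst])
  show ?thesis
    unfolding split_beta' log_weight_def
    by (intro borel_measurable_add ou_measurable[OF p] ou_int_measurable[OF p]) simp_all
qed

section \<open>The measurable family of backward orbits\<close>

text \<open>One jointly measurable selection of backward orbits, fixed once for all paths and data.
  The datum ranges over all of \<open>H\<close>, but only its low modes are prescribed, so for good
  paths and times up to 0 the orbit depends on \<open>P v\<close> alone.\<close>

definition Y :: "path \<times> 'h \<Rightarrow> real \<Rightarrow> 'h" where
  "Y = (SOME y. (\<lambda>(p, t). y p t) \<in> borel_measurable ((Pr \<Otimes>\<^sub>M borel) \<Otimes>\<^sub>M borel) \<and>
      (\<forall>\<omega>\<in>\<Omega>. \<forall>v. backward_sol 0 (log_weight \<omega>) (y (\<omega>, v)) \<and> P (y (\<omega>, v) 0) = P v))"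

lemma Y_props:
  "(\<lambda>(p, t). Y p t) \<in> borel_measurable ((Pr \<Otimes>\<^sub>M borel) \<Otimes>\<^sub>M borel) \<and>
      (\<forall>\<omega>\<in>\<Omega>. \<forall>v. backward_sol 0 (log_weight \<omega>) (Y (\<omega>, v)) \<and> P (Y (\<omega>, v) 0) = P v)"
proof -
  obtain y :: "path \<times> 'h \<Rightarrow> real \<Rightarrow> 'h" where y: "(\<lambda>(p, t). y p t) \<in> borel_measurable ((Pr \<Otimes>\<^sub>M borel) \<Otimes>\<^sub>M borel)"
    "\<And>p. p \<in> space (Pr \<Otimes>\<^sub>M borel) \<Longrightarrow> backward_sol 0 (log_weight (fst p)) (y p)"
    "\<And>p. p \<in> space (Pr \<Otimes>\<^sub>M borel) \<Longrightarrow> P (y p 0) = P (snd p)"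
    using backward_sol_exists[where a = "\<lambda>p. log_weight (fst p)", OF log_weight_joint_measurable measurable_snd] by blast
  have "\<forall>\<omega>\<in>\<Omega>. \<forall>v. backward_sol 0 (log_weight \<omega>) (y (\<omega>, v)) \<and> P (y (\<omega>, v) 0) = P v"
  proof (intro ballI allI)
    fix \<omega> and v :: 'h assume "\<omega> \<in> \<Omega>"
    then have "(\<omega>, v) \<in> space (Pr \<Otimes>\<^sub>M borel)" by (simp add: space_pair_measure space_Pr)
    from y(2,3)[OF this] show "backward_sol 0 (log_weight \<omega>) (y (\<omega>, v)) \<and> P (y (\<omega>, v) 0) = P v" by simp
  qed
  with y(1) have ex: "\<exists>y. (\<lambda>(p, t). y p t) \<in> borel_measurable ((Pr \<Otimes>\<^sub>M borel) \<Otimes>\<^sub>M borel) \<and>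
      (\<forall>\<omega>\<in>\<Omega>. \<forall>v. backward_sol 0 (log_weight \<omega>) (y (\<omega>, v)) \<and> P (y (\<omega>, v) 0) = P v)" by blast
  show ?thesis unfolding Y_def by (rule someI_ex[OF ex])
qed

text \<open>In the coordinates of \<open>H\<close>, the manifold of the random equation is the range
  of this map and equally its set of fixed points.\<close>

definition lift :: "path \<Rightarrow> 'h \<Rightarrow> 'h" where "lift \<omega> v = Y (\<omega>, v) 0"

lemma Y_bsol: "\<omega> \<in> \<Omega> \<Longrightarrow> backward_sol 0 (log_weight \<omega>) (Y (\<omega>, v))"
  using Y_props by blast

lemma P_lift: "\<omega> \<in> \<Omega> \<Longrightarrow> P (lift \<omega> v) = P v"
  using Y_props by (simp add: lift_def)

lemma lift_measurable:
  assumes p: "p \<in> M \<rightarrow>\<^sub>M Pr" and v: "v \<in> borel_measurable M"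
  shows "(\<lambda>x. lift (p x) (v x)) \<in> borel_measurable M"
proof -
  have Y: "(\<lambda>(p, t). Y p t) \<in> borel_measurable ((Pr \<Otimes>\<^sub>M borel) \<Otimes>\<^sub>M borel)" using Y_props by blast
  show ?thesis
    unfolding lift_def by (rule measurable_curry_borel[OF Y measurable_Pair[OF p v]]) simp
qed

lemma lift_unique:
  assumes "\<omega> \<in> \<Omega>" "backward_sol 0 (log_weight \<omega>) y" "P (y 0) = P v"
  shows "y 0 = lift \<omega> v"
  using backward_sol_lipschitz[OF assms(2) Y_bsol[OF assms(1)] log_weight_measurable[OF assms(1)], of 0 v] P_lift[OF assms(1), of v] assms(3)
  by (simp add: lift_def linear_diff[OF bounded_linear.linear[OF bounded_linear_P]])

lemma lift_lipschitz:
  assumes "\<omega> \<in> \<Omega>" shows "norm (lift \<omega> v - lift \<omega> v') \<le> norm (v - v') / (1 - \<mu>)"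
proof -
  have "norm (lift \<omega> v - lift \<omega> v') \<le> norm (P (lift \<omega> v - lift \<omega> v')) / (1 - \<mu>)"
    using backward_sol_lipschitz[OF Y_bsol[OF assms] Y_bsol[OF assms] log_weight_measurable[OF assms], of 0 v v'] by (simp add: lift_def)
  also have "P (lift \<omega> v - lift \<omega> v') = P (v - v')"
    by (simp add: linear_diff[OF bounded_linear.linear[OF bounded_linear_P]] P_lift[OF assms])
  also have "norm (P (v - v')) / (1 - \<mu>) \<le> norm (v - v') / (1 - \<mu>)"
    using \<mu> by (intro divide_right_mono norm_P) auto
  finally show ?thesis .
qed

lemma lift_cong: "\<omega> \<in> \<Omega> \<Longrightarrow> P v = P v' \<Longrightarrow> lift \<omega> v = lift \<omega> v'"
  using lift_unique[OF _ Y_bsol, of \<omega> v v'] P_lift[of \<omega> v] by (simp add: lift_def)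

lemma lift_continuous: "\<omega> \<in> \<Omega> \<Longrightarrow> continuous_on UNIV (lift \<omega>)"
proof (rule lipschitz_on_continuous_on[where L = "1 / (1 - \<mu>)"])
  assume "\<omega> \<in> \<Omega>"
  then show "(1 / (1 - \<mu>))-lipschitz_on UNIV (lift \<omega>)"
    using \<mu> lift_lipschitz by (auto simp: lipschitz_on_def dist_norm)
qed

definition ubar :: "real \<Rightarrow> path \<Rightarrow> 'h \<Rightarrow> 'h" where
  "ubar t \<omega> \<xi> = exp (ou_int \<omega> 0 t) *\<^sub>R Ji (Y (\<omega>, J \<xi>) t)"

definition \<psi> :: "path \<Rightarrow> 'h \<Rightarrow> 'h" where "\<psi> \<omega> \<xi> = Ji (Q (lift \<omega> (J \<xi>)))"

text \<open>The parameter \<open>k\<close> treats both equations at once: \<open>k = 0\<close> is the random equation and \<open>k = 1\<close> the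
  Stratonovich equation.\<close>

definition scale :: "real \<Rightarrow> path \<Rightarrow> real" where "scale k \<omega> = exp (k * ou \<omega>)"
definition graph_map :: "real \<Rightarrow> path \<Rightarrow> 'h \<Rightarrow> 'h" where
  "graph_map k \<omega> \<xi> = scale k \<omega> *\<^sub>R \<psi> \<omega> (scale (- k) \<omega> *\<^sub>R \<xi>)"
definition manifold :: "real \<Rightarrow> path \<Rightarrow> 'h set" where
  "manifold k \<omega> = {\<xi> + graph_map k \<omega> \<xi> | \<xi>. \<xi> \<in> H1}"
definition flow :: "real \<Rightarrow> real \<Rightarrow> path \<Rightarrow> 'h \<Rightarrow> 'h" where
  "flow k t \<omega> x = scale k (path_shift t \<omega>) *\<^sub>R u t \<omega> (scale (- k) \<omega> *\<^sub>R x)"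
definition scaled_lift :: "real \<Rightarrow> path \<Rightarrow> 'h \<Rightarrow> 'h" where
  "scaled_lift k \<omega> v = scale k \<omega> *\<^sub>R lift \<omega> (scale (- k) \<omega> *\<^sub>R v)"

lemma scale_pos: "0 < scale k \<omega>" and scale_inv [simp]: "scale k \<omega> * scale (- k) \<omega> = 1" "scale (- k) \<omega> * scale k \<omega> = 1"
  by (simp_all add: scale_def exp_add[symmetric])

lemma P_scaleR: "P (c *\<^sub>R x) = c *\<^sub>R P x" and Q_scaleR: "Q (c *\<^sub>R x) = c *\<^sub>R Q x"
  by (simp_all add: linear_scale[OF bounded_linear.linear[OF bounded_linear_P]] linear_scale[OF bounded_linear.linear[OF bounded_linear_Q]])

lemma Q_diff: "Q (x - y) = Q x - Q y"
  by (rule linear_diff[OF bounded_linear.linear[OF bounded_linear_Q]])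

lemma P_scaled_lift: "\<omega> \<in> \<Omega> \<Longrightarrow> P (scaled_lift k \<omega> v) = P v"
  by (simp add: scaled_lift_def P_scaleR P_lift)

lemma scaled_lift_cong: "\<omega> \<in> \<Omega> \<Longrightarrow> P v = P v' \<Longrightarrow> scaled_lift k \<omega> v = scaled_lift k \<omega> v'"
  unfolding scaled_lift_def using lift_cong[of \<omega> "scale (- k) \<omega> *\<^sub>R v" "scale (- k) \<omega> *\<^sub>R v'"] by (simp add: P_scaleR)

lemma graph_map_eq: "\<xi> \<in> D \<Longrightarrow> graph_map k \<omega> \<xi> = Ji (Q (scaled_lift k \<omega> (J \<xi>)))"
  by (simp add: graph_map_def \<psi>_def scaled_lift_def J_scaleR Q_scaleR Ji_scaleR)

text \<open>As \<open>scaled_lift\<close> depends only on the low modes of its argument, the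
  manifold may be parametrised by all of \<open>H\<close>; the graph becomes the range of a single
  continuous map.\<close>

lemma manifold_eq:
  assumes "\<omega> \<in> \<Omega>" shows "manifold k \<omega> = range (\<lambda>v. Ji (scaled_lift k \<omega> v))"
proof
  show "manifold k \<omega> \<subseteq> range (\<lambda>v. Ji (scaled_lift k \<omega> v))"
  proof
    fix x assume "x \<in> manifold k \<omega>"
    then obtain \<xi> where \<xi>: "\<xi> \<in> H1" "x = \<xi> + graph_map k \<omega> \<xi>" by (auto simp: manifold_def)
    have "x = Ji (P (J \<xi>) + Q (scaled_lift k \<omega> (J \<xi>)))"
      using \<xi> by (simp add: H1_iff graph_map_eq Ji_add Ji_J)
    also have "P (J \<xi>) = P (scaled_lift k \<omega> (J \<xi>))" using assms by (simp add: P_scaled_lift)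
    finally show "x \<in> range (\<lambda>v. Ji (scaled_lift k \<omega> v))" by (simp add: P_plus_Q)
  qed
  show "range (\<lambda>v. Ji (scaled_lift k \<omega> v)) \<subseteq> manifold k \<omega>"
  proof clarify
    fix v
    have "Ji (scaled_lift k \<omega> v) = Ji (P v) + Ji (Q (scaled_lift k \<omega> v))"
      using P_plus_Q[of "scaled_lift k \<omega> v"] assms by (simp add: Ji_add[symmetric] P_scaled_lift)
    moreover have "graph_map k \<omega> (Ji (P v)) = Ji (Q (scaled_lift k \<omega> v))"
      using scaled_lift_cong[OF assms, of "P v" v k] by (simp add: graph_map_eq)
    ultimately have "Ji (scaled_lift k \<omega> v) = Ji (P v) + graph_map k \<omega> (Ji (P v))" by simp
    moreover have "Ji (P v) \<in> H1" by (simp add: H1_iff)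
    ultimately show "Ji (scaled_lift k \<omega> v) \<in> manifold k \<omega>" unfolding manifold_def by blast
  qed
qed

lemma scaled_lift_continuous: "\<omega> \<in> \<Omega> \<Longrightarrow> continuous_on UNIV (scaled_lift k \<omega>)"
  unfolding scaled_lift_def[abs_def]
  by (intro continuous_intros continuous_on_compose2[OF lift_continuous]) auto

lemma scale_measurable:
  assumes "p \<in> M \<rightarrow>\<^sub>M Pr" shows "(\<lambda>x. scale k (p x)) \<in> borel_measurable M"
proof -
  have "(\<lambda>x. ou (path_shift 0 (p x))) \<in> borel_measurable M" by (rule ou_measurable[OF assms]) simp
  then have "(\<lambda>x. exp (k * ou (path_shift 0 (p x)))) \<in> borel_measurable M" by measurable
  also have "(\<lambda>x. exp (k * ou (path_shift 0 (p x)))) \<in> borel_measurable M \<longleftrightarrow> (\<lambda>x. scale k (p x)) \<in> borel_measurable M"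
    using measurable_space[OF assms] by (intro measurable_cong) (simp add: scale_def space_Pr \<Omega>_0)
  finally show ?thesis .
qed

lemma scaled_lift_measurable:
  assumes "p \<in> M \<rightarrow>\<^sub>M Pr" "v \<in> borel_measurable M"
  shows "(\<lambda>x. scaled_lift k (p x) (v x)) \<in> borel_measurable M"
  unfolding scaled_lift_def by (intro borel_measurable_scaleR lift_measurable scale_measurable assms)

section \<open>The flows as random dynamical systems\<close>

lemma u_forward_sol:
  assumes "\<omega> \<in> \<Omega>" "x \<in> D"
  shows "forward_sol (log_weight \<omega>) (J x) (\<lambda>t. exp (- ou_int \<omega> 0 t) *\<^sub>R J (u t \<omega> x))" and "0 \<le> t \<Longrightarrow> u t \<omega> x \<in> D"
proof -
  have m: "mild_solution lam e \<sigma> F \<omega> x (\<lambda>t. u t \<omega> x)" using solution assms by (simp add: D_def)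
  note * = mild_solution_forward_sol[OF \<Omega>_path[OF assms(1)] log_weight_measurable[OF assms(1)] assms(2) m]
  show "forward_sol (log_weight \<omega>) (J x) (\<lambda>t. exp (- ou_int \<omega> 0 t) *\<^sub>R J (u t \<omega> x))" by (rule *(1))
  show "0 \<le> t \<Longrightarrow> u t \<omega> x \<in> D" by (rule *(2))
qed

text \<open>Both sides solve the forward problem for the shifted path, after the rescaling by
  \<open>exp (ou_int \<omega> 0 s)\<close> that the change of unknown requires; uniqueness does the
  rest.\<close>

lemma u_cocycle:
  assumes \<omega>: "\<omega> \<in> \<Omega>" and x: "x \<in> D" and s: "0 \<le> s" and t: "0 \<le> t"
  shows "u (t + s) \<omega> x = u t (path_shift s \<omega>) (u s \<omega> x)"
proof -
  let ?Z = "ou_int \<omega> 0"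
  let ?y = "\<lambda>t. exp (- ?Z t) *\<^sub>R J (u t \<omega> x)"
  have us: "u s \<omega> x \<in> D" by (rule u_forward_sol(2)[OF \<omega> x s])
  have "forward_sol (\<lambda>r. log_weight \<omega> (s + r) - ?Z s) (exp (?Z s) *\<^sub>R ?y s) (\<lambda>r. exp (?Z s) *\<^sub>R ?y (s + r))"
    by (rule forward_sol_shift[OF u_forward_sol(1)[OF \<omega> x] log_weight_measurable[OF \<omega>] s])
  moreover have "(\<lambda>r. log_weight \<omega> (s + r) - ?Z s) = log_weight (path_shift s \<omega>)" using log_weight_shift[OF \<omega>] by auto
  moreover have "exp (?Z s) *\<^sub>R ?y s = J (u s \<omega> x)" by (simp add: exp_minus)
  ultimately have 1: "forward_sol (log_weight (path_shift s \<omega>)) (J (u s \<omega> x)) (\<lambda>r. exp (?Z s) *\<^sub>R ?y (s + r))" by simp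
  have "exp (?Z s) *\<^sub>R ?y (s + t) = exp (- ou_int (path_shift s \<omega>) 0 t) *\<^sub>R J (u t (path_shift s \<omega>) (u s \<omega> x))"
    by (rule forward_sol_unique[OF 1 u_forward_sol(1)[OF \<Omega>_shift[OF \<omega>] us] log_weight_measurable[OF \<Omega>_shift[OF \<omega>]] t])
  also have "ou_int (path_shift s \<omega>) 0 t = ?Z (s + t) - ?Z s"
    by (rule ou_path.ou_int_shift[OF \<Omega>_path[OF \<omega>]])
  also have "exp (- (?Z (s + t) - ?Z s)) = exp (?Z s) * exp (- ?Z (s + t))"
    by (simp add: exp_add[symmetric])
  finally have "J (u (s + t) \<omega> x) = J (u t (path_shift s \<omega>) (u s \<omega> x))" by simp
  then show ?thesis
    using Ji_J[OF u_forward_sol(2)[OF \<omega> x, of "s + t"]] Ji_J[OF u_forward_sol(2)[OF \<Omega>_shift[OF \<omega>] us t]] s t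
    by (metis add.commute add_nonneg_nonneg)
qed

lemma u_0:
  assumes \<omega>: "\<omega> \<in> \<Omega>" and x: "x \<in> D" shows "u 0 \<omega> x = x"
proof -
  have "fw.conv (\<lambda>s. indicator {0..} s *\<^sub>R g (log_weight \<omega>) s (exp (- ou_int \<omega> 0 s) *\<^sub>R J (u s \<omega> x))) 0 = 0"
    unfolding fw_conv_cutoff[OF order_refl] by (simp add: fw.conv_def diag_def)
  moreover have "S 0 v = v" for v by (rule coeff_eqI) (simp add: S_inner)
  ultimately have "J (u 0 \<omega> x) = J x"
    using fsolD[OF u_forward_sol(1)[OF \<omega> x] order_refl] by (simp add: ou_path.ou_int_0[OF \<Omega>_path[OF \<omega>]])
  then show ?thesis using Ji_J[OF u_forward_sol(2)[OF \<omega> x order_refl]] Ji_J[OF x] by metis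
qed

lemma flow_rds: "random_dynamical_system Pr path_shift D n\<sigma> (flow k)"
  unfolding random_dynamical_system_def
proof (intro conjI ballI allI impI)
  fix \<omega> x assume \<omega>: "\<omega> \<in> space Pr" and x: "x \<in> D"
  then have \<omega>': "\<omega> \<in> \<Omega>" by (simp add: space_Pr)
  have sx: "c *\<^sub>R x \<in> D" for c by (rule subspace_scale[OF subspace_D x])
  show "flow k 0 \<omega> x = x"
    by (simp add: flow_def \<Omega>_0[OF \<omega>'] u_0[OF \<omega>' sx])
  fix s t :: real assume s: "0 \<le> s" and t: "0 \<le> t"
  have e: "scale (- k) (path_shift s \<omega>) *\<^sub>R flow k s \<omega> x = u s \<omega> (scale (- k) \<omega> *\<^sub>R x)"
    by (simp add: flow_def)
  show "flow k (t + s) \<omega> x = flow k t (path_shift s \<omega>) (flow k s \<omega> x)"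
    using e u_cocycle[OF \<omega>' sx s t] by (simp add: flow_def path_shift_path_shift add.commute)
next
  let ?M = "restrict_space borel {0..} \<Otimes>\<^sub>M (Pr \<Otimes>\<^sub>M norm_borel D n\<sigma>)"
  \<comment> \<open>A jointly measurable family of forward solutions; \<open>eq\<close> below
    identifies the flow with it by uniqueness.\<close>
  obtain y :: "path \<times> 'h \<Rightarrow> real \<Rightarrow> 'h" where ym: "(\<lambda>(p, t). y p t) \<in> borel_measurable ((Pr \<Otimes>\<^sub>M borel) \<Otimes>\<^sub>M borel)"
    and y: "\<And>p. p \<in> space (Pr \<Otimes>\<^sub>M borel) \<Longrightarrow> forward_sol (log_weight (fst p)) (snd p) (y p)"
    using forward_sol_exists[where a = "\<lambda>p. log_weight (fst p)", OF log_weight_joint_measurable measurable_snd] by blast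
  have tm: "fst \<in> borel_measurable ?M"
    by (rule measurable_compose[OF measurable_fst measurable_restrict_space1]) simp
  have \<omega>m: "(\<lambda>q. fst (snd q)) \<in> ?M \<rightarrow>\<^sub>M Pr" by (rule measurable_compose[OF measurable_snd measurable_fst])
  have xm: "(\<lambda>q. J (snd (snd q))) \<in> borel_measurable ?M"
    by (rule measurable_compose[OF measurable_compose[OF measurable_snd measurable_snd] J_measurable])
  have zm: "(\<lambda>q. ou (path_shift (fst q) (fst (snd q)))) \<in> borel_measurable ?M" by (rule ou_measurable[OF \<omega>m tm])
  have Zm: "(\<lambda>q. ou_int (fst (snd q)) 0 (fst q)) \<in> borel_measurable ?M" by (rule ou_int_measurable[OF \<omega>m tm])
  have sxm: "(\<lambda>q. scale (- k) (fst (snd q)) *\<^sub>R J (snd (snd q))) \<in> borel_measurable ?M"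
    by (intro borel_measurable_scaleR scale_measurable \<omega>m xm)
  have "(\<lambda>q. y (fst (snd q), scale (- k) (fst (snd q)) *\<^sub>R J (snd (snd q))) (fst q)) \<in> borel_measurable ?M"
    by (rule measurable_curry_borel[OF ym measurable_Pair[OF \<omega>m sxm] tm])
  then have m: "(\<lambda>q. exp (k * ou (path_shift (fst q) (fst (snd q)))) *\<^sub>R exp (ou_int (fst (snd q)) 0 (fst q)) *\<^sub>R
      y (fst (snd q), scale (- k) (fst (snd q)) *\<^sub>R J (snd (snd q))) (fst q)) \<in> borel_measurable ?M"
    using zm Zm by measurable
  have eq: "flow k (fst q) (fst (snd q)) (snd (snd q)) \<in> D \<and>
     J (flow k (fst q) (fst (snd q)) (snd (snd q))) = exp (k * ou (path_shift (fst q) (fst (snd q)))) *\<^sub>R exp (ou_int (fst (snd q)) 0 (fst q)) *\<^sub>R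
      y (fst (snd q), scale (- k) (fst (snd q)) *\<^sub>R J (snd (snd q))) (fst q)" if q: "q \<in> space ?M" for q
  proof -
    obtain t \<omega> x where q_eq: "q = (t, \<omega>, x)" by (metis prod.exhaust)
    have t: "0 \<le> t" and \<omega>: "\<omega> \<in> \<Omega>" and x: "x \<in> D"
      using q by (auto simp: q_eq space_pair_measure space_restrict_space space_Pr space_norm_borel)
    have sx: "scale (- k) \<omega> *\<^sub>R x \<in> D" by (rule subspace_scale[OF subspace_D x])
    have uD: "u t \<omega> (scale (- k) \<omega> *\<^sub>R x) \<in> D" by (rule u_forward_sol(2)[OF \<omega> sx t])
    have "forward_sol (log_weight \<omega>) (scale (- k) \<omega> *\<^sub>R J x) (y (\<omega>, scale (- k) \<omega> *\<^sub>R J x))"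
      using y[of "(\<omega>, scale (- k) \<omega> *\<^sub>R J x)"] \<omega> by (simp add: space_pair_measure space_Pr)
    then have "y (\<omega>, scale (- k) \<omega> *\<^sub>R J x) t = exp (- ou_int \<omega> 0 t) *\<^sub>R J (u t \<omega> (scale (- k) \<omega> *\<^sub>R x))"
      using u_forward_sol(1)[OF \<omega> sx] by (intro forward_sol_unique[OF _ _ log_weight_measurable[OF \<omega>] t]) (simp_all add: J_scaleR x)
    then have "J (u t \<omega> (scale (- k) \<omega> *\<^sub>R x)) = exp (ou_int \<omega> 0 t) *\<^sub>R y (\<omega>, scale (- k) \<omega> *\<^sub>R J x) t"
      by (simp add: exp_minus)
    then show ?thesis
      using uD by (simp add: q_eq flow_def scale_def J_scaleR subspace_scale[OF subspace_D])
  qed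
  show "(\<lambda>(t, \<omega>, x). flow k t \<omega> x) \<in> ?M \<rightarrow>\<^sub>M norm_borel D n\<sigma>"
    unfolding measurable_norm_borel split_beta'
  proof
    show "(\<lambda>q. flow k (fst q) (fst (snd q)) (snd (snd q))) \<in> space ?M \<rightarrow> D" using eq by blast
    show "(\<lambda>q. J (flow k (fst q) (fst (snd q)) (snd (snd q)))) \<in> borel_measurable ?M"
      by (subst measurable_cong[OF conjunct2[OF eq]]) (assumption, rule m)
  qed
qed

section \<open>Measurability, invariance and attraction of the manifold\<close>

text \<open>In the coordinates of \<open>H\<close> the manifold is the fixed-point set of the
  continuous map \<open>scaled_lift k \<omega>\<close>, hence closed. It is also the range of that
  map, so the distance is an infimum over a countable dense set of arguments and therefore
  measurable in \<omega>.\<close>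

lemma manifold_random_set: "random_set Pr D n\<sigma> (manifold k)"
  unfolding random_set_def space_Pr
proof (intro conjI ballI)
  fix \<omega> assume \<omega>: "\<omega> \<in> \<Omega>"
  show "manifold k \<omega> \<noteq> {}" unfolding manifold_eq[OF \<omega>] by blast
  show "closedin (norm_topology D n\<sigma>) (manifold k \<omega>)"
  proof (rule closedin_D)
    show "manifold k \<omega> \<subseteq> D" unfolding manifold_eq[OF \<omega>] by auto
    have "Ji -` manifold k \<omega> = {v. v = scaled_lift k \<omega> v}"
    proof (intro set_eqI iffI)
      fix v assume "v \<in> Ji -` manifold k \<omega>"
      then obtain v' where "Ji v = Ji (scaled_lift k \<omega> v')" unfolding manifold_eq[OF \<omega>] by auto
      then have v: "v = scaled_lift k \<omega> v'" by (metis J_Ji)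
      then have "P v = P v'" by (simp add: P_scaled_lift[OF \<omega>])
      from scaled_lift_cong[OF \<omega> this, of k] have "v = scaled_lift k \<omega> v" by (rule trans[OF v sym])
      then show "v \<in> {v. v = scaled_lift k \<omega> v}" by (rule CollectI)
    next
      fix v assume "v \<in> {v. v = scaled_lift k \<omega> v}"
      from CollectD[OF this] have "Ji v = Ji (scaled_lift k \<omega> v)" by (rule arg_cong)
      then show "v \<in> Ji -` manifold k \<omega>" unfolding manifold_eq[OF \<omega>] by (metis rangeI vimageI)
    qed
    then show "closed (Ji -` manifold k \<omega>)"
      using closed_Collect_eq[OF continuous_on_id scaled_lift_continuous[OF \<omega>, of k]] by simp
  qed
next
  fix x assume x: "x \<in> D"
  obtain C :: "'h set" where C: "countable C" "\<And>X. open X \<Longrightarrow> X \<noteq> {} \<Longrightarrow> \<exists>d\<in>C. d \<in> X"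
    using countable_dense_exists by blast
  have "C \<noteq> {}" using C(2)[of UNIV] by auto
  have eq: "set_dist n\<sigma> x (manifold k \<omega>) = (INF v\<in>C. norm (J x - scaled_lift k \<omega> v))" if \<omega>: "\<omega> \<in> \<Omega>" for \<omega>
  proof -
    have "set_dist n\<sigma> x (manifold k \<omega>) = (INF v. norm (J x - scaled_lift k \<omega> v))"
      unfolding set_dist_def manifold_eq[OF \<omega>] image_image n\<sigma>_J using x by (simp add: J_diff)
    also have "\<dots> = (INF v\<in>C. norm (J x - scaled_lift k \<omega> v))"
    proof (rule antisym)
      show "(INF v. norm (J x - scaled_lift k \<omega> v)) \<le> (INF v\<in>C. norm (J x - scaled_lift k \<omega> v))"
        using \<open>C \<noteq> {}\<close> by (intro cINF_superset_mono) (auto intro!: bdd_belowI[of _ 0])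
      show "(INF v\<in>C. norm (J x - scaled_lift k \<omega> v)) \<le> (INF v. norm (J x - scaled_lift k \<omega> v))"
      proof (rule cINF_greatest)
        fix v
        show "(INF v\<in>C. norm (J x - scaled_lift k \<omega> v)) \<le> norm (J x - scaled_lift k \<omega> v)"
        proof (rule ccontr)
          assume "\<not> ?thesis"
          then have "norm (J x - scaled_lift k \<omega> v) < (INF v\<in>C. norm (J x - scaled_lift k \<omega> v))" (is "_ < ?I") by simp
          moreover have "open {v. norm (J x - scaled_lift k \<omega> v) < ?I}"
            by (intro open_Collect_less continuous_intros scaled_lift_continuous[OF \<omega>])
          ultimately obtain d where d: "d \<in> C" "norm (J x - scaled_lift k \<omega> d) < ?I"
            using C(2)[of "{v. norm (J x - scaled_lift k \<omega> v) < ?I}"] by blast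
          have "?I \<le> norm (J x - scaled_lift k \<omega> d)" by (rule cINF_lower[OF _ d(1)]) (auto intro!: bdd_belowI[of _ 0])
          then show False using d(2) by simp
        qed
      qed simp
    qed
    finally show ?thesis .
  qed
  have "(\<lambda>\<omega>. INF v\<in>C. norm (J x - scaled_lift k \<omega> v)) \<in> borel_measurable Pr"
  proof (rule borel_measurable_cINF[OF C(1)])
    show "(\<lambda>\<omega>. norm (J x - scaled_lift k \<omega> v)) \<in> borel_measurable Pr" for v
      using scaled_lift_measurable[of "\<lambda>\<omega>. \<omega>" Pr "\<lambda>_. v" k] by measurable
  qed (auto intro!: bdd_belowI[of _ 0])
  then show "(\<lambda>\<omega>. set_dist n\<sigma> x (manifold k \<omega>)) \<in> borel_measurable Pr"
    by (subst measurable_cong[OF eq]) (simp_all add: space_Pr)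
qed

text \<open>The link between orbits and the manifold: a backward orbit ending at \<tau>, shifted to
  end at 0, is by uniqueness the one selected over the shifted path for its own end value.
  Invariance and attraction both rest on it.\<close>

lemma flow_in_manifold:
  assumes \<omega>: "\<omega> \<in> \<Omega>" and v: "backward_sol \<tau> (log_weight \<omega>) v" 
  shows "Ji (scale k (path_shift \<tau> \<omega>) *\<^sub>R exp (ou_int \<omega> 0 \<tau>) *\<^sub>R v \<tau>) \<in> manifold k (path_shift \<tau> \<omega>)"
proof -
  let ?c = "scale k (path_shift \<tau> \<omega>)" and ?c' = "scale (- k) (path_shift \<tau> \<omega>)" and ?Z = "ou_int \<omega> 0 \<tau>"
  have "backward_sol 0 (\<lambda>s. log_weight \<omega> (s + \<tau>) - ?Z) (\<lambda>s. exp ?Z *\<^sub>R v (s + \<tau>))" by (rule backward_sol_shift[OF v])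
  moreover have "(\<lambda>s. log_weight \<omega> (s + \<tau>) - ?Z) = log_weight (path_shift \<tau> \<omega>)"
    using log_weight_shift[OF \<omega>] by (auto simp: add.commute)
  ultimately have "exp ?Z *\<^sub>R v \<tau> = lift (path_shift \<tau> \<omega>) (exp ?Z *\<^sub>R v \<tau>)"
    using lift_unique[OF \<Omega>_shift[OF \<omega>], of \<tau> "\<lambda>s. exp ?Z *\<^sub>R v (s + \<tau>)" "exp ?Z *\<^sub>R v \<tau>"] by simp
  moreover have "?c' *\<^sub>R (?c *\<^sub>R w) = w" for w :: 'h by simp
  ultimately have "scaled_lift k (path_shift \<tau> \<omega>) (?c *\<^sub>R exp ?Z *\<^sub>R v \<tau>) = ?c *\<^sub>R exp ?Z *\<^sub>R v \<tau>"
    unfolding scaled_lift_def by (simp only:)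
  then have "?c *\<^sub>R exp ?Z *\<^sub>R v \<tau> = scaled_lift k (path_shift \<tau> \<omega>) (?c *\<^sub>R exp ?Z *\<^sub>R v \<tau>)" by (rule sym)
  then show ?thesis unfolding manifold_eq[OF \<Omega>_shift[OF \<omega>]] by (intro range_eqI) (rule arg_cong)
qed

lemma manifold_invariant: "invariant_set Pr path_shift (flow k) (manifold k)"
  unfolding invariant_set_def space_Pr
proof (intro ballI allI impI)
  fix \<omega> and t :: real assume \<omega>: "\<omega> \<in> \<Omega>" and t: "0 \<le> t"
  show "flow k t \<omega> ` manifold k \<omega> \<subseteq> manifold k (path_shift t \<omega>)"
    unfolding manifold_eq[OF \<omega>]
  proof clarify
    fix v
    let ?x = "Ji (lift \<omega> (scale (- k) \<omega> *\<^sub>R v))"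
    have x: "scale (- k) \<omega> *\<^sub>R Ji (scaled_lift k \<omega> v) = ?x" by (simp add: scaled_lift_def Ji_scaleR)
    have "forward_sol (log_weight \<omega>) (Y (\<omega>, scale (- k) \<omega> *\<^sub>R v) 0) (\<lambda>t. exp (- ou_int \<omega> 0 t) *\<^sub>R J (u t \<omega> ?x))"
      using u_forward_sol(1)[OF \<omega>, of ?x] by (simp add: lift_def)
    from invariance[OF log_weight_measurable[OF \<omega>] this Y_bsol[OF \<omega>] t] obtain w where
      w: "backward_sol t (log_weight \<omega>) w" "w t = exp (- ou_int \<omega> 0 t) *\<^sub>R J (u t \<omega> ?x)" by blast
    have "flow k t \<omega> (Ji (scaled_lift k \<omega> v)) = Ji (scale k (path_shift t \<omega>) *\<^sub>R exp (ou_int \<omega> 0 t) *\<^sub>R w t)"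
      unfolding flow_def x w(2) using u_forward_sol(2)[OF \<omega> _ t, of ?x] by (simp add: Ji_scaleR Ji_J exp_minus)
    then show "flow k t \<omega> (Ji (scaled_lift k \<omega> v)) \<in> manifold k (path_shift t \<omega>)" using flow_in_manifold[OF \<omega> w(1)] by simp
  qed
qed

lemma manifold_attracts:
  assumes x: "x \<in> D" and \<omega>: "\<omega> \<in> \<Omega>" and t: "0 \<le> t"
  shows "set_dist n\<sigma> (flow k t \<omega> x) (manifold k (path_shift t \<omega>)) \<le>
    exp (k * ou (path_shift t \<omega>) + ou_int \<omega> 0 t - k * ou \<omega> - \<beta> * t) * (n\<sigma> x / (1 - \<mu>))"
proof -
  let ?x = "scale (- k) \<omega> *\<^sub>R x" and ?Z = "ou_int \<omega> 0 t" and ?c = "scale k (path_shift t \<omega>)"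
  have sx: "?x \<in> D" by (rule subspace_scale[OF subspace_D x])
  have uD: "u t \<omega> ?x \<in> D" by (rule u_forward_sol(2)[OF \<omega> sx t])
  obtain v where v: "\<And>\<tau>. 0 \<le> \<tau> \<Longrightarrow> backward_sol \<tau> (log_weight \<omega>) v"
    "\<And>\<tau>. 0 \<le> \<tau> \<Longrightarrow> norm (exp (- ou_int \<omega> 0 \<tau>) *\<^sub>R J (u \<tau> \<omega> ?x) - v \<tau>) \<le> norm (J ?x) / (1 - \<mu>) * exp (- \<beta> * \<tau>)"
    using attraction[OF log_weight_measurable[OF \<omega>] u_forward_sol(1)[OF \<omega> sx]] by blast
  let ?y = "Ji (?c *\<^sub>R exp ?Z *\<^sub>R v t)"
  have "set_dist n\<sigma> (flow k t \<omega> x) (manifold k (path_shift t \<omega>)) \<le> n\<sigma> (flow k t \<omega> x - ?y)"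
    unfolding set_dist_def
    by (rule cINF_lower[OF _ flow_in_manifold[OF \<omega> v(1)[OF t]]]) (auto intro!: bdd_belowI[of _ 0] simp: n\<sigma>_J)
  also have "\<dots> = norm ((?c * exp ?Z) *\<^sub>R (exp (- ?Z) *\<^sub>R J (u t \<omega> ?x) - v t))"
    using uD by (simp add: n\<sigma>_J flow_def J_diff J_scaleR subspace_scale[OF subspace_D] scaleR_diff_right exp_minus mult.assoc)
  also have "\<dots> \<le> ?c * exp ?Z * (norm (J ?x) / (1 - \<mu>) * exp (- \<beta> * t))"
    using mult_left_mono[OF v(2)[OF t], of "?c * exp ?Z"] scale_pos[of k "path_shift t \<omega>"] by simp
  also have "\<dots> = exp (k * ou (path_shift t \<omega>) + ?Z - k * ou \<omega> - \<beta> * t) * (n\<sigma> x / (1 - \<mu>))"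
  proof -
    have "norm (J ?x) = scale (- k) \<omega> * n\<sigma> x" using x scale_pos[of "- k" \<omega>] by (simp add: n\<sigma>_J J_scaleR)
    moreover have "exp (k * ou (path_shift t \<omega>) + ?Z - k * ou \<omega> - \<beta> * t) = ?c * exp ?Z * (scale (- k) \<omega> * exp (- \<beta> * t))"
      by (simp add: scale_def exp_add[symmetric])
    ultimately show ?thesis by simp
  qed
  finally show ?thesis .
qed

text \<open>Half of the rate \<beta> is sacrificed. On good paths the noise terms in the exponent
  are sublinear in time, hence eventually below \<open>\<beta> / 2 * t\<close>, and \<open>K\<close>
  comes from the finite supremum of what remains.\<close>

lemma manifold_attraction_rate:
  assumes x: "x \<in> D"
  shows "\<exists>K. K \<in> borel_measurable Pr \<and>
        (\<forall>\<omega>\<in>\<Omega>. \<forall>t\<ge>0. set_dist n\<sigma> (flow k t \<omega> x) (manifold k (path_shift t \<omega>)) \<le> K \<omega> * exp (- (\<beta> / 2) * t))"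
proof -
  let ?\<phi> = "\<lambda>\<omega> t. exp (k * ou (path_shift t \<omega>) + ou_int \<omega> 0 t - k * ou \<omega> - \<beta> / 2 * t)"
  have oum: "ou \<in> borel_measurable Pr"
  proof -
    have "(\<lambda>\<omega>. ou (path_shift 0 \<omega>)) \<in> borel_measurable Pr" by (rule ou_measurable) simp_all
    then show ?thesis by (subst measurable_cong[of _ _ "\<lambda>\<omega>. ou (path_shift 0 \<omega>)"]) (simp_all add: space_Pr \<Omega>_0)
  qed
  obtain K where K: "K \<in> borel_measurable Pr" "\<And>\<omega> t. \<omega> \<in> space Pr \<Longrightarrow> 0 \<le> t \<Longrightarrow> ?\<phi> \<omega> t \<le> K \<omega>"
  proof (rule sup_bound_measurable[of ?\<phi> Pr])
    show "(\<lambda>\<omega>. ?\<phi> \<omega> t) \<in> borel_measurable Pr" for t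
      using ou_measurable[of "\<lambda>\<omega>. \<omega>" Pr "\<lambda>_. t"] ou_int_measurable[of "\<lambda>\<omega>. \<omega>" Pr "\<lambda>_. t"] oum by measurable
    show "isCont (?\<phi> \<omega>) t" if "\<omega> \<in> space Pr" for \<omega> t
      using that by (intro continuous_intros ou_continuous ou_int_isCont) (simp_all add: space_Pr)
    show "\<forall>\<^sub>F t in at_top. ?\<phi> \<omega> t \<le> 1" if "\<omega> \<in> space Pr" for \<omega>
    proof -
      have "((\<lambda>t. ou (path_shift t \<omega>) / t) \<longlongrightarrow> 0) at_top" "((\<lambda>t. ou_int \<omega> 0 t / t) \<longlongrightarrow> 0) at_top"
        using good that by (auto simp: good_paths_def space_Pr)
      moreover have "((\<lambda>t. k * ou \<omega> / t) \<longlongrightarrow> 0) at_top"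
        by (rule tendsto_divide_0[OF tendsto_const filterlim_at_top_imp_at_infinity[OF filterlim_ident]])
      ultimately have "((\<lambda>t. k * (ou (path_shift t \<omega>) / t) + ou_int \<omega> 0 t / t - k * ou \<omega> / t) \<longlongrightarrow> k * 0 + 0 - 0) at_top"
        by (intro tendsto_intros)
      then have "\<forall>\<^sub>F t in at_top. k * (ou (path_shift t \<omega>) / t) + ou_int \<omega> 0 t / t - k * ou \<omega> / t < \<beta> / 2"
        using \<beta>_pos by (intro order_tendstoD(2)) auto
      then show ?thesis
        using eventually_gt_at_top[of 0]
      proof eventually_elim
        case (elim t)
        have "k * (ou (path_shift t \<omega>) / t) + ou_int \<omega> 0 t / t - k * ou \<omega> / t = (k * ou (path_shift t \<omega>) + ou_int \<omega> 0 t - k * ou \<omega>) / t"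
          by (simp add: add_divide_distrib diff_divide_distrib)
        then have "(k * ou (path_shift t \<omega>) + ou_int \<omega> 0 t - k * ou \<omega>) / t < \<beta> / 2" using elim(1) by simp
        then have "k * ou (path_shift t \<omega>) + ou_int \<omega> 0 t - k * ou \<omega> < \<beta> / 2 * t" using elim(2) by (simp only: pos_divide_less_eq)
        then show ?case by simp
      qed
    qed
  qed (rule that)
  show ?thesis
  proof (intro exI[of _ "\<lambda>\<omega>. K \<omega> * (n\<sigma> x / (1 - \<mu>))"] conjI ballI allI impI)
    show "(\<lambda>\<omega>. K \<omega> * (n\<sigma> x / (1 - \<mu>))) \<in> borel_measurable Pr" using K(1) by measurable
    fix \<omega> and t :: real assume \<omega>: "\<omega> \<in> \<Omega>" and t: "0 \<le> t"
    have "exp (k * ou (path_shift t \<omega>) + ou_int \<omega> 0 t - k * ou \<omega> - \<beta> * t) = ?\<phi> \<omega> t * exp (- (\<beta> / 2) * t)"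
      unfolding exp_add[symmetric] by (simp add: field_simps)
    also have "\<dots> \<le> K \<omega> * exp (- (\<beta> / 2) * t)"
      using K(2)[of \<omega> t] \<omega> t by (intro mult_right_mono) (simp_all add: space_Pr)
    finally have "exp (k * ou (path_shift t \<omega>) + ou_int \<omega> 0 t - k * ou \<omega> - \<beta> * t) * (n\<sigma> x / (1 - \<mu>)) \<le>
        K \<omega> * exp (- (\<beta> / 2) * t) * (n\<sigma> x / (1 - \<mu>))"
      using \<mu> by (intro mult_right_mono) (simp_all add: n\<sigma>_J)
    then show "set_dist n\<sigma> (flow k t \<omega> x) (manifold k (path_shift t \<omega>)) \<le> K \<omega> * (n\<sigma> x / (1 - \<mu>)) * exp (- (\<beta> / 2) * t)"
      using manifold_attracts[OF x \<omega> t, of k] by (simp add: mult_ac)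
  qed
qed

lemma graph_map_range: "graph_map k \<omega> \<in> H1 \<rightarrow> H2"
  by (auto simp: graph_map_eq H1_D H2_iff)

lemma manifold_inertial:
  assumes "\<And>\<omega>. \<omega> \<in> \<Omega> \<Longrightarrow> reg (graph_map k \<omega>)"
  shows "inertial_manifold reg Pr path_shift D n\<sigma> H1 H2 (flow k) (manifold k)"
  unfolding inertial_manifold_def space_Pr
proof (intro conjI)
  show "\<forall>\<omega>\<in>\<Omega>. \<exists>m. m \<in> H1 \<rightarrow> H2 \<and> reg m \<and> manifold k \<omega> = {\<xi> + m \<xi> | \<xi>. \<xi> \<in> H1}"
    using assms graph_map_range unfolding manifold_def by blast
  show "\<exists>b>0. \<forall>x\<in>D. \<exists>K. K \<in> borel_measurable Pr \<and>
        (\<forall>\<omega>\<in>\<Omega>. \<forall>t\<ge>0. set_dist n\<sigma> (flow k t \<omega> x) (manifold k (path_shift t \<omega>)) \<le> K \<omega> * exp (- b * t))"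
    using manifold_attraction_rate \<beta>_pos by (intro exI[of _ "\<beta> / 2"]) auto
qed (intro flow_rds subspace_H H1_finite H1_Int_H2 D_sum manifold_random_set manifold_invariant)+

section \<open>Regularity of the graph\<close>

text \<open>The two scale factors are reciprocal, so the constant is that of \<open>lift\<close>,
  independent of \<open>k\<close> and \<omega>.\<close>

lemma scaled_lift_lipschitz:
  assumes "\<omega> \<in> \<Omega>" shows "norm (scaled_lift k \<omega> v - scaled_lift k \<omega> v') \<le> norm (v - v') / (1 - \<mu>)"
proof -
  have "norm (scaled_lift k \<omega> v - scaled_lift k \<omega> v') = scale k \<omega> * norm (lift \<omega> (scale (- k) \<omega> *\<^sub>R v) - lift \<omega> (scale (- k) \<omega> *\<^sub>R v'))"
    using scale_pos[of k \<omega>] by (simp add: scaled_lift_def scaleR_diff_right[symmetric])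
  also have "\<dots> \<le> scale k \<omega> * (norm (scale (- k) \<omega> *\<^sub>R v - scale (- k) \<omega> *\<^sub>R v') / (1 - \<mu>))"
    using scale_pos[of k \<omega>] by (intro mult_left_mono lift_lipschitz assms) auto
  also have "\<dots> = (scale k \<omega> * scale (- k) \<omega>) * (norm (v - v') / (1 - \<mu>))"
    using scale_pos[of "- k" \<omega>] by (simp add: scaleR_diff_right[symmetric] del: scale_inv)
  finally show ?thesis by simp
qed

lemma graph_map_lipschitz:
  assumes "\<omega> \<in> \<Omega>" shows "lipschitz_map H1 n\<sigma> n\<sigma> (graph_map k \<omega>)"
  unfolding lipschitz_map_def
proof (intro exI[of _ "1 / (1 - \<mu>)"] ballI)
  fix x y assume xy: "x \<in> H1" "y \<in> H1"
  have "n\<sigma> (graph_map k \<omega> x - graph_map k \<omega> y) = norm (Q (scaled_lift k \<omega> (J x) - scaled_lift k \<omega> (J y)))"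
    using xy by (simp add: graph_map_eq H1_D n\<sigma>_J J_diff Q_diff)
  also have "\<dots> \<le> norm (scaled_lift k \<omega> (J x) - scaled_lift k \<omega> (J y))" by (rule norm_Q)
  also have "\<dots> \<le> norm (J x - J y) / (1 - \<mu>)" by (rule scaled_lift_lipschitz[OF assms])
  finally show "n\<sigma> (graph_map k \<omega> x - graph_map k \<omega> y) \<le> 1 / (1 - \<mu>) * n\<sigma> (x - y)"
    using xy by (simp add: n\<sigma>_J J_diff H1_D)
qed

lemma graph_map_C1:
  assumes C1: "C1_map D n\<sigma> UNIV norm F" and \<omega>: "\<omega> \<in> \<Omega>"
  shows "C1_map H1 n\<sigma> H2 n\<sigma> (graph_map k \<omega>)"
proof -
  obtain F' where "\<forall>x\<in>D. bounded_linear_map D n\<sigma> UNIV norm (F' x)"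
    "\<forall>x\<in>D. \<forall>\<epsilon>>0. \<exists>\<delta>>0. \<forall>h\<in>D. n\<sigma> h < \<delta> \<longrightarrow> norm (F (x + h) - F x - F' x h) \<le> \<epsilon> * n\<sigma> h"
    "\<forall>x\<in>D. \<forall>\<epsilon>>0. \<exists>\<delta>>0. \<forall>y\<in>D. n\<sigma> (y - x) < \<delta> \<longrightarrow> (\<forall>h\<in>D. norm (F' y h - F' x h) \<le> \<epsilon> * n\<sigma> h)"
    using C1 unfolding C1_map_def by (elim conjE exE) (rule that; assumption)
  note F' = bspec[OF this(1)] bspec[OF this(2), rule_format] bspec[OF this(3), rule_format]
  \<comment> \<open>The derivative of \<open>f\<close>, that is of \<open>F\<close> composed with
    \<open>Ji\<close>, by the chain rule.\<close>
  define fd where "fd x h = F' (Ji x) (Ji h)" for x h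
  have nJ: "n\<sigma> (Ji v) = norm v" for v by (simp add: n\<sigma>_J)
  interpret d: inertial_C1 lam e F \<sigma> L \<mu> \<beta> N fd
  proof (rule inertial_C1.intro[OF inertial_axioms], rule inertial_C1_axioms.intro)
    show "linear (fd x)" for x
      using F'(1)[of "Ji x"] unfolding bounded_linear_map_def fd_def
      by (intro linearI) (simp_all add: Ji_add Ji_scaleR)
    show "\<exists>\<delta>>0. \<forall>h. norm h < \<delta> \<longrightarrow> norm (f (x + h) - f x - fd x h) \<le> \<epsilon> * norm h" if "0 < \<epsilon>" for x \<epsilon>
    proof -
      obtain \<delta> where \<delta>: "\<delta> > 0" "\<And>h. h \<in> D \<Longrightarrow> n\<sigma> h < \<delta> \<Longrightarrow> norm (F (Ji x + h) - F (Ji x) - F' (Ji x) h) \<le> \<epsilon> * n\<sigma> h"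
        using F'(2)[OF Ji_in_D[of x] \<open>0 < \<epsilon>\<close>] by blast
      then show ?thesis by (intro exI[of _ \<delta>]) (simp add: f_def fd_def Ji_add nJ[symmetric])
    qed
    show "\<exists>\<delta>>0. \<forall>y. norm (y - x) < \<delta> \<longrightarrow> (\<forall>h. norm (fd y h - fd x h) \<le> \<epsilon> * norm h)" if "0 < \<epsilon>" for x \<epsilon>
    proof -
      obtain \<delta> where \<delta>: "\<delta> > 0" "\<And>y h. y \<in> D \<Longrightarrow> n\<sigma> (y - Ji x) < \<delta> \<Longrightarrow> h \<in> D \<Longrightarrow> norm (F' y h - F' (Ji x) h) \<le> \<epsilon> * n\<sigma> h"
        using F'(3)[OF Ji_in_D[of x] \<open>0 < \<epsilon>\<close>] by blast
      have "norm (fd y h - fd x h) \<le> \<epsilon> * norm h" if "norm (y - x) < \<delta>" for y h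
        using \<delta>(2)[of "Ji y" "Ji h"] that by (simp add: fd_def nJ Ji_diff[symmetric])
      then show ?thesis using \<delta>(1) by blast
    qed
  qed
  let ?c = "scale k \<omega>" and ?c' = "scale (- k) \<omega>"
  have a: "log_weight \<omega> \<in> borel_measurable borel" by (rule log_weight_measurable[OF \<omega>])
  have z: "backward_sol 0 (log_weight \<omega>) (Y (\<omega>, v))" "P (Y (\<omega>, v) 0) = P v" for v
    using Y_bsol[OF \<omega>] P_lift[OF \<omega>] by (simp_all add: lift_def)
  have "\<exists>w. d.variation_sol (log_weight \<omega>) (Y (\<omega>, v)) h w" for v h
    using d.variation_sol_exists[OF a z(1)] by blast
  then obtain V where V: "\<And>v h. d.variation_sol (log_weight \<omega>) (Y (\<omega>, v)) h (V v h)" by metis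
  have V_lin: "linear (\<lambda>h. V v h 0)" for v
    by (rule d.variation_sol_linear[OF a z(1) V order_refl])
  have V_bound: "norm (V v h 0) \<le> norm h / (1 - \<mu>)" for v h
  proof -
    have "norm (V v h 0) \<le> norm h / (1 - \<mu>) * exp (- \<beta> * 0)" using V[of v h] unfolding d.variation_sol_def by blast
    then show ?thesis by simp
  qed
  \<comment> \<open>In the derivative the inner and outer scale factors cancel, because
    \<open>V v h 0\<close> is linear in \<open>h\<close>; only the base point stays scaled.\<close>
  define G where "G \<xi> h = Ji (Q (V (?c' *\<^sub>R J \<xi>) (J h) 0))" for \<xi> h
  have nG: "n\<sigma> (Ji x - Ji y) = norm (x - y)" for x y by (simp add: n\<sigma>_J J_diff)
  have J_scale: "n\<sigma> (?c' *\<^sub>R h) = ?c' * n\<sigma> h" if "h \<in> D" for h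
    using that scale_pos[of "- k" \<omega>] by (simp add: n\<sigma>_J J_scaleR)
  show ?thesis
    unfolding C1_map_def
  proof (intro conjI exI[of _ G] ballI allI impI)
    show "graph_map k \<omega> \<in> H1 \<rightarrow> H2" by (rule graph_map_range)
    fix \<xi> assume \<xi>: "\<xi> \<in> H1"
    then have \<xi>D: "\<xi> \<in> D" by (rule H1_D)
    show "bounded_linear_map H1 n\<sigma> H2 n\<sigma> (G \<xi>)"
      unfolding bounded_linear_map_def
    proof (intro conjI ballI allI exI[of _ "1 / (1 - \<mu>)"])
      show "G \<xi> \<in> H1 \<rightarrow> H2" by (auto simp: G_def H2_iff)
      show "G \<xi> (x + y) = G \<xi> x + G \<xi> y" if "x \<in> H1" "y \<in> H1" for x y
        using that by (simp add: G_def H1_D J_add linear_add[OF V_lin] linear_add[OF bounded_linear.linear[OF bounded_linear_Q]] Ji_add)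
      show "G \<xi> (c *\<^sub>R x) = c *\<^sub>R G \<xi> x" if "x \<in> H1" for c x
        using that by (simp add: G_def H1_D J_scaleR linear_scale[OF V_lin] Q_scaleR Ji_scaleR)
      show "n\<sigma> (G \<xi> x) \<le> 1 / (1 - \<mu>) * n\<sigma> x" for x
        using order_trans[OF norm_Q V_bound, of "?c' *\<^sub>R J \<xi>" "J x"] by (simp add: G_def n\<sigma>_J)
    qed
    fix \<epsilon> :: real assume \<epsilon>: "0 < \<epsilon>"
    show "\<exists>\<delta>>0. \<forall>h\<in>H1. n\<sigma> h < \<delta> \<longrightarrow> n\<sigma> (graph_map k \<omega> (\<xi> + h) - graph_map k \<omega> \<xi> - G \<xi> h) \<le> \<epsilon> * n\<sigma> h"
    proof -
      let ?v = "?c' *\<^sub>R J \<xi>"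
      obtain \<delta> where \<delta>: "\<delta> > 0" "\<And>h. norm h < \<delta> \<Longrightarrow> norm (lift \<omega> (?v + h) - lift \<omega> ?v - V ?v h 0) \<le> \<epsilon> * norm h"
        using d.derivative_remainder[where z = "\<lambda>v. Y (\<omega>, v)" and V = "V ?v" and \<xi> = ?v, OF a z V \<epsilon>]
        unfolding lift_def by blast
      show ?thesis
      \<comment> \<open>The argument of \<open>lift\<close> is scaled by \<open>?c'\<close>, hence
        the admissible radius by its reciprocal \<open>?c\<close>.\<close>
      proof (intro exI[of _ "?c * \<delta>"] conjI ballI impI)
        show "0 < ?c * \<delta>" using \<delta>(1) scale_pos by simp
        fix h assume h: "h \<in> H1" "n\<sigma> h < ?c * \<delta>"
        have hD: "h \<in> D" by (rule H1_D[OF h(1)])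
        have "?c' * n\<sigma> h < ?c' * (?c * \<delta>)" using h(2) scale_pos by (intro mult_strict_left_mono)
        then have n: "norm (?c' *\<^sub>R J h) < \<delta>"
          using scale_pos[of "- k" \<omega>] by (simp add: n\<sigma>_J mult.assoc[symmetric])
        have e: "graph_map k \<omega> (\<xi> + h) - graph_map k \<omega> \<xi> - G \<xi> h =
            Ji (?c *\<^sub>R Q (lift \<omega> (?v + ?c' *\<^sub>R J h) - lift \<omega> ?v - V ?v (?c' *\<^sub>R J h) 0))"
          using \<xi>D hD subspace_add[OF subspace_D \<xi>D hD]
          by (simp add: graph_map_eq scaled_lift_def G_def J_add scaleR_add_right Q_diff Q_scaleR Ji_diff Ji_scaleR
              linear_scale[OF V_lin] scaleR_diff_right)
        have "n\<sigma> (graph_map k \<omega> (\<xi> + h) - graph_map k \<omega> \<xi> - G \<xi> h) =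
            ?c * norm (Q (lift \<omega> (?v + ?c' *\<^sub>R J h) - lift \<omega> ?v - V ?v (?c' *\<^sub>R J h) 0))"
          unfolding e nJ using scale_pos[of k \<omega>] by simp
        also have "\<dots> \<le> ?c * (\<epsilon> * norm (?c' *\<^sub>R J h))"
          using scale_pos[of k \<omega>] by (intro mult_left_mono order_trans[OF norm_Q \<delta>(2)[OF n]]) simp
        also have "\<dots> = (?c * ?c') * (\<epsilon> * n\<sigma> h)" using scale_pos[of "- k" \<omega>] by (simp add: n\<sigma>_J del: scale_inv)
        finally show "n\<sigma> (graph_map k \<omega> (\<xi> + h) - graph_map k \<omega> \<xi> - G \<xi> h) \<le> \<epsilon> * n\<sigma> h" by simp
      qed
    qed
    show "\<exists>\<delta>>0. \<forall>y\<in>H1. n\<sigma> (y - \<xi>) < \<delta> \<longrightarrow> (\<forall>h\<in>H1. n\<sigma> (G y h - G \<xi> h) \<le> \<epsilon> * n\<sigma> h)"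
    proof -
      let ?v = "?c' *\<^sub>R J \<xi>"
      obtain \<delta> where \<delta>: "\<delta> > 0" "\<And>v h. norm (v - ?v) < \<delta> \<Longrightarrow> norm (V v h 0 - V ?v h 0) \<le> \<epsilon> * norm h"
        using d.derivative_continuous[where z = "\<lambda>v. Y (\<omega>, v)" and V = V and \<xi> = ?v, OF a z V \<epsilon>] by blast
      show ?thesis
      proof (intro exI[of _ "?c * \<delta>"] conjI ballI impI)
        show "0 < ?c * \<delta>" using \<delta>(1) scale_pos by simp
        fix y h assume y: "y \<in> H1" "n\<sigma> (y - \<xi>) < ?c * \<delta>" and h: "h \<in> H1"
        have yD: "y \<in> D" by (rule H1_D[OF y(1)])
        have "?c' * n\<sigma> (y - \<xi>) < ?c' * (?c * \<delta>)" using y(2) scale_pos by (intro mult_strict_left_mono)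
        then have n: "norm (?c' *\<^sub>R J y - ?v) < \<delta>"
          using scale_pos[of "- k" \<omega>] yD \<xi>D by (simp add: n\<sigma>_J J_diff mult.assoc[symmetric] scaleR_diff_right[symmetric])
        have "n\<sigma> (G y h - G \<xi> h) = norm (Q (V (?c' *\<^sub>R J y) (J h) 0 - V ?v (J h) 0))"
          by (simp add: G_def nG Q_diff)
        also have "\<dots> \<le> \<epsilon> * norm (J h)" by (rule order_trans[OF norm_Q \<delta>(2)[OF n]])
        finally show "n\<sigma> (G y h - G \<xi> h) \<le> \<epsilon> * n\<sigma> h" by (simp add: n\<sigma>_J)
      qed
    qed
  qed
qed

section \<open>The defining integral and the two equations\<close>

lemma \<psi>_measurable:
  "(\<lambda>(\<omega>, \<xi>). \<psi> \<omega> \<xi>) \<in> Pr \<Otimes>\<^sub>M restrict_space (norm_borel D n\<sigma>) H1 \<rightarrow>\<^sub>M restrict_space (norm_borel D n\<sigma>) H2"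
proof (rule measurable_restrict_space2)
  show "(\<lambda>(\<omega>, \<xi>). \<psi> \<omega> \<xi>) \<in> space (Pr \<Otimes>\<^sub>M restrict_space (norm_borel D n\<sigma>) H1) \<rightarrow> H2"
    by (auto simp: \<psi>_def H2_iff)
  have \<xi>: "(\<lambda>p. J (snd p)) \<in> borel_measurable (Pr \<Otimes>\<^sub>M restrict_space (norm_borel D n\<sigma>) H1)"
    by (rule measurable_compose[OF measurable_snd measurable_restrict_space1[OF J_measurable]])
  have "(\<lambda>p. Q (lift (fst p) (J (snd p)))) \<in> borel_measurable (Pr \<Otimes>\<^sub>M restrict_space (norm_borel D n\<sigma>) H1)"
    unfolding Q_def projQ_diag by (intro measurable_diag lift_measurable measurable_fst \<xi>) simp
  from measurable_compose[OF this Ji_measurable]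
  show "(\<lambda>(\<omega>, \<xi>). \<psi> \<omega> \<xi>) \<in> Pr \<Otimes>\<^sub>M restrict_space (norm_borel D n\<sigma>) H1 \<rightarrow>\<^sub>M norm_borel D n\<sigma>"
    by (simp add: \<psi>_def split_beta')
qed

lemma ubar_solution:
  assumes "\<omega> \<in> \<Omega>" "\<xi> \<in> H1"
  shows "(\<lambda>t. ubar t \<omega> \<xi>) \<in> C_beta_minus lam e \<sigma> \<beta> \<omega>"
    and "backward_solution lam e N F \<omega> \<xi> (\<lambda>t. ubar t \<omega> \<xi>)"
    and "interval_lebesgue_integrable lborel (-\<infinity>) 0
         (\<lambda>s. evol lam e \<omega> 0 s (projQ e N (G_map F (path_shift s \<omega>) (ubar s \<omega> \<xi>))))"
    and "\<psi> \<omega> \<xi> = interval_lebesgue_integral lborel (-\<infinity>) 0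
         (\<lambda>s. evol lam e \<omega> 0 s (projQ e N (G_map F (path_shift s \<omega>) (ubar s \<omega> \<xi>))))"
proof -
  have PJ: "P (Y (\<omega>, J \<xi>) 0) = J \<xi>" using P_lift[OF assms(1), of "J \<xi>"] assms(2) by (simp add: lift_def H1_iff)
  note I = backward_solutionI[OF \<Omega>_path[OF assms(1)] Y_bsol[OF assms(1)] log_weight_measurable[OF assms(1)] assms(2) PJ,
      of "\<lambda>t. ubar t \<omega> \<xi>", OF ubar_def]
  show "(\<lambda>t. ubar t \<omega> \<xi>) \<in> C_beta_minus lam e \<sigma> \<beta> \<omega>" by (rule I(1))
  show "backward_solution lam e N F \<omega> \<xi> (\<lambda>t. ubar t \<omega> \<xi>)" by (rule I(2))
  show "interval_lebesgue_integrable lborel (-\<infinity>) 0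
         (\<lambda>s. evol lam e \<omega> 0 s (projQ e N (G_map F (path_shift s \<omega>) (ubar s \<omega> \<xi>))))" by (rule I(3))
  show "\<psi> \<omega> \<xi> = interval_lebesgue_integral lborel (-\<infinity>) 0
         (\<lambda>s. evol lam e \<omega> 0 s (projQ e N (G_map F (path_shift s \<omega>) (ubar s \<omega> \<xi>))))"
    using I(4) by (simp add: \<psi>_def lift_def)
qed

lemma ubar_unique:
  assumes \<omega>: "\<omega> \<in> \<Omega>" and \<xi>: "\<xi> \<in> H1"
    and w: "w \<in> C_beta_minus lam e \<sigma> \<beta> \<omega>" "backward_solution lam e N F \<omega> \<xi> w" and t: "t \<le> 0"
  shows "w t = ubar t \<omega> \<xi>"
proof -
  note D = backward_solutionD[OF \<Omega>_path[OF \<omega>] log_weight_measurable[OF \<omega>] \<xi> w]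
  let ?y = "\<lambda>t. exp (- ou_int \<omega> 0 t) *\<^sub>R J (w t)"
  have "P (?y 0 - Y (\<omega>, J \<xi>) 0) = 0"
    using D(2) P_lift[OF \<omega>, of "J \<xi>"] \<xi> by (simp add: lift_def H1_iff linear_diff[OF bounded_linear.linear[OF bounded_linear_P]])
  then have y: "?y t = Y (\<omega>, J \<xi>) t"
    using backward_sol_lipschitz[OF D(1) Y_bsol[OF \<omega>, of "J \<xi>"] log_weight_measurable[OF \<omega>] t] by simp
  have "w t = exp (ou_int \<omega> 0 t) *\<^sub>R Ji (?y t)" by (rule D(3)[OF t])
  then show ?thesis unfolding y ubar_def .
qed

lemma manifold_0: "manifold 0 = (\<lambda>\<omega>. {\<xi> + \<psi> \<omega> \<xi> | \<xi>. \<xi> \<in> H1})"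
  by (simp add: manifold_def[abs_def] graph_map_def scale_def)

lemma manifold_1: "manifold 1 = (\<lambda>\<omega>. {\<xi> + exp (ou \<omega>) *\<^sub>R \<psi> \<omega> (exp (- ou \<omega>) *\<^sub>R \<xi>) | \<xi>. \<xi> \<in> H1})"
  by (simp add: manifold_def[abs_def] graph_map_def scale_def)

lemma flow_0: "flow 0 = u"
  by (simp add: fun_eq_iff flow_def scale_def)

lemma flow_1: "flow 1 = strat_flow u"
  by (simp add: fun_eq_iff flow_def scale_def strat_flow_def)

lemma graph_map_0: "graph_map 0 \<omega> = \<psi> \<omega>"
  by (simp add: fun_eq_iff graph_map_def scale_def)

lemma manifold_1_image: "\<omega> \<in> \<Omega> \<Longrightarrow> manifold 1 \<omega> = (\<lambda>y. exp (ou \<omega>) *\<^sub>R y) ` manifold 0 \<omega>"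
proof -
  assume \<omega>: "\<omega> \<in> \<Omega>"
  have "range (\<lambda>v. Ji (scaled_lift 1 \<omega> v)) = (\<lambda>y. exp (ou \<omega>) *\<^sub>R y) ` range (\<lambda>v. Ji (scaled_lift 0 \<omega> v))" (is "?A = ?B")
  proof
    show "?A \<subseteq> ?B"
    proof clarify
      fix v
      have "Ji (scaled_lift 1 \<omega> v) = exp (ou \<omega>) *\<^sub>R Ji (scaled_lift 0 \<omega> (exp (- ou \<omega>) *\<^sub>R v))" by (simp add: scaled_lift_def scale_def Ji_scaleR)
      then show "Ji (scaled_lift 1 \<omega> v) \<in> ?B" by blast
    qed
    show "?B \<subseteq> ?A"
    proof clarify
      fix v
      have "exp (ou \<omega>) *\<^sub>R Ji (scaled_lift 0 \<omega> v) = Ji (scaled_lift 1 \<omega> (exp (ou \<omega>) *\<^sub>R v))" by (simp add: scaled_lift_def scale_def Ji_scaleR exp_minus)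
      then show "exp (ou \<omega>) *\<^sub>R Ji (scaled_lift 0 \<omega> v) \<in> ?A" by blast
    qed
  qed
  then show ?thesis unfolding manifold_eq[OF \<omega>] .
qed

end

theorem theorem4p2:
  fixes lam :: "nat \<Rightarrow> real"
    and e :: "nat \<Rightarrow> 'h::{real_inner,banach,second_countable_topology}"
    and F :: "'h \<Rightarrow> 'h"
    and \<sigma> L \<mu> \<beta> :: real
    and N :: nat
    and W Pr :: "path measure"
    and \<Omega> :: "path set"
    and u :: "real \<Rightarrow> path \<Rightarrow> 'h \<Rightarrow> 'h"
    and D H1 H2 :: "'h set"
    and n\<sigma> :: "'h \<Rightarrow> real"
  assumes spectral: "spectral_data lam e"
    and \<sigma>: "0 \<le> \<sigma>" "\<sigma> < 1"
    and D_def: "D = pow_dom lam e \<sigma>"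
    and n\<sigma>_def: "n\<sigma> = pow_norm lam e \<sigma>"
    and F0: "F 0 = 0"
    and L: "L > 0"
    and F_lipschitz: "\<forall>u1\<in>D. \<forall>u2\<in>D. norm (F u1 - F u2) \<le> L * n\<sigma> (u1 - u2)"
    and N: "N \<ge> 1" "lam N < lam (Suc N)"
    and H1_def: "H1 = projP e N ` D"
    and H2_def: "H2 = projQ e N ` D"
    and wiener: "two_sided_wiener W"
    and good: "good_paths W \<Omega>"
    and Pr_def: "Pr = restrict_space W \<Omega>"
    and solution: "\<forall>\<omega>\<in>\<Omega>. \<forall>x\<in>D. mild_solution lam e \<sigma> F \<omega> x (\<lambda>t. u t \<omega> x)"
    and \<mu>: "0 < \<mu>" "\<mu> < 1"
    and gap: "lam (Suc N) - lam N \<ge> 2 * L / \<mu> *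
      (lam N powr \<sigma>
       + (if \<sigma> = 0 then 1 else \<sigma> powr \<sigma>) * Gamma (1 - \<sigma>) * (lam (Suc N) - lam N) powr \<sigma>
       + lam (Suc N) powr \<sigma>)"
    and \<beta>_def: "\<beta> = lam N + 2 / \<mu> * L * lam N powr \<sigma>"
  shows "\<exists>ubar \<psi>.
    (\<forall>\<omega>\<in>\<Omega>. \<forall>\<xi>\<in>H1.
       (\<lambda>t. ubar t \<omega> \<xi>) \<in> C_beta_minus lam e \<sigma> \<beta> \<omega> \<and>
       backward_solution lam e N F \<omega> \<xi> (\<lambda>t. ubar t \<omega> \<xi>) \<and>
       (\<forall>w \<in> C_beta_minus lam e \<sigma> \<beta> \<omega>. backward_solution lam e N F \<omega> \<xi> w \<longrightarrow>
          (\<forall>t\<le>0. w t = ubar t \<omega> \<xi>))) \<and>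
    (\<forall>\<omega>\<in>\<Omega>. \<forall>\<xi>\<in>H1.
       interval_lebesgue_integrable lborel (-\<infinity>) 0
         (\<lambda>s. evol lam e \<omega> 0 s (projQ e N (G_map F (path_shift s \<omega>) (ubar s \<omega> \<xi>)))) \<and>
       \<psi> \<omega> \<xi> = interval_lebesgue_integral lborel (-\<infinity>) 0
         (\<lambda>s. evol lam e \<omega> 0 s (projQ e N (G_map F (path_shift s \<omega>) (ubar s \<omega> \<xi>))))) \<and>
    (\<forall>\<omega>\<in>\<Omega>. \<psi> \<omega> \<in> H1 \<rightarrow> H2 \<and> lipschitz_map H1 n\<sigma> n\<sigma> (\<psi> \<omega>)) \<and>
    (\<lambda>(\<omega>, \<xi>). \<psi> \<omega> \<xi>) \<in>
       Pr \<Otimes>\<^sub>M restrict_space (norm_borel D n\<sigma>) H1 \<rightarrow>\<^sub>M restrict_space (norm_borel D n\<sigma>) H2 \<and>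
    (let M = (\<lambda>\<omega>. {\<xi> + \<psi> \<omega> \<xi> | \<xi>. \<xi> \<in> H1});
         M' = (\<lambda>\<omega>. {\<xi> + exp (ou \<omega>) *\<^sub>R \<psi> \<omega> (exp (- ou \<omega>) *\<^sub>R \<xi>) | \<xi>. \<xi> \<in> H1})
     in lipschitz_inertial_manifold Pr path_shift D n\<sigma> H1 H2 u M \<and>
        (\<forall>\<omega>\<in>\<Omega>. M' \<omega> = (\<lambda>y. exp (ou \<omega>) *\<^sub>R y) ` M \<omega>) \<and>
        lipschitz_inertial_manifold Pr path_shift D n\<sigma> H1 H2 (strat_flow u) M' \<and>
        (C1_map D n\<sigma> UNIV norm F \<longrightarrow>
           (\<forall>\<omega>\<in>\<Omega>. C1_map H1 n\<sigma> H2 n\<sigma> (\<psi> \<omega>)) \<and>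
           C1_inertial_manifold Pr path_shift D n\<sigma> H1 H2 u M \<and>
           C1_inertial_manifold Pr path_shift D n\<sigma> H1 H2 (strat_flow u) M'))"
proof -
  have onb: "onb lam e" using spectral by (rule onb.intro)
  have inertial: "inertial lam e F \<sigma> L \<mu> \<beta> N"
  proof (rule inertial.intro[OF onb], rule inertial_axioms.intro)
    show "\<forall>u1\<in>pow_dom lam e \<sigma>. \<forall>u2\<in>pow_dom lam e \<sigma>. norm (F u1 - F u2) \<le> L * pow_norm lam e \<sigma> (u1 - u2)"
      using F_lipschitz unfolding D_def n\<sigma>_def .
  qed (rule \<sigma> F0 L N \<mu> gap \<beta>_def)+
  have noise: "noise W Pr \<Omega>"
    using wiener unfolding two_sided_wiener_def by (intro noise.intro good Pr_def) blast+
  interpret s: setting lam e F \<sigma> L \<mu> \<beta> N W Pr \<Omega> u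
    by (intro setting.intro inertial noise setting_axioms.intro) (use solution in \<open>simp add: D_def\<close>)
  have eqs: "s.D = D" "s.n\<sigma> = n\<sigma>" "s.H1 = H1" "s.H2 = H2"
    by (simp_all add: s.D_def D_def s.n\<sigma>_def n\<sigma>_def s.H1_def H1_def s.H2_def H2_def)
  have lip: "lipschitz_inertial_manifold Pr path_shift D n\<sigma> H1 H2 (s.flow k) (s.manifold k)" for k
    unfolding lipschitz_inertial_manifold_def
    by (rule s.manifold_inertial[unfolded eqs]) (rule s.graph_map_lipschitz[unfolded eqs])
  have C1: "C1_inertial_manifold Pr path_shift D n\<sigma> H1 H2 (s.flow k) (s.manifold k)"
    if "C1_map D n\<sigma> UNIV norm F" for k
    unfolding C1_inertial_manifold_def
    by (rule s.manifold_inertial[unfolded eqs]) (rule s.graph_map_C1[unfolded eqs, OF that])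
  show ?thesis
  proof (rule exI[of _ s.ubar], rule exI[of _ s.\<psi>],
      unfold Let_def s.manifold_0[unfolded eqs, symmetric] s.manifold_1[unfolded eqs, symmetric],
      intro conjI ballI impI allI)
    fix \<omega> assume \<omega>: "\<omega> \<in> \<Omega>"
    show "s.\<psi> \<omega> \<in> H1 \<rightarrow> H2" using s.graph_map_range[of 0 \<omega>] unfolding s.graph_map_0 eqs .
    show "lipschitz_map H1 n\<sigma> n\<sigma> (s.\<psi> \<omega>)" using s.graph_map_lipschitz[OF \<omega>, of 0] unfolding s.graph_map_0 eqs .
    show "s.manifold 1 \<omega> = (\<lambda>y. exp (ou \<omega>) *\<^sub>R y) ` s.manifold 0 \<omega>" by (rule s.manifold_1_image[OF \<omega>])
    show "C1_map H1 n\<sigma> H2 n\<sigma> (s.\<psi> \<omega>)" if "C1_map D n\<sigma> UNIV norm F"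
      using s.graph_map_C1[unfolded eqs, OF that \<omega>, of 0] unfolding s.graph_map_0 .
    fix \<xi> assume "\<xi> \<in> H1"
    then have \<xi>: "\<xi> \<in> s.H1" by (simp add: eqs)
    show "(\<lambda>t. s.ubar t \<omega> \<xi>) \<in> C_beta_minus lam e \<sigma> \<beta> \<omega>" by (rule s.ubar_solution(1)[OF \<omega> \<xi>])
    show "backward_solution lam e N F \<omega> \<xi> (\<lambda>t. s.ubar t \<omega> \<xi>)" by (rule s.ubar_solution(2)[OF \<omega> \<xi>])
    show "interval_lebesgue_integrable lborel (-\<infinity>) 0
         (\<lambda>s'. evol lam e \<omega> 0 s' (projQ e N (G_map F (path_shift s' \<omega>) (s.ubar s' \<omega> \<xi>))))"
      by (rule s.ubar_solution(3)[OF \<omega> \<xi>])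
    show "s.\<psi> \<omega> \<xi> = interval_lebesgue_integral lborel (-\<infinity>) 0
         (\<lambda>s'. evol lam e \<omega> 0 s' (projQ e N (G_map F (path_shift s' \<omega>) (s.ubar s' \<omega> \<xi>))))"
      by (rule s.ubar_solution(4)[OF \<omega> \<xi>])
    fix w t assume "w \<in> C_beta_minus lam e \<sigma> \<beta> \<omega>" "backward_solution lam e N F \<omega> \<xi> w" "t \<le> (0::real)"
    then show "w t = s.ubar t \<omega> \<xi>" by (rule s.ubar_unique[OF \<omega> \<xi>])
  next
    show "(\<lambda>(\<omega>, \<xi>). s.\<psi> \<omega> \<xi>) \<in> Pr \<Otimes>\<^sub>M restrict_space (norm_borel D n\<sigma>) H1 \<rightarrow>\<^sub>M restrict_space (norm_borel D n\<sigma>) H2"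
      using s.\<psi>_measurable unfolding eqs .
    show "lipschitz_inertial_manifold Pr path_shift D n\<sigma> H1 H2 u (s.manifold 0)" using lip[of 0] unfolding s.flow_0 .
    show "lipschitz_inertial_manifold Pr path_shift D n\<sigma> H1 H2 (strat_flow u) (s.manifold 1)" using lip[of 1] unfolding s.flow_1 .
    assume F: "C1_map D n\<sigma> UNIV norm F"
    show "C1_inertial_manifold Pr path_shift D n\<sigma> H1 H2 u (s.manifold 0)" using C1[OF F, of 0] unfolding s.flow_0 .
    show "C1_inertial_manifold Pr path_shift D n\<sigma> H1 H2 (strat_flow u) (s.manifold 1)" using C1[OF F, of 1] unfolding s.flow_1 .
  qed
qed

end
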